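(* Let $H(x)$ be an $L^2$-degree $0$ reducible quasiperiodic operator family whose density of states measure is absolutely continuous (with respect to Lebesgue measure). Let $\mathbb T_0$, $T_k\to+\infty$ and $Q(x)$, $x\in\mathbb T_0$, be as in the conclusion of the theorem stating: there is a full-measure set $\mathbb T_0\subset\mathbb T^d$ and $T_k\to\infty$ such that $Q(x)=\operatorname{s-lim}_{k\to\infty}\frac1{T_k}\int_0^{T_k}e^{iH(x)t}Ae^{-iH(x)t}\,dt$ exists for all $x\in\mathbb T_0$, where $(A\psi)_n=i(\psi_{n+1}-\psi_{n-1})$. Then for almost every $x\in\mathbb T^d$, $$\|Q(x)\|=\frac{1}{\pi}\operatorname*{ess\,sup}_{N\in[0,1]}\frac{dE}{dN}(N).$$
   Context: Let $d\ge1$, let $v:\mathbb T^d=\mathbb R^d/\mathbb Z^d\to\mathbb R$ be continuous (also viewed as a $\mathbb Z^d$-periodic function on $\mathbb R^d$), and let $\alpha=(\alpha_1,\dots,\alpha_d)\in\mathbb R^d$ be such that $\{1,\alpha_1,\dots,\alpha_d\}$ is linearly independent over $\mathbb Q$. For $x\in\mathbb T^d$, $H(x)$ is the bounded self-adjoint operator on $\ell^2(\mathbb Z)$ given by $(H(x)\psi)_n=\psi_{n+1}+\psi_{n-1}+v(x+n\alpha)\psi_n$, $n\in\mathbb Z$. For $E\in\mathbb R$ let $S_{v,E}(x)=\begin{pmatrix}E-v(x)&-1\\1&0\end{pmatrix}$. The density of states measure is $N(\Delta)=\int_{\mathbb T^d}\langle\mathbb E_{H(x)}(\Delta)\delta_0,\delta_0\rangle\,dx$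 for Borel $\Delta\subset\mathbb R$, where $\mathbb E_H(\Delta)$ is the spectral projection of $H$; the integrated density of states is $N(E)=N((-\infty,E])$, and $\rho(E)=(1-N(E))/2$ (the fibered rotation number of the cocycle $(x,w)\mapsto(x+\alpha,S_{v,E}(x)w)$). The family $H(x)$ is called $L^2$-degree $0$ reducible if for $N$-almost every $E$ there exists a measurable $B(\cdot,E)\in L^2(\mathbb T^d;GL(2,\mathbb C))$ with $|\det B(x,E)|=1$ and $B(x+\alpha,E)S_{v,E}(x)B(x,E)^{-1}=\operatorname{diag}(e^{2\pi i\rho(E)},e^{-2\pi i\rho(E)})$ for a.e. $x\in\mathbb T^d$. The function $E(N)$ is the inverse of the non-decreasing function $N(E)$; it is defined on $[0,1]$ except possibly at countably many points (corresponding to gaps of the spectrum), where it is defined arbitrarily so that $E(\cdot)$ is non-decreasing on $[0,1]$; hence $dE/dN$ exists almost everywhere on $[0,1]$. *)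

theory Defs
  imports "HOL-Probability.Probability"
begin

definition l2 :: "(int \<Rightarrow> complex) \<Rightarrow> bool" where
  "l2 \<psi> \<longleftrightarrow> (\<lambda>n. (cmod (\<psi> n))^2) summable_on UNIV"

definition l2norm :: "(int \<Rightarrow> complex) \<Rightarrow> real" where
  "l2norm \<psi> = sqrt (infsum (\<lambda>n. (cmod (\<psi> n))^2) UNIV)"

definition opnorm :: "((int \<Rightarrow> complex) \<Rightarrow> (int \<Rightarrow> complex)) \<Rightarrow> real" where
  "opnorm Q = Sup {l2norm (Q \<psi>) | \<psi>. l2 \<psi> \<and> l2norm \<psi> \<le> 1}"

definition delta0 :: "int \<Rightarrow> complex" where
  "delta0 n = (if n = 0 then 1 else 0)"

text \<open>The unit cube [0,1]^d, a fundamental domain of the torus T^d = R^d / Z^d.\<close>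
definition unit_cube :: "(real^'d) set" where
  "unit_cube = cbox 0 One"

definition Zd_periodic :: "(real^'d \<Rightarrow> 'b) \<Rightarrow> bool" where
  "Zd_periodic f \<longleftrightarrow> (\<forall>x (k::'d \<Rightarrow> int). f (x + (\<chi> i. real_of_int (k i))) = f x)"

definition rat_indep :: "real^'d \<Rightarrow> bool" where
  "rat_indep \<alpha> \<longleftrightarrow> (\<forall>(q0::rat) (q::'d \<Rightarrow> rat).
     of_rat q0 + (\<Sum>i\<in>UNIV. of_rat (q i) * (\<alpha> $ i)) = 0 \<longrightarrow> q0 = 0 \<and> (\<forall>i. q i = 0))"

definition Hop :: "(real^'d \<Rightarrow> real) \<Rightarrow> real^'d \<Rightarrow> real^'d \<Rightarrow> (int \<Rightarrow> complex) \<Rightarrow> (int \<Rightarrow> complex)" where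
  "Hop v \<alpha> x \<psi> = (\<lambda>n. \<psi> (n + 1) + \<psi> (n - 1) + complex_of_real (v (x + real_of_int n *\<^sub>R \<alpha>)) * \<psi> n)"

definition Aop :: "(int \<Rightarrow> complex) \<Rightarrow> (int \<Rightarrow> complex)" where
  "Aop \<psi> = (\<lambda>n. \<i> * (\<psi> (n + 1) - \<psi> (n - 1)))"

text \<open>exp(s L) for a bounded operator L on l2(Z), via its (norm convergent) power series,
  evaluated coordinatewise.\<close>
definition expop :: "((int \<Rightarrow> complex) \<Rightarrow> (int \<Rightarrow> complex)) \<Rightarrow> complex \<Rightarrow> (int \<Rightarrow> complex) \<Rightarrow> (int \<Rightarrow> complex)" where
  "expop L s \<psi> = (\<lambda>n. \<Sum>k. (s ^ k / of_nat (fact k)) * ((L ^^ k) \<psi>) n)"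

definition heis :: "(real^'d \<Rightarrow> real) \<Rightarrow> real^'d \<Rightarrow> real^'d \<Rightarrow> real \<Rightarrow> (int \<Rightarrow> complex) \<Rightarrow> (int \<Rightarrow> complex)" where
  "heis v \<alpha> x t \<psi> = expop (Hop v \<alpha> x) (\<i> * of_real t) (Aop (expop (Hop v \<alpha> x) (- \<i> * of_real t) \<psi>))"

definition time_avg :: "(real^'d \<Rightarrow> real) \<Rightarrow> real^'d \<Rightarrow> real^'d \<Rightarrow> real \<Rightarrow> (int \<Rightarrow> complex) \<Rightarrow> (int \<Rightarrow> complex)" where
  "time_avg v \<alpha> x T \<psi> = (\<lambda>n. complex_of_real (1 / T) * integral {0..T} (\<lambda>t. heis v \<alpha> x t \<psi> n))"

text \<open>Spectral measure of delta_0 for H(x), i.e. Delta |-> <E_{H(x)}(Delta) delta_0, delta_0>: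
  the (unique) finite Borel measure on R whose moments are <H(x)^k delta_0, delta_0>.\<close>
definition specmeas :: "(real^'d \<Rightarrow> real) \<Rightarrow> real^'d \<Rightarrow> real^'d \<Rightarrow> real measure" where
  "specmeas v \<alpha> x = (THE \<mu>. sets \<mu> = sets borel \<and> finite_measure \<mu> \<and>
      (\<forall>k::nat. integrable \<mu> (\<lambda>l. l ^ k) \<and>
         complex_of_real (integral\<^sup>L \<mu> (\<lambda>l. l ^ k)) = ((Hop v \<alpha> x ^^ k) delta0) 0))"

definition dos :: "(real^'d \<Rightarrow> real) \<Rightarrow> real^'d \<Rightarrow> real measure" where
  "dos v \<alpha> = measure_of UNIV (sets borel)
      (\<lambda>\<Delta>. \<integral>\<^sup>+ x. emeasure (specmeas v \<alpha> x) \<Delta> \<partial>(lebesgue_on unit_cube))"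

definition ids :: "(real^'d \<Rightarrow> real) \<Rightarrow> real^'d \<Rightarrow> real \<Rightarrow> real" where
  "ids v \<alpha> E = measure (dos v \<alpha>) {..E}"

definition rot :: "(real^'d \<Rightarrow> real) \<Rightarrow> real^'d \<Rightarrow> real \<Rightarrow> real" where
  "rot v \<alpha> E = (1 - ids v \<alpha> E) / 2"

definition Smat :: "(real^'d \<Rightarrow> real) \<Rightarrow> real \<Rightarrow> real^'d \<Rightarrow> complex^2^2" where
  "Smat v E x = vector [vector [complex_of_real (E - v x), -1], vector [1, 0]]"

definition diag_rot :: "real \<Rightarrow> complex^2^2" where
  "diag_rot r = vector [vector [exp (2 * pi * \<i> * of_real r), 0], vector [0, exp (- 2 * pi * \<i> * of_real r)]]"

definition L2_deg0_reducible :: "(real^'d \<Rightarrow> real) \<Rightarrow> real^'d \<Rightarrow> bool" where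
  "L2_deg0_reducible v \<alpha> \<longleftrightarrow>
    (AE E in dos v \<alpha>. \<exists>B :: real^'d \<Rightarrow> complex^2^2.
       B \<in> borel_measurable lborel \<and> Zd_periodic B \<and>
       (\<forall>i j. integrable (lebesgue_on unit_cube) (\<lambda>x. (cmod (B x $ i $ j))^2)) \<and>
       (AE x in lebesgue_on unit_cube.
          cmod (det (B x)) = 1 \<and>
          B (x + \<alpha>) ** Smat v E x ** matrix_inv (B x) = diag_rot (rot v \<alpha> E)))"

definition Einv :: "(real^'d \<Rightarrow> real) \<Rightarrow> real^'d \<Rightarrow> real \<Rightarrow> real" where
  "Einv v \<alpha> N = Inf {E. N \<le> ids v \<alpha> E}"

end

theory Submission
  imports Defs
begin

text \<open>The second column of the reducing matrix solves, at phase \<open>t = \<plusminus>\<rho>(E)\<close>, the eigenvalue equation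
  \<open>e(t) a(x+\<alpha>) + e(-t) a(x-\<alpha>) + v(x) a(x) = E(t) a(x)\<close> on the torus, that is, of the Aubry dual of \<open>H\<close>.
  Let \<open>f(x, t)\<close> be a measurable choice of normalised solutions. Since \<open>E(t) \<noteq> E(t - k\<cdot>\<alpha>)\<close> for almost every \<open>t\<close>,
  symmetry of the dual operator makes the shifted eigenfunctions \<open>e\<^sub>k f(\<cdot>, t)\<close> and \<open>f(\<cdot>, t - k\<cdot>\<alpha>)\<close> orthogonal,
  and this says that for almost every \<open>x\<close> the functions \<open>t \<mapsto> e(nt) f(x + n\<alpha>, t)\<close> form, up to conjugation, an
  orthonormal basis of \<open>L\<^sup>2\<close> of the circle in which \<open>H(x)\<close> is multiplication by \<open>E(t)\<close>. The matrix elements of the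
  time average have Fourier coefficients in \<open>x\<close> containing the averages of \<open>exp(is(E(t) - E(t - k\<cdot>\<alpha>)))\<close>; these vanish
  in the limit unless \<open>k = 0\<close>, so \<open>Q(x)\<close> is multiplication by the current \<open>g(t) = \<langle>f, A(t) f\<rangle>\<close>, and
  \<open>\<parallel>Q(x)\<parallel>\<close> is the essential supremum of \<open>|g|\<close>. The Hellmann--Feynman formula \<open>E'(t) = 2\<pi> g(t)\<close> and
  \<open>t = \<plusminus>(1 - N)/2\<close> turn \<open>|g|\<close> into \<open>(dE/dN)/\<pi>\<close>.\<close>

section \<open>Square integrable functions\<close>

text \<open>Three obstacles shape the argument. Reducibility gives eigenfunctions for almost every
  energy separately, with no measurable dependence on it; so the kernel projection of the dual
  operator minus \<open>E t\<close> is built as a strong limit of polynomials in the operator,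
  jointly in \<open>(x, t)\<close>, and applied to the characters. Next, orthogonality of the
  shifted eigenfunctions only shows that the frame \<open>\<phi> x\<close> has an isometric analysis
  map; that it is orthonormal follows by a count: its members have norm at most 1, and the mean over
  x of the squared norms is 1. Finally f is merely square integrable in t, so Hellmann--Feynman
  rests on mean-square continuity of translations. Existence of Q(x) is a hypothesis, so weak limits
  suffice to identify it. Absolute continuity acts twice: absence of atoms gives N(E(y)) = y, the
  source of E(t) \<noteq> E(t - k\<cdot>\<alpha>), and a positive derivative of N makes E(N)
  differentiable almost everywhere. As \<open>specmeas\<close> is a definite description through
  moments, a moment problem is solved before \<open>dos\<close> is known to be a probability
  measure.\<close>

definition sqint :: "'a measure \<Rightarrow> ('a \<Rightarrow> complex) \<Rightarrow> bool" where
  "sqint M u \<longleftrightarrow> u \<in> borel_measurable M \<and> integrable M (\<lambda>x. (cmod (u x))^2)"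

definition ip :: "'a measure \<Rightarrow> ('a \<Rightarrow> complex) \<Rightarrow> ('a \<Rightarrow> complex) \<Rightarrow> complex" where
  "ip M u w = (LINT x|M. cnj (u x) * w x)"

text \<open>No quotient by null functions is taken: elements of L2 remain functions, and
  \<open>norm_sq M u = 0\<close> does the duty of \<open>u = 0\<close>. The same notions serve l2 of
  the integers, the torus, the circle and their products.\<close>

definition norm_sq :: "'a measure \<Rightarrow> ('a \<Rightarrow> complex) \<Rightarrow> real" where
  "norm_sq M u = (LINT x|M. (cmod (u x))^2)"

lemma borel_measurable_cnj'[measurable (raw)]:
  "f \<in> borel_measurable M \<Longrightarrow> (\<lambda>x. cnj (f x)) \<in> borel_measurable M"
  by (rule borel_measurable_continuous_on[where f = cnj]) (auto intro: continuous_intros)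

lemma sqint_measurable[measurable_dest]: "sqint M u \<Longrightarrow> u \<in> borel_measurable M"
  by (simp add: sqint_def)

lemma sqint_integrable: "sqint M u \<Longrightarrow> integrable M (\<lambda>x. (cmod (u x))^2)"
  by (simp add: sqint_def)

lemma sqint_zero[simp]: "sqint M (\<lambda>x. 0)"
  by (simp add: sqint_def)

lemma cmod_add_sq: "(cmod (a + b))^2 \<le> 2 * (cmod a)^2 + 2 * (cmod b)^2"
proof -
  have "(cmod (a + b))^2 \<le> (cmod a + cmod b)^2"
    by (intro power_mono norm_triangle_ineq) auto
  also have "\<dots> \<le> 2 * (cmod a)^2 + 2 * (cmod b)^2"
    using zero_le_power2[of "cmod a - cmod b"] by (simp add: power2_eq_square algebra_simps)
  finally show ?thesis .
qed

lemma sqint_add: assumes "sqint M u" "sqint M w" shows "sqint M (\<lambda>x. u x + w x)"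
proof -
  note [measurable] = sqint_measurable[OF assms(1)] sqint_measurable[OF assms(2)]
  have "integrable M (\<lambda>x. 2 * (cmod (u x))^2 + 2 * (cmod (w x))^2)"
    using assms[THEN sqint_integrable] by auto
  then have "integrable M (\<lambda>x. (cmod (u x + w x))^2)"
    by (rule Bochner_Integration.integrable_bound) (use cmod_add_sq in auto)
  then show ?thesis by (simp add: sqint_def)
qed

lemma sqint_mult_bounded:
  assumes "sqint M u" and [measurable]: "b \<in> borel_measurable M" and b: "\<And>x. x \<in> space M \<Longrightarrow> cmod (b x) \<le> C"
  shows "sqint M (\<lambda>x. b x * u x)"
proof -
  note [measurable] = sqint_measurable[OF assms(1)]
  have "integrable M (\<lambda>x. C^2 * (cmod (u x))^2)"
    using assms(1)[THEN sqint_integrable] by auto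
  then have "integrable M (\<lambda>x. (cmod (b x * u x))^2)"
    by (rule Bochner_Integration.integrable_bound)
       (auto intro!: AE_I2 simp: norm_mult power_mult_distrib mult_right_mono power_mono b)
  then show ?thesis by (simp add: sqint_def)
qed

lemma sqint_cmult: "sqint M u \<Longrightarrow> sqint M (\<lambda>x. c * u x)"
  by (rule sqint_mult_bounded[where C = "cmod c"]) auto

lemma sqint_uminus: "sqint M u \<Longrightarrow> sqint M (\<lambda>x. - u x)"
  using sqint_cmult[of M u "-1"] by simp

lemma sqint_cnj: "sqint M u \<Longrightarrow> sqint M (\<lambda>x. cnj (u x))"
  by (auto simp: sqint_def)

lemma sqint_diff: "sqint M u \<Longrightarrow> sqint M w \<Longrightarrow> sqint M (\<lambda>x. u x - w x)"
  using sqint_add[OF _ sqint_uminus, of M u w] by simp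

lemma sqint_sum: "(\<And>i. i \<in> I \<Longrightarrow> sqint M (u i)) \<Longrightarrow> sqint M (\<lambda>x. \<Sum>i\<in>I. u i x)"
  by (induction I rule: infinite_finite_induct) (auto intro: sqint_add)

lemma sqint_const: "finite_measure M \<Longrightarrow> sqint M (\<lambda>x. c)"
  by (simp add: sqint_def finite_measure.integrable_const)

lemma sqint_bounded:
  assumes "finite_measure M" "b \<in> borel_measurable M" "\<And>x. x \<in> space M \<Longrightarrow> cmod (b x) \<le> C"
  shows "sqint M b"
  using sqint_mult_bounded[OF sqint_const[OF assms(1), of 1] assms(2,3)] by simp

lemma integrable_ip: assumes "sqint M u" "sqint M w" shows "integrable M (\<lambda>x. cnj (u x) * w x)"
proof -
  note [measurable] = sqint_measurable[OF assms(1)] sqint_measurable[OF assms(2)]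
  have "integrable M (\<lambda>x. (cmod (u x))^2 + (cmod (w x))^2)"
    using assms[THEN sqint_integrable] by auto
  then show ?thesis
  proof (rule Bochner_Integration.integrable_bound)
    show "AE x in M. norm (cnj (u x) * w x) \<le> norm ((cmod (u x))^2 + (cmod (w x))^2)"
    proof (rule AE_I2)
      fix x
      have "0 \<le> (cmod (u x) - cmod (w x))^2" "0 \<le> cmod (u x) * cmod (w x)" by auto
      then have "cmod (u x) * cmod (w x) \<le> (cmod (u x))^2 + (cmod (w x))^2"
        unfolding power2_diff by linarith
      then show "norm (cnj (u x) * w x) \<le> norm ((cmod (u x))^2 + (cmod (w x))^2)"
        by (simp add: norm_mult)
    qed
  qed measurable
qed

lemma integrable_sqint: "finite_measure M \<Longrightarrow> sqint M u \<Longrightarrow> integrable M u"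
  using integrable_ip[OF sqint_const[of M 1], of u] by simp

lemma ip_cnj: "cnj (ip M u w) = ip M w u"
proof -
  have "cnj (ip M u w) = (LINT x|M. cnj (cnj (u x) * w x))" unfolding ip_def by (rule Bochner_Integration.integral_cnj[symmetric])
  then show ?thesis by (simp add: ip_def mult.commute)
qed

lemma ip_self: "ip M u u = of_real (norm_sq M u)"
proof -
  have "cnj (u x) * u x = complex_of_real ((cmod (u x))^2)" for x
    unfolding complex_norm_square by (simp only: mult.commute)
  then show ?thesis unfolding ip_def norm_sq_def by (simp only: integral_complex_of_real)
qed

lemma norm_sq_nonneg[simp]: "0 \<le> norm_sq M u"
  by (simp add: norm_sq_def)

lemma ip_add_right: "sqint M u \<Longrightarrow> sqint M w \<Longrightarrow> sqint M z \<Longrightarrow> ip M u (\<lambda>x. w x + z x) = ip M u w + ip M u z"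
  unfolding ip_def by (simp add: distrib_left integrable_ip)

lemma ip_diff_right: "sqint M u \<Longrightarrow> sqint M w \<Longrightarrow> sqint M z \<Longrightarrow> ip M u (\<lambda>x. w x - z x) = ip M u w - ip M u z"
  unfolding ip_def by (simp add: right_diff_distrib integrable_ip)

lemma ip_scale_right: "ip M u (\<lambda>x. c * w x) = c * ip M u w"
  unfolding ip_def by (simp add: mult.left_commute[of _ c])

lemma ip_scale_left: "ip M (\<lambda>x. c * w x) u = cnj c * ip M w u"
  unfolding ip_def by (simp add: mult.assoc)

lemma ip_add_left: "sqint M u \<Longrightarrow> sqint M w \<Longrightarrow> sqint M z \<Longrightarrow> ip M (\<lambda>x. w x + z x) u = ip M w u + ip M z u"
  unfolding ip_def by (simp add: distrib_right integrable_ip)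

lemma ip_diff_left: "sqint M u \<Longrightarrow> sqint M w \<Longrightarrow> sqint M z \<Longrightarrow> ip M (\<lambda>x. w x - z x) u = ip M w u - ip M z u"
  unfolding ip_def by (simp add: left_diff_distrib integrable_ip)

lemma ip_sum_right:
  assumes "sqint M u" "\<And>i. i \<in> I \<Longrightarrow> sqint M (w i)"
  shows "ip M u (\<lambda>x. \<Sum>i\<in>I. w i x) = (\<Sum>i\<in>I. ip M u (w i))"
  using assms(2)
proof (induction I rule: infinite_finite_induct)
  case (insert i I)
  then show ?case using assms(1) by (simp add: ip_add_right sqint_sum)
qed (simp_all add: ip_def)

lemma ip_sum_left:
  assumes "sqint M u" "\<And>i. i \<in> I \<Longrightarrow> sqint M (w i)"
  shows "ip M (\<lambda>x. \<Sum>i\<in>I. w i x) u = (\<Sum>i\<in>I. ip M (w i) u)"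
  using ip_sum_right[OF assms, of I "\<lambda>i. i"] ip_sum_right[OF assms]
  by (metis (no_types, lifting) cnj_sum ip_cnj sum.cong)

lemma norm_sq_scale: "norm_sq M (\<lambda>x. c * u x) = (cmod c)^2 * norm_sq M u"
  by (simp add: norm_sq_def norm_mult power_mult_distrib)

lemma norm_sq_minus_commute: "norm_sq M (\<lambda>x. u x - w x) = norm_sq M (\<lambda>x. w x - u x)"
  by (simp add: norm_sq_def norm_minus_commute)

lemma norm_sq_add_expand:
  assumes "sqint M u" "sqint M w"
  shows "norm_sq M (\<lambda>x. u x + w x) = norm_sq M u + 2 * Re (ip M u w) + norm_sq M w"
proof -
  have "complex_of_real (norm_sq M (\<lambda>x. u x + w x)) = ip M u u + ip M u w + ip M w u + ip M w w"
    using assms by (simp add: ip_self[symmetric] ip_add_left ip_add_right sqint_add)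
  also have "ip M w u = cnj (ip M u w)" by (simp add: ip_cnj)
  finally have "Re (complex_of_real (norm_sq M (\<lambda>x. u x + w x))) = Re (ip M u u + ip M u w + cnj (ip M u w) + ip M w w)"
    by simp
  then show ?thesis by (simp add: ip_self)
qed

lemma norm_sq_diff_expand:
  assumes "sqint M u" "sqint M w"
  shows "norm_sq M (\<lambda>x. u x - w x) = norm_sq M u - 2 * Re (ip M u w) + norm_sq M w"
  using norm_sq_add_expand[OF assms(1) sqint_cmult[OF assms(2), of "-1"]] ip_scale_right[of M u "-1" w]
  by (simp add: norm_sq_def)

lemma norm_sq_zeroD: "sqint M u \<Longrightarrow> norm_sq M u = 0 \<Longrightarrow> AE x in M. u x = 0"
  unfolding norm_sq_def using integral_nonneg_eq_0_iff_AE[of M "\<lambda>x. (cmod (u x))^2"] sqint_integrable[of M u]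
  by auto

lemma norm_sq_zeroI: "AE x in M. u x = 0 \<Longrightarrow> norm_sq M u = 0"
  unfolding norm_sq_def by (rule integral_eq_zero_AE) auto

lemma norm_sq_cong_AE:
  assumes "sqint M u" "w \<in> borel_measurable M" "AE x in M. w x = u x"
  shows "norm_sq M w = norm_sq M u"
proof -
  note [measurable] = sqint_measurable[OF assms(1)] assms(2)
  show ?thesis unfolding norm_sq_def by (rule integral_cong_AE) (use assms(3) in auto)
qed

text \<open>With \<open>z = ip M u w\<close> and real \<open>s\<close>, the squared norm of
  \<open>u - s * cnj z * w\<close> is a nonnegative quadratic polynomial in \<open>s\<close>. Its
  minimum is at \<open>s = 1 / norm_sq M w\<close>; if \<open>norm_sq M w = 0\<close> it is affine,
  which forces \<open>z = 0\<close>.\<close>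

lemma cauchy_schwarz:
  assumes "sqint M u" "sqint M w"
  shows "(cmod (ip M u w))^2 \<le> norm_sq M u * norm_sq M w"
proof -
  define z where "z = ip M u w"
  have *: "0 \<le> norm_sq M u - 2 * s * (cmod z)^2 + s^2 * (cmod z)^2 * norm_sq M w" for s :: real
  proof -
    have "norm_sq M (\<lambda>x. u x + (- (of_real s * cnj z)) * w x) \<ge> 0" by simp
    also have "norm_sq M (\<lambda>x. u x + (- (of_real s * cnj z)) * w x)
        = norm_sq M u + 2 * Re ((- (of_real s * cnj z)) * z) + (cmod (- (of_real s * cnj z)))^2 * norm_sq M w"
      using norm_sq_add_expand[OF assms(1) sqint_cmult[OF assms(2), of "- (of_real s * cnj z)"]]
      unfolding ip_scale_right norm_sq_scale z_def by simp
    also have "Re ((- (of_real s * cnj z)) * z) = - (s * (cmod z)^2)"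
      unfolding cmod_power2 by (simp add: power2_eq_square algebra_simps)
    finally show ?thesis by (simp add: norm_mult power_mult_distrib algebra_simps)
  qed
  show ?thesis
  proof (cases "norm_sq M w = 0")
    case True
    have "(cmod z)^2 = 0"
    proof (rule ccontr)
      assume a: "(cmod z)^2 \<noteq> 0"
      \<comment> \<open>At this \<open>s\<close> the affine expression equals -1.\<close>
      show False using *[of "(norm_sq M u + 1) / (2 * (cmod z)^2)"] True a by simp
    qed
    then show ?thesis by (simp add: z_def True)
  next
    case False
    then have "norm_sq M w > 0" using norm_sq_nonneg[of M w] by linarith
    then show ?thesis using *[of "1 / norm_sq M w"] unfolding z_def[symmetric]
      by (simp add: field_simps power2_eq_square)
  qed
qed

lemma ip_zero_right:
  assumes "sqint M u" "sqint M w" "norm_sq M w = 0" shows "ip M u w = 0"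
  using cauchy_schwarz[OF assms(1,2)] assms(3) by simp

lemma tendsto_ip_zero:
  assumes "sqint M u" "\<And>j. sqint M (s j)" "(\<lambda>j. norm_sq M (s j)) \<longlonglongrightarrow> 0"
  shows "(\<lambda>j. ip M u (s j)) \<longlonglongrightarrow> 0"
proof -
  have "(\<lambda>j. norm_sq M u * norm_sq M (s j)) \<longlonglongrightarrow> norm_sq M u * 0" by (intro tendsto_intros assms)
  then have "(\<lambda>j. (cmod (ip M u (s j)))^2) \<longlonglongrightarrow> 0"
    using tendsto_sandwich[of "\<lambda>_. 0" "\<lambda>j. (cmod (ip M u (s j)))^2" sequentially "\<lambda>j. norm_sq M u * norm_sq M (s j)" 0]
      cauchy_schwarz[OF assms(1,2)] by simp
  then have "(\<lambda>j. sqrt ((cmod (ip M u (s j)))^2)) \<longlonglongrightarrow> sqrt 0" by (intro tendsto_real_sqrt)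
  then show ?thesis by (simp add: tendsto_norm_zero_iff)
qed

lemma tendsto_ip_right:
  assumes "sqint M u" "\<And>j. sqint M (s j)" "sqint M w" "(\<lambda>j. norm_sq M (\<lambda>x. s j x - w x)) \<longlonglongrightarrow> 0"
  shows "(\<lambda>j. ip M u (s j)) \<longlonglongrightarrow> ip M u w"
proof -
  have "(\<lambda>j. ip M u (\<lambda>x. s j x - w x)) \<longlonglongrightarrow> 0"
    by (rule tendsto_ip_zero) (use assms sqint_diff in auto)
  then have "(\<lambda>j. ip M u (s j) - ip M u w) \<longlonglongrightarrow> 0" using assms by (simp add: ip_diff_right)
  then show ?thesis by (simp add: LIM_zero_iff)
qed

lemma tendsto_ip_left:
  assumes "sqint M u" "\<And>j. sqint M (s j)" "sqint M w" "(\<lambda>j. norm_sq M (\<lambda>x. s j x - w x)) \<longlonglongrightarrow> 0"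
  shows "(\<lambda>j. ip M (s j) u) \<longlonglongrightarrow> ip M w u"
  using tendsto_cnj[OF tendsto_ip_right[OF assms]] by (simp add: ip_cnj)

lemma tendsto_norm_sq:
  assumes "\<And>j. sqint M (s j)" "sqint M w" "(\<lambda>j. norm_sq M (\<lambda>x. s j x - w x)) \<longlonglongrightarrow> 0"
  shows "(\<lambda>j. norm_sq M (s j)) \<longlonglongrightarrow> norm_sq M w"
proof -
  have 1: "(\<lambda>j. norm_sq M w - 2 * Re (ip M w (s j)) + norm_sq M (s j)) \<longlonglongrightarrow> 0"
    using assms by (simp add: norm_sq_diff_expand[OF assms(2) assms(1), symmetric] norm_sq_minus_commute[of M w])
  have "(\<lambda>j. ip M w (s j)) \<longlonglongrightarrow> ip M w w" by (rule tendsto_ip_right) (use assms in auto)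
  then have 2: "(\<lambda>j. 2 * Re (ip M w (s j))) \<longlonglongrightarrow> 2 * Re (ip M w w)" by (intro tendsto_intros)
  show ?thesis
    using tendsto_diff[OF tendsto_add[OF 1 2] tendsto_const[of "norm_sq M w"]] by (simp add: ip_self)
qed

text \<open>A fast subsequence converges almost everywhere. Its limit is \<open>u\<close>, and
  Fatou's lemma carries the Cauchy bounds over to \<open>s n - u\<close> along the full
  sequence.\<close>

lemma riesz_fischer:
  assumes s: "\<And>n. sqint M (s n)"
    and cauchy: "\<And>e. e > 0 \<Longrightarrow> \<exists>N. \<forall>m\<ge>N. \<forall>n\<ge>N. norm_sq M (\<lambda>x. s m x - s n x) < e"
  obtains u where "sqint M u" "(\<lambda>n. norm_sq M (\<lambda>x. s n x - u x)) \<longlonglongrightarrow> 0"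
proof -
  note [measurable] = sqint_measurable[OF s]
  have nn: "(\<integral>\<^sup>+x. ennreal ((cmod (u x))^2) \<partial>M) = ennreal (norm_sq M u)" if "sqint M u" for u
    unfolding norm_sq_def by (rule nn_integral_eq_integral) (use that sqint_integrable in auto)
  have "\<exists>N. \<forall>j::nat. (\<forall>m\<ge>N j. \<forall>n\<ge>N j. norm_sq M (\<lambda>x. s m x - s n x) < (1/4)^j)"
    by (rule choice) (use cauchy in auto)
  then obtain N where N: "\<And>j m n. m \<ge> N j \<Longrightarrow> n \<ge> N j \<Longrightarrow> norm_sq M (\<lambda>x. s m x - s n x) < (1/4)^j" by blast
  \<comment> \<open>Summing the \<open>N i\<close> makes \<open>r\<close> monotone and keeps
    \<open>N j \<le> r j\<close>; the summand \<open>j\<close> lets \<open>r\<close> pass every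
    threshold.\<close>
  define r where "r j = (\<Sum>i\<le>j. N i) + j" for j
  have rN: "N j \<le> r j" "r j \<le> r (Suc j)" "j \<le> r j" for j
    by (auto simp: r_def intro: order_trans[OF member_le_sum[of j "{..j}" N]])
  define D where "D j x = s (r (Suc j)) x - s (r j) x" for j x
  have Dm[measurable]: "D j \<in> borel_measurable M" for j unfolding D_def by measurable
  have D: "sqint M (D j)" "norm_sq M (D j) < (1/4)^j" for j
    unfolding D_def using rN[of j] s by (auto intro!: sqint_diff N order_trans[OF rN(1) rN(2)])
  \<comment> \<open>The weight \<open>2^j\<close> against the bound \<open>(1/4)^j\<close> leaves a
    convergent sum. Finiteness almost everywhere then bounds \<open>D j x\<close> by a geometric
    sequence of ratio 1 / sqrt 2.\<close>
  have "(\<integral>\<^sup>+x. (\<Sum>j. ennreal (2^j * (cmod (D j x))^2)) \<partial>M) = (\<Sum>j. \<integral>\<^sup>+x. ennreal (2^j * (cmod (D j x))^2) \<partial>M)"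
    by (rule nn_integral_suminf) measurable
  also have "\<dots> = (\<Sum>j. ennreal (2^j * norm_sq M (D j)))"
    by (simp add: ennreal_mult nn_integral_cmult nn D)
  also have "\<dots> \<le> (\<Sum>j. ennreal ((1/2)^j))"
  proof (intro suminf_le ennreal_leI)
    fix j have "2^j * norm_sq M (D j) \<le> 2^j * (1/4)^j" using D(2)[of j] by (intro mult_left_mono) auto
    also have "\<dots> = (1/2)^j" by (simp add: power_mult_distrib[symmetric])
    finally show "2^j * norm_sq M (D j) \<le> (1/2)^j" .
  qed auto
  also have "\<dots> < \<infinity>"
    by (subst suminf_ennreal2) (auto simp: summable_geometric)
  finally have "AE x in M. (\<Sum>j. ennreal (2^j * (cmod (D j x))^2)) \<noteq> \<infinity>"
    by (intro nn_integral_PInf_AE) (auto simp: less_top[symmetric])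
  then have conv: "AE x in M. convergent (\<lambda>j. s (r j) x)"
  proof eventually_elim
    fix x assume "(\<Sum>j. ennreal (2^j * (cmod (D j x))^2)) \<noteq> \<infinity>"
    then have "summable (\<lambda>j. 2^j * (cmod (D j x))^2)"
      by (intro summable_suminf_not_top) auto
    then have "Bseq (\<lambda>j. 2^j * (cmod (D j x))^2)"
      by (intro convergent_imp_Bseq summable_LIMSEQ_zero[THEN convergentI])
    then obtain K where K: "K > 0" "\<And>j. norm (2^j * (cmod (D j x))^2) \<le> K" by (auto simp: Bseq_def)
    have "cmod (D j x) \<le> sqrt K * (1 / sqrt 2)^j" for j
    proof (rule power2_le_imp_le)
      have "(cmod (D j x))^2 \<le> K * (1/2)^j" using K(2)[of j] by (simp add: field_simps abs_mult)
      also have "\<dots> = (sqrt K * (1 / sqrt 2)^j)^2"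
      proof -
        have "((1 / sqrt 2)^j)^2 = ((1 / sqrt 2)^2)^j" by (simp only: power_mult[symmetric] mult.commute)
        then show ?thesis using K(1) by (simp add: power_mult_distrib power_divide)
      qed
      finally show "(cmod (D j x))^2 \<le> (sqrt K * (1 / sqrt 2)^j)^2" .
    qed (use K in auto)
    moreover have "summable (\<lambda>j. sqrt K * (1 / sqrt 2)^j)"
      by (intro summable_mult summable_geometric) auto
    ultimately have "summable (\<lambda>j. D j x)" by (intro summable_comparison_test[OF _ \<open>summable (\<lambda>j. sqrt K * (1 / sqrt 2)^j)\<close>]) auto
    then have "convergent (\<lambda>n. \<Sum>j<n. D j x)" by (simp add: summable_iff_convergent)
    moreover have "(\<Sum>j<n. D j x) = s (r n) x - s (r 0) x" for n
      unfolding D_def by (rule sum_lessThan_telescope)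
    ultimately have "convergent (\<lambda>n. (s (r n) x - s (r 0) x))" by simp
    then have "convergent (\<lambda>n. (s (r n) x - s (r 0) x) + s (r 0) x)" by (intro convergent_add convergent_const)
    then show "convergent (\<lambda>j. s (r j) x)" by simp
  qed
  define u where "u x = lim (\<lambda>j. s (r j) x)" for x
  have um[measurable]: "u \<in> borel_measurable M" unfolding u_def by measurable
  have tou: "AE x in M. (\<lambda>j. s (r j) x) \<longlonglongrightarrow> u x"
    using conv by eventually_elim (simp add: u_def convergent_LIMSEQ_iff)
  have bound: "(\<integral>\<^sup>+x. ennreal ((cmod (s n x - u x))^2) \<partial>M) \<le> ennreal e"
    if e: "e > 0" "\<And>m. m \<ge> N' \<Longrightarrow> norm_sq M (\<lambda>x. s n x - s m x) < e" for n e N'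
  proof -
    have "(\<integral>\<^sup>+x. ennreal ((cmod (s n x - u x))^2) \<partial>M) = (\<integral>\<^sup>+x. liminf (\<lambda>j. ennreal ((cmod (s n x - s (r j) x))^2)) \<partial>M)"
    proof (rule nn_integral_cong_AE, use tou in eventually_elim)
      fix x assume "(\<lambda>j. s (r j) x) \<longlonglongrightarrow> u x"
      then have "(\<lambda>j. ennreal ((cmod (s n x - s (r j) x))^2)) \<longlonglongrightarrow> ennreal ((cmod (s n x - u x))^2)"
        by (intro tendsto_ennrealI tendsto_intros)
      then show "ennreal ((cmod (s n x - u x))^2) = liminf (\<lambda>j. ennreal ((cmod (s n x - s (r j) x))^2))"
        using lim_imp_Liminf[OF trivial_limit_sequentially] by metis
    qed
    also have "\<dots> \<le> liminf (\<lambda>j. \<integral>\<^sup>+x. ennreal ((cmod (s n x - s (r j) x))^2) \<partial>M)"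
      by (rule nn_integral_liminf) measurable
    also have "\<dots> \<le> ennreal e"
    proof (rule Liminf_le)
      show "\<forall>\<^sub>F j in sequentially. (\<integral>\<^sup>+x. ennreal ((cmod (s n x - s (r j) x))^2) \<partial>M) \<le> ennreal e"
        using eventually_ge_at_top[of N']
      proof eventually_elim
        fix j assume "N' \<le> j"
        then have "N' \<le> r j" using rN(3)[of j] by linarith
        then show "(\<integral>\<^sup>+x. ennreal ((cmod (s n x - s (r j) x))^2) \<partial>M) \<le> ennreal e"
          using e(2)[of "r j"] by (subst nn) (auto intro!: sqint_diff s ennreal_leI)
      qed
    qed auto
    finally show ?thesis .
  qed
  have sqd: "sqint M (\<lambda>x. s n x - u x)" if e: "e > 0" "\<And>m. m \<ge> N' \<Longrightarrow> norm_sq M (\<lambda>x. s n x - s m x) < e" for n e N'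
    unfolding sqint_def
  proof safe
    show "integrable M (\<lambda>x. (cmod (s n x - u x))^2)"
      by (rule integrableI_bounded) (use bound[OF that, of N'] in \<open>auto intro: le_less_trans\<close>)
  qed measurable
  obtain n0 where n0: "\<forall>m\<ge>n0. \<forall>n\<ge>n0. norm_sq M (\<lambda>x. s m x - s n x) < 1" using cauchy[of 1] by auto
  \<comment> \<open>\<open>u\<close> is recovered from one fixed term and its square integrable
    difference to \<open>u\<close>.\<close>
  have "sqint M (\<lambda>x. s n0 x - (s n0 x - u x))"
    by (intro sqint_diff s sqd[of 1 n0]) (use n0 in auto)
  then have u: "sqint M u" by simp
  have "(\<lambda>n. norm_sq M (\<lambda>x. s n x - u x)) \<longlonglongrightarrow> 0"
  proof (rule LIMSEQ_I)
    fix e :: real assume e: "e > 0"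
    then obtain N' where N': "\<forall>m\<ge>N'. \<forall>n\<ge>N'. norm_sq M (\<lambda>x. s m x - s n x) < e/2" using cauchy[of "e/2"] by auto
    show "\<exists>no. \<forall>n\<ge>no. norm (norm_sq M (\<lambda>x. s n x - u x) - 0) < e"
    proof (intro exI[of _ N'] allI impI)
      fix n assume n: "n \<ge> N'"
      have "ennreal (norm_sq M (\<lambda>x. s n x - u x)) \<le> ennreal (e/2)"
        using bound[of "e/2" N' n] e N' n by (simp add: nn sqint_diff s u)
      then show "norm (norm_sq M (\<lambda>x. s n x - u x) - 0) < e" using e by (simp add: ennreal_le_iff)
    qed
  qed
  with u that show ?thesis by blast
qed


section \<open>Square summable sequences and orthonormal systems\<close>

abbreviation CS :: "int measure" where "CS \<equiv> count_space UNIV"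

text \<open>Series over the integers are reached through symmetric partial sums, so that sequential
  limits suffice.\<close>

lemma int_sums_lim:
  fixes f :: "int \<Rightarrow> 'b::{banach, second_countable_topology}"
  assumes "integrable CS f"
  shows "(\<lambda>N. \<Sum>i\<in>{-int N..int N}. f i) \<longlonglongrightarrow> (LINT i|CS. f i)"
proof -
  have "(\<lambda>N. LINT i|CS. indicator {-int N..int N} i *\<^sub>R f i) \<longlonglongrightarrow> (LINT i|CS. f i)"
  proof (rule integral_dominated_convergence[where w = "\<lambda>i. norm (f i)"])
    show "AE i in CS. (\<lambda>N. indicator {-int N..int N} i *\<^sub>R f i) \<longlonglongrightarrow> f i"
    proof (rule AE_I2)
      fix i
      have "\<forall>\<^sub>F N in sequentially. f i = indicator {-int N..int N} i *\<^sub>R f i"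
        using eventually_ge_at_top[of "nat \<bar>i\<bar>"] by eventually_elim (auto simp: indicator_def)
      then show "(\<lambda>N. indicator {-int N..int N} i *\<^sub>R f i) \<longlonglongrightarrow> f i"
        by (rule Lim_transform_eventually[OF tendsto_const])
    qed
  qed (use assms in \<open>auto simp: indicator_def\<close>)
  moreover have "(LINT i|CS. indicator {-int N..int N} i *\<^sub>R f i) = (\<Sum>i\<in>{-int N..int N}. f i)" for N
  proof -
    have "(LINT i|CS. indicator {-int N..int N} i *\<^sub>R f i)
        = (\<Sum>i | i \<in> UNIV \<and> indicator {-int N..int N} i *\<^sub>R f i \<noteq> 0. indicator {-int N..int N} i *\<^sub>R f i)"
      by (rule lebesgue_integral_count_space_finite_support)
         (rule finite_subset[of _ "{-int N..int N}"], auto simp: indicator_def split: if_splits)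
    also have "\<dots> = (\<Sum>i\<in>{-int N..int N}. f i)"
      by (rule sum.mono_neutral_cong_left) (auto simp: indicator_def split: if_splits)
    finally show ?thesis .
  qed
  ultimately show ?thesis by simp
qed

text \<open>Bridge from integrals over counting measure to the unordered sums in which
  \<open>l2\<close> and \<open>l2norm\<close> are phrased.\<close>

lemma sqint_CS_iff: "sqint CS a \<longleftrightarrow> (\<lambda>i. (cmod (a i))^2) summable_on UNIV"
proof -
  have "(\<lambda>i. (cmod (a i))^2) summable_on UNIV \<longleftrightarrow> Infinite_Set_Sum.abs_summable_on (\<lambda>i. (cmod (a i))^2) UNIV"
    using abs_summable_equivalent[of "\<lambda>i. (cmod (a i))^2" UNIV] by simp
  then show ?thesis by (simp add: sqint_def abs_summable_on_def)
qed

lemma norm_sq_CS: "sqint CS a \<Longrightarrow> norm_sq CS a = infsum (\<lambda>i. (cmod (a i))^2) UNIV"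
proof -
  assume "sqint CS a"
  then have "Infinite_Set_Sum.abs_summable_on (\<lambda>i. (cmod (a i))^2) UNIV" by (simp add: sqint_def abs_summable_on_def)
  then show ?thesis using infsetsum_infsum[of "\<lambda>i. (cmod (a i))^2" UNIV] by (simp add: norm_sq_def infsetsum_def)
qed

lemma sqint_CS_bounded_sums:
  assumes "\<And>J. finite J \<Longrightarrow> (\<Sum>i\<in>J. (cmod (a i))^2) \<le> C"
  shows "sqint CS a" "norm_sq CS a \<le> C"
proof -
  show s: "sqint CS a" unfolding sqint_CS_iff
    by (rule nonneg_bdd_above_summable_on) (use assms in \<open>auto intro!: bdd_aboveI[of _ C]\<close>)
  show "norm_sq CS a \<le> C" unfolding norm_sq_def
    by (rule LIMSEQ_le_const2[OF int_sums_lim[OF sqint_integrable[OF s]]]) (use assms in auto)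
qed

lemma norm_sq_CS_sum_le:
  assumes "sqint CS a" "finite J" shows "(\<Sum>i\<in>J. (cmod (a i))^2) \<le> norm_sq CS a"
  unfolding norm_sq_CS[OF assms(1)]
  by (rule finite_sum_le_infsum) (use assms sqint_CS_iff in auto)

lemma norm_sq_CS_zeroD: "sqint CS a \<Longrightarrow> norm_sq CS a = 0 \<Longrightarrow> a i = 0"
  using norm_sq_CS_sum_le[of a "{i}"] by simp

definition orthonormal :: "'a measure \<Rightarrow> (int \<Rightarrow> 'a \<Rightarrow> complex) \<Rightarrow> bool" where
  "orthonormal M e \<longleftrightarrow> (\<forall>i. sqint M (e i)) \<and> (\<forall>i j. ip M (e i) (e j) = (if i = j then 1 else 0))"

definition complete_orthonormal :: "'a measure \<Rightarrow> (int \<Rightarrow> 'a \<Rightarrow> complex) \<Rightarrow> bool" where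
  "complete_orthonormal M e \<longleftrightarrow> orthonormal M e \<and> (\<forall>u. sqint M u \<longrightarrow> (\<forall>i. ip M (e i) u = 0) \<longrightarrow> norm_sq M u = 0)"

lemma orthonormal_sqint: "orthonormal M e \<Longrightarrow> sqint M (e i)"
  by (simp add: orthonormal_def)

lemma orthonormal_ip_sum:
  assumes "orthonormal M e" "finite J"
  shows "ip M (e k) (\<lambda>x. \<Sum>i\<in>J. a i * e i x) = (if k \<in> J then a k else 0)"
proof -
  have "ip M (e k) (\<lambda>x. \<Sum>i\<in>J. a i * e i x) = (\<Sum>i\<in>J. a i * ip M (e k) (e i))"
    using assms(1) by (subst ip_sum_right) (auto simp: orthonormal_sqint sqint_cmult ip_scale_right)
  also have "\<dots> = (\<Sum>i\<in>J. if k = i then a i else 0)"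
    using assms(1) by (intro sum.cong) (auto simp: orthonormal_def)
  finally show ?thesis using assms(2) by simp
qed

lemma orthonormal_norm_sq_sum:
  assumes "orthonormal M e" "finite J"
  shows "norm_sq M (\<lambda>x. \<Sum>i\<in>J. a i * e i x) = (\<Sum>i\<in>J. (cmod (a i))^2)"
proof -
  have "complex_of_real (norm_sq M (\<lambda>x. \<Sum>i\<in>J. a i * e i x)) = (\<Sum>i\<in>J. cnj (a i) * ip M (e i) (\<lambda>x. \<Sum>i\<in>J. a i * e i x))"
    unfolding ip_self[symmetric]
    using assms(1) by (subst ip_sum_left) (auto simp: orthonormal_sqint sqint_cmult sqint_sum ip_scale_left)
  also have "\<dots> = (\<Sum>i\<in>J. cnj (a i) * a i)"
    using assms by (intro sum.cong) (auto simp: orthonormal_ip_sum)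
  also have "\<dots> = complex_of_real (\<Sum>i\<in>J. (cmod (a i))^2)"
    by (simp add: complex_norm_square mult.commute del: of_real_power)
  finally show ?thesis using of_real_eq_iff by blast
qed

lemma bessel:
  assumes "orthonormal M e" "sqint M u"
  shows "sqint CS (\<lambda>i. ip M (e i) u)" "norm_sq CS (\<lambda>i. ip M (e i) u) \<le> norm_sq M u"
proof -
  have *: "(\<Sum>i\<in>J. (cmod (ip M (e i) u))^2) \<le> norm_sq M u" if "finite J" for J
  proof -
    let ?s = "\<lambda>x. \<Sum>i\<in>J. ip M (e i) u * e i x"
    have s: "sqint M ?s" by (intro sqint_sum sqint_cmult orthonormal_sqint[OF assms(1)])
    have "ip M ?s u = (\<Sum>i\<in>J. cnj (ip M (e i) u) * ip M (e i) u)"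
      using assms by (subst ip_sum_left) (auto simp: orthonormal_sqint sqint_cmult ip_scale_left)
    also have "\<dots> = complex_of_real (\<Sum>i\<in>J. (cmod (ip M (e i) u))^2)"
      by (simp add: complex_norm_square mult.commute del: of_real_power)
    finally have "Re (ip M u ?s) = (\<Sum>i\<in>J. (cmod (ip M (e i) u))^2)"
      by (subst ip_cnj[symmetric]) (simp del: of_real_sum)
    then show ?thesis
      using norm_sq_diff_expand[OF assms(2) s] orthonormal_norm_sq_sum[OF assms(1) that] norm_sq_nonneg[of M "\<lambda>x. u x - ?s x"] by simp
  qed
  show "sqint CS (\<lambda>i. ip M (e i) u)" "norm_sq CS (\<lambda>i. ip M (e i) u) \<le> norm_sq M u"
    using sqint_CS_bounded_sums[OF *] by auto
qed

text \<open>The squared distance of two symmetric partial sums is the difference of the partial sums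
  \<open>t\<close> of the squared coefficients, so the Cauchy property is inherited from
  \<open>t\<close>.\<close>

lemma orthonormal_series:
  assumes e: "orthonormal M e" and a: "sqint CS a"
  obtains u where "sqint M u" "(\<lambda>N. norm_sq M (\<lambda>x. (\<Sum>i\<in>{-int N..int N}. a i * e i x) - u x)) \<longlonglongrightarrow> 0"
    "\<And>k. ip M (e k) u = a k" "norm_sq M u = norm_sq CS a"
proof -
  let ?J = "\<lambda>N. {-int N..int N}"
  let ?s = "\<lambda>N x. \<Sum>i\<in>?J N. a i * e i x"
  have s: "sqint M (?s N)" for N by (intro sqint_sum sqint_cmult orthonormal_sqint[OF e])
  define t where "t N = (\<Sum>i\<in>?J N. (cmod (a i))^2)" for N
  have lim: "t \<longlonglongrightarrow> norm_sq CS a"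
    unfolding t_def norm_sq_def by (rule int_sums_lim[OF sqint_integrable[OF a]])
  have diff: "norm_sq M (\<lambda>x. ?s m x - ?s n x) = t m - t n" if "n \<le> m" for m n
  proof -
    have sub: "?J n \<subseteq> ?J m" using that by auto
    have "(\<lambda>x. ?s m x - ?s n x) = (\<lambda>x. \<Sum>i\<in>?J m - ?J n. a i * e i x)"
      by (rule ext, rule sum_diff[OF _ sub, symmetric]) simp
    then show ?thesis using sum_diff[OF _ sub, of "\<lambda>i. (cmod (a i))^2"] by (simp add: orthonormal_norm_sq_sum[OF e] t_def)
  qed
  have "\<exists>N. \<forall>m\<ge>N. \<forall>n\<ge>N. norm_sq M (\<lambda>x. ?s m x - ?s n x) < r" if "r > 0" for r :: real
  proof -
    have "Cauchy t" using lim by (intro LIMSEQ_imp_Cauchy)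
    then obtain N where N: "\<forall>m\<ge>N. \<forall>n\<ge>N. \<bar>t m - t n\<bar> < r"
      using \<open>r > 0\<close> by (auto simp: Cauchy_def dist_real_def)
    have "norm_sq M (\<lambda>x. ?s m x - ?s n x) < r" if "m \<ge> N" "n \<ge> N" for m n
    proof (cases "n \<le> m")
      case True then show ?thesis using N that by (auto simp: diff abs_less_iff)
    next
      case False
      then have "norm_sq M (\<lambda>x. ?s m x - ?s n x) = t n - t m"
        using diff[of m n] by (subst norm_sq_minus_commute) simp
      then show ?thesis using N that by (simp add: abs_less_iff)
    qed
    then show ?thesis by blast
  qed
  from riesz_fischer[OF s this] obtain u where u: "sqint M u" "(\<lambda>N. norm_sq M (\<lambda>x. ?s N x - u x)) \<longlonglongrightarrow> 0" by blast
  have "ip M (e k) u = a k" for k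
  proof (rule LIMSEQ_unique)
    show "(\<lambda>N. ip M (e k) (?s N)) \<longlonglongrightarrow> ip M (e k) u"
      by (rule tendsto_ip_right) (use e u s orthonormal_sqint in auto)
    have "\<forall>\<^sub>F N in sequentially. a k = ip M (e k) (?s N)"
      using eventually_ge_at_top[of "nat \<bar>k\<bar>"] by eventually_elim (subst orthonormal_ip_sum[OF e], auto)
    then show "(\<lambda>N. ip M (e k) (?s N)) \<longlonglongrightarrow> a k"
      by (rule Lim_transform_eventually[OF tendsto_const])
  qed
  moreover have "norm_sq M u = norm_sq CS a"
  proof (rule LIMSEQ_unique[OF _ lim])
    show "t \<longlonglongrightarrow> norm_sq M u"
      using tendsto_norm_sq[OF s u] unfolding t_def by (simp add: orthonormal_norm_sq_sum[OF e])
  qed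
  ultimately show ?thesis using that u by blast
qed

lemma complete_orthonormal_expansion:
  assumes e: "complete_orthonormal M e" and u: "sqint M u"
  shows "(\<lambda>N. norm_sq M (\<lambda>x. (\<Sum>i\<in>{-int N..int N}. ip M (e i) u * e i x) - u x)) \<longlonglongrightarrow> 0"
    and "norm_sq CS (\<lambda>i. ip M (e i) u) = norm_sq M u"
proof -
  have o: "orthonormal M e" using e by (simp add: complete_orthonormal_def)
  obtain w where w: "sqint M w" "(\<lambda>N. norm_sq M (\<lambda>x. (\<Sum>i\<in>{-int N..int N}. ip M (e i) u * e i x) - w x)) \<longlonglongrightarrow> 0"
    "\<And>k. ip M (e k) w = ip M (e k) u" "norm_sq M w = norm_sq CS (\<lambda>i. ip M (e i) u)"
    using orthonormal_series[OF o bessel(1)[OF o u]] by blast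
  have "norm_sq M (\<lambda>x. w x - u x) = 0"
    using e w u unfolding complete_orthonormal_def by (auto simp: ip_diff_right orthonormal_sqint[OF o] sqint_diff)
  then have eq: "AE x in M. w x = u x" using norm_sq_zeroD[OF sqint_diff[OF w(1) u]] by auto
  have "norm_sq M (\<lambda>x. (\<Sum>i\<in>{-int N..int N}. ip M (e i) u * e i x) - w x)
      = norm_sq M (\<lambda>x. (\<Sum>i\<in>{-int N..int N}. ip M (e i) u * e i x) - u x)" for N
    by (rule norm_sq_cong_AE) (use eq in \<open>auto intro!: sqint_measurable sqint_diff sqint_sum sqint_cmult orthonormal_sqint[OF o] u w\<close>)
  then show "(\<lambda>N. norm_sq M (\<lambda>x. (\<Sum>i\<in>{-int N..int N}. ip M (e i) u * e i x) - u x)) \<longlonglongrightarrow> 0" using w(2) by simp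
  have "norm_sq M w = norm_sq M u" by (rule norm_sq_cong_AE) (use eq u w sqint_measurable in auto)
  then show "norm_sq CS (\<lambda>i. ip M (e i) u) = norm_sq M u" using w(4) by simp
qed

lemma parseval:
  assumes e: "complete_orthonormal M e" and u: "sqint M u" and w: "sqint M w"
  shows "ip CS (\<lambda>i. ip M (e i) u) (\<lambda>i. ip M (e i) w) = ip M u w"
proof -
  have o: "orthonormal M e" using e by (simp add: complete_orthonormal_def)
  show ?thesis
  proof (rule LIMSEQ_unique)
    show "(\<lambda>N. \<Sum>i\<in>{-int N..int N}. cnj (ip M (e i) u) * ip M (e i) w) \<longlonglongrightarrow> ip CS (\<lambda>i. ip M (e i) u) (\<lambda>i. ip M (e i) w)"
      unfolding ip_def[of CS] by (rule int_sums_lim) (intro integrable_ip bessel(1)[OF o] u w)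
    have "(\<lambda>N. ip M (\<lambda>x. (\<Sum>i\<in>{-int N..int N}. ip M (e i) u * e i x)) w) \<longlonglongrightarrow> ip M u w"
      by (rule tendsto_ip_left[OF w _ u complete_orthonormal_expansion(1)[OF e u]])
         (intro sqint_sum sqint_cmult orthonormal_sqint[OF o])
    moreover have "ip M (\<lambda>x. (\<Sum>i\<in>J. ip M (e i) u * e i x)) w = (\<Sum>i\<in>J. cnj (ip M (e i) u) * ip M (e i) w)" for J
      using o w by (subst ip_sum_left) (auto simp: orthonormal_sqint sqint_cmult ip_scale_left)
    ultimately show "(\<lambda>N. \<Sum>i\<in>{-int N..int N}. cnj (ip M (e i) u) * ip M (e i) w) \<longlonglongrightarrow> ip M u w" by simp
  qed
qed

section \<open>Weighted shifts along a measure preserving map\<close>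

text \<open>The inverse is carried along because the adjoint of composition with
  \<open>\<sigma>\<close> is composition with \<open>\<tau>\<close>.\<close>

locale measure_preserving_pair =
  fixes M :: "'a measure" and \<sigma> \<tau> :: "'a \<Rightarrow> 'a"
  assumes \<sigma>_measurable[measurable]: "\<sigma> \<in> M \<rightarrow>\<^sub>M M" and \<tau>_measurable[measurable]: "\<tau> \<in> M \<rightarrow>\<^sub>M M"
    and \<sigma>\<tau>: "\<And>z. z \<in> space M \<Longrightarrow> \<sigma> (\<tau> z) = z" and \<tau>\<sigma>: "\<And>z. z \<in> space M \<Longrightarrow> \<tau> (\<sigma> z) = z"
    and distr_\<sigma>: "distr M M \<sigma> = M"
begin

lemma distr_\<tau>: "distr M M \<tau> = M"
proof -
  have "distr M M \<tau> = distr (distr M M \<sigma>) M \<tau>" by (simp add: distr_\<sigma>)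
  also have "\<dots> = distr M M (\<tau> \<circ> \<sigma>)" by (rule distr_distr) auto
  also have "\<dots> = distr M M (\<lambda>z. z)" by (rule distr_cong) (auto simp: \<tau>\<sigma>)
  finally show ?thesis by simp
qed

lemma swap: "measure_preserving_pair M \<tau> \<sigma>"
  by standard (auto simp: \<sigma>\<tau> \<tau>\<sigma> distr_\<tau>)

lemma integral_comp: "f \<in> borel_measurable M \<Longrightarrow> (LINT z|M. f (\<sigma> z)) = (LINT z|M. f z)"
  for f :: "'a \<Rightarrow> 'b::{banach, second_countable_topology}"
  using integral_distr[OF \<sigma>_measurable, of f] by (simp add: distr_\<sigma>)

lemma integrable_comp: "integrable M f \<Longrightarrow> integrable M (\<lambda>z. f (\<sigma> z))"
  for f :: "'a \<Rightarrow> 'b::{banach, second_countable_topology}"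
  using integrable_distr[OF \<sigma>_measurable, of f] by (simp add: distr_\<sigma>)

lemma sqint_comp: "sqint M u \<Longrightarrow> sqint M (\<lambda>z. u (\<sigma> z))"
  unfolding sqint_def by (auto intro: integrable_comp[of "\<lambda>x. (cmod (u x))^2"])

lemma norm_sq_comp: "sqint M u \<Longrightarrow> norm_sq M (\<lambda>z. u (\<sigma> z)) = norm_sq M u"
  unfolding norm_sq_def by (rule integral_comp) (auto simp: sqint_def)

lemma AE_comp: "AE z in M. P z \<Longrightarrow> AE z in M. P (\<sigma> z)"
  using AE_distrD[OF \<sigma>_measurable, of P] unfolding distr_\<sigma> .

end

text \<open>Common form of all operators of the proof. The second coefficient of \<open>J\<close> is
  chosen so that the two shift terms are adjoint to each other. Instances are H(x) and the current A
  on the integers, and their dual counterparts on the torus and on torus times circle.\<close>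

locale jacobi = measure_preserving_pair +
  fixes p :: "'a \<Rightarrow> complex" and q :: "'a \<Rightarrow> real" and V :: real
  assumes p_measurable[measurable]: "p \<in> borel_measurable M" and p_le: "\<And>z. z \<in> space M \<Longrightarrow> cmod (p z) \<le> 1"
    and q_measurable[measurable]: "q \<in> borel_measurable M" and q_le: "\<And>z. z \<in> space M \<Longrightarrow> \<bar>q z\<bar> \<le> V"
begin

definition J :: "('a \<Rightarrow> complex) \<Rightarrow> 'a \<Rightarrow> complex" where
  "J u z = p z * u (\<sigma> z) + cnj (p (\<tau> z)) * u (\<tau> z) + of_real (q z) * u z"

lemma J_terms:
  assumes "sqint M u"
  shows "sqint M (\<lambda>z. p z * u (\<sigma> z))" "sqint M (\<lambda>z. cnj (p (\<tau> z)) * u (\<tau> z))" "sqint M (\<lambda>z. of_real (q z) * u z)"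
proof -
  interpret s: measure_preserving_pair M \<tau> \<sigma> by (rule swap)
  have sp: "z \<in> space M \<Longrightarrow> \<tau> z \<in> space M" for z using measurable_space[OF \<tau>_measurable] .
  show "sqint M (\<lambda>z. p z * u (\<sigma> z))"
    by (rule sqint_mult_bounded[OF sqint_comp[OF assms], where C = 1]) (auto simp: p_le)
  show "sqint M (\<lambda>z. cnj (p (\<tau> z)) * u (\<tau> z))"
    by (rule sqint_mult_bounded[OF s.sqint_comp[OF assms], where C = 1]) (auto simp: p_le sp)
  show "sqint M (\<lambda>z. of_real (q z) * u z)"
    by (rule sqint_mult_bounded[OF assms, where C = V]) (auto simp: q_le)
qed

lemma sqint_J: "sqint M u \<Longrightarrow> sqint M (J u)"
  unfolding J_def using J_terms[of u] by (intro sqint_add)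

lemma J_linear: "J (\<lambda>z. a * u z + b * w z) z = a * J u z + b * J w z"
  by (simp add: J_def algebra_simps)

lemma J_symmetric:
  assumes u: "sqint M u" and w: "sqint M w"
  shows "ip M (J u) w = ip M u (J w)"
proof -
  note [measurable] = sqint_measurable[OF u] sqint_measurable[OF w]
  interpret s: measure_preserving_pair M \<tau> \<sigma> by (rule swap)
  have 1: "ip M (\<lambda>z. p z * u (\<sigma> z)) w = ip M u (\<lambda>z. cnj (p (\<tau> z)) * w (\<tau> z))"
  proof -
    have "ip M (\<lambda>z. p z * u (\<sigma> z)) w = (LINT z|M. cnj (p (\<tau> z) * u (\<sigma> (\<tau> z))) * w (\<tau> z))"
      unfolding ip_def by (rule s.integral_comp[symmetric]) measurable
    also have "\<dots> = ip M u (\<lambda>z. cnj (p (\<tau> z)) * w (\<tau> z))"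
      unfolding ip_def by (rule Bochner_Integration.integral_cong) (auto simp: \<sigma>\<tau>)
    finally show ?thesis .
  qed
  have 2: "ip M (\<lambda>z. cnj (p (\<tau> z)) * u (\<tau> z)) w = ip M u (\<lambda>z. p z * w (\<sigma> z))"
  proof -
    have "ip M (\<lambda>z. cnj (p (\<tau> z)) * u (\<tau> z)) w = (LINT z|M. cnj (cnj (p (\<tau> (\<sigma> z))) * u (\<tau> (\<sigma> z))) * w (\<sigma> z))"
      unfolding ip_def by (rule integral_comp[symmetric]) measurable
    also have "\<dots> = ip M u (\<lambda>z. p z * w (\<sigma> z))"
      unfolding ip_def by (rule Bochner_Integration.integral_cong) (auto simp: \<tau>\<sigma>)
    finally show ?thesis .
  qed
  have 3: "ip M (\<lambda>z. of_real (q z) * u z) w = ip M u (\<lambda>z. of_real (q z) * w z)"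
    unfolding ip_def by (simp add: mult_ac)
  show ?thesis
    unfolding J_def using u w J_terms[OF u] J_terms[OF w]
    by (simp add: ip_add_left ip_add_right sqint_add 1 2 3)
qed

text \<open>The constant comes from (a + b + c)^2 \<le> 3 (a^2 + b^2 + c^2): each shift contributes
  3, the diagonal term 3 V^2.\<close>

lemma norm_sq_J_le:
  assumes u: "sqint M u" shows "norm_sq M (J u) \<le> (6 + 3 * V^2) * norm_sq M u"
proof -
  note [measurable] = sqint_measurable[OF u]
  interpret s: measure_preserving_pair M \<tau> \<sigma> by (rule swap)
  note sq = sqint_integrable[OF u] sqint_integrable[OF sqint_comp[OF u]] sqint_integrable[OF s.sqint_comp[OF u]]
  have "norm_sq M (J u) \<le> (LINT z|M. 3 * (cmod (u (\<sigma> z)))^2 + 3 * (cmod (u (\<tau> z)))^2 + 3 * V^2 * (cmod (u z))^2)"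
    unfolding norm_sq_def
  proof (rule integral_mono)
    show "integrable M (\<lambda>x. (cmod (J u x))^2)" using sqint_J[OF u] by (rule sqint_integrable)
    show "integrable M (\<lambda>z. 3 * (cmod (u (\<sigma> z)))^2 + 3 * (cmod (u (\<tau> z)))^2 + 3 * V^2 * (cmod (u z))^2)"
      using sq by auto
    fix z assume z: "z \<in> space M"
    have tz: "\<tau> z \<in> space M" using z measurable_space[OF \<tau>_measurable] by blast
    have "cmod (J u z) \<le> cmod (u (\<sigma> z)) + cmod (u (\<tau> z)) + V * cmod (u z)"
      unfolding J_def
      by (intro order_trans[OF norm_triangle_ineq] add_mono)
         (auto simp: norm_mult p_le[OF z] p_le[OF tz] q_le[OF z] intro!: mult_left_le_one_le mult_right_mono)
    then have "(cmod (J u z))^2 \<le> (cmod (u (\<sigma> z)) + cmod (u (\<tau> z)) + V * cmod (u z))^2"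
      by (intro power_mono) auto
    also have "\<dots> \<le> 3 * (cmod (u (\<sigma> z)))^2 + 3 * (cmod (u (\<tau> z)))^2 + 3 * (V * cmod (u z))^2"
      for a b c :: real
      using zero_le_power2[of "cmod (u (\<sigma> z)) - cmod (u (\<tau> z))"] zero_le_power2[of "cmod (u (\<sigma> z)) - V * cmod (u z)"]
        zero_le_power2[of "cmod (u (\<tau> z)) - V * cmod (u z)"]
      by (simp add: power2_eq_square algebra_simps)
    finally show "(cmod (J u z))^2 \<le> 3 * (cmod (u (\<sigma> z)))^2 + 3 * (cmod (u (\<tau> z)))^2 + 3 * V^2 * (cmod (u z))^2"
      by (simp add: power_mult_distrib)
  qed
  also have "\<dots> = (6 + 3 * V^2) * norm_sq M u"
    using sq norm_sq_comp[OF u] s.norm_sq_comp[OF u] by (simp add: norm_sq_def algebra_simps)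
  finally show ?thesis .
qed

end

section \<open>Bounded symmetric operators and the projection onto their kernel\<close>

locale symmetric_operator =
  fixes M :: "'a measure" and S :: "('a \<Rightarrow> complex) \<Rightarrow> 'a \<Rightarrow> complex" and R :: real
  assumes S_sqint: "\<And>u. sqint M u \<Longrightarrow> sqint M (S u)"
    and S_linear: "\<And>a b u w z. S (\<lambda>z. a * u z + b * w z) z = a * S u z + b * S w z"
    and S_symmetric: "\<And>u w. sqint M u \<Longrightarrow> sqint M w \<Longrightarrow> ip M (S u) w = ip M u (S w)"
    and S_bound: "\<And>u. sqint M u \<Longrightarrow> norm_sq M (S u) \<le> R^2 * norm_sq M u"
    and R_pos: "R > 0"
begin

lemma S_diff: "S (\<lambda>z. u z - w z) z = S u z - S w z"
  using S_linear[of 1 u "-1" w z] by simp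

lemma S_diff': "S (\<lambda>z. u z - w z) = (\<lambda>z. S u z - S w z)"
  by (rule ext) (rule S_diff)

lemma S_cmult: "S (\<lambda>z. c * u z) z = c * S u z"
  using S_linear[of c u 0 u z] by simp

lemma S_tendsto:
  assumes "\<And>j. sqint M (s j)" "sqint M w" "(\<lambda>j. norm_sq M (\<lambda>x. s j x - w x)) \<longlonglongrightarrow> 0"
  shows "(\<lambda>j. norm_sq M (\<lambda>x. S (s j) x - S w x)) \<longlonglongrightarrow> 0"
proof -
  have "(\<lambda>j. R^2 * norm_sq M (\<lambda>x. s j x - w x)) \<longlonglongrightarrow> R^2 * 0"
    by (intro tendsto_intros assms)
  moreover have "norm_sq M (\<lambda>x. S (s j) x - S w x) \<le> R^2 * norm_sq M (\<lambda>x. s j x - w x)" for j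
    using S_bound[OF sqint_diff[OF assms(1) assms(2)]] by (simp add: S_diff')
  ultimately show ?thesis
    using tendsto_sandwich[of "\<lambda>_. 0" "\<lambda>j. norm_sq M (\<lambda>x. S (s j) x - S w x)" sequentially "\<lambda>j. R^2 * norm_sq M (\<lambda>x. s j x - w x)" 0]
    by simp
qed

definition K :: "('a \<Rightarrow> complex) \<Rightarrow> 'a \<Rightarrow> complex" where
  "K u z = u z - of_real (1 / R^2) * S (S u) z"

lemma K_sqint: "sqint M u \<Longrightarrow> sqint M (K u)"
  unfolding K_def by (intro sqint_diff sqint_cmult S_sqint)

lemma K_pow_sqint: "sqint M u \<Longrightarrow> sqint M ((K ^^ n) u)"
  by (induction n) (auto intro: K_sqint)

lemma K_symmetric: "sqint M u \<Longrightarrow> sqint M w \<Longrightarrow> ip M (K u) w = ip M u (K w)"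
  unfolding K_def
  by (simp add: ip_diff_left ip_diff_right S_sqint sqint_cmult ip_scale_left ip_scale_right S_symmetric
      del: of_real_divide of_real_power)

lemma K_pow_symmetric: "sqint M u \<Longrightarrow> sqint M w \<Longrightarrow> ip M ((K ^^ n) u) w = ip M u ((K ^^ n) w)"
proof (induction n arbitrary: w)
  case (Suc n)
  then have "ip M ((K ^^ Suc n) u) w = ip M u ((K ^^ n) (K w))"
    by (simp add: K_symmetric K_pow_sqint K_sqint)
  then show ?case by (simp add: funpow_swap1)
qed simp

lemma K_form: "sqint M u \<Longrightarrow> Re (ip M u (K u)) = norm_sq M u - norm_sq M (S u) / R^2"
proof -
  assume u: "sqint M u"
  have "ip M u (K u) = ip M u u - of_real (1 / R^2) * ip M u (S (S u))"
    unfolding K_def by (simp add: u ip_diff_right S_sqint sqint_cmult ip_scale_right del: of_real_divide of_real_power)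
  also have "ip M u (S (S u)) = of_real (norm_sq M (S u))"
    using S_symmetric[OF u S_sqint[OF u]] by (simp add: ip_self)
  finally show ?thesis by (simp add: ip_self flip: of_real_divide of_real_power)
qed

lemma K_S: "K (S u) = S (K u)"
  unfolding K_def fun_eq_iff by (simp add: S_diff S_cmult del: of_real_divide of_real_power)

lemma K_pow_S: "(K ^^ n) (S u) = S ((K ^^ n) u)"
  by (induction n) (simp_all add: K_S)

text \<open>Halve the exponent: an even power gives a squared norm, an odd one the form of
  \<open>K\<close> at \<open>(K ^^ k) u\<close>, which is nonnegative by the norm bound on
  \<open>S\<close>.\<close>

lemma K_pow_form_pos: assumes u: "sqint M u" shows "0 \<le> Re (ip M u ((K ^^ n) u))"
proof (cases "even n")
  case True
  then obtain k where "n = k + k" by (auto elim!: evenE simp: mult_2)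
  then have "ip M u ((K ^^ n) u) = ip M ((K ^^ k) u) ((K ^^ k) u)"
    by (simp add: funpow_add K_pow_symmetric K_pow_sqint u)
  then show ?thesis by (simp add: ip_self)
next
  case False
  then obtain k where "n = k + Suc k" by (auto elim!: oddE simp: mult_2)
  then have "ip M u ((K ^^ n) u) = ip M ((K ^^ k) u) (K ((K ^^ k) u))"
    by (simp only: funpow_add K_pow_symmetric K_pow_sqint u K_sqint o_apply funpow.simps)
  moreover have "norm_sq M (S ((K ^^ k) u)) / R^2 \<le> norm_sq M ((K ^^ k) u)"
    using S_bound[OF K_pow_sqint[OF u, of k]] R_pos by (simp add: divide_le_eq mult.commute)
  ultimately show ?thesis by (simp add: K_form K_pow_sqint u)
qed

text \<open>Since \<open>K\<close> commutes with \<open>S\<close>, the drop is the form of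
  \<open>K ^^ n\<close> at \<open>S u\<close>, divided by \<open>R^2\<close>.\<close>

lemma K_pow_form_decr:
  assumes u: "sqint M u" shows "Re (ip M u ((K ^^ Suc n) u)) \<le> Re (ip M u ((K ^^ n) u))"
proof -
  have "(K ^^ Suc n) u = (\<lambda>z. (K ^^ n) u z - of_real (1 / R^2) * S ((K ^^ n) (S u)) z)"
    by (simp add: K_pow_S fun_eq_iff K_def del: of_real_divide of_real_power)
  then have "ip M u ((K ^^ Suc n) u) = ip M u ((K ^^ n) u) - of_real (1 / R^2) * ip M (S u) ((K ^^ n) (S u))"
    by (simp add: ip_diff_right u K_pow_sqint S_sqint sqint_cmult ip_scale_right S_symmetric
        del: of_real_divide of_real_power)
  moreover have "0 \<le> 1 / R^2 * Re (ip M (S u) ((K ^^ n) (S u)))"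
    using K_pow_form_pos[OF S_sqint[OF u]] by simp
  ultimately show ?thesis by (simp flip: of_real_divide of_real_power)
qed

text \<open>\<open>K = 1 - S\<^sup>2/R\<^sup>2\<close> satisfies \<open>0 \<le> K \<le> 1\<close>, so its powers converge strongly to the projection onto the kernel of \<open>S\<close>.\<close>

lemma K_pow_converges:
  assumes u: "sqint M u"
  obtains P where "sqint M P" "(\<lambda>n. norm_sq M (\<lambda>z. (K ^^ n) u z - P z)) \<longlonglongrightarrow> 0" "AE z in M. S P z = 0"
proof -
  define c where "c n = Re (ip M u ((K ^^ n) u))" for n
  have "decseq c" unfolding c_def by (intro decseq_SucI K_pow_form_decr u)
  then obtain L where L: "c \<longlonglongrightarrow> L"
    using decseq_convergent[of c 0] K_pow_form_pos[OF u] unfolding c_def by blast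
  have ipm: "ip M ((K ^^ m) u) ((K ^^ n) u) = ip M u ((K ^^ (m + n)) u)" for m n
    by (simp add: funpow_add K_pow_symmetric K_pow_sqint u)
  \<comment> \<open>Inner products of iterates depend only on the sum of the exponents, so
    convergence of the real sequence \<open>c\<close> gives the Cauchy property in norm.\<close>
  have nd: "norm_sq M (\<lambda>z. (K ^^ m) u z - (K ^^ n) u z) = c (m + m) - 2 * c (m + n) + c (n + n)" for m n
    using arg_cong[OF ipm[of m m], of Re] arg_cong[OF ipm[of n n], of Re]
    by (simp add: norm_sq_diff_expand K_pow_sqint u ipm ip_self c_def)
  have "\<exists>N. \<forall>m\<ge>N. \<forall>n\<ge>N. norm_sq M (\<lambda>z. (K ^^ m) u z - (K ^^ n) u z) < e" if "e > 0" for e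
  proof -
    have "\<exists>N. \<forall>n\<ge>N. \<bar>c n - L\<bar> < e / 4" using LIMSEQ_D[OF L, of "e/4"] that by simp
    then obtain N where N: "\<And>n. n \<ge> N \<Longrightarrow> \<bar>c n - L\<bar> < e / 4" by blast
    have "norm_sq M (\<lambda>z. (K ^^ m) u z - (K ^^ n) u z) < e" if "m \<ge> N" "n \<ge> N" for m n
      using N[of "m + m"] N[of "m + n"] N[of "n + n"] that unfolding nd abs_less_iff by linarith
    then show ?thesis by blast
  qed
  from riesz_fischer[OF K_pow_sqint[OF u] this] obtain P
    where P: "sqint M P" "(\<lambda>n. norm_sq M (\<lambda>z. (K ^^ n) u z - P z)) \<longlonglongrightarrow> 0" by blast
  have SP: "sqint M (S (S P))" using P by (intro S_sqint)
  have "(\<lambda>n. norm_sq M (\<lambda>z. S (S ((K ^^ n) u)) z - S (S P) z)) \<longlonglongrightarrow> 0"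
    by (intro S_tendsto S_sqint K_pow_sqint u P)
  then have 1: "(\<lambda>n. norm_sq M (S (S ((K ^^ n) u)))) \<longlonglongrightarrow> norm_sq M (S (S P))"
    by (rule tendsto_norm_sq[rotated 2]) (intro S_sqint K_pow_sqint u P)+
  \<comment> \<open>By definition of \<open>K\<close>, applying \<open>S\<close> twice is
    \<open>R^2\<close> times the difference of consecutive iterates; hence the factor
    \<open>R^4\<close>.\<close>
  have "norm_sq M (S (S ((K ^^ n) u))) = R^4 * (c (n + n) - 2 * c (n + Suc n) + c (Suc n + Suc n))" for n
  proof -
    have "(\<lambda>z. (K ^^ n) u z - (K ^^ Suc n) u z) = (\<lambda>z. of_real (1 / R^2) * S (S ((K ^^ n) u)) z)"
      by (simp add: fun_eq_iff K_def del: of_real_divide of_real_power)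
    then have "norm_sq M (\<lambda>z. (K ^^ n) u z - (K ^^ Suc n) u z) = (1 / R^2)^2 * norm_sq M (S (S ((K ^^ n) u)))"
      by (simp only: norm_sq_scale norm_of_real power2_abs)
    then have "norm_sq M (S (S ((K ^^ n) u))) = R^4 * norm_sq M (\<lambda>z. (K ^^ n) u z - (K ^^ Suc n) u z)"
      using R_pos by (simp add: field_simps power_mult[symmetric])
    then show ?thesis unfolding nd .
  qed
  moreover have "(\<lambda>n. R^4 * (c (n + n) - 2 * c (n + Suc n) + c (Suc n + Suc n))) \<longlonglongrightarrow> R^4 * (L - 2 * L + L)"
    by (intro tendsto_intros LIMSEQ_subseq_LIMSEQ[OF L, unfolded o_def]) (auto simp: strict_mono_def)
  ultimately have "norm_sq M (S (S P)) = 0" using 1 LIMSEQ_unique by fastforce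
  \<comment> \<open>From \<open>S (S P) = 0\<close> to \<open>S P = 0\<close>: by symmetry this
    inner product is the squared norm of \<open>S P\<close>.\<close>
  then have "ip M P (S (S P)) = 0" by (intro ip_zero_right P SP)
  then have "norm_sq M (S P) = 0"
    using S_symmetric[OF P(1) S_sqint[OF P(1)]] by (simp add: ip_self)
  then have "AE z in M. S P z = 0" by (intro norm_sq_zeroD S_sqint P)
  with P that show ?thesis by blast
qed

text \<open>Kernel vectors are fixed by \<open>K\<close>, so their pairing with the iterates is
  constant. In the limit this identifies \<open>P\<close> of the preceding lemma as the orthogonal
  projection of \<open>u\<close> onto the kernel.\<close>

lemma K_pow_kernel:
  assumes u: "sqint M u" and a: "sqint M a" "AE z in M. S a z = 0"
  shows "ip M ((K ^^ n) u) a = ip M u a"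
proof (induction n)
  case (Suc n)
  have n0: "norm_sq M (S a) = 0" by (intro norm_sq_zeroI a)
  have "ip M ((K ^^ Suc n) u) a = ip M ((K ^^ n) u) a - of_real (1 / R^2) * ip M (S ((K ^^ n) u)) (S a)"
    using K_pow_sqint[OF u, of n] a(1)
    by (simp add: K_def[abs_def] ip_diff_left S_sqint sqint_cmult ip_scale_left S_symmetric del: of_real_divide of_real_power)
  also have "ip M (S ((K ^^ n) u)) (S a) = 0"
    by (intro ip_zero_right S_sqint K_pow_sqint u a n0)
  finally show ?case using Suc by simp
qed simp

end

sublocale jacobi \<subseteq> symmetric_operator M J "sqrt (6 + 3 * V^2)"
proof
  show "norm_sq M (J u) \<le> (sqrt (6 + 3 * V^2))^2 * norm_sq M u" if "sqint M u" for u
    using norm_sq_J_le[OF that] by (simp add: add_nonneg_nonneg)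
  show "0 < sqrt (6 + 3 * V^2)" by (simp add: add_pos_nonneg)
qed (use sqint_J J_linear J_symmetric in auto)

section \<open>Differentiation of measures on the line\<close>

lemma emeasure_UN_le_nn:
  assumes C: "countable C" and X: "\<And>j. j \<in> C \<Longrightarrow> X j \<in> sets M"
  shows "emeasure M (\<Union>j\<in>C. X j) \<le> (\<integral>\<^sup>+j. emeasure M (X j) \<partial>count_space C)"
proof (cases "finite C")
  case True
  then show ?thesis using X emeasure_subadditive_finite[of C X M] by (auto simp: nn_integral_count_space_finite)
next
  case False
  define g where "g = from_nat_into C"
  have g: "bij_betw g UNIV C" unfolding g_def using C False by (intro bij_betw_from_nat_into)
  then have gC: "g n \<in> C" for n by (auto simp: bij_betw_def)
  have "(\<Union>j\<in>C. X j) = (\<Union>n. X (g n))" using g by (auto simp: bij_betw_def)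
  then have "emeasure M (\<Union>j\<in>C. X j) \<le> (\<Sum>n. emeasure M (X (g n)))"
    using X gC by (auto intro!: emeasure_subadditive_countably)
  also have "\<dots> = (\<integral>\<^sup>+n. emeasure M (X (g n)) \<partial>count_space UNIV)" by (simp add: nn_integral_count_space_nat)
  also have "\<dots> = (\<integral>\<^sup>+j. emeasure M (X j) \<partial>count_space C)" by (rule nn_integral_bij_count_space[OF g])
  finally show ?thesis .
qed

text \<open>Vitali covering. The points of \<open>A\<close> around which arbitrarily small balls
  carry mass above \<open>c * r\<close> lie in the fivefold enlargements of disjoint such balls, all
  inside an open set of small measure, so they form a negligible set.\<close>

lemma measure_density_zero:
  fixes \<mu> :: "real measure"
  assumes fin: "finite_measure \<mu>" and sets: "sets \<mu> = sets borel" and A: "A \<in> sets borel" "emeasure \<mu> A = 0"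
  shows "AE x in lborel. x \<in> A \<longrightarrow> (\<forall>c>0. \<exists>\<delta>>0. \<forall>r. 0 < r \<and> r < \<delta> \<longrightarrow> measure \<mu> (cball x r) \<le> c * r)"
proof -
  interpret finite_measure \<mu> by fact
  have msets: "B \<in> sets borel \<Longrightarrow> B \<in> sets \<mu>" for B using sets by simp
  have neg: "negligible {x \<in> A. \<forall>\<delta>>0. \<exists>r. 0 < r \<and> r < \<delta> \<and> c * r < measure \<mu> (cball x r)}" (is "negligible ?B") if c: "c > 0" for c
    unfolding negligible_outer_le
  proof (intro allI impI)
    fix \<epsilon> :: real assume e: "\<epsilon> > 0"
    \<comment> \<open>A ball of radius \<open>5 * \<rho>\<close> has length
      \<open>10 * \<rho>\<close>, while \<open>c * \<rho>\<close> is below the mass of the small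
      ball: hence the factor c / 10.\<close>
    define \<eta> where "\<eta> = \<epsilon> * c / 10"
    have \<eta>: "\<eta> > 0" using e c by (simp add: \<eta>_def)
    have "emeasure \<mu> A = (INF U\<in>{U. A \<subseteq> U \<and> open U}. emeasure \<mu> U)"
      by (rule outer_regular) (use sets A in auto)
    then have "(INF U\<in>{U. A \<subseteq> U \<and> open U}. emeasure \<mu> U) < ennreal \<eta>" using A \<eta> by simp
    then obtain U where U: "A \<subseteq> U" "open U" "emeasure \<mu> U < ennreal \<eta>" by (auto simp: INF_less_iff)
    then have mU: "measure \<mu> U < \<eta>" using \<eta> by (simp add: emeasure_eq_measure ennreal_less_iff)
    have "\<exists>r. 0 < r \<and> r < 1 \<and> cball x r \<subseteq> U \<and> c * r < measure \<mu> (cball x r)" if "x \<in> ?B" for x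
    proof -
      have "x \<in> U" using that U by auto
      then obtain d where d: "d > 0" "cball x d \<subseteq> U" using U(2) open_contains_cball by blast
      have "min 1 d > 0" using d by simp
      moreover have "\<forall>\<delta>>0. \<exists>r. 0 < r \<and> r < \<delta> \<and> c * r < measure \<mu> (cball x r)" using that by simp
      ultimately obtain r where r: "0 < r" "r < min 1 d" "c * r < measure \<mu> (cball x r)"
        by blast
      then have "cball x r \<subseteq> cball x d" by auto
      then show ?thesis using r d by auto
    qed
    then have "\<forall>x\<in>?B. \<exists>r. 0 < r \<and> r < 1 \<and> cball x r \<subseteq> U \<and> c * r < measure \<mu> (cball x r)" by (rule ballI)
    from bchoice[OF this] obtain \<rho> where \<rho>: "\<And>x. x \<in> ?B \<Longrightarrow> 0 < \<rho> x \<and> \<rho> x < 1 \<and> cball x (\<rho> x) \<subseteq> U \<and> c * \<rho> x < measure \<mu> (cball x (\<rho> x))"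
      by blast
    obtain C where C: "countable C" "C \<subseteq> ?B"
      "pairwise (\<lambda>i j. disjnt (cball i (\<rho> i)) (cball j (\<rho> j))) C"
      "\<And>i. i \<in> ?B \<Longrightarrow> \<exists>j. j \<in> C \<and> \<not> disjnt (cball i (\<rho> i)) (cball j (\<rho> j)) \<and> cball i (\<rho> i) \<subseteq> ball j (5 * \<rho> j)"
      using Vitali_covering_lemma_cballs_balls[of ?B \<rho> 1 "\<lambda>x. x"] \<rho> by (metis (no_types, lifting) less_imp_le)
    define T where "T = (\<Union>j\<in>C. ball j (5 * \<rho> j))"
    have sub: "?B \<subseteq> T"
    proof
      fix x assume x: "x \<in> ?B"
      then obtain j where "j \<in> C" "cball x (\<rho> x) \<subseteq> ball j (5 * \<rho> j)" using C(4) by blast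
      moreover have "x \<in> cball x (\<rho> x)" using \<rho>[OF x] by simp
      ultimately show "x \<in> T" unfolding T_def by blast
    qed
    have Tb[measurable]: "T \<in> sets borel" unfolding T_def by (rule borel_open) auto
    have "emeasure lborel T \<le> (\<integral>\<^sup>+j. emeasure lborel (ball j (5 * \<rho> j)) \<partial>count_space C)"
      unfolding T_def by (rule emeasure_UN_le_nn) (use C in auto)
    also have "\<dots> \<le> (\<integral>\<^sup>+j. ennreal (10 / c) * emeasure \<mu> (cball j (\<rho> j)) \<partial>count_space C)"
    proof (rule nn_integral_mono)
      fix j assume "j \<in> space (count_space C)"
      then have j: "j \<in> ?B" using C by auto
      have "emeasure lborel (ball j (5 * \<rho> j)) = ennreal (10 * \<rho> j)"
        using \<rho>[OF j] by (simp add: ball_eq_greaterThanLessThan)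
      also have "\<dots> \<le> ennreal (10 / c * measure \<mu> (cball j (\<rho> j)))"
        using \<rho>[OF j] c by (intro ennreal_leI) (simp add: field_simps)
      also have "\<dots> = ennreal (10 / c) * emeasure \<mu> (cball j (\<rho> j))"
        using c by (simp add: emeasure_eq_measure ennreal_mult[symmetric])
      finally show "emeasure lborel (ball j (5 * \<rho> j)) \<le> ennreal (10 / c) * emeasure \<mu> (cball j (\<rho> j))" .
    qed
    also have "\<dots> = ennreal (10 / c) * (\<integral>\<^sup>+j. emeasure \<mu> (cball j (\<rho> j)) \<partial>count_space C)"
      by (rule nn_integral_cmult) simp
    also have "(\<integral>\<^sup>+j. emeasure \<mu> (cball j (\<rho> j)) \<partial>count_space C) = emeasure \<mu> (\<Union>j\<in>C. cball j (\<rho> j))"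
      by (rule emeasure_UN_countable[symmetric])
         (use C in \<open>auto simp: disjoint_family_on_def pairwise_def disjnt_def intro!: msets\<close>)
    also have "\<dots> \<le> emeasure \<mu> U"
    proof (rule emeasure_mono)
      show "(\<Union>j\<in>C. cball j (\<rho> j)) \<subseteq> U" using C(2) \<rho> by blast
    qed (use U in \<open>auto intro!: msets borel_open\<close>)
    also have "\<dots> \<le> ennreal \<eta>" using U(3) by simp
    also have "ennreal (10 / c) * ennreal \<eta> = ennreal \<epsilon>"
      using c e by (simp add: \<eta>_def ennreal_mult[symmetric])
    finally have le: "emeasure lborel T \<le> ennreal \<epsilon>" by (simp add: mult_left_mono)
    then have "emeasure lborel T < \<infinity>" by (simp add: le_less_trans)
    then have "T \<in> lmeasurable" by (simp add: fmeasurable_def)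
    moreover have "measure lebesgue T \<le> \<epsilon>"
      using le e by (simp add: measure_def enn2real_leI)
    ultimately show "\<exists>T. ?B \<subseteq> T \<and> T \<in> lmeasurable \<and> measure lebesgue T \<le> \<epsilon>" using sub by blast
  qed
  let ?B = "\<lambda>c. {x \<in> A. \<forall>\<delta>>0. \<exists>r. 0 < r \<and> r < \<delta> \<and> c * r < measure \<mu> (cball x r)}"
  have "AE x in lebesgue. \<forall>n::nat. x \<notin> ?B (1 / Suc n)"
    unfolding AE_all_countable
    by (intro allI, rule AE_not_in[OF neg[unfolded negligible_iff_null_sets]]) simp
  then have "AE x in lborel. \<forall>n::nat. x \<notin> ?B (1 / Suc n)"
    by (simp add: AE_completion_iff)
  then show ?thesis
  proof eventually_elim
    fix x assume x: "\<forall>n::nat. x \<notin> ?B (1 / Suc n)"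
    show "x \<in> A \<longrightarrow> (\<forall>c>0. \<exists>\<delta>>0. \<forall>r. 0 < r \<and> r < \<delta> \<longrightarrow> measure \<mu> (cball x r) \<le> c * r)"
    proof (intro impI allI)
      fix c :: real assume A: "x \<in> A" and c: "c > 0"
      obtain n :: nat where n: "1 / Suc n < c" using c nat_approx_posE by (metis of_nat_Suc)
      have "\<not> (\<forall>\<delta>>0. \<exists>r. 0 < r \<and> r < \<delta> \<and> 1 / Suc n * r < measure \<mu> (cball x r))" using x A by blast
      then have "\<exists>\<delta>>0. \<forall>r. 0 < r \<and> r < \<delta> \<longrightarrow> \<not> 1 / Suc n * r < measure \<mu> (cball x r)" by blast
      then obtain \<delta> where d: "\<delta> > 0" "\<And>r. 0 < r \<Longrightarrow> r < \<delta> \<Longrightarrow> measure \<mu> (cball x r) \<le> 1 / Suc n * r"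
        unfolding not_less by blast
      have "measure \<mu> (cball x r) \<le> c * r" if "0 < r" "r < \<delta>" for r
        using d(2)[OF that] mult_right_mono[of "1 / Suc n" c r] n that by linarith
      then show "\<exists>\<delta>>0. \<forall>r. 0 < r \<and> r < \<delta> \<longrightarrow> measure \<mu> (cball x r) \<le> c * r" using d(1) by blast
    qed
  qed
qed


text \<open>\<open>ennreal\<close> sends negative reals to 0, so \<open>ennreal (a - b)\<close> is a
  positive part.\<close>

lemma ennreal_le_add_diff: "0 \<le> b \<Longrightarrow> ennreal a \<le> ennreal b + ennreal (a - b)"
proof (cases "b \<le> a")
  case True
  moreover assume "0 \<le> b"
  ultimately show ?thesis by (simp flip: ennreal_plus)
next
  case False
  then show ?thesis by (simp add: ennreal_leI ennreal_neg)
qed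

text \<open>Lebesgue differentiation by comparison with constants. For rational q the measures with
  densities max(n - q, 0) and max(q - n, 0) vanish where n \<le> q and where q \<le> n, so almost
  everywhere there they have density zero. Rationals close to \<open>n x\<close> on both sides
  squeeze the mass of short intervals at \<open>x\<close>. The claim is for \<mu>-almost every point
  because only there is the density known to be positive.\<close>

lemma derivative_of_absolutely_continuous:
  fixes \<mu> :: "real measure"
  assumes fin: "finite_measure \<mu>" and sets: "sets \<mu> = sets borel" and ac: "absolutely_continuous lborel \<mu>"
  shows "AE x in \<mu>. \<exists>D>0. ((\<lambda>x. measure \<mu> {..x}) has_real_derivative D) (at x)"
proof -
  interpret finite_measure \<mu> by fact
  have msets[simp]: "B \<in> sets \<mu> \<longleftrightarrow> B \<in> sets borel" for B using sets by simp
  obtain f where f[measurable]: "f \<in> borel_measurable lborel" and df: "density lborel f = \<mu>"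
    using sigma_finite_measure.Radon_Nikodym[OF sigma_finite_lborel ac] sets by auto
  have "(\<integral>\<^sup>+x. f x \<partial>lborel) = emeasure \<mu> UNIV"
    by (subst df[symmetric]) (simp add: emeasure_density)
  then have "AE x in lborel. f x \<noteq> \<infinity>"
    by (intro nn_integral_PInf_AE) (auto simp: emeasure_eq_measure)
  then have fn: "AE x in lborel. f x = ennreal (enn2real (f x))" by (auto simp: top.not_eq_extremum)
  define n where "n x = enn2real (f x)" for x
  have nm[measurable]: "n \<in> borel_measurable lborel" unfolding n_def by measurable
  have n0: "n x \<ge> 0" for x by (simp add: n_def)
  have em: "emeasure \<mu> B = (\<integral>\<^sup>+x\<in>B. ennreal (n x) \<partial>lborel)" if "B \<in> sets borel" for B
  proof -
    have "emeasure \<mu> B = (\<integral>\<^sup>+x\<in>B. f x \<partial>lborel)"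
      using that by (subst df[symmetric]) (simp add: emeasure_density)
    also have "\<dots> = (\<integral>\<^sup>+x\<in>B. ennreal (n x) \<partial>lborel)"
      by (rule nn_integral_cong_AE) (use fn in \<open>auto simp: n_def\<close>)
    finally show ?thesis .
  qed
  define P where "P q = density lborel (\<lambda>x. ennreal (n x - q))" for q
  \<comment> \<open>The cut-off to \<open>{-k..k}\<close> keeps the measure finite; near a given
    point it has no effect once \<open>k\<close> is large.\<close>
  define Z where "Z q k = density lborel (\<lambda>x. ennreal ((q - n x) * indicator {-real k..real k} x))" for q k
  have setsPZ[simp]: "sets (P q) = sets borel" "sets (Z q k) = sets borel" for q k by (simp_all add: P_def Z_def)
  have finP: "finite_measure (P q)" if "q \<ge> 0" for q
  proof (rule finite_measureI)
    have "emeasure (P q) UNIV \<le> emeasure \<mu> UNIV"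
      unfolding P_def by (subst em) (auto simp: emeasure_density that intro!: nn_integral_mono ennreal_leI)
    then show "emeasure (P q) (space (P q)) \<noteq> \<infinity>" by (auto simp: P_def emeasure_eq_measure top.extremum_unique)
  qed
  have finZ: "finite_measure (Z q k)" if "q \<ge> 0" for q k
  proof (rule finite_measureI)
    have "emeasure (Z q k) UNIV \<le> (\<integral>\<^sup>+x. ennreal q * indicator {-real k..real k} x \<partial>lborel)"
      unfolding Z_def
      by (auto simp: emeasure_density n0 that intro!: nn_integral_mono split: split_indicator intro!: ennreal_leI)
    also have "\<dots> < \<infinity>" by (subst nn_integral_cmult_indicator) (auto simp: ennreal_mult_less_top)
    finally show "emeasure (Z q k) (space (Z q k)) \<noteq> \<infinity>" by (auto simp: Z_def)
  qed
  let ?G = "\<lambda>\<nu> x. \<forall>c>0. \<exists>\<delta>>0. \<forall>r. 0 < r \<and> r < \<delta> \<longrightarrow> measure \<nu> (cball x r) \<le> c * r"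
  have GP: "AE x in lborel. n x \<le> q \<longrightarrow> ?G (P q) x" if "q \<ge> 0" for q
  proof -
    have "emeasure (P q) {x. n x \<le> q} = 0" unfolding P_def
      by (subst emeasure_density) (auto simp: nn_integral_0_iff_AE ennreal_neg split: split_indicator)
    then show ?thesis using measure_density_zero[OF finP[OF that], of "{x. n x \<le> q}"] by simp
  qed
  have GZ: "AE x in lborel. q \<le> n x \<longrightarrow> ?G (Z q k) x" if "q \<ge> 0" for q k
  proof -
    have "emeasure (Z q k) {x. q \<le> n x} = 0" unfolding Z_def
      by (subst emeasure_density) (auto simp: nn_integral_0_iff_AE ennreal_neg split: split_indicator)
    then show ?thesis using measure_density_zero[OF finZ[OF that, of k], of "{x. q \<le> n x}"] by simp
  qed
  have "AE x in lborel. \<forall>q::rat. 0 \<le> q \<longrightarrow> n x \<le> of_rat q \<longrightarrow> ?G (P (of_rat q)) x"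
    unfolding AE_all_countable by (intro allI AE_impI GP) auto
  moreover have "AE x in lborel. \<forall>q::rat. \<forall>k::nat. 0 \<le> q \<longrightarrow> of_rat q \<le> n x \<longrightarrow> ?G (Z (of_rat q) k) x"
    unfolding AE_all_countable by (intro allI AE_impI GZ) auto
  ultimately have "AE x in lborel. n x > 0 \<longrightarrow> (\<exists>D>0. ((\<lambda>x. measure \<mu> {..x}) has_real_derivative D) (at x))"
  proof eventually_elim
    fix x assume xP: "\<forall>q::rat. 0 \<le> q \<longrightarrow> n x \<le> of_rat q \<longrightarrow> ?G (P (of_rat q)) x"
      and xZ: "\<forall>q::rat. \<forall>k::nat. 0 \<le> q \<longrightarrow> of_rat q \<le> n x \<longrightarrow> ?G (Z (of_rat q) k) x"
    show "n x > 0 \<longrightarrow> (\<exists>D>0. ((\<lambda>x. measure \<mu> {..x}) has_real_derivative D) (at x))"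
    proof
      assume nx: "n x > 0"
      \<comment> \<open>Stated for every \<open>I\<close> of length \<open>h\<close> inside
        \<open>cball x h\<close>, so that it serves the left and the right difference quotient
        alike.\<close>
      have key: "\<exists>\<delta>>0. \<forall>h I. 0 < h \<longrightarrow> h < \<delta> \<longrightarrow> I \<in> sets borel \<longrightarrow> I \<subseteq> cball x h \<longrightarrow> emeasure lborel I = ennreal h
          \<longrightarrow> \<bar>measure \<mu> I - n x * h\<bar> \<le> \<epsilon> * h" if e: "\<epsilon> > 0" for \<epsilon>
      proof -
        obtain q1 where q1: "n x < of_rat q1" "of_rat q1 < n x + \<epsilon> / 2" using of_rat_dense[of "n x" "n x + \<epsilon>/2"] e by auto
        obtain q2 where q2: "max 0 (n x - \<epsilon> / 2) < of_rat q2" "of_rat q2 < n x"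
          using of_rat_dense[of "max 0 (n x - \<epsilon> / 2)" "n x"] nx e by auto
        define r1 :: real where "r1 = of_rat q1"
        define r2 :: real where "r2 = of_rat q2"
        have r: "0 \<le> r1" "n x \<le> r1" "r1 < n x + \<epsilon> / 2" "0 \<le> r2" "r2 \<le> n x" "n x - \<epsilon> / 2 < r2" "0 \<le> q1" "0 \<le> q2"
          using q1 q2 n0[of x] by (auto simp: r1_def r2_def) (metis less_eq_rat_def n0 of_rat_less_0_iff not_less order_less_trans le_less_trans)+
        obtain k :: nat where k: "\<bar>x\<bar> + 1 \<le> real k" using real_arch_simple by blast
        obtain d1 where d1: "d1 > 0" "\<And>s. 0 < s \<Longrightarrow> s < d1 \<Longrightarrow> measure (P r1) (cball x s) \<le> \<epsilon> / 2 * s"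
          using xP[rule_format, of q1 "\<epsilon>/2"] r e unfolding r1_def by auto
        obtain d2 where d2: "d2 > 0" "\<And>s. 0 < s \<Longrightarrow> s < d2 \<Longrightarrow> measure (Z r2 k) (cball x s) \<le> \<epsilon> / 2 * s"
          using xZ[rule_format, of q2 "\<epsilon>/2" k] r e unfolding r2_def by auto
        interpret P: finite_measure "P r1" using finP r by simp
        interpret Z: finite_measure "Z r2 k" using finZ r by simp
        show ?thesis
        proof (intro exI[of _ "min 1 (min d1 d2)"] conjI allI impI)
          fix h I assume h: "0 < h" "h < min 1 (min d1 d2)" and I[measurable]: "I \<in> sets borel" and Is: "I \<subseteq> cball x h"
            and Il: "emeasure lborel I = ennreal h"
          have "emeasure \<mu> I \<le> (\<integral>\<^sup>+y. ennreal r1 * indicator I y + ennreal (n y - r1) * indicator I y \<partial>lborel)"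
            unfolding em[OF I]
            by (intro nn_integral_mono) (auto split: split_indicator intro!: ennreal_le_add_diff r)
          also have "\<dots> = ennreal r1 * ennreal h + emeasure (P r1) I"
            by (subst nn_integral_add) (auto simp: nn_integral_cmult_indicator Il P_def emeasure_density)
          also have "\<dots> \<le> ennreal r1 * ennreal h + emeasure (P r1) (cball x h)"
            by (intro add_left_mono emeasure_mono Is) auto
          finally have "ennreal (measure \<mu> I) \<le> ennreal (r1 * h + measure (P r1) (cball x h))"
            using r h by (simp add: emeasure_eq_measure P.emeasure_eq_measure ennreal_mult)
          then have 1: "measure \<mu> I \<le> r1 * h + \<epsilon> / 2 * h"
            using d1(2)[of h] h r by (subst (asm) ennreal_le_iff) auto
          have "ennreal r2 * ennreal h = (\<integral>\<^sup>+y. ennreal r2 * indicator I y \<partial>lborel)"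
            by (subst nn_integral_cmult_indicator) (auto simp: Il)
          also have "\<dots> \<le> (\<integral>\<^sup>+y. ennreal (n y) * indicator I y + ennreal ((r2 - n y) * indicator {-real k..real k} y) * indicator I y \<partial>lborel)"
          proof (rule nn_integral_mono)
            fix y
            have "y \<in> I \<Longrightarrow> y \<in> {-real k..real k}" using Is h k by (auto simp: dist_real_def)
            then show "ennreal r2 * indicator I y \<le> ennreal (n y) * indicator I y + ennreal ((r2 - n y) * indicator {-real k..real k} y) * indicator I y"
              by (auto split: split_indicator intro!: ennreal_le_add_diff n0)
          qed
          also have "\<dots> = emeasure \<mu> I + emeasure (Z r2 k) I"
            by (subst nn_integral_add) (auto simp: em[OF I] Z_def emeasure_density)
          also have "\<dots> \<le> emeasure \<mu> I + emeasure (Z r2 k) (cball x h)"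
            by (intro add_left_mono emeasure_mono Is) auto
          finally have "ennreal (r2 * h) \<le> ennreal (measure \<mu> I + measure (Z r2 k) (cball x h))"
            using r h by (simp add: emeasure_eq_measure Z.emeasure_eq_measure ennreal_mult)
          then have 2: "r2 * h \<le> measure \<mu> I + \<epsilon> / 2 * h"
            using d2(2)[of h] h r by (subst (asm) ennreal_le_iff) auto
          have "r1 * h \<le> (n x + \<epsilon>/2) * h" "(n x - \<epsilon>/2) * h \<le> r2 * h" using r h by (auto intro!: mult_right_mono)
          then show "\<bar>measure \<mu> I - n x * h\<bar> \<le> \<epsilon> * h"
            using 1 2 by (simp add: abs_le_iff algebra_simps)
        qed (use d1 d2 in auto)
      qed
      have "((\<lambda>x. measure \<mu> {..x}) has_real_derivative n x) (at x)"
        unfolding DERIV_def LIM_eq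
      proof (intro allI impI)
        fix r :: real assume r: "0 < r"
        then obtain \<delta> where d: "\<delta> > 0" "\<And>h I. 0 < h \<Longrightarrow> h < \<delta> \<Longrightarrow> I \<in> sets borel \<Longrightarrow> I \<subseteq> cball x h \<Longrightarrow> emeasure lborel I = ennreal h
          \<Longrightarrow> \<bar>measure \<mu> I - n x * h\<bar> \<le> (r/2) * h" using key[of "r/2"] by auto
        have diff: "measure \<mu> {..b} - measure \<mu> {..a} = measure \<mu> {a<..b}" if "a \<le> b" for a b
        proof -
          have "{..b} = {..a} \<union> {a<..b}" using that by auto
          then have "measure \<mu> {..b} = measure \<mu> {..a} + measure \<mu> {a<..b}"
            by (subst finite_measure_Union[symmetric]) (auto simp: sets)
          then show ?thesis by simp
        qed
        show "\<exists>s>0. \<forall>h. h \<noteq> 0 \<and> norm (h - 0) < s \<longrightarrow> norm ((measure \<mu> {..x + h} - measure \<mu> {..x}) / h - n x) < r"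
        proof (intro exI[of _ \<delta>] conjI allI impI d(1))
          fix h :: real assume h: "h \<noteq> 0 \<and> norm (h - 0) < \<delta>"
          have "\<bar>(measure \<mu> {..x + h} - measure \<mu> {..x}) / h - n x\<bar> \<le> r / 2"
          proof (cases "h > 0")
            case True
            have "\<bar>measure \<mu> {x<..x+h} - n x * h\<bar> \<le> (r/2) * h"
              by (rule d(2)) (use True h in \<open>auto simp: dist_real_def\<close>)
            then show ?thesis using diff[of x "x + h"] True by (simp add: field_simps abs_le_iff)
          next
            case False
            have "\<bar>measure \<mu> {x+h<..x} - n x * (-h)\<bar> \<le> (r/2) * (-h)"
              by (rule d(2)) (use False h in \<open>auto simp: dist_real_def\<close>)
            moreover have "(measure \<mu> {..x + h} - measure \<mu> {..x}) / h - n x = (measure \<mu> {x+h<..x} - n x * (-h)) / (-h)"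
              using diff[of "x + h" x] False h by (simp add: field_simps)
            moreover have "\<bar>a / k\<bar> \<le> r / 2" if "0 < k" "\<bar>a\<bar> \<le> (r/2) * k" for a k :: real
              using that by (simp add: field_simps)
            ultimately show ?thesis using False h by (metis linorder_neqE_linordered_idom neg_0_less_iff_less)
          qed
          then show "norm ((measure \<mu> {..x + h} - measure \<mu> {..x}) / h - n x) < r" using r by simp
        qed
      qed
      then show "\<exists>D>0. ((\<lambda>x. measure \<mu> {..x}) has_real_derivative D) (at x)" using nx by blast
    qed
  qed
  then have 1: "AE x in \<mu>. n x > 0 \<longrightarrow> (\<exists>D>0. ((\<lambda>x. measure \<mu> {..x}) has_real_derivative D) (at x))"
    by (rule absolutely_continuous_AE[OF _ ac, rotated]) (simp add: sets)
  have "AE x in \<mu>. n x > 0"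
  proof -
    have "AE x in density lborel f. n x > 0"
      unfolding AE_density[OF f] using fn
    proof eventually_elim
      fix x assume x: "f x = ennreal (enn2real (f x))"
      show "0 < f x \<longrightarrow> 0 < n x"
      proof (rule impI, rule ccontr)
        assume "0 < f x" "\<not> 0 < n x"
        then have "n x = 0" using n0[of x] by simp
        then show False using x \<open>0 < f x\<close> by (simp add: n_def)
      qed
    qed
    then show ?thesis unfolding df .
  qed
  with 1 show ?thesis by eventually_elim blast
qed

section \<open>The quantile function of a distribution and its derivative\<close>

context cdf_distribution
begin

text \<open>To the left of \<open>I y\<close> the distribution function is at most \<open>y\<close>;
  without atoms it is continuous and cannot jump over \<open>y\<close>.\<close>

lemma cdf_I:
  assumes cont: "\<And>x. measure M {x} = 0" and y: "0 < y" "y < 1"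
  shows "cdf M (I y) = y"
proof (rule antisym)
  show "y \<le> cdf M (I y)" using pseudoinverse[OF y, of "I y"] by simp
  have "isCont (cdf M) (I y)" using cont isCont_cdf by simp
  then have "((cdf M) \<longlongrightarrow> cdf M (I y)) (at_left (I y))" by (simp add: isCont_def filterlim_at_split)
  moreover have "\<forall>\<^sub>F x in at_left (I y). cdf M x \<le> y"
  proof -
    have "\<forall>\<^sub>F x in at_left (I y). x < I y" by (simp add: eventually_at_filter)
    then show ?thesis
  proof eventually_elim
    fix x assume "x < I y"
    then show "cdf M x \<le> y" using pseudoinverse[OF y, of x] by linarith
  qed
  qed
  ultimately show "cdf M (I y) \<le> y" by (intro tendsto_upperbound) auto
qed

text \<open>\<open>M\<close> is the image of Lebesgue measure on (0, 1) under its quantile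
  function.\<close>

lemma AE_quantile: assumes "AE E in M. P E" shows "AE y in lborel. 0 < y \<and> y < 1 \<longrightarrow> P (I y)"
proof -
  have "AE y in restrict_space lborel {0<..<1}. P (I y)"
  proof (rule AE_distrD[where f = I and P = P and M' = borel])
    show "I \<in> measurable (restrict_space lborel {0<..<1}) borel"
      using measurable_CI by (simp cong: measurable_cong_sets add: sets_restrict_space)
    show "AE E in distr (restrict_space lborel {0<..<1}) borel I. P E" using assms unfolding distr_I_eq_M .
  qed
  then show ?thesis by (subst (asm) AE_restrict_space_iff) auto
qed

text \<open>\<open>I\<close> inverts the distribution function. A positive derivative at
  \<open>I y\<close> puts \<open>cdf M\<close> strictly below and above \<open>y\<close> on the two
  sides of \<open>I y\<close>; this makes \<open>I\<close> continuous at \<open>y\<close>, and the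
  inverse function rule applies.\<close>

lemma I_differentiable:
  assumes ac: "absolutely_continuous lborel M"
  shows "AE y in lborel. 0 < y \<and> y < 1 \<longrightarrow> (\<exists>D>0. (I has_real_derivative D) (at y))"
proof -
  have cont: "measure M {x} = 0" for x
  proof -
    have "{x} \<in> null_sets lborel" by (simp add: null_sets_def)
    then have "{x} \<in> null_sets M" using ac by (auto simp: absolutely_continuous_def)
    then show ?thesis by (simp add: measure_def null_sets_def)
  qed
  have "AE x in M. \<exists>D>0. ((\<lambda>x. measure M {..x}) has_real_derivative D) (at x)"
    by (rule derivative_of_absolutely_continuous[OF _ _ ac]) (auto intro: finite_measure_axioms)
  from AE_quantile[OF this] show ?thesis
  proof eventually_elim
    fix y assume *: "0 < y \<and> y < 1 \<longrightarrow> (\<exists>D>0. ((\<lambda>x. measure M {..x}) has_real_derivative D) (at (I y)))"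
    show "0 < y \<and> y < 1 \<longrightarrow> (\<exists>D>0. (I has_real_derivative D) (at y))"
    proof
      assume y: "0 < y \<and> y < 1"
      then obtain D where D: "D > 0" "(cdf M has_real_derivative D) (at (I y))" using * by (auto simp: cdf_def2[abs_def])
      have inv: "cdf M (I z) = z" if "z \<in> {0<..<1}" for z using cdf_I[OF cont] that by auto
      have "isCont I y" unfolding isCont_def
      proof (rule order_tendstoI)
        fix a assume a: "a < I y"
        obtain d where d: "d > 0" "\<And>h. 0 < h \<Longrightarrow> h < d \<Longrightarrow> cdf M (I y - h) < cdf M (I y)"
          using DERIV_pos_inc_left[OF D(2,1)] by blast
        define h where "h = min (d/2) (I y - a)"
        have h: "0 < h" "h < d" "h \<le> I y - a" using d a by (auto simp: h_def)
        have "cdf M (I y - h) < y" using d(2)[OF h(1,2)] inv[of y] y by simp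
        moreover have "\<forall>\<^sub>F z in at y. z > max 0 (cdf M (I y - h)) \<and> z < 1"
          using calculation y by (intro eventually_conj order_tendstoD[OF tendsto_ident_at]) auto
        ultimately show "\<forall>\<^sub>F z in at y. a < I z"
        proof (elim eventually_mono)
          fix z assume z: "z > max 0 (cdf M (I y - h)) \<and> z < 1"
          then have "\<not> I z \<le> I y - h" using pseudoinverse[of z "I y - h"] by auto
          then show "a < I z" using h by linarith
        qed
      next
        fix a assume a: "I y < a"
        obtain d where d: "d > 0" "\<And>h. 0 < h \<Longrightarrow> h < d \<Longrightarrow> cdf M (I y) < cdf M (I y + h)"
          using DERIV_pos_inc_right[OF D(2,1)] by blast
        define h where "h = min (d/2) ((a - I y) / 2)"
        have h: "0 < h" "h < d" "h < a - I y" using d a by (auto simp: h_def min_def)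
        have "y < cdf M (I y + h)" using d(2)[OF h(1,2)] inv[of y] y by simp
        then have "\<forall>\<^sub>F z in at y. z < min 1 (cdf M (I y + h)) \<and> z > 0"
          using y by (intro eventually_conj order_tendstoD[OF tendsto_ident_at]) auto
        then show "\<forall>\<^sub>F z in at y. I z < a"
        proof (elim eventually_mono)
          fix z assume z: "z < min 1 (cdf M (I y + h)) \<and> z > 0"
          then have "I z \<le> I y + h" using pseudoinverse[of z "I y + h"] by auto
          then show "I z < a" using h by linarith
        qed
      qed
      then have "(I has_real_derivative inverse D) (at y)"
        by (rule DERIV_inverse_function[where f = "cdf M" and a = 0 and b = 1, rotated -1]) (use D y inv in auto)
      then show "\<exists>D>0. (I has_real_derivative D) (at y)" using D(1) by (intro exI[of _ "inverse D"]) auto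
    qed
  qed
qed

end

section \<open>The Hausdorff moment problem\<close>

text \<open>\<open>L j i\<close> stands for the integral of x^j (1 - x)^i. The recurrence is x + (1
  - x) = 1, and the formula expands the m-th power of this identity.\<close>

lemma binomial_expansion_decreasing:
  fixes L :: "nat \<Rightarrow> nat \<Rightarrow> real"
  assumes L: "\<And>j i. L j i = L (Suc j) i + L j (Suc i)"
  shows "L a b = (\<Sum>i\<le>m. of_nat (m choose i) * L (a + i) (b + (m - i)))"
proof (induction m)
  case (Suc m)
  have "L a b = (\<Sum>i\<le>m. of_nat (m choose i) * (L (a + Suc i) (b + (m - i)) + L (a + i) (b + (Suc m - i))))"
    unfolding Suc by (intro sum.cong refl) (subst L, simp add: Suc_diff_le)
  also have "\<dots> = (\<Sum>i\<le>m. of_nat (m choose i) * L (a + Suc i) (b + (m - i))) + (\<Sum>i\<le>m. of_nat (m choose i) * L (a + i) (b + (Suc m - i)))"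
    by (simp add: distrib_left sum.distrib)
  also have "(\<Sum>i\<le>m. of_nat (m choose i) * L (a + i) (b + (Suc m - i)))
      = L a (b + Suc m) + (\<Sum>i\<le>m. of_nat (m choose Suc i) * L (a + Suc i) (b + (m - i)))"
  proof -
    have "(\<Sum>i\<le>m. of_nat (m choose i) * L (a + i) (b + (Suc m - i))) = (\<Sum>i\<le>Suc m. of_nat (m choose i) * L (a + i) (b + (Suc m - i)))"
      by simp
    also have "\<dots> = L a (b + Suc m) + (\<Sum>i\<le>m. of_nat (m choose Suc i) * L (a + Suc i) (b + (m - i)))"
      by (subst sum.atMost_Suc_shift) simp
    finally show ?thesis .
  qed
  finally have "L a b = L a (b + Suc m) + (\<Sum>i\<le>m. of_nat (Suc m choose Suc i) * L (a + Suc i) (b + (m - i)))"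
    by (simp add: sum.distrib[symmetric] distrib_right algebra_simps)
  also have "\<dots> = (\<Sum>i\<le>Suc m. of_nat (Suc m choose i) * L (a + i) (b + (Suc m - i)))"
    by (subst sum.atMost_Suc_shift) simp
  finally show ?case .
qed simp

text \<open>The quotient of binomials is a product of factors (k - i) / (n - i), each within j / (n
  - j) of k / n. Products of factors in [-1, 1] differ by at most the sum of the differences of the
  factors.\<close>

lemma falling_ratio_approx:
  fixes n j k :: nat
  assumes "k \<le> n" "2 * j < n"
  shows "\<bar>real (k choose j) / real (n choose j) - (real k / real n)^j\<bar> \<le> real j * (real j / (real n - real j))"
proof -
  have n: "real n - real j > 0" "real n > 0" using assms by auto
  have eq: "real (k choose j) / real (n choose j) = (\<Prod>i<j. (real k - real i) / (real n - real i))"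
    by (simp add: binomial_gbinomial gbinomial_prod_rev prod_dividef atLeast0LessThan)
  have "\<bar>(\<Prod>i<j. (real k - real i) / (real n - real i)) - (\<Prod>i<j. real k / real n)\<bar>
      \<le> (\<Sum>i<j. \<bar>(real k - real i) / (real n - real i) - real k / real n\<bar>)"
    unfolding real_norm_def[symmetric]
  proof (rule norm_prod_diff)
    fix i assume i: "i \<in> {..<j}"
    then have i': "real i < real j" "real i \<ge> 0" by auto
    have p: "real n - real i > 0" using n i' by linarith
    have "real k - real i \<le> real n - real i" "- (real k - real i) \<le> real n - real i"
      using assms i' by auto
    then have "\<bar>real k - real i\<bar> \<le> real n - real i" by (simp add: abs_le_iff)
    then show "norm ((real k - real i) / (real n - real i)) \<le> 1"
      using p by (simp add: abs_divide divide_le_eq)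
    show "norm (real k / real n) \<le> 1" using assms n by (simp add: divide_le_eq)
  qed
  also have "\<dots> \<le> (\<Sum>i<j. real j / (real n - real j))"
  proof (rule sum_mono)
    fix i assume i: "i \<in> {..<j}"
    then have i': "real i < real j" "real i \<ge> 0" by auto
    have p: "real n - real i > 0" using n i' by linarith
    have "(real k - real i) / (real n - real i) - real k / real n = - (real i * (1 - real k / real n)) / (real n - real i)"
      using p n by (simp add: field_simps)
    then have "\<bar>(real k - real i) / (real n - real i) - real k / real n\<bar> = real i * \<bar>1 - real k / real n\<bar> / (real n - real i)"
      using p by (simp add: abs_mult abs_divide)
    also have "\<dots> \<le> real j * 1 / (real n - real j)"
      using p n i' assms by (intro frac_le mult_mono) (auto simp: abs_le_iff field_simps)
    finally show "\<bar>(real k - real i) / (real n - real i) - real k / real n\<bar> \<le> real j / (real n - real j)" by simp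
  qed
  finally show ?thesis by (simp add: eq)
qed

text \<open>Makes powers bounded and continuous on the whole line, as testing weak convergence
  demands, without changing them on [0, 1].\<close>

definition clamp01 :: "real \<Rightarrow> real" where "clamp01 x = max 0 (min 1 x)"

text \<open>Bernstein's construction: mass (n choose k) L k (n - k) at the point k / n. The
  normalised factorial moments of these measures equal \<open>L j 0\<close> exactly, the power
  moments differ from them by O(1/n), and a weak limit along a subsequence has the required
  moments.\<close>

theorem hausdorff_moments:
  fixes L :: "nat \<Rightarrow> nat \<Rightarrow> real"
  assumes L: "\<And>j i. L j i = L (Suc j) i + L j (Suc i)" and pos: "\<And>j i. L j i \<ge> 0" and L0: "L 0 0 = 1"
  obtains M :: "real measure" where "real_distribution M" "AE x in M. x \<in> {0..1}" "\<And>j. integral\<^sup>L M (\<lambda>x. x ^ j) = L j 0"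
proof -
  define w where "w n k = (if k \<le> n then real (n choose k) * L k (n - k) else 0)" for n k
  have w0: "w n k \<ge> 0" for n k using pos by (simp add: w_def)
  have wsum: "(\<Sum>k\<le>n. w n k) = 1" for n
    using binomial_expansion_decreasing[of L, OF L, of 0 0 n] L0 by (simp add: w_def)
  have wnn: "(\<integral>\<^sup>+k. ennreal (w n k) \<partial>count_space UNIV) = 1" for n
  proof -
    have "(\<integral>\<^sup>+k. ennreal (w n k) \<partial>count_space UNIV) = (\<Sum>k | k \<le> n. ennreal (w n k))"
      by (rule nn_integral_count_space') (auto simp: w_def split: if_splits)
    also have "\<dots> = ennreal (\<Sum>k\<le>n. w n k)" by (subst sum_ennreal) (auto simp: w0 atMost_def)
    finally show ?thesis by (simp add: wsum)
  qed
  define pm where "pm n = embed_pmf (w n)" for n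
  have pmf: "pmf (pm n) k = w n k" for n k unfolding pm_def by (rule pmf_embed_pmf[OF w0 wnn])
  have set: "set_pmf (pm n) \<subseteq> {..n}" for n by (auto simp: set_pmf_eq pmf w_def split: if_splits)
  define \<mu> where "\<mu> n = distr (measure_pmf (pm n)) borel (\<lambda>k. real k / real n)" for n
  have rd: "real_distribution (\<mu> n)" for n unfolding \<mu>_def
    by (rule prob_space.real_distribution_distr) (auto intro: prob_space_measure_pmf)
  have int\<mu>: "integral\<^sup>L (\<mu> n) f = (\<Sum>k\<le>n. w n k * f (real k / real n))" if [measurable]: "f \<in> borel_measurable borel" for n and f :: "real \<Rightarrow> real"
    unfolding \<mu>_def
    by (subst integral_distr, simp, simp, subst integral_measure_pmf_real[of "{..n}"])
       (use set[of n] in \<open>auto simp: pmf mult.commute\<close>)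
  have mom: "(\<Sum>k\<le>n. w n k * (real (k choose j) / real (n choose j))) = L j 0" if "j \<le> n" for n j
  proof -
    have nz: "real (n choose j) > 0" using that by simp
    have "(\<Sum>k\<le>n. w n k * (real (k choose j) / real (n choose j))) = (\<Sum>k\<in>{j..n}. w n k * (real (k choose j) / real (n choose j)))"
      by (rule sum.mono_neutral_right) (auto simp: binomial_eq_0 not_le)
    also have "\<dots> = (\<Sum>k\<in>{j..n}. real ((n - j) choose (k - j)) * L k (n - k))"
    proof (rule sum.cong[OF refl])
      fix k assume k: "k \<in> {j..n}"
      have "(n choose k) * (k choose j) = (n choose j) * ((n - j) choose (k - j))"
        using k choose_mult[of j k n] by simp
      then have "real (n choose k) * real (k choose j) = real (n choose j) * real ((n - j) choose (k - j))"
        by (simp flip: of_nat_mult)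
      then show "w n k * (real (k choose j) / real (n choose j)) = real ((n - j) choose (k - j)) * L k (n - k)"
        using nz k by (simp add: w_def field_simps)
    qed
    also have "\<dots> = (\<Sum>i\<le>n - j. real ((n - j) choose i) * L (j + i) (0 + (n - j - i)))"
      by (rule sum.reindex_bij_witness[of _ "\<lambda>i. j + i" "\<lambda>k. k - j"]) (use that in auto)
    also have "\<dots> = L j 0" by (rule binomial_expansion_decreasing[of L, OF L, symmetric])
    finally show ?thesis .
  qed
  have "tight \<mu>" unfolding tight_def
  proof (intro conjI allI impI rd)
    fix \<epsilon> :: real assume "\<epsilon> > 0"
    have "measure (\<mu> n) {- 1<..1} = 1" for n
    proof -
      have "measure (\<mu> n) {- 1<..1} = measure (measure_pmf (pm n)) ((\<lambda>k. real k / real n) -` {- 1<..1})"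
        unfolding \<mu>_def by (subst measure_distr) auto
      also have "\<dots> = 1"
        by (subst measure_pmf.prob_eq_1) (use set[of n] in \<open>auto simp: AE_measure_pmf_iff divide_le_eq intro: less_le_trans[of "-1" 0]\<close>)
      finally show ?thesis .
    qed
    then show "\<exists>a b. a < b \<and> (\<forall>n. 1 - \<epsilon> < measure (\<mu> n) {a<..b})"
      using \<open>\<epsilon> > 0\<close> by (intro exI[of _ "-1"] exI[of _ 1]) auto
  qed
  from tight_imp_convergent_subsubsequence[OF this, of "\<lambda>n. n"]
  obtain r M where r: "strict_mono r" and M: "real_distribution M" and conv: "weak_conv_m (\<mu> \<circ> r) M"
    by (auto simp: strict_mono_def o_def)
  interpret M: real_distribution M by fact
  have lim: "(\<lambda>n. integral\<^sup>L (\<mu> (r n)) f) \<longlonglongrightarrow> integral\<^sup>L M f" if "\<And>x. isCont f x" "\<And>x. norm (f x) \<le> B" for f :: "real \<Rightarrow> real" and B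
    using weak_conv_imp_integral_bdd_continuous_conv[OF _ M, of "\<mu> \<circ> r" f B] rd conv that by auto
  have contc: "isCont clamp01 x" for x unfolding clamp01_def[abs_def] by (intro continuous_intros)
  have clamp: "0 \<le> clamp01 x" "clamp01 x \<le> 1" for x by (auto simp: clamp01_def)
  have clamp_eq: "x \<in> {0..1} \<Longrightarrow> clamp01 x = x" for x by (auto simp: clamp01_def)
  have AE01: "AE x in M. x \<in> {0..1}"
  proof -
    define f where "f x = min 1 \<bar>x - clamp01 x\<bar>" for x
    have fc: "isCont f x" for x unfolding f_def by (intro continuous_intros contc)
    have f01: "0 \<le> f x" "f x \<le> 1" for x by (auto simp: f_def)
    have [measurable]: "f \<in> borel_measurable borel" using fc by (intro borel_measurable_continuous_onI continuous_at_imp_continuous_on) auto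
    have "integral\<^sup>L (\<mu> n) f = 0" for n
      by (subst int\<mu>) (auto intro!: sum.neutral simp: f_def clamp_eq divide_le_eq)
    then have "integral\<^sup>L M f = 0" using lim[of f 1] fc f01 by (simp add: LIMSEQ_const_iff)
    moreover have "integrable M f" by (rule M.integrable_const_bound[of _ 1]) (use f01 in auto)
    ultimately have "AE x in M. f x = 0" using integral_nonneg_eq_0_iff_AE[of M f] f01 by auto
    then show ?thesis by eventually_elim (auto simp: f_def clamp01_def min_def max_def split: if_splits)
  qed
  have "integral\<^sup>L M (\<lambda>x. x ^ j) = L j 0" for j
  proof -
    define f where "f x = clamp01 x ^ j" for x
    have fc: "isCont f x" for x unfolding f_def by (intro continuous_intros contc)
    have f01: "0 \<le> f x" "f x \<le> 1" for x using clamp[of x] by (auto simp: f_def power_le_one)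
    have [measurable]: "f \<in> borel_measurable borel" using fc by (intro borel_measurable_continuous_onI continuous_at_imp_continuous_on) auto
    have bnd: "\<bar>integral\<^sup>L (\<mu> n) f - L j 0\<bar> \<le> real j * (real j / (real n - real j))" if n: "2 * j < n" for n
    proof -
      have "integral\<^sup>L (\<mu> n) f - L j 0 = (\<Sum>k\<le>n. w n k * ((real k / real n)^j - real (k choose j) / real (n choose j)))"
        using n by (subst int\<mu>, simp, subst mom[symmetric, of j n])
          (auto simp: f_def clamp_eq divide_le_eq right_diff_distrib sum_subtractf)
      also have "\<bar>\<dots>\<bar> \<le> (\<Sum>k\<le>n. w n k * (real j * (real j / (real n - real j))))"
      proof (intro order_trans[OF sum_abs] sum_mono)
        fix k assume "k \<in> {..n}"
        then have "\<bar>(real k / real n)^j - real (k choose j) / real (n choose j)\<bar> \<le> real j * (real j / (real n - real j))"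
          using falling_ratio_approx[of k n j] n by (subst abs_minus_commute) simp
        then show "\<bar>w n k * ((real k / real n)^j - real (k choose j) / real (n choose j))\<bar> \<le> w n k * (real j * (real j / (real n - real j)))"
          unfolding abs_mult abs_of_nonneg[OF w0] by (rule mult_left_mono[OF _ w0])
      qed
      also have "\<dots> = real j * (real j / (real n - real j))" by (subst sum_distrib_right[symmetric]) (simp add: wsum)
      finally show ?thesis .
    qed
    have "(\<lambda>n. integral\<^sup>L (\<mu> n) f - L j 0) \<longlonglongrightarrow> 0"
    proof (rule Lim_null_comparison)
      show "\<forall>\<^sub>F n in sequentially. norm (integral\<^sup>L (\<mu> n) f - L j 0) \<le> real j * (real j / (real n - real j))"
        using eventually_gt_at_top[of "2 * j"] by eventually_elim (use bnd in auto)
      have "filterlim (\<lambda>n. real n - real j) at_top sequentially"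
        using filterlim_tendsto_add_at_top[OF tendsto_const filterlim_real_sequentially, of "- real j"] by (simp add: add.commute)
      then have "(\<lambda>n. real j / (real n - real j)) \<longlonglongrightarrow> 0"
        by (rule real_tendsto_divide_at_top[OF tendsto_const])
      then show "(\<lambda>n. real j * (real j / (real n - real j))) \<longlonglongrightarrow> 0" by (rule tendsto_mult_right_zero)
    qed
    then have "(\<lambda>n. integral\<^sup>L (\<mu> n) f) \<longlonglongrightarrow> L j 0" by (simp add: LIM_zero_iff)
    then have "(\<lambda>n. integral\<^sup>L (\<mu> (r n)) f) \<longlonglongrightarrow> L j 0" using LIMSEQ_subseq_LIMSEQ[OF _ r] by (auto simp: o_def)
    then have "integral\<^sup>L M f = L j 0" using lim[of f 1] fc f01 LIMSEQ_unique by auto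
    moreover have "integral\<^sup>L M (\<lambda>x. x ^ j) = integral\<^sup>L M f"
      by (rule integral_cong_AE) (use AE01 in \<open>auto simp: f_def clamp_eq\<close>)
    ultimately show ?thesis by simp
  qed
  with M AE01 that show ?thesis by blast
qed

section \<open>Spectral measures\<close>

text \<open>Chebyshev's inequality with exponents 2k tending to infinity. The definition of
  \<open>specmeas\<close> admits arbitrary finite measures as competitors, so the bound on the
  support has to be read off the moments.\<close>

lemma moments_imp_bounded_support:
  fixes M :: "real measure"
  assumes "finite_measure M" "sets M = sets borel" and R: "R \<ge> 0"
    and int: "\<And>k. integrable M (\<lambda>l. l ^ (2 * k))" and le: "\<And>k. integral\<^sup>L M (\<lambda>l. l ^ (2 * k)) \<le> R ^ (2 * k)"
  shows "AE l in M. \<bar>l\<bar> \<le> R"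
proof -
  interpret finite_measure M by fact
  have [measurable_cong]: "sets M = sets borel" by fact
  have sp: "space M = UNIV" using sets_eq_imp_space_eq[OF assms(2)] by simp
  have "AE l in M. \<bar>l\<bar> < R + 1 / Suc n" for n
  proof -
    define c where "c = R + 1 / Suc n"
    have c: "R < c" "0 < c" using R by (auto simp: c_def intro: add_nonneg_pos)
    have "measure M {l. c \<le> \<bar>l\<bar>} \<le> (R / c) ^ (2 * k)" for k
    proof -
      have "c ^ (2 * k) * measure M {l. c \<le> \<bar>l\<bar>} = integral\<^sup>L M (\<lambda>l. c ^ (2 * k) * indicator {l. c \<le> \<bar>l\<bar>} l)"
        by (simp add: sp)
      also have "\<dots> \<le> integral\<^sup>L M (\<lambda>l. l ^ (2 * k))"
      proof (rule integral_mono[OF _ int])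
        show "integrable M (\<lambda>l. c ^ (2 * k) * indicator {l. c \<le> \<bar>l\<bar>} l)"
          by (intro integrable_mult_right integrable_real_indicator) (auto simp: emeasure_eq_measure)
        show "c ^ (2 * k) * indicator {l. c \<le> \<bar>l\<bar>} l \<le> l ^ (2 * k)" for l
        proof (cases "c \<le> \<bar>l\<bar>")
          case True
          then have "c ^ (2 * k) \<le> \<bar>l\<bar> ^ (2 * k)" using c by (intro power_mono) auto
          then show ?thesis using True by (simp add: power_even_abs)
        qed (simp add: zero_le_even_power)
      qed
      also have "\<dots> \<le> R ^ (2 * k)" by (rule le)
      finally show ?thesis using c by (simp add: power_divide field_simps)
    qed
    moreover have "(\<lambda>k. (R / c) ^ (2 * k)) \<longlonglongrightarrow> 0"
    proof -
      have "(\<lambda>k. ((R / c)^2) ^ k) \<longlonglongrightarrow> 0" using c R by (intro LIMSEQ_realpow_zero) (auto simp: power_less_one_iff)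
      then show ?thesis by (simp add: power_mult)
    qed
    ultimately have "measure M {l. c \<le> \<bar>l\<bar>} \<le> 0" by (intro LIMSEQ_le_const) auto
    then have "measure M {l. c \<le> \<bar>l\<bar>} = 0" by (simp add: measure_le_0_iff)
    then have "AE l in M. l \<notin> {l. c \<le> \<bar>l\<bar>}"
      by (intro AE_not_in null_setsI) (auto simp: emeasure_eq_measure)
    then show ?thesis by eventually_elim (simp add: c_def)
  qed
  then have "AE l in M. \<forall>n. \<bar>l\<bar> < R + 1 / Suc n" by (simp add: AE_all_countable)
  then show ?thesis
  proof eventually_elim
    fix l assume l: "\<forall>n. \<bar>l\<bar> < R + 1 / Suc n"
    show "\<bar>l\<bar> \<le> R"
    proof (rule ccontr)
      assume "\<not> \<bar>l\<bar> \<le> R"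
      then obtain n where "1 / Suc n < \<bar>l\<bar> - R" using nat_approx_posE[of "\<bar>l\<bar> - R"] by auto
      then show False using l[rule_format, of n] by linarith
    qed
  qed
qed

text \<open>For bounded support the characteristic function is the sum of a power series whose
  coefficients are given by the moments.\<close>

lemma moments_unique:
  fixes M N :: "real measure"
  assumes M: "real_distribution M" "AE l in M. \<bar>l\<bar> \<le> R" and N: "real_distribution N" "AE l in N. \<bar>l\<bar> \<le> R"
    and R: "R \<ge> 0" and mom: "\<And>k. integral\<^sup>L M (\<lambda>l. l ^ k) = integral\<^sup>L N (\<lambda>l. l ^ k)"
  shows "M = N"
proof (rule Levy_uniqueness[OF M(1) N(1)], rule ext)
  fix t
  have ser: "(\<lambda>k. (\<i> * of_real t)^k / fact k * complex_of_real (integral\<^sup>L P (\<lambda>l. l ^ k))) sums char P t"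
    if P: "real_distribution P" "AE l in P. \<bar>l\<bar> \<le> R" for P
  proof -
    interpret real_distribution P by fact
    have il: "integrable P (\<lambda>l. l ^ k)" for k
      by (rule integrable_const_bound[of _ "R ^ k"]) (use P(2) in \<open>auto elim!: eventually_mono simp: power_abs intro!: power_mono\<close>)
    have "(\<lambda>k. CLINT l|P. (\<i> * of_real t)^k / fact k * complex_of_real (l ^ k)) sums (CLINT l|P. (\<Sum>k. (\<i> * of_real t)^k / fact k * complex_of_real (l ^ k)))"
    proof (rule sums_integral)
      show "integrable P (\<lambda>l. (\<i> * of_real t)^k / fact k * complex_of_real (l ^ k))" for k
        using il[of k] by (intro integrable_mult_right integrable_of_real)
      have nrm: "norm ((\<i> * of_real t)^k / fact k * complex_of_real (l ^ k)) = \<bar>t * l\<bar> ^ k / fact k" for k l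
        by (simp add: norm_mult norm_divide norm_power abs_mult power_mult_distrib power_abs)
      show "AE l in P. summable (\<lambda>k. norm ((\<i> * of_real t)^k / fact k * complex_of_real (l ^ k)))"
        unfolding nrm using summable_exp[of "\<bar>t * l\<bar>" for l] by (simp add: field_simps)
      show "summable (\<lambda>k. LINT l|P. norm ((\<i> * of_real t)^k / fact k * complex_of_real (l ^ k)))"
      proof (rule summable_comparison_test[OF _ summable_exp[of "\<bar>t\<bar> * R"]], intro exI[of _ 0] allI impI)
        fix k
        have "(LINT l|P. norm ((\<i> * of_real t)^k / fact k * complex_of_real (l ^ k))) \<le> (LINT l|P. (\<bar>t\<bar> * R) ^ k / fact k)"
        proof (rule integral_mono_AE)
          show "integrable P (\<lambda>l. norm ((\<i> * of_real t)^k / fact k * complex_of_real (l ^ k)))"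
            using il[of k] by (intro integrable_norm integrable_mult_right integrable_of_real)
          show "AE l in P. norm ((\<i> * of_real t)^k / fact k * complex_of_real (l ^ k)) \<le> (\<bar>t\<bar> * R) ^ k / fact k"
            unfolding nrm using P(2) by eventually_elim (auto intro!: divide_right_mono power_mono mult_left_mono simp: abs_mult)
        qed simp
        then show "norm (LINT l|P. norm ((\<i> * of_real t)^k / fact k * complex_of_real (l ^ k))) \<le> inverse (fact k) * (\<bar>t\<bar> * R) ^ k"
          using prob_space by (simp add: abs_of_nonneg divide_inverse mult.commute del: space_eq_univ)
      qed
    qed
    moreover have "(\<Sum>k. (\<i> * of_real t)^k / fact k * complex_of_real (l ^ k)) = iexp (t * l)" for l
      unfolding exp_def by (simp add: power_mult_distrib scaleR_conv_of_real field_simps)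
    moreover have "(CLINT l|P. (\<i> * of_real t)^k / fact k * complex_of_real (l ^ k)) = (\<i> * of_real t)^k / fact k * complex_of_real (integral\<^sup>L P (\<lambda>l. l ^ k))" for k
      by (subst Bochner_Integration.integral_mult_right_zero) (simp only: integral_complex_of_real)
    ultimately show ?thesis by (simp only: char_def)
  qed
  show "char M t = char N t"
    using sums_unique2[OF ser[OF M] ser[OF N, folded mom]] .
qed

context symmetric_operator
begin

lemma S_form_bound: assumes u: "sqint M u" shows "\<bar>Re (ip M u (S u))\<bar> \<le> R * norm_sq M u"
proof -
  have "(cmod (ip M u (S u)))^2 \<le> norm_sq M u * norm_sq M (S u)" by (intro cauchy_schwarz S_sqint u)
  also have "\<dots> \<le> norm_sq M u * (R^2 * norm_sq M u)" by (intro mult_left_mono S_bound u) auto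
  also have "\<dots> = (R * norm_sq M u)^2" by (simp add: power2_eq_square)
  finally have "cmod (ip M u (S u)) \<le> R * norm_sq M u" using R_pos by (simp add: power2_le_iff_abs_le abs_of_nonneg)
  then show ?thesis using abs_Re_le_cmod order_trans by blast
qed

text \<open>Rescales the spectrum from [-R, R] into [0, 1]. With \<open>T'\<close> for 1 - T, the
  forms of \<open>T^j T'^i\<close> obey the recurrence of the Hausdorff moment problem.\<close>

definition T :: "('a \<Rightarrow> complex) \<Rightarrow> 'a \<Rightarrow> complex" where
  "T u z = of_real (1 / (2 * R)) * S u z + of_real (1/2) * u z"

definition T' :: "('a \<Rightarrow> complex) \<Rightarrow> 'a \<Rightarrow> complex" where
  "T' u z = u z - T u z"

lemma T_sqint: "sqint M u \<Longrightarrow> sqint M (T u)" unfolding T_def by (intro sqint_add sqint_cmult S_sqint)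
lemma T'_sqint: "sqint M u \<Longrightarrow> sqint M (T' u)" unfolding T'_def by (intro sqint_diff T_sqint)

lemma T_pow_sqint: "sqint M u \<Longrightarrow> sqint M ((T ^^ n) u)" by (induction n) (auto intro: T_sqint)
lemma T'_pow_sqint: "sqint M u \<Longrightarrow> sqint M ((T' ^^ n) u)" by (induction n) (auto intro: T'_sqint)

lemma T_symmetric: "sqint M u \<Longrightarrow> sqint M w \<Longrightarrow> ip M (T u) w = ip M u (T w)"
  unfolding T_def by (simp add: ip_add_left ip_add_right S_sqint sqint_cmult ip_scale_left ip_scale_right S_symmetric
      del: of_real_divide of_real_mult)

lemma T'_symmetric: "sqint M u \<Longrightarrow> sqint M w \<Longrightarrow> ip M (T' u) w = ip M u (T' w)"
  unfolding T'_def by (simp add: ip_diff_left ip_diff_right T_sqint T_symmetric)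

lemma T_linear: "T (\<lambda>z. a * u z + b * w z) = (\<lambda>z. a * T u z + b * T w z)"
  unfolding T_def S_linear by (rule ext) (simp add: algebra_simps del: of_real_divide of_real_mult)

lemma T_diff: "T (\<lambda>z. u z - w z) = (\<lambda>z. T u z - T w z)"
  using T_linear[of 1 u "-1" w] by simp

lemma T_pow_linear: "(T ^^ n) (\<lambda>z. a * u z + b * w z) = (\<lambda>z. a * (T ^^ n) u z + b * (T ^^ n) w z)"
  by (induction n) (simp_all add: T_linear)

lemma T_T': "T (T' u) = T' (T u)"
proof -
  have "T' u = (\<lambda>z. u z - T u z)" "T' (T u) = (\<lambda>z. T u z - T (T u) z)" by (simp_all add: T'_def fun_eq_iff)
  then show ?thesis by (simp add: T_diff)
qed

lemma T_T'_pow: "T ((T' ^^ n) u) = (T' ^^ n) (T u)"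
  by (induction n) (simp_all add: T_T')

lemma T'_T_pow: "T' ((T ^^ n) u) = (T ^^ n) (T' u)"
  by (induction n) (simp_all add: T_T'[symmetric])

lemma T_pos: "sqint M u \<Longrightarrow> 0 \<le> Re (ip M u (T u))" and T'_pos: "sqint M u \<Longrightarrow> 0 \<le> Re (ip M u (T' u))"
proof -
  assume u: "sqint M u"
  have "ip M u (T u) = of_real (1 / (2 * R)) * ip M u (S u) + of_real (1/2) * ip M u u"
    unfolding T_def by (simp add: ip_add_right S_sqint sqint_cmult ip_scale_right u del: of_real_divide of_real_mult)
  then have 1: "Re (ip M u (T u)) = Re (ip M u (S u)) / (2 * R) + norm_sq M u / 2"
    by (simp add: ip_self)
  have "- (R * norm_sq M u) \<le> Re (ip M u (S u))" "Re (ip M u (S u)) \<le> R * norm_sq M u" using S_form_bound[OF u] by (auto simp: abs_le_iff)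
  then have 2: "- (norm_sq M u / 2) \<le> Re (ip M u (S u)) / (2 * R)" "Re (ip M u (S u)) / (2 * R) \<le> norm_sq M u / 2"
    using R_pos by (simp_all add: field_simps)
  show "0 \<le> Re (ip M u (T u))" using 1 2 by linarith
  have "ip M u (T' u) = ip M u u - ip M u (T u)"
    unfolding T'_def by (simp add: ip_diff_right u T_sqint)
  then show "0 \<le> Re (ip M u (T' u))" using 1 2 by (simp add: ip_self)
qed

lemma T_T'_split: "u = (\<lambda>z. T u z + T' u z)"
  by (simp add: T'_def)

text \<open>Pull out the even part of the exponents; the case of two odd exponents uses
  \<open>T (1-T) = T (1-T)\<^sup>2 + (1-T) T\<^sup>2\<close>.\<close>

lemma TT'_form_pos: "sqint M u \<Longrightarrow> 0 \<le> Re (ip M u ((T ^^ j) ((T' ^^ i) u)))"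
proof (induction "j + i" arbitrary: j i u rule: less_induct)
  case less
  note u = less.prems
  consider (a) j' where "j = Suc (Suc j')" | (b) i' where "i = Suc (Suc i')" | (c) "j = 0" "i = 0" | (d) "j = 1" "i = 0"
    | (e) "j = 0" "i = 1" | (f) "j = 1" "i = 1"
    by (metis One_nat_def not0_implies_Suc)
  then show ?case
  proof cases
    case a
    have "(T ^^ j) ((T' ^^ i) u) = T ((T ^^ j') ((T' ^^ i) (T u)))"
      unfolding a by (simp add: funpow_swap1 T_T'_pow)
    then have "ip M u ((T ^^ j) ((T' ^^ i) u)) = ip M (T u) ((T ^^ j') ((T' ^^ i) (T u)))"
      using u by (simp add: T_symmetric T_pow_sqint T'_pow_sqint T_sqint)
    then show ?thesis using less.hyps[of j' i "T u"] a T_sqint[OF u] by simp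
  next
    case b
    have "(T ^^ j) ((T' ^^ i) u) = T' ((T ^^ j) ((T' ^^ i') (T' u)))"
      unfolding b by (simp add: funpow_swap1 T'_T_pow)
    then have "ip M u ((T ^^ j) ((T' ^^ i) u)) = ip M (T' u) ((T ^^ j) ((T' ^^ i') (T' u)))"
      using u by (simp add: T'_symmetric T_pow_sqint T'_pow_sqint T'_sqint)
    then show ?thesis using less.hyps[of j i' "T' u"] b T'_sqint[OF u] by simp
  next
    case f
    have Tadd: "T (\<lambda>z. a z + b z) = (\<lambda>z. T a z + T b z)" for a b using T_linear[of 1 a 1 b] by simp
    have "T (T' u) = (\<lambda>z. T (T' (T u)) z + T (T' (T' u)) z)"
      by (subst (1) T_T'_split[of "T' u"], subst Tadd) (simp add: T_T')
    then have "ip M u (T (T' u)) = ip M u (\<lambda>z. T (T' (T u)) z + T (T' (T' u)) z)"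
      by (rule arg_cong)
    also have "\<dots> = ip M u (T (T' (T u))) + ip M u (T (T' (T' u)))"
      using u by (simp only: ip_add_right T_sqint T'_sqint)
    also have "T (T' (T' u)) = T' (T (T' u))" by (rule T_T')
    also have "ip M u (T (T' (T u))) + ip M u (T' (T (T' u))) = ip M (T u) (T' (T u)) + ip M (T' u) (T (T' u))"
      using u by (simp add: T_symmetric T'_symmetric T_sqint T'_sqint)
    finally show ?thesis using f T_pos[OF T'_sqint[OF u]] T'_pos[OF T_sqint[OF u]] by simp
  qed (use u T_pos T'_pos in \<open>auto simp: ip_self\<close>)
qed

text \<open>Hausdorff's theorem solves the moment problem for \<open>T\<close>; the affine map from
  [0, 1] onto [-R, R] turns the solution into one for \<open>S\<close>.\<close>

theorem spectral_measure_exists: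
  assumes u: "sqint M u" "norm_sq M u = 1"
  obtains N :: "real measure" where "real_distribution N" "AE l in N. \<bar>l\<bar> \<le> R"
    "\<And>k. complex_of_real (integral\<^sup>L N (\<lambda>l. l ^ k)) = ip M u ((S ^^ k) u)"
proof -
  have S_pow: "sqint M ((S ^^ k) u)" for k by (induction k) (auto intro: u S_sqint)
  define L where "L j i = Re (ip M u ((T ^^ j) ((T' ^^ i) u)))" for j i
  have "L j i = L (Suc j) i + L j (Suc i)" for j i
  proof -
    have "(T ^^ j) ((T' ^^ i) u) = (\<lambda>z. (T ^^ Suc j) ((T' ^^ i) u) z + (T ^^ j) ((T' ^^ Suc i) u) z)"
      by (subst T_T'_split) (simp add: T'_T_pow)
    then show ?thesis unfolding L_def using u
      by (simp only: ip_add_right T_pow_sqint T'_pow_sqint plus_complex.sel)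
  qed
  from hausdorff_moments[of L, OF this]
  obtain P where P: "real_distribution P" "AE x in P. x \<in> {0..1}" "\<And>j. integral\<^sup>L P (\<lambda>x. x ^ j) = L j 0"
    using TT'_form_pos[OF u(1)] u by (auto simp: L_def ip_self)
  interpret P: real_distribution P by fact
  define N where "N = distr P borel (\<lambda>x. 2 * R * x - R)"
  have N: "real_distribution N" unfolding N_def by (rule P.real_distribution_distr) simp
  have AEN: "AE l in N. \<bar>l\<bar> \<le> R" unfolding N_def
  proof (subst AE_distr_iff)
    show "AE x in P. \<bar>2 * R * x - R\<bar> \<le> R"
      using P(2)
    proof eventually_elim
      fix x :: real assume "x \<in> {0..1}"
      then have "0 \<le> R * x" "R * x \<le> R" using R_pos by (auto simp: mult_left_le)
      then show "\<bar>2 * R * x - R\<bar> \<le> R" by (simp add: abs_le_iff)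
    qed
  qed auto
  have ii: "integrable P (\<lambda>x. x ^ j * (2 * R * x - R) ^ k)" for j k
  proof (rule P.integrable_const_bound[of _ "R ^ k"])
    show "AE x in P. norm (x ^ j * (2 * R * x - R) ^ k) \<le> R ^ k"
      using P(2)
    proof eventually_elim
      fix x :: real assume x: "x \<in> {0..1}"
      then have "0 \<le> R * x" "R * x \<le> R" using R_pos by (auto simp: mult_left_le)
      then have "\<bar>2 * R * x - R\<bar> ^ k \<le> R ^ k" by (intro power_mono) (auto simp: abs_le_iff)
      moreover have "\<bar>x\<bar> ^ j \<le> 1" using x by (intro power_le_one) auto
      ultimately have "\<bar>x\<bar> ^ j * \<bar>2 * R * x - R\<bar> ^ k \<le> 1 * R ^ k" using R_pos by (intro mult_mono) auto
      then show "norm (x ^ j * (2 * R * x - R) ^ k) \<le> R ^ k" by (simp add: abs_mult power_abs)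
    qed
  qed simp
  \<comment> \<open>The extra power \<open>x ^ j\<close> carries the induction on \<open>k\<close>:
    by S = 2 R T - R, one factor \<open>2 * R * x - R\<close> is traded for moments with
    \<open>Suc j\<close> and \<open>j\<close>.\<close>
  have mom: "(LINT x|P. x ^ j * (2 * R * x - R) ^ k) = Re (ip M u ((T ^^ j) ((S ^^ k) u)))" for j k
  proof (induction k arbitrary: j)
    case 0
    then show ?case using P(3)[of j] by (simp add: L_def)
  next
    case (Suc k)
    have "S w z = of_real (2 * R) * T w z + of_real (- R) * w z" for w z
      using R_pos by (simp add: T_def field_simps)
    then have "(S ^^ Suc k) u = (\<lambda>z. of_real (2 * R) * T ((S ^^ k) u) z + of_real (- R) * (S ^^ k) u z)"
      by (simp add: fun_eq_iff)
    then have "(T ^^ j) ((S ^^ Suc k) u) = (\<lambda>z. of_real (2 * R) * (T ^^ Suc j) ((S ^^ k) u) z + of_real (- R) * (T ^^ j) ((S ^^ k) u) z)"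
      by (simp only: T_pow_linear funpow_swap1 funpow.simps o_apply)
    then have "ip M u ((T ^^ j) ((S ^^ Suc k) u)) = of_real (2 * R) * ip M u ((T ^^ Suc j) ((S ^^ k) u)) + of_real (- R) * ip M u ((T ^^ j) ((S ^^ k) u))"
      using u S_pow[of k] by (simp only: ip_add_right T_pow_sqint sqint_cmult ip_scale_right)
    then have "Re (ip M u ((T ^^ j) ((S ^^ Suc k) u))) = 2 * R * (LINT x|P. x ^ Suc j * (2 * R * x - R) ^ k) - R * (LINT x|P. x ^ j * (2 * R * x - R) ^ k)"
      using Suc[of "Suc j"] Suc[of j] by simp
    also have "\<dots> = (LINT x|P. 2 * R * (x ^ Suc j * (2 * R * x - R) ^ k) - R * (x ^ j * (2 * R * x - R) ^ k))"
      using ii[of "Suc j" k] ii[of j k] by simp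
    also have "\<dots> = (LINT x|P. x ^ j * (2 * R * x - R) ^ Suc k)"
      by (rule Bochner_Integration.integral_cong) (auto simp: algebra_simps)
    finally show ?case by simp
  qed
  have S_pow_sym: "sqint M w \<Longrightarrow> ip M ((S ^^ k) u) w = ip M u ((S ^^ k) w)" for k w
  proof (induction k arbitrary: w)
    case (Suc k)
    have "ip M ((S ^^ Suc k) u) w = ip M ((S ^^ k) u) (S w)"
      using S_symmetric[OF S_pow[of k] Suc.prems] by simp
    also have "\<dots> = ip M u ((S ^^ k) (S w))" by (rule Suc.IH[OF S_sqint[OF Suc.prems]])
    finally show ?case by (simp add: funpow_swap1)
  qed simp
  have "complex_of_real (integral\<^sup>L N (\<lambda>l. l ^ k)) = ip M u ((S ^^ k) u)" for k
  proof -
    have "integral\<^sup>L N (\<lambda>l. l ^ k) = Re (ip M u ((S ^^ k) u))"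
      unfolding N_def using mom[of 0 k] by (subst integral_distr) auto
    moreover have "cnj (ip M u ((S ^^ k) u)) = ip M u ((S ^^ k) u)"
      by (simp add: ip_cnj S_pow_sym u)
    then have "Im (ip M u ((S ^^ k) u)) = 0" by (simp add: complex_eq_iff)
    ultimately show ?thesis by (simp add: complex_eq_iff)
  qed
  with N AEN that show ?thesis by blast
qed

end

section \<open>The density of states measure\<close>

lemma measure_preserving_pair_shift_int: "measure_preserving_pair CS (\<lambda>n. n + 1) (\<lambda>n. n - 1)"
proof
  show "distr CS CS (\<lambda>n. n + 1) = CS"
    by (rule distr_bij_count_space) (auto intro!: bij_betwI[where g = "\<lambda>n. n - 1"])
qed auto

lemma jacobi_Hop:
  assumes "\<And>x. \<bar>v x\<bar> \<le> V"
  shows "jacobi CS (\<lambda>n. n + 1) (\<lambda>n. n - 1) (\<lambda>_. 1) (\<lambda>n. v (x + real_of_int n *\<^sub>R \<alpha>)) V"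
  using measure_preserving_pair_shift_int by (rule jacobi.intro) (unfold_locales, use assms in auto)

lemma J_Hop:
  assumes "\<And>x. \<bar>v x\<bar> \<le> V"
  shows "jacobi.J (\<lambda>n. n + 1) (\<lambda>n. n - 1) (\<lambda>_. 1) (\<lambda>n. v (x + real_of_int n *\<^sub>R \<alpha>)) = Hop v \<alpha> x"
proof -
  interpret jacobi CS "\<lambda>n. n + 1" "\<lambda>n. n - 1" "\<lambda>_. 1" "\<lambda>n. v (x + real_of_int n *\<^sub>R \<alpha>)" V
    using assms by (rule jacobi_Hop)
  show ?thesis by (simp add: fun_eq_iff J_def Hop_def)
qed

lemma symmetric_operator_Hop:
  assumes "\<And>x. \<bar>v x\<bar> \<le> V"
  shows "symmetric_operator CS (Hop v \<alpha> x) (sqrt (6 + 3 * V^2))"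
proof -
  interpret jacobi CS "\<lambda>n. n + 1" "\<lambda>n. n - 1" "\<lambda>_. 1" "\<lambda>n. v (x + real_of_int n *\<^sub>R \<alpha>)" V
    using assms by (rule jacobi_Hop)
  show ?thesis using symmetric_operator_axioms J_Hop[of v V x \<alpha>, OF assms] by simp
qed

lemma ip_delta0: "ip CS delta0 w = w 0"
proof -
  have "ip CS delta0 w = (LINT n|CS. indicator {0} n *\<^sub>R w 0)"
    unfolding ip_def by (rule Bochner_Integration.integral_cong) (auto simp: delta0_def indicator_def)
  then show ?thesis by (simp add: measure_count_space)
qed

lemma sqint_delta0: "sqint CS delta0" and norm_sq_delta0: "norm_sq CS delta0 = 1"
proof -
  have "(cmod (delta0 n))^2 = indicator {0} n" for n by (simp add: delta0_def indicator_def)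
  then show "sqint CS delta0" "norm_sq CS delta0 = 1"
    unfolding sqint_def norm_sq_def by (simp_all add: measure_count_space)
qed

lemma real_distributionI: "prob_space M \<Longrightarrow> sets M = sets borel \<Longrightarrow> real_distribution M"
  by (simp add: real_distribution_def real_distribution_axioms_def)

lemma integrable_powers:
  fixes M :: "real measure"
  assumes "real_distribution M" "AE l in M. \<bar>l\<bar> \<le> R"
  shows "integrable M (\<lambda>l. l ^ k)"
proof -
  interpret real_distribution M by fact
  show ?thesis
proof (rule integrable_const_bound[of _ "R ^ k"])
  show "AE l in M. norm (l ^ k) \<le> R ^ k"
    using assms(2) by eventually_elim (auto simp: power_abs intro!: power_mono)
qed simp
qed

text \<open>The definite description needs exactly one solution. Existence is
  \<open>spectral_measure_exists\<close> at \<open>delta0\<close>. For uniqueness, the zeroth moment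
  fixes the mass, the even moments confine the support, and then the moments determine the
  measure.\<close>

lemma specmeas_properties:
  assumes v: "\<And>x. \<bar>v x\<bar> \<le> V"
  shows "real_distribution (specmeas v \<alpha> x)" "AE l in specmeas v \<alpha> x. \<bar>l\<bar> \<le> sqrt (6 + 3 * V^2)"
    "complex_of_real (integral\<^sup>L (specmeas v \<alpha> x) (\<lambda>l. l ^ k)) = ((Hop v \<alpha> x ^^ k) delta0) 0"
proof -
  define R where "R = sqrt (6 + 3 * V^2)"
  interpret symmetric_operator CS "Hop v \<alpha> x" R unfolding R_def using v by (rule symmetric_operator_Hop)
  obtain N :: "real measure" where N: "real_distribution N" "AE l in N. \<bar>l\<bar> \<le> R"
    "\<And>k. complex_of_real (integral\<^sup>L N (\<lambda>l. l ^ k)) = ((Hop v \<alpha> x ^^ k) delta0) 0"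
    using spectral_measure_exists[OF sqint_delta0 norm_sq_delta0] by (auto simp: ip_delta0)
  interpret N: real_distribution N by fact
  have iN: "integrable N (\<lambda>l. l ^ k)" for k by (rule integrable_powers[OF N(1,2)])
  have eq: "specmeas v \<alpha> x = N" unfolding specmeas_def
  proof (rule the_equality)
    show "sets N = sets borel \<and> finite_measure N \<and> (\<forall>k. integrable N (\<lambda>l. l ^ k) \<and>
       complex_of_real (integral\<^sup>L N (\<lambda>l. l ^ k)) = ((Hop v \<alpha> x ^^ k) delta0) 0)"
      using N(3) iN N.finite_measure_axioms by simp
  next
    fix \<mu> assume \<mu>: "sets \<mu> = sets borel \<and> finite_measure \<mu> \<and> (\<forall>k. integrable \<mu> (\<lambda>l. l ^ k) \<and>
       complex_of_real (integral\<^sup>L \<mu> (\<lambda>l. l ^ k)) = ((Hop v \<alpha> x ^^ k) delta0) 0)"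
    then interpret \<mu>: finite_measure \<mu> by simp
    have mom: "integral\<^sup>L \<mu> (\<lambda>l. l ^ k) = integral\<^sup>L N (\<lambda>l. l ^ k)" for k
      using \<mu> N(3)[of k] by (metis of_real_eq_iff)
    have "measure \<mu> (space \<mu>) = 1" using mom[of 0] N.prob_space by simp
    then have p: "prob_space \<mu>" by (intro prob_spaceI) (simp add: \<mu>.emeasure_eq_measure)
    have "integral\<^sup>L N (\<lambda>l. l ^ (2 * k)) \<le> R ^ (2 * k)" for k
    proof -
      have "integral\<^sup>L N (\<lambda>l. l ^ (2 * k)) \<le> integral\<^sup>L N (\<lambda>l. R ^ (2 * k))"
      proof (rule integral_mono_AE[OF iN])
        show "AE l in N. l ^ (2 * k) \<le> R ^ (2 * k)" using N(2)
        proof eventually_elim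
          fix l :: real assume "\<bar>l\<bar> \<le> R"
          then have "\<bar>l\<bar> ^ (2 * k) \<le> R ^ (2 * k)" by (intro power_mono) auto
          then show "l ^ (2 * k) \<le> R ^ (2 * k)" by (simp add: power_even_abs)
        qed
      qed simp
      then show ?thesis using N.prob_space by simp
    qed
    then have "AE l in \<mu>. \<bar>l\<bar> \<le> R"
      using \<mu> R_pos by (intro moments_imp_bounded_support) (auto simp: mom)
    with p \<mu> N R_pos show "\<mu> = N"
      by (intro moments_unique[of \<mu> R N]) (auto intro: real_distributionI simp: mom)
  qed
  show "real_distribution (specmeas v \<alpha> x)" "AE l in specmeas v \<alpha> x. \<bar>l\<bar> \<le> sqrt (6 + 3 * V^2)"
    "complex_of_real (integral\<^sup>L (specmeas v \<alpha> x) (\<lambda>l. l ^ k)) = ((Hop v \<alpha> x ^^ k) delta0) 0"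
    unfolding eq using N unfolding R_def by simp_all
qed

text \<open>All the measures live on [-R, R], where Weierstrass approximation reduces a continuous
  \<open>f\<close> to polynomials and hence to the moments.\<close>

lemma integral_kernel_measurable:
  fixes \<mu> :: "'x \<Rightarrow> real measure"
  assumes \<mu>: "\<And>x. real_distribution (\<mu> x)" "\<And>x. AE l in \<mu> x. \<bar>l\<bar> \<le> R"
    and mom: "\<And>k. (\<lambda>x. integral\<^sup>L (\<mu> x) (\<lambda>l. l ^ k)) \<in> borel_measurable X"
    and f: "continuous_on UNIV f" "\<And>l. \<bar>f l\<bar> \<le> (B::real)"
  shows "(\<lambda>x. integral\<^sup>L (\<mu> x) f) \<in> borel_measurable X"
proof -
  have ik: "integrable (\<mu> x) (\<lambda>l. l ^ k)" for k x
    by (rule integrable_powers[OF \<mu>])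
  have "\<exists>g. real_polynomial_function g \<and> (\<forall>l\<in>cbox (-R) R. \<bar>f l - g l\<bar> < 1 / Suc n)" for n
  proof -
    obtain g where "real_polynomial_function g" "\<And>l. l \<in> cbox (-R) R \<Longrightarrow> \<bar>f l - g l\<bar> < 1 / Suc n"
      using Stone_Weierstrass_real_polynomial_function[OF compact_cbox continuous_on_subset[OF f(1)], of "-R" R "1 / Suc n"] by auto
    then show ?thesis by blast
  qed
  then have "\<forall>n. \<exists>g. real_polynomial_function g \<and> (\<forall>l\<in>cbox (-R) R. \<bar>f l - g l\<bar> < 1 / Suc n)" by blast
  from choice[OF this] obtain g where
    gg: "\<forall>n. real_polynomial_function (g n) \<and> (\<forall>l\<in>cbox (-R) R. \<bar>f l - g n l\<bar> < 1 / Suc n)" by blast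
  have g: "\<And>n. real_polynomial_function (g n)" using gg by blast
  have g2: "\<bar>f l - g n l\<bar> < 1 / Suc n" if "\<bar>l\<bar> \<le> R" for n l
    using gg[rule_format, of n] that by (auto simp: abs_le_iff)
  have poly: "\<exists>a m. g n = (\<lambda>x. \<Sum>i\<le>m. a i * x ^ i)" for n
    using g[of n] by (auto simp: real_polynomial_function_iff_sum)
  show ?thesis
  proof (rule borel_measurable_LIMSEQ_real)
    fix x
    interpret \<mu>: real_distribution "\<mu> x" by (rule \<mu>)
    have "f \<in> borel_measurable borel" by (rule borel_measurable_continuous_onI[OF f(1)])
    then have fm: "integrable (\<mu> x) f"
      by (intro \<mu>.integrable_const_bound[of _ B]) (use f in auto)
    have ig: "integrable (\<mu> x) (g n)" for n
      using poly[of n] ik by auto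
    show "(\<lambda>n. integral\<^sup>L (\<mu> x) (g n)) \<longlonglongrightarrow> integral\<^sup>L (\<mu> x) f"
    proof (rule LIM_zero_cancel, rule Lim_null_comparison)
      show "\<forall>\<^sub>F n in sequentially. norm (integral\<^sup>L (\<mu> x) (g n) - integral\<^sup>L (\<mu> x) f) \<le> 1 / Suc n"
      proof (intro always_eventually allI)
        fix n
        have "norm (integral\<^sup>L (\<mu> x) (g n) - integral\<^sup>L (\<mu> x) f) = norm (LINT l|\<mu> x. g n l - f l)"
          using ig fm by simp
        also have "\<dots> \<le> (LINT l|\<mu> x. norm (g n l - f l))" by (rule integral_norm_bound)
        also have "\<dots> \<le> (LINT l|\<mu> x. 1 / Suc n)"
        proof (rule integral_mono_AE)
          show "integrable (\<mu> x) (\<lambda>l. norm (g n l - f l))" using ig[of n] fm by auto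
          show "AE l in \<mu> x. norm (g n l - f l) \<le> 1 / Suc n"
            using \<mu>(2)[of x]
          proof eventually_elim
            fix l assume "\<bar>l\<bar> \<le> R"
            from g2[OF this, of n] show "norm (g n l - f l) \<le> 1 / Suc n" by (simp add: abs_minus_commute)
          qed
        qed simp
        also have "\<dots> = 1 / Suc n" using \<mu>.prob_space by simp
        finally show "norm (integral\<^sup>L (\<mu> x) (g n) - integral\<^sup>L (\<mu> x) f) \<le> 1 / Suc n" .
      qed
      show "(\<lambda>n. 1 / real (Suc n)) \<longlonglongrightarrow> 0" by (rule lim_1_over_n[THEN LIMSEQ_Suc, unfolded of_nat_Suc[symmetric]])
    qed
  next
    fix n
    obtain a m where gn: "g n = (\<lambda>x. \<Sum>i\<le>m. a i * x ^ i)" using poly[of n] by blast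
    have "integral\<^sup>L (\<mu> x) (g n) = (\<Sum>i\<le>m. a i * integral\<^sup>L (\<mu> x) (\<lambda>l. l ^ i))" for x
      unfolding gn using ik by simp
    then show "(\<lambda>x. integral\<^sup>L (\<mu> x) (g n)) \<in> borel_measurable X" using mom by simp
  qed
qed

text \<open>Moments are polynomial expressions in finitely many values of \<open>v\<close> along the
  orbit, hence measurable in x. Measurability then passes from moments to continuous functions, to
  half-lines, and to all Borel sets.\<close>

lemma specmeas_kernel:
  assumes v: "\<And>x. \<bar>v x\<bar> \<le> V" and vm[measurable]: "v \<in> borel_measurable borel"
  shows "specmeas v \<alpha> \<in> borel \<rightarrow>\<^sub>M prob_algebra borel"
proof -
  note sm = specmeas_properties[of v V, OF v]
  have Hm: "(\<lambda>x. (Hop v \<alpha> x ^^ k) delta0 n) \<in> borel_measurable borel" for k n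
  proof (induction k arbitrary: n)
    case (Suc k)
    note Suc[measurable]
    have "(Hop v \<alpha> x ^^ Suc k) delta0 n = (Hop v \<alpha> x ^^ k) delta0 (n + 1) + (Hop v \<alpha> x ^^ k) delta0 (n - 1)
        + complex_of_real (v (x + real_of_int n *\<^sub>R \<alpha>)) * (Hop v \<alpha> x ^^ k) delta0 n" for x
      by (simp add: Hop_def[of v \<alpha> x "(Hop v \<alpha> x ^^ k) delta0"])
    then show ?case by simp
  qed simp
  have "integral\<^sup>L (specmeas v \<alpha> x) (\<lambda>l. l ^ k) = Re ((Hop v \<alpha> x ^^ k) delta0 0)" for x k
    by (simp add: sm(3)[symmetric])
  then have mom: "(\<lambda>x. integral\<^sup>L (specmeas v \<alpha> x) (\<lambda>l. l ^ k)) \<in> borel_measurable borel" for k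
    using Hm[of k 0] by simp
  show ?thesis
  proof (rule measurable_prob_algebra_generated[of _ UNIV "range atMost"])
    show "sets borel = sigma_sets UNIV (range (atMost :: real \<Rightarrow> _))"
      by (subst borel_eq_atMost) (simp add: sets_measure_of)
    have "{..a} \<inter> {..b} = {..min a b}" for a b :: real by auto
    then show "Int_stable (range (atMost :: real \<Rightarrow> _))" unfolding Int_stable_def by auto
    show "prob_space (specmeas v \<alpha> x)" for x using sm(1) real_distribution_def by blast
    show "sets (specmeas v \<alpha> x) = sets borel" for x
    proof -
      interpret real_distribution "specmeas v \<alpha> x" by (rule sm)
      show ?thesis by simp
    qed
    fix A :: "real set" assume "A \<in> range atMost"
    then obtain a where A: "A = {..a}" by auto
    \<comment> \<open>For positive \<open>n\<close>, a ramp from 1 at \<open>a\<close> down to 0 at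
      a + 1/n; the ramps converge pointwise to the indicator of the half-line.\<close>
    define f where "f n l = max 0 (min 1 (1 - real n * (l - a)))" for n l
    have "(\<lambda>x. measure (specmeas v \<alpha> x) {..a}) \<in> borel_measurable borel"
    proof (rule borel_measurable_LIMSEQ_real)
      show "(\<lambda>x. integral\<^sup>L (specmeas v \<alpha> x) (f n)) \<in> borel_measurable borel" for n
        by (rule integral_kernel_measurable[OF sm(1,2) mom, where B = 1])
           (auto simp: f_def[abs_def] intro!: continuous_intros)
      fix x
      interpret real_distribution "specmeas v \<alpha> x" by (rule sm)
      have "(\<lambda>n. integral\<^sup>L (specmeas v \<alpha> x) (f n)) \<longlonglongrightarrow> (LINT l|specmeas v \<alpha> x. indicator {..a} l)"
      proof (rule integral_dominated_convergence[where w = "\<lambda>_. 1"])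
        show "AE l in specmeas v \<alpha> x. (\<lambda>n. f n l) \<longlonglongrightarrow> indicator {..a} l"
        proof (rule AE_I2)
          fix l
          show "(\<lambda>n. f n l) \<longlonglongrightarrow> indicator {..a} l"
          proof (cases "l \<le> a")
            case True
            then have "f n l = 1" for n by (simp add: f_def mult_nonneg_nonpos)
            then show ?thesis using True by simp
          next
            case False
            then obtain N where N: "real N * (l - a) > 1" using reals_Archimedean3[of "l - a"] by auto
            have "\<forall>\<^sub>F n in sequentially. 0 = f n l" using eventually_ge_at_top[of N]
            proof eventually_elim
              fix n assume "N \<le> n"
              then have "real N * (l - a) \<le> real n * (l - a)" using False by (intro mult_right_mono) auto
              then show "0 = f n l" using N by (simp add: f_def)
            qed
            then have "(\<lambda>n. f n l) \<longlonglongrightarrow> 0" by (rule Lim_transform_eventually[OF tendsto_const])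
            then show ?thesis using False by simp
          qed
        qed
        show "f n \<in> borel_measurable (specmeas v \<alpha> x)" for n
          unfolding f_def[abs_def] by measurable
      qed (auto simp: f_def)
      then show "(\<lambda>n. integral\<^sup>L (specmeas v \<alpha> x) (f n)) \<longlonglongrightarrow> measure (specmeas v \<alpha> x) {..a}" by simp
    qed
    moreover have "emeasure (specmeas v \<alpha> x) A = ennreal (measure (specmeas v \<alpha> x) {..a})" for x
    proof -
      interpret real_distribution "specmeas v \<alpha> x" by (rule sm)
      show ?thesis by (simp add: A emeasure_eq_measure)
    qed
    ultimately show "(\<lambda>x. emeasure (specmeas v \<alpha> x) A) \<in> borel_measurable borel" by simp
  qed simp
qed

lemma emeasure_unit_cube: "emeasure lborel (unit_cube :: (real^'d) set) = 1"
  unfolding unit_cube_def by (subst emeasure_lborel_cbox) (auto simp: inner_sum_left inner_Basis intro!: prod.neutral)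

text \<open>\<open>measure_of\<close> has the intended values only for a countably additive set
  function. Additivity is obtained by recognising \<open>dos\<close> as the monadic bind of Lebesgue
  measure on the cube with the kernel \<open>specmeas\<close>.\<close>

lemma dos_real_distribution:
  fixes v :: "real^'d \<Rightarrow> real"
  assumes v: "\<And>x. \<bar>v x\<bar> \<le> V" and vm: "v \<in> borel_measurable borel"
  shows "real_distribution (dos v \<alpha>)"
proof -
  define X where "X = lebesgue_on (unit_cube :: (real^'d) set)"
  have uc: "unit_cube \<in> sets lebesgue" "emeasure lebesgue (unit_cube :: (real^'d) set) = 1"
    using emeasure_unit_cube by (auto simp: unit_cube_def)
  have pX: "prob_space X" unfolding X_def
    by (rule prob_spaceI) (simp add: emeasure_restrict_space uc)
  interpret X: prob_space X by fact
  have K: "specmeas v \<alpha> \<in> X \<rightarrow>\<^sub>M prob_algebra borel"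
    unfolding X_def by (intro measurable_restrict_space1 measurable_completion) (use specmeas_kernel[OF v vm] in simp)
  have XA: "X \<in> space (prob_algebra X)" using pX by (simp add: space_prob_algebra)
  have sb: "sets (X \<bind> specmeas v \<alpha>) = sets borel"
    using sets_bind'[OF XA K] .
  have "dos v \<alpha> = measure_of UNIV (sets borel) (emeasure (X \<bind> specmeas v \<alpha>))"
    unfolding dos_def X_def[symmetric]
  proof (rule measure_of_eq)
    show "(\<integral>\<^sup>+ x. emeasure (specmeas v \<alpha> x) a \<partial>X) = emeasure (X \<bind> specmeas v \<alpha>) a"
      if "a \<in> sigma_sets UNIV (sets borel)" for a
      using that emeasure_bind_prob_algebra[OF XA K, of a] sets.sigma_sets_eq[of "borel :: real measure"] by simp
  qed simp
  also have "\<dots> = X \<bind> specmeas v \<alpha>"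
    using measure_of_of_measure[of "X \<bind> specmeas v \<alpha>"] sb sets_eq_imp_space_eq[OF sb] by simp
  finally have eq: "dos v \<alpha> = X \<bind> specmeas v \<alpha>" .
  show ?thesis unfolding eq
    by (rule real_distributionI[OF prob_space_bind'[OF XA K] sb])
qed

section \<open>Parseval frames of unit vectors\<close>

lemma norm_sq_CS_tendsto_pointwise:
  assumes "\<And>j. sqint CS (s j)" "sqint CS w" "(\<lambda>j. norm_sq CS (\<lambda>n. s j n - w n)) \<longlonglongrightarrow> 0"
  shows "(\<lambda>j. s j i) \<longlonglongrightarrow> w i"
proof (rule LIM_zero_cancel, rule Lim_null_comparison)
  have "(cmod (s j i - w i))^2 \<le> norm_sq CS (\<lambda>n. s j n - w n)" for j
    using norm_sq_CS_sum_le[OF sqint_diff[OF assms(1) assms(2)], of "{i}" j] by simp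
  then show "\<forall>\<^sub>F j in sequentially. norm (s j i - w i) \<le> sqrt (norm_sq CS (\<lambda>n. s j n - w n))"
    by (intro always_eventually allI real_le_rsqrt)
  show "(\<lambda>j. sqrt (norm_sq CS (\<lambda>n. s j n - w n))) \<longlonglongrightarrow> 0"
    using tendsto_real_sqrt[OF assms(3)] by simp
qed

text \<open>The infinite matrix with entries \<open>ip M (\<phi> n) (e m)\<close> has orthonormal
  columns. Expanding \<open>c\<close> in the basis \<open>e\<close> shows that the coefficient
  sequence of \<open>c\<close> with respect to \<open>\<phi>\<close> is the corresponding series of
  columns.\<close>

lemma isometry_from_columns:
  assumes e: "complete_orthonormal M e" and \<phi>: "\<And>n. sqint M (\<phi> n)" and w: "orthonormal CS (\<lambda>m n. ip M (\<phi> n) (e m))" and c: "sqint M c"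
  shows "sqint CS (\<lambda>n. ip M (\<phi> n) c)" "norm_sq CS (\<lambda>n. ip M (\<phi> n) c) = norm_sq M c"
proof -
  have o: "orthonormal M e" using e by (simp add: complete_orthonormal_def)
  define a where "a m = ip M (e m) c" for m
  have a: "sqint CS a" unfolding a_def by (rule bessel(1)[OF o c])
  obtain \<psi> where \<psi>: "sqint CS \<psi>" "(\<lambda>N. norm_sq CS (\<lambda>n. (\<Sum>i\<in>{-int N..int N}. a i * ip M (\<phi> n) (e i)) - \<psi> n)) \<longlonglongrightarrow> 0"
    "norm_sq CS \<psi> = norm_sq CS a"
    using orthonormal_series[OF w a] by blast
  have s: "sqint CS (\<lambda>n. \<Sum>i\<in>J. a i * ip M (\<phi> n) (e i))" for J
    by (intro sqint_sum sqint_cmult orthonormal_sqint[OF w])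
  have "\<psi> n = ip M (\<phi> n) c" for n
  proof (rule LIMSEQ_unique)
    show "(\<lambda>N. \<Sum>i\<in>{-int N..int N}. a i * ip M (\<phi> n) (e i)) \<longlonglongrightarrow> \<psi> n"
      by (rule norm_sq_CS_tendsto_pointwise[OF s \<psi>(1,2)])
    have "(\<lambda>N. ip M (\<phi> n) (\<lambda>x. \<Sum>i\<in>{-int N..int N}. a i * e i x)) \<longlonglongrightarrow> ip M (\<phi> n) c"
      unfolding a_def by (rule tendsto_ip_right[OF \<phi> _ c complete_orthonormal_expansion(1)[OF e c]])
        (intro sqint_sum sqint_cmult orthonormal_sqint[OF o])
    moreover have "ip M (\<phi> n) (\<lambda>x. \<Sum>i\<in>J. a i * e i x) = (\<Sum>i\<in>J. a i * ip M (\<phi> n) (e i))" for J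
      using \<phi> o by (subst ip_sum_right) (auto simp: orthonormal_sqint sqint_cmult ip_scale_right)
    ultimately show "(\<lambda>N. \<Sum>i\<in>{-int N..int N}. a i * ip M (\<phi> n) (e i)) \<longlonglongrightarrow> ip M (\<phi> n) c" by simp
  qed
  then have "\<psi> = (\<lambda>n. ip M (\<phi> n) c)" by auto
  then show "sqint CS (\<lambda>n. ip M (\<phi> n) c)" "norm_sq CS (\<lambda>n. ip M (\<phi> n) c) = norm_sq M c"
    using \<psi> complete_orthonormal_expansion(2)[OF e c] by (auto simp: a_def[abs_def])
qed

text \<open>Apply the isometry to \<open>\<phi> n\<close> itself: its n-th coefficient alone gives
  \<open>(norm_sq M (\<phi> n))^2 \<le> norm_sq M (\<phi> n)\<close>.\<close>

lemma frame_norm_le: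
  assumes e: "complete_orthonormal M e" and \<phi>: "\<And>n. sqint M (\<phi> n)" and w: "orthonormal CS (\<lambda>m n. ip M (\<phi> n) (e m))"
  shows "norm_sq M (\<phi> n) \<le> 1"
proof -
  note iso = isometry_from_columns[OF e \<phi> w \<phi>[of n]]
  have "(norm_sq M (\<phi> n))^2 \<le> norm_sq M (\<phi> n)"
    using norm_sq_CS_sum_le[OF iso(1), of "{n}"] iso(2) by (simp add: ip_self)
  then have le: "norm_sq M (\<phi> n) * norm_sq M (\<phi> n) \<le> norm_sq M (\<phi> n)" by (simp add: power2_eq_square)
  show ?thesis
  proof (rule ccontr)
    assume "\<not> norm_sq M (\<phi> n) \<le> 1"
    then have "norm_sq M (\<phi> n) * 1 < norm_sq M (\<phi> n) * norm_sq M (\<phi> n)" by (intro mult_strict_left_mono) auto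
    then show False using le by simp
  qed
qed

text \<open>The orthonormal system \<open>w\<close> makes \<open>\<phi>\<close> a Parseval frame, and a unit vector of such a frame is orthogonal to all its other members.\<close>

lemma complete_orthonormal_from_frame:
  assumes e: "complete_orthonormal M e" and \<phi>: "\<And>n. sqint M (\<phi> n)" and w: "orthonormal CS (\<lambda>m n. ip M (\<phi> n) (e m))"
    and unit: "\<And>n. norm_sq M (\<phi> n) = 1"
  shows "complete_orthonormal M \<phi>"
  unfolding complete_orthonormal_def orthonormal_def
proof (intro conjI allI impI)
  note iso = isometry_from_columns[OF e \<phi> w]
  show "sqint M (\<phi> n)" for n by (rule \<phi>)
  show "ip M (\<phi> i) (\<phi> j) = (if i = j then 1 else 0)" for i j
  proof (cases "i = j")
    case True
    then show ?thesis by (simp add: ip_self unit)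
  next
    case False
    then show ?thesis
      using norm_sq_CS_sum_le[OF iso(1)[OF \<phi>[of j]], of "{i, j}"] iso(2)[OF \<phi>[of j]] by (simp add: ip_self unit)
  qed
  fix u assume u: "sqint M u" and "\<forall>i. ip M (\<phi> i) u = 0"
  then have "norm_sq CS (\<lambda>n. ip M (\<phi> n) u) = 0" by (simp add: norm_sq_def)
  then show "norm_sq M u = 0" using iso(2)[OF u] by simp
qed

section \<open>Diagonalised operators on the integers\<close>

lemma jacobi_Aop: "jacobi CS (\<lambda>n. n + 1) (\<lambda>n. n - 1) (\<lambda>_. \<i>) (\<lambda>_. 0) 0"
proof
  show "distr CS CS (\<lambda>n. n + 1) = CS"
    by (rule distr_bij_count_space) (auto intro!: bij_betwI[where g = "\<lambda>n. n - 1"])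
qed auto

lemma Aop_properties:
  assumes "sqint CS u"
  shows "sqint CS (Aop u)" "norm_sq CS (Aop u) \<le> 6 * norm_sq CS u" "sqint CS w \<Longrightarrow> ip CS (Aop u) w = ip CS u (Aop w)"
proof -
  interpret jacobi CS "\<lambda>n. n + 1" "\<lambda>n. n - 1" "\<lambda>_. \<i>" "\<lambda>_. 0" 0 by (rule jacobi_Aop)
  have J: "J = Aop" by (simp add: fun_eq_iff J_def Aop_def algebra_simps)
  show "sqint CS (Aop u)" "norm_sq CS (Aop u) \<le> 6 * norm_sq CS u" "sqint CS w \<Longrightarrow> ip CS (Aop u) w = ip CS u (Aop w)"
    using sqint_J[OF assms] norm_sq_J_le[OF assms] J_symmetric[OF assms] by (simp_all add: J)
qed

lemma sigma_finite_CS: "sigma_finite_measure CS"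
  by (rule sigma_finite_measure_count_space_countable) simp

abbreviation tint :: "real \<Rightarrow> real measure" where "tint T \<equiv> restrict_space lborel {0..T}"

lemma finite_tint: "finite_measure (tint T)"
  by (rule finite_measureI) (auto simp: emeasure_restrict_space emeasure_lborel_Icc_eq)

lemma measure_tint: "0 \<le> T \<Longrightarrow> measure (tint T) {0..T} = T"
  by (subst measure_restrict_space) auto

text \<open>\<open>W\<close> below is the unitary map from L2(M) onto l2 attached to the basis
  \<open>\<phi>\<close>, and it carries multiplication by \<open>E\<close> to \<open>L\<close>. In
  the application \<open>M\<close> is the circle of phases and \<open>L\<close> is H(x).\<close>

locale diagonalised =
  fixes M :: "'m measure" and \<phi> :: "int \<Rightarrow> 'm \<Rightarrow> complex" and E :: "'m \<Rightarrow> real" and B :: real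
    and L :: "(int \<Rightarrow> complex) \<Rightarrow> int \<Rightarrow> complex"
  assumes sf: "sigma_finite_measure M"
    and \<phi>: "complete_orthonormal M \<phi>" and E_measurable[measurable]: "E \<in> borel_measurable M" and E_le: "\<And>t. t \<in> space M \<Longrightarrow> \<bar>E t\<bar> \<le> B"
    and L_W: "\<And>c. sqint M c \<Longrightarrow> L (\<lambda>n. ip M (\<phi> n) c) = (\<lambda>n. ip M (\<phi> n) (\<lambda>t. of_real (E t) * c t))"
begin

definition W :: "('m \<Rightarrow> complex) \<Rightarrow> int \<Rightarrow> complex" where "W c n = ip M (\<phi> n) c"

definition ev :: "real \<Rightarrow> ('m \<Rightarrow> complex) \<Rightarrow> 'm \<Rightarrow> complex" where "ev s c t = cis (s * E t) * c t"

lemma orthonormal_\<phi>: "orthonormal M \<phi>" using \<phi> by (simp add: complete_orthonormal_def)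
lemma sqint_\<phi>: "sqint M (\<phi> n)" using orthonormal_\<phi> by (rule orthonormal_sqint)

lemma sqint_W: "sqint M c \<Longrightarrow> sqint CS (W c)"
  unfolding W_def[abs_def] by (rule bessel(1)[OF orthonormal_\<phi>])

lemma norm_sq_W: "sqint M c \<Longrightarrow> norm_sq CS (W c) = norm_sq M c"
  unfolding W_def[abs_def] by (rule complete_orthonormal_expansion(2)[OF \<phi>])

lemma ip_W: "sqint M c \<Longrightarrow> sqint M d \<Longrightarrow> ip CS (W c) (W d) = ip M c d"
  unfolding W_def[abs_def] by (rule parseval[OF \<phi>])

lemma W_surj: assumes "sqint CS \<psi>" obtains c where "sqint M c" "\<psi> = W c"
  using orthonormal_series[OF orthonormal_\<phi> assms] unfolding W_def[abs_def] by metis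

lemma W_diff: "sqint M c \<Longrightarrow> sqint M d \<Longrightarrow> W (\<lambda>t. c t - d t) = (\<lambda>n. W c n - W d n)"
  unfolding W_def by (simp add: ip_diff_right sqint_\<phi>)

lemma W_component: "sqint M d \<Longrightarrow> W d n = ip CS (W (\<phi> n)) (W d)"
  by (simp add: ip_W sqint_\<phi>) (simp add: W_def)

lemma cis_E_measurable[measurable]: "(\<lambda>t. cis (s * E t)) \<in> borel_measurable M"
  unfolding cis_conv_exp by measurable

lemma sqint_ev: "sqint M c \<Longrightarrow> sqint M (ev s c)"
  unfolding ev_def by (rule sqint_mult_bounded[where C = 1]) auto

lemma norm_sq_ev: "norm_sq M (ev s c) = norm_sq M c"
  by (simp add: norm_sq_def ev_def norm_mult)

lemma ip_ev: "ip M c (ev s d) = ip M (ev (- s) c) d"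
  unfolding ip_def ev_def by (simp add: cis_cnj mult_ac)

lemma sqint_E_pow: "sqint M c \<Longrightarrow> sqint M (\<lambda>t. of_real (E t) ^ k * c t)"
proof (rule sqint_mult_bounded[where C = "B ^ k"])
  show "cmod (of_real (E t) ^ k) \<le> B ^ k" if "t \<in> space M" for t
    using E_le[OF that] by (simp add: norm_power power_mono)
qed auto

lemma L_pow_W: "sqint M c \<Longrightarrow> (L ^^ k) (W c) = W (\<lambda>t. of_real (E t) ^ k * c t)"
proof (induction k)
  case (Suc k)
  then have "(L ^^ Suc k) (W c) = L (W (\<lambda>t. of_real (E t) ^ k * c t))" by simp
  also have "\<dots> = W (\<lambda>t. of_real (E t) * (of_real (E t) ^ k * c t))"
    unfolding W_def[abs_def] by (rule L_W[OF sqint_E_pow[OF Suc.prems]])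
  finally show ?case by (simp add: mult.assoc)
qed simp

text \<open>\<open>expop\<close> is a series in each coordinate separately. The n-th coordinate is
  an integral against \<open>\<phi> n\<close>, and the series is integrated termwise, dominated by
  the exponential series of |s| B.\<close>

lemma expop_W: assumes c: "sqint M c" shows "expop L (\<i> * of_real s) (W c) = W (ev s c)"
proof
  fix n
  note [measurable] = sqint_measurable[OF c] sqint_measurable[OF sqint_\<phi>]
  define h where "h t = cnj (\<phi> n t) * c t" for t
  have h: "integrable M h" unfolding h_def by (intro integrable_ip sqint_\<phi> c)
  note [measurable] = borel_measurable_integrable[OF h]
  define g where "g k t = ((\<i> * of_real s)^k / of_nat (fact k)) * (of_real (E t)^k * h t)" for k t
  have gm[measurable]: "g k \<in> borel_measurable M" for k unfolding g_def by measurable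
  have gn: "cmod (g k t) = \<bar>s * E t\<bar>^k / fact k * cmod (h t)" for k t
    by (simp add: g_def norm_mult norm_divide norm_power abs_mult power_mult_distrib)
  have gb: "cmod (g k t) \<le> (\<bar>s\<bar> * B)^k / fact k * cmod (h t)" if "t \<in> space M" for k t
    unfolding gn using E_le[OF that]
    by (intro mult_right_mono divide_right_mono power_mono) (auto simp: abs_mult intro!: mult_left_mono)
  have gi: "integrable M (g k)" for k
  proof (rule Bochner_Integration.integrable_bound[of M "\<lambda>t. (\<bar>s\<bar> * B)^k / fact k * cmod (h t)"])
    show "AE t in M. norm (g k t) \<le> norm ((\<bar>s\<bar> * B)^k / fact k * cmod (h t))"
      unfolding real_norm_def by (intro AE_I2 order_trans[OF gb abs_ge_self])
  qed (use h in auto)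
  have "(\<lambda>k. LINT t|M. g k t) sums (LINT t|M. (\<Sum>k. g k t))"
  proof (rule sums_integral[OF gi])
    show "AE t in M. summable (\<lambda>k. norm (g k t))"
    proof (rule AE_I2)
      fix t
      have "summable (\<lambda>k. inverse (fact k) * \<bar>s * E t\<bar>^k)" by (rule summable_exp)
      then have "summable (\<lambda>k. (inverse (fact k) * \<bar>s * E t\<bar>^k) * cmod (h t))" by (rule summable_mult2)
      then show "summable (\<lambda>k. norm (g k t))" by (simp add: gn divide_inverse mult_ac)
    qed
    have "summable (\<lambda>k. (inverse (fact k) * (\<bar>s\<bar> * B)^k) * (LINT t|M. cmod (h t)))" by (intro summable_mult2 summable_exp)
    then show "summable (\<lambda>k. LINT t|M. norm (g k t))"
    proof (rule summable_comparison_test'[of _ 0])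
      fix k
      have "(LINT t|M. norm (g k t)) \<le> (LINT t|M. (\<bar>s\<bar> * B)^k / fact k * cmod (h t))"
        by (rule integral_mono) (use gi h gb in auto)
      also have "\<dots> = (inverse (fact k) * (\<bar>s\<bar> * B)^k) * (LINT t|M. cmod (h t))" by (simp add: divide_inverse mult_ac)
      finally show "norm (LINT t|M. norm (g k t)) \<le> (inverse (fact k) * (\<bar>s\<bar> * B)^k) * (LINT t|M. cmod (h t))" by simp
    qed
  qed
  moreover have "(\<Sum>k. g k t) = cnj (\<phi> n t) * ev s c t" for t
  proof -
    have "(\<lambda>k. ((\<i> * of_real s * of_real (E t))^k /\<^sub>R fact k) * h t) sums (exp (\<i> * of_real s * of_real (E t)) * h t)"
      by (intro sums_mult2 exp_converges)
    then have "(\<lambda>k. g k t) sums (exp (\<i> * of_real s * of_real (E t)) * h t)"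
      by (simp add: g_def power_mult_distrib scaleR_conv_of_real divide_inverse mult_ac)
    then show ?thesis by (simp add: sums_iff h_def ev_def cis_conv_exp mult_ac)
  qed
  moreover have "(LINT t|M. g k t) = ((\<i> * of_real s)^k / of_nat (fact k)) * ((L ^^ k) (W c)) n" for k
  proof -
    have "g k t = ((\<i> * of_real s)^k / of_nat (fact k)) * (cnj (\<phi> n t) * (of_real (E t)^k * c t))" for t
      by (simp add: g_def h_def mult_ac)
    then show ?thesis unfolding L_pow_W[OF c] W_def ip_def by (simp only:) (rule Bochner_Integration.integral_mult_right_zero)
  qed
  ultimately show "expop L (\<i> * of_real s) (W c) n = W (ev s c) n"
    unfolding expop_def by (simp add: sums_iff W_def ip_def)
qed

definition hs :: "real \<Rightarrow> (int \<Rightarrow> complex) \<Rightarrow> int \<Rightarrow> complex" where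
  "hs s \<psi> = expop L (\<i> * of_real s) (Aop (expop L (- \<i> * of_real s) \<psi>))"

text \<open>Matrix element of the evolved current, with the evolution moved onto both vectors. In
  this form boundedness, hermitian symmetry and measurability in \<open>s\<close> are immediate from
  those of \<open>Aop\<close> and \<open>W\<close>.\<close>

definition am :: "real \<Rightarrow> ('m \<Rightarrow> complex) \<Rightarrow> ('m \<Rightarrow> complex) \<Rightarrow> complex" where
  "am s c d = ip CS (W (ev (- s) c)) (Aop (W (ev (- s) d)))"

lemma hs_W_ex: assumes c: "sqint M c"
  obtains d where "sqint M d" "Aop (W (ev (- s) c)) = W d" "hs s (W c) = W (ev s d)"
proof -
  obtain d where d: "sqint M d" "Aop (W (ev (- s) c)) = W d"
    using W_surj[OF Aop_properties(1)[OF sqint_W[OF sqint_ev[OF c]]]] by blast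
  have "expop L (- \<i> * of_real s) (W c) = W (ev (- s) c)" using expop_W[OF c, of "- s"] by simp
  then have "hs s (W c) = W (ev s d)" unfolding hs_def by (simp add: d expop_W del: mult_minus_left)
  with d that show ?thesis by blast
qed

lemma sqint_hs: "sqint M c \<Longrightarrow> sqint CS (hs s (W c))"
  using hs_W_ex[of c s] sqint_W sqint_ev by metis

lemma norm_sq_hs_le: assumes c: "sqint M c" shows "norm_sq CS (hs s (W c)) \<le> 6 * norm_sq M c"
proof -
  obtain d where d: "sqint M d" "Aop (W (ev (- s) c)) = W d" "hs s (W c) = W (ev s d)" using hs_W_ex[OF c] .
  have "norm_sq CS (hs s (W c)) = norm_sq CS (Aop (W (ev (- s) c)))" using d by (simp add: norm_sq_W sqint_ev norm_sq_ev)
  also have "\<dots> \<le> 6 * norm_sq CS (W (ev (- s) c))" by (intro Aop_properties sqint_W sqint_ev c)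
  finally show ?thesis using c by (simp add: norm_sq_W sqint_ev norm_sq_ev)
qed

lemma ip_hs: assumes c: "sqint M c" and c': "sqint M c'" shows "ip CS (W c') (hs s (W c)) = am s c' c"
proof -
  obtain d where d: "sqint M d" "Aop (W (ev (- s) c)) = W d" "hs s (W c) = W (ev s d)" using hs_W_ex[OF c] .
  have "ip CS (W c') (hs s (W c)) = ip M c' (ev s d)" using d c' by (simp add: ip_W sqint_ev)
  also have "\<dots> = ip CS (W (ev (- s) c')) (W d)" using d c' by (simp add: ip_W sqint_ev ip_ev)
  finally show ?thesis by (simp add: am_def d)
qed

lemma hs_component: "sqint M c \<Longrightarrow> hs s (W c) n = am s (\<phi> n) c"
  using hs_W_ex[of c s] W_component ip_hs[of c "\<phi> n" s] sqint_\<phi> sqint_ev by metis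

lemma am_symmetric: "sqint M c \<Longrightarrow> sqint M d \<Longrightarrow> am s c d = cnj (am s d c)"
  unfolding am_def by (subst Aop_properties(3)[symmetric]) (auto simp: ip_cnj sqint_W sqint_ev)

lemma am_bound: assumes "sqint M c" "sqint M d" shows "(cmod (am s c d))^2 \<le> 6 * norm_sq M c * norm_sq M d"
proof -
  have "(cmod (am s c d))^2 \<le> norm_sq CS (W (ev (- s) c)) * norm_sq CS (Aop (W (ev (- s) d)))"
    unfolding am_def by (intro cauchy_schwarz Aop_properties sqint_W sqint_ev assms)
  also have "\<dots> \<le> norm_sq M c * (6 * norm_sq M d)"
    using Aop_properties(2)[OF sqint_W[OF sqint_ev[OF assms(2)]], of "- s"] assms
    by (intro mult_mono) (auto simp: norm_sq_W sqint_ev norm_sq_ev)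
  finally show ?thesis by simp
qed

lemma W_ev_measurable[measurable]: assumes c: "sqint M c" shows "(\<lambda>s. W (ev s c) n) \<in> borel_measurable borel"
proof -
  interpret sigma_finite_measure M by (rule sf)
  note [measurable] = sqint_measurable[OF c] sqint_measurable[OF sqint_\<phi>]
  show ?thesis unfolding W_def ip_def ev_def cis_conv_exp by measurable
qed

lemma am_measurable[measurable]: assumes c: "sqint M c" and d: "sqint M d" shows "(\<lambda>s. am s c d) \<in> borel_measurable borel"
proof -
  interpret sigma_finite_measure CS by (rule sigma_finite_CS)
  note [measurable] = W_ev_measurable[OF c] W_ev_measurable[OF d]
  have 1: "(\<lambda>s. W (ev (- s) c) n) \<in> borel_measurable borel" "(\<lambda>s. W (ev (- s) d) n) \<in> borel_measurable borel" for n
    using measurable_compose[OF borel_measurable_uminus[OF measurable_ident] W_ev_measurable[OF c]]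
      measurable_compose[OF borel_measurable_uminus[OF measurable_ident] W_ev_measurable[OF d]] by simp_all
  note [measurable] = 1
  have "(\<lambda>(n, s). cnj (W (ev (- s) c) n) * Aop (W (ev (- s) d)) n) \<in> borel_measurable (CS \<Otimes>\<^sub>M borel)"
    unfolding Aop_def by (rule measurable_pair_measure_countable1) auto
  from measurable_pair_swap[OF this]
  have "(\<lambda>(s, n). cnj (W (ev (- s) c) n) * Aop (W (ev (- s) d)) n) \<in> borel_measurable (borel \<Otimes>\<^sub>M CS)"
    by simp
  then show ?thesis unfolding am_def ip_def by (rule borel_measurable_lebesgue_integral)
qed

lemma am_integrable: "sqint M c \<Longrightarrow> sqint M d \<Longrightarrow> integrable (tint T) (\<lambda>s. am s c d)"
proof -
  assume cd: "sqint M c" "sqint M d"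
  interpret finite_measure "tint T" by (rule finite_tint)
  have "(\<lambda>s. am s c d) \<in> borel_measurable (tint T)"
    using am_measurable[OF cd] by (intro measurable_restrict_space1) simp
  moreover have "cmod (am s c d) \<le> sqrt (6 * norm_sq M c * norm_sq M d)" for s
    using am_bound[OF cd] by (rule real_le_rsqrt)
  ultimately show ?thesis by (intro integrable_const_bound[of _ "sqrt (6 * norm_sq M c * norm_sq M d)"]) auto
qed

definition tavg :: "real \<Rightarrow> (int \<Rightarrow> complex) \<Rightarrow> int \<Rightarrow> complex" where
  "tavg T \<psi> n = complex_of_real (1 / T) * integral {0..T} (\<lambda>s. hs s \<psi> n)"

lemma tavg_W: assumes c: "sqint M c"
  shows "tavg T (W c) n = complex_of_real (1 / T) * (LINT s|tint T. am s (\<phi> n) c)"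
proof -
  have "set_integrable lborel {0..T} (\<lambda>s. am s (\<phi> n) c)"
    using am_integrable[OF sqint_\<phi> c, of T n] by (simp add: set_integrable_def integrable_restrict_space)
  from set_borel_integral_eq_integral(2)[OF this]
  show ?thesis unfolding tavg_def hs_component[OF c]
    by (simp add: integral_restrict_space set_lebesgue_integral_def)
qed

text \<open>Cauchy--Schwarz in time for each coordinate, then the bound on
  \<open>norm_sq CS (hs s (W c))\<close>, uniform in \<open>s\<close>, under the time
  integral.\<close>

lemma sqint_tavg: assumes c: "sqint M c" and T: "T > 0" shows "sqint CS (tavg T (W c))"
proof (rule sqint_CS_bounded_sums(1))
  fix J :: "int set" assume J: "finite J"
  interpret finite_measure "tint T" by (rule finite_tint)
  have sq: "sqint (tint T) (\<lambda>s. am s (\<phi> n) c)" for n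
  proof (rule sqint_bounded[OF finite_tint])
    show "(\<lambda>s. am s (\<phi> n) c) \<in> borel_measurable (tint T)"
      using am_measurable[OF sqint_\<phi> c] by (intro measurable_restrict_space1) simp
    show "cmod (am s (\<phi> n) c) \<le> sqrt (6 * norm_sq M (\<phi> n) * norm_sq M c)" for s
      using am_bound[OF sqint_\<phi> c] by (rule real_le_rsqrt)
  qed
  have "(\<Sum>n\<in>J. (cmod (tavg T (W c) n))^2) \<le> (\<Sum>n\<in>J. (1 / T) * norm_sq (tint T) (\<lambda>s. am s (\<phi> n) c))"
  proof (rule sum_mono)
    fix n
    have "(cmod (tavg T (W c) n))^2 = (1 / T)^2 * (cmod (ip (tint T) (\<lambda>s. 1) (\<lambda>s. am s (\<phi> n) c)))^2"
      by (simp add: tavg_W[OF c] ip_def norm_mult norm_divide power_mult_distrib power_divide)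
    also have "\<dots> \<le> (1 / T)^2 * (norm_sq (tint T) (\<lambda>s. 1) * norm_sq (tint T) (\<lambda>s. am s (\<phi> n) c))"
      by (intro mult_left_mono cauchy_schwarz sqint_const finite_tint sq) auto
    also have "norm_sq (tint T) (\<lambda>s. 1) = T" using T by (simp add: norm_sq_def measure_tint space_restrict_space)
    finally show "(cmod (tavg T (W c) n))^2 \<le> (1 / T) * norm_sq (tint T) (\<lambda>s. am s (\<phi> n) c)"
      using T by (simp add: power2_eq_square)
  qed
  also have "\<dots> = (1 / T) * (LINT s|tint T. (\<Sum>n\<in>J. (cmod (am s (\<phi> n) c))^2))"
    using sqint_integrable[OF sq] by (simp add: norm_sq_def sum_distrib_left Bochner_Integration.integral_sum)
  also have "\<dots> \<le> (1 / T) * (LINT s|tint T. 6 * norm_sq M c)"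
  proof (intro mult_left_mono integral_mono)
    show "integrable (tint T) (\<lambda>s. \<Sum>n\<in>J. (cmod (am s (\<phi> n) c))^2)" using sqint_integrable[OF sq] by auto
    show "(\<Sum>n\<in>J. (cmod (am s (\<phi> n) c))^2) \<le> 6 * norm_sq M c" for s
      using norm_sq_CS_sum_le[OF sqint_hs[OF c] J, of s] norm_sq_hs_le[OF c, of s] by (simp add: hs_component[OF c])
  qed (use T in auto)
  also have "\<dots> = 6 * norm_sq M c" using T by (simp add: measure_tint space_restrict_space)
  finally show "(\<Sum>n\<in>J. (cmod (tavg T (W c) n))^2) \<le> 6 * norm_sq M c" .
qed

text \<open>\<open>tavg\<close> is defined coordinate by coordinate; Fubini on integers times [0, T]
  takes the inner product inside the time integral.\<close>

lemma ip_tavg: assumes c: "sqint M c" and c': "sqint M c'" and T: "T > 0"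
  shows "ip CS (W c') (tavg T (W c)) = complex_of_real (1 / T) * (LINT s|tint T. am s c' c)"
proof -
  interpret N: finite_measure "tint T" by (rule finite_tint)
  interpret C: sigma_finite_measure CS by (rule sigma_finite_CS)
  interpret P: pair_sigma_finite CS "tint T" ..
  let ?h = "\<lambda>(n, s). am s (\<phi> n) c"
  let ?w = "\<lambda>(n, s). W c' n"
  have amm: "(\<lambda>s. am s (\<phi> n) c) \<in> borel_measurable (tint T)" for n
    using am_measurable[OF sqint_\<phi> c] by (intro measurable_restrict_space1) simp
  have hm: "?h \<in> borel_measurable (CS \<Otimes>\<^sub>M tint T)"
    by (rule measurable_pair_measure_countable1) (use amm in auto)
  have wm: "?w \<in> borel_measurable (CS \<Otimes>\<^sub>M tint T)"
    by (rule measurable_pair_measure_countable1) auto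
  have "sqint (CS \<Otimes>\<^sub>M tint T) ?h"
    unfolding sqint_def
  proof (intro conjI hm integrableI_bounded)
    show "(\<lambda>z. (cmod (?h z))^2) \<in> borel_measurable (CS \<Otimes>\<^sub>M tint T)" using hm by measurable
    have "(\<integral>\<^sup>+z. ennreal (norm ((cmod (?h z))^2)) \<partial>(CS \<Otimes>\<^sub>M tint T)) = (\<integral>\<^sup>+s. \<integral>\<^sup>+n. ennreal ((cmod (am s (\<phi> n) c))^2) \<partial>CS \<partial>tint T)"
      using hm by (subst P.nn_integral_snd[symmetric]) auto
    also have "\<dots> = (\<integral>\<^sup>+s. ennreal (norm_sq CS (hs s (W c))) \<partial>tint T)"
      unfolding norm_sq_def
      by (intro nn_integral_cong, subst nn_integral_eq_integral)
         (use sqint_integrable[OF sqint_hs[OF c]] in \<open>auto simp: hs_component[OF c]\<close>)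
    also have "\<dots> \<le> (\<integral>\<^sup>+s. ennreal (6 * norm_sq M c) \<partial>tint T)"
      by (intro nn_integral_mono ennreal_leI norm_sq_hs_le c)
    also have "\<dots> < \<infinity>" using N.emeasure_finite by (simp add: ennreal_mult_eq_top_iff less_top[symmetric])
    finally show "(\<integral>\<^sup>+z. ennreal (norm ((cmod (?h z))^2)) \<partial>(CS \<Otimes>\<^sub>M tint T)) < \<infinity>" .
  qed
  moreover have "sqint (CS \<Otimes>\<^sub>M tint T) ?w"
    unfolding sqint_def
  proof (intro conjI wm integrableI_bounded)
    show "(\<lambda>z. (cmod (?w z))^2) \<in> borel_measurable (CS \<Otimes>\<^sub>M tint T)" using wm by measurable
    have "(\<integral>\<^sup>+z. ennreal (norm ((cmod (?w z))^2)) \<partial>(CS \<Otimes>\<^sub>M tint T)) = (\<integral>\<^sup>+s. \<integral>\<^sup>+n. ennreal ((cmod (W c' n))^2) \<partial>CS \<partial>tint T)"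
      using wm by (subst P.nn_integral_snd[symmetric]) auto
    also have "\<dots> = (\<integral>\<^sup>+s. ennreal (norm_sq CS (W c')) \<partial>tint T)"
      unfolding norm_sq_def
      by (intro nn_integral_cong nn_integral_eq_integral) (use sqint_integrable[OF sqint_W[OF c']] in auto)
    also have "\<dots> < \<infinity>" using N.emeasure_finite by (simp add: ennreal_mult_eq_top_iff less_top[symmetric])
    finally show "(\<integral>\<^sup>+z. ennreal (norm ((cmod (?w z))^2)) \<partial>(CS \<Otimes>\<^sub>M tint T)) < \<infinity>" .
  qed
  ultimately have int: "integrable (CS \<Otimes>\<^sub>M tint T) (\<lambda>z. cnj (?w z) * ?h z)" by (intro integrable_ip)
  have "(LINT n|CS. LINT s|tint T. cnj (W c' n) * am s (\<phi> n) c) = (LINT s|tint T. LINT n|CS. cnj (W c' n) * am s (\<phi> n) c)"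
    using P.Fubini_integral[of "\<lambda>n s. cnj (W c' n) * am s (\<phi> n) c"] int by (simp add: case_prod_beta')
  also have "\<dots> = (LINT s|tint T. am s c' c)"
    by (rule Bochner_Integration.integral_cong) (auto simp: ip_hs[OF c c', symmetric] ip_def hs_component[OF c])
  finally show ?thesis
    unfolding ip_def[of CS "W c'"] tavg_W[OF c] by (simp add: mult.left_commute)
qed

lemma time_average_limit:
  assumes T: "filterlim T at_top sequentially"
    and Q: "\<And>\<psi>. sqint CS \<psi> \<Longrightarrow> sqint CS (Q \<psi>)" "\<And>\<psi>. sqint CS \<psi> \<Longrightarrow> (\<lambda>k. norm_sq CS (\<lambda>n. tavg (T k) \<psi> n - Q \<psi> n)) \<longlonglongrightarrow> 0"
    and c: "sqint M c" and c': "sqint M c'"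
  shows "(\<lambda>k. complex_of_real (1 / T k) * (LINT s|tint (T k). am s c' c)) \<longlonglongrightarrow> ip CS (W c') (Q (W c))"
proof -
  have "\<forall>\<^sub>F k in sequentially. T k > 0" using T by (simp add: filterlim_at_top_dense)
  \<comment> \<open>Finitely many \<open>T k\<close> may fail to be positive; the sequence is
    shifted past them.\<close>
  then obtain k0 where k0: "\<And>k. k \<ge> k0 \<Longrightarrow> T k > 0" by (auto simp: eventually_sequentially)
  have "(\<lambda>k. norm_sq CS (\<lambda>n. tavg (T (k + k0)) (W c) n - Q (W c) n)) \<longlonglongrightarrow> 0"
    using LIMSEQ_ignore_initial_segment[OF Q(2)[OF sqint_W[OF c]]] .
  then have "(\<lambda>k. ip CS (W c') (tavg (T (k + k0)) (W c))) \<longlonglongrightarrow> ip CS (W c') (Q (W c))"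
    by (rule tendsto_ip_right[rotated 3]) (auto intro!: sqint_W c c' Q sqint_tavg k0)
  then have "(\<lambda>k. complex_of_real (1 / T (k + k0)) * (LINT s|tint (T (k + k0)). am s c' c)) \<longlonglongrightarrow> ip CS (W c') (Q (W c))"
    using k0 c c' by (simp add: ip_tavg)
  then show ?thesis by (rule LIMSEQ_offset)
qed

lemma W_unique:
  assumes e: "complete_orthonormal M e" and \<psi>: "sqint CS \<psi>" and d: "sqint M d"
    and eq: "\<And>m. ip CS (W (e m)) \<psi> = ip M (e m) d"
  shows "\<psi> = W d"
proof -
  have o: "orthonormal M e" using e by (simp add: complete_orthonormal_def)
  obtain c where c: "sqint M c" "\<psi> = W c" using W_surj[OF \<psi>] by blast
  have "ip M (e m) (\<lambda>t. c t - d t) = 0" for m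
    using eq[of m] c d by (simp add: ip_W orthonormal_sqint[OF o] ip_diff_right)
  then have "norm_sq M (\<lambda>t. c t - d t) = 0" using e c d sqint_diff unfolding complete_orthonormal_def by blast
  then have "norm_sq CS (\<lambda>n. W c n - W d n) = 0" using norm_sq_W[OF sqint_diff[OF c(1) d]] by (simp add: W_diff c d)
  then have "W c n - W d n = 0" for n using norm_sq_CS_zeroD[OF sqint_diff[OF sqint_W sqint_W]] c d by blast
  then show ?thesis using c by auto
qed

text \<open>Only matrix elements between basis vectors are known, and neither linearity nor
  boundedness of \<open>Q\<close> is at hand. The matrix elements settle \<open>Q\<close> on each
  \<open>W (e l)\<close>. For general \<open>c\<close>, hermitian symmetry of \<open>am\<close>
  moves \<open>Q\<close> from \<open>W c\<close> onto the basis vector it is tested against.\<close>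

theorem Q_diagonal:
  assumes T: "filterlim T at_top sequentially"
    and Q: "\<And>\<psi>. sqint CS \<psi> \<Longrightarrow> sqint CS (Q \<psi>)" "\<And>\<psi>. sqint CS \<psi> \<Longrightarrow> (\<lambda>k. norm_sq CS (\<lambda>n. tavg (T k) \<psi> n - Q \<psi> n)) \<longlonglongrightarrow> 0"
    and e: "complete_orthonormal M e" and gm: "g \<in> borel_measurable M" and gb: "\<And>t. t \<in> space M \<Longrightarrow> \<bar>g t\<bar> \<le> (G::real)"
    and lim: "\<And>m l. (\<lambda>k. complex_of_real (1 / T k) * (LINT s|tint (T k). am s (e m) (e l))) \<longlonglongrightarrow> ip M (e m) (\<lambda>t. of_real (g t) * e l t)"
    and c: "sqint M c"
  shows "Q (W c) = W (\<lambda>t. of_real (g t) * c t)"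
proof -
  have o: "orthonormal M e" using e by (simp add: complete_orthonormal_def)
  note se = orthonormal_sqint[OF o]
  have sg: "sqint M (\<lambda>t. of_real (g t) * c t)" if "sqint M c" for c
    by (rule sqint_mult_bounded[OF that, where C = G]) (use gm gb in auto)
  have 1: "Q (W (e l)) = W (\<lambda>t. of_real (g t) * e l t)" for l
  proof (rule W_unique[OF e _ sg[OF se]])
    show "sqint CS (Q (W (e l)))" by (intro Q sqint_W se)
    show "ip CS (W (e m)) (Q (W (e l))) = ip M (e m) (\<lambda>t. of_real (g t) * e l t)" for m
      by (rule LIMSEQ_unique[OF time_average_limit[OF T Q se se] lim])
  qed
  show ?thesis
  proof (rule W_unique[OF e _ sg[OF c]])
    show "sqint CS (Q (W c))" by (intro Q sqint_W c)
    fix m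
    have "(\<lambda>k. complex_of_real (1 / T k) * (LINT s|tint (T k). am s c (e m))) \<longlonglongrightarrow> ip CS (W c) (Q (W (e m)))"
      by (rule time_average_limit[OF T Q se c])
    from tendsto_cnj[OF this]
    have "(\<lambda>k. complex_of_real (1 / T k) * (LINT s|tint (T k). am s (e m) c)) \<longlonglongrightarrow> cnj (ip CS (W c) (Q (W (e m))))"
      unfolding am_symmetric[OF se c] by (simp add: complex_cnj_mult del: of_real_divide)
    from LIMSEQ_unique[OF time_average_limit[OF T Q c se] this]
    have "ip CS (W (e m)) (Q (W c)) = cnj (ip CS (W c) (W (\<lambda>t. of_real (g t) * e m t)))" by (simp add: 1)
    also have "\<dots> = ip M (\<lambda>t. of_real (g t) * e m t) c" by (simp add: ip_W c sg se ip_cnj)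
    also have "\<dots> = ip M (e m) (\<lambda>t. of_real (g t) * c t)" by (simp add: ip_def mult_ac)
    finally show "ip CS (W (e m)) (Q (W c)) = ip M (e m) (\<lambda>t. of_real (g t) * c t)" .
  qed
qed

lemma l2_iff: "l2 \<psi> \<longleftrightarrow> sqint CS \<psi>"
  by (simp add: l2_def sqint_CS_iff)

lemma l2norm_eq: "sqint CS \<psi> \<Longrightarrow> l2norm \<psi> = sqrt (norm_sq CS \<psi>)"
  by (simp add: l2norm_def norm_sq_CS)

text \<open>As \<open>W\<close> is unitary, this is the norm of a multiplication operator, tested
  from below on the normalised indicator of the set where |g| exceeds \<open>z\<close>. Stating it
  through upper bounds \<open>z\<close> postpones \<open>esssup\<close> and its extended real values
  to the end.\<close>

theorem
  assumes fin: "finite_measure M" and gm: "g \<in> borel_measurable M" and gb: "\<And>t. t \<in> space M \<Longrightarrow> \<bar>g t\<bar> \<le> (G::real)"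
    and Q: "\<And>c. sqint M c \<Longrightarrow> Q (W c) = W (\<lambda>t. of_real (g t) * c t)"
  shows opnorm_le_iff: "z \<ge> 0 \<Longrightarrow> opnorm Q \<le> z \<longleftrightarrow> (AE t in M. \<bar>g t\<bar> \<le> z)"
    and opnorm_nonneg: "0 \<le> opnorm Q"
proof -
  interpret finite_measure M by fact
  note [measurable] = gm
  have sg: "sqint M (\<lambda>t. of_real (g t) * c t)" if "sqint M c" for c
    by (rule sqint_mult_bounded[OF that, where C = G]) (use gm gb in auto)
  have bnd: "norm_sq M (\<lambda>t. of_real (g t) * c t) \<le> y^2 * norm_sq M c" if c: "sqint M c" and y: "AE t in M. \<bar>g t\<bar> \<le> y" for c y
  proof -
    have "norm_sq M (\<lambda>t. of_real (g t) * c t) \<le> (LINT t|M. y^2 * (cmod (c t))^2)"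
      unfolding norm_sq_def
    proof (rule integral_mono_AE)
      show "AE t in M. (cmod (of_real (g t) * c t))^2 \<le> y^2 * (cmod (c t))^2"
        using y
      proof eventually_elim
        fix t assume "\<bar>g t\<bar> \<le> y"
        then have "\<bar>g t\<bar>^2 \<le> y^2" by (intro power_mono) auto
        then show "(cmod (of_real (g t) * c t))^2 \<le> y^2 * (cmod (c t))^2"
          by (simp add: norm_mult power_mult_distrib mult_right_mono)
      qed
    qed (use sqint_integrable[OF c] sqint_integrable[OF sg[OF c]] in auto)
    then show ?thesis by (simp add: norm_sq_def)
  qed
  define X where "X = {l2norm (Q \<psi>) | \<psi>. l2 \<psi> \<and> l2norm \<psi> \<le> 1}"
  have X: "X = {sqrt (norm_sq M (\<lambda>t. of_real (g t) * c t)) | c. sqint M c \<and> norm_sq M c \<le> 1}"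
  proof -
    have *: "l2norm (Q (W c)) = sqrt (norm_sq M (\<lambda>t. of_real (g t) * c t))" "l2 (W c)" "l2norm (W c) = sqrt (norm_sq M c)" if "sqint M c" for c
      using that by (simp_all add: Q l2norm_eq l2_iff sqint_W norm_sq_W sg)
    show ?thesis unfolding X_def
    proof (intro set_eqI iffI)
      fix r assume "r \<in> {l2norm (Q \<psi>) | \<psi>. l2 \<psi> \<and> l2norm \<psi> \<le> 1}"
      then obtain \<psi> where \<psi>: "r = l2norm (Q \<psi>)" "l2 \<psi>" "l2norm \<psi> \<le> 1" by blast
      obtain c where "sqint M c" "\<psi> = W c" using W_surj \<psi>(2) l2_iff by blast
      then show "r \<in> {sqrt (norm_sq M (\<lambda>t. of_real (g t) * c t)) | c. sqint M c \<and> norm_sq M c \<le> 1}" using \<psi> * by auto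
    next
      fix r assume "r \<in> {sqrt (norm_sq M (\<lambda>t. of_real (g t) * c t)) | c. sqint M c \<and> norm_sq M c \<le> 1}"
      then obtain c where "r = sqrt (norm_sq M (\<lambda>t. of_real (g t) * c t))" "sqint M c" "norm_sq M c \<le> 1" by blast
      then show "r \<in> {l2norm (Q \<psi>) | \<psi>. l2 \<psi> \<and> l2norm \<psi> \<le> 1}" using *[of c] by (auto intro!: exI[of _ "W c"])
    qed
  qed
  have ub: "x \<le> y" if "x \<in> X" "AE t in M. \<bar>g t\<bar> \<le> y" "y \<ge> 0" for x y
  proof -
    have "\<exists>c. x = sqrt (norm_sq M (\<lambda>t. of_real (g t) * c t)) \<and> sqint M c \<and> norm_sq M c \<le> 1" using that(1) unfolding X by simp
    then obtain c where c: "x = sqrt (norm_sq M (\<lambda>t. of_real (g t) * c t))" "sqint M c" "norm_sq M c \<le> 1" by blast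
    have "norm_sq M (\<lambda>t. of_real (g t) * c t) \<le> y^2 * 1" using bnd[OF c(2) that(2)] c(3) by (meson mult_left_mono order_trans zero_le_power2)
    then show ?thesis using c(1) that(3) by (simp add: real_le_lsqrt)
  qed
  have ne: "X \<noteq> {}" unfolding X by (auto intro!: exI[of _ "\<lambda>_. 0"] simp: norm_sq_def)
  have bdd: "bdd_above X"
    using ub[of _ "\<bar>G\<bar>"] gb by (intro bdd_aboveI[of _ "\<bar>G\<bar>"]) (auto intro: order_trans[OF _ abs_ge_self])
  have op: "opnorm Q = Sup X" by (simp add: opnorm_def X_def)
  have "sqrt (norm_sq M (\<lambda>t. of_real (g t) * 0)) \<in> X" unfolding X by (auto intro!: exI[of _ "\<lambda>_. 0"] simp: norm_sq_def)
  from cSup_upper[OF this bdd] show "0 \<le> opnorm Q" by (simp add: op norm_sq_def)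
  assume z: "z \<ge> 0"
  show "opnorm Q \<le> z \<longleftrightarrow> (AE t in M. \<bar>g t\<bar> \<le> z)"
  proof
    assume le: "opnorm Q \<le> z"
    show "AE t in M. \<bar>g t\<bar> \<le> z"
    proof (rule ccontr)
      assume nAE: "\<not> (AE t in M. \<bar>g t\<bar> \<le> z)"
      define A where "A = {t \<in> space M. \<not> \<bar>g t\<bar> \<le> z}"
      have A[measurable]: "A \<in> sets M" unfolding A_def by measurable
      have "measure M A \<noteq> 0" using nAE AE_iff_measurable[OF A, of "\<lambda>t. \<bar>g t\<bar> \<le> z"] by (auto simp: A_def emeasure_eq_measure)
      then have mA: "measure M A > 0" by (simp add: zero_less_measure_iff)
      define c where "c t = complex_of_real (indicator A t / sqrt (measure M A))" for t
      have cm[measurable]: "c \<in> borel_measurable M" unfolding c_def by measurable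
      have cn: "(cmod (c t))^2 = indicator A t / measure M A" for t
        using mA by (simp add: c_def indicator_def norm_divide power_divide)
      have c: "sqint M c" unfolding sqint_def cn by (simp add: emeasure_eq_measure)
      have n1: "norm_sq M c = 1" unfolding norm_sq_def cn using mA by simp
      have "norm_sq M (\<lambda>t. of_real (g t) * c t) > z^2"
      proof -
        have "0 < (LINT t|M. (cmod (of_real (g t) * c t))^2 - z^2 * (cmod (c t))^2)"
        proof -
          have int: "integrable M (\<lambda>t. (cmod (of_real (g t) * c t))^2 - z^2 * (cmod (c t))^2)"
            using sqint_integrable[OF c] sqint_integrable[OF sg[OF c]] by auto
          have nonneg: "0 \<le> (cmod (of_real (g t) * c t))^2 - z^2 * (cmod (c t))^2" if "t \<in> space M" for t
          proof (cases "t \<in> A")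
            case True
            then have "z^2 \<le> \<bar>g t\<bar>^2" using z by (intro power_mono) (auto simp: A_def)
            then show ?thesis by (simp add: norm_mult power_mult_distrib mult_right_mono)
          qed (simp add: c_def)
          have "(LINT t|M. (cmod (of_real (g t) * c t))^2 - z^2 * (cmod (c t))^2) \<noteq> 0"
          proof
            assume "(LINT t|M. (cmod (of_real (g t) * c t))^2 - z^2 * (cmod (c t))^2) = 0"
            then have "AE t in M. (cmod (of_real (g t) * c t))^2 - z^2 * (cmod (c t))^2 = 0"
              using integral_nonneg_eq_0_iff_AE[OF int] nonneg by auto
            then have "AE t in M. \<bar>g t\<bar> \<le> z"
            proof (rule AE_mp, intro AE_I2 impI)
              fix t assume t: "t \<in> space M" and eq: "(cmod (of_real (g t) * c t))^2 - z^2 * (cmod (c t))^2 = 0"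
              show "\<bar>g t\<bar> \<le> z"
              proof (rule ccontr)
                assume n: "\<not> \<bar>g t\<bar> \<le> z"
                then have "t \<in> A" using t by (simp add: A_def)
                then have "(cmod (c t))^2 > 0" using mA by (simp add: cn)
                moreover have "(\<bar>g t\<bar>^2 - z^2) * (cmod (c t))^2 = 0" using eq by (simp add: norm_mult power_mult_distrib algebra_simps)
                ultimately have "\<bar>g t\<bar>^2 = z^2" by simp
                moreover have "z^2 < \<bar>g t\<bar>^2" using n z by (intro power_strict_mono) auto
                ultimately show False by linarith
              qed
            qed
            then show False using nAE by simp
          qed
          moreover have "0 \<le> (LINT t|M. (cmod (of_real (g t) * c t))^2 - z^2 * (cmod (c t))^2)"
            by (rule integral_nonneg_AE) (use nonneg in auto)
          ultimately show ?thesis by linarith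
        qed
        also have "\<dots> = norm_sq M (\<lambda>t. of_real (g t) * c t) - z^2 * norm_sq M c"
          unfolding norm_sq_def using sqint_integrable[OF c] sqint_integrable[OF sg[OF c]] by simp
        finally show ?thesis by (simp add: n1)
      qed
      then have "sqrt (norm_sq M (\<lambda>t. of_real (g t) * c t)) > z" using z by (simp add: real_less_rsqrt)
      moreover have "sqrt (norm_sq M (\<lambda>t. of_real (g t) * c t)) \<in> X" unfolding X using c n1 by auto
      then have "sqrt (norm_sq M (\<lambda>t. of_real (g t) * c t)) \<le> Sup X" using bdd by (rule cSup_upper)
      ultimately show False using le op by linarith
    qed
  next
    assume "AE t in M. \<bar>g t\<bar> \<le> z"
    then show "opnorm Q \<le> z" unfolding op using ub z by (intro cSup_least ne) auto
  qed
qed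

end

section \<open>The torus\<close>

text \<open>Half-open, so that every class modulo the lattice has exactly one representative and
  translations become bijections of \<open>cube\<close>. The closed \<open>unit_cube\<close> differs
  from it by a null set.\<close>

definition cube :: "'a::euclidean_space set" where
  "cube = {x. \<forall>b\<in>Basis. 0 \<le> x \<bullet> b \<and> x \<bullet> b < 1}"

text \<open>Over an arbitrary Euclidean space, so that it provides the d-dimensional torus and the
  circle of phases at once.\<close>

definition torus :: "'a::euclidean_space measure" where
  "torus = restrict_space lborel cube"

definition frac_vec :: "'a::euclidean_space \<Rightarrow> 'a" where
  "frac_vec x = (\<Sum>b\<in>Basis. frac (x \<bullet> b) *\<^sub>R b)"

definition int_lattice :: "'a::euclidean_space set" where
  "int_lattice = {k. \<forall>b\<in>Basis. k \<bullet> b \<in> \<int>}"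

definition translate :: "'a::euclidean_space \<Rightarrow> 'a \<Rightarrow> 'a" where
  "translate a x = frac_vec (x + a)"

definition character :: "'a::euclidean_space \<Rightarrow> 'a \<Rightarrow> complex" where
  "character k x = cis (2 * pi * (k \<bullet> x))"

lemma cube_eq_Inter: "cube = (\<Inter>b\<in>Basis. (\<lambda>x::'a::euclidean_space. x \<bullet> b) -` {0..<1})"
  by (auto simp: cube_def)

lemma cube_borel[measurable]: "cube \<in> sets borel"
  unfolding cube_eq_Inter
  by (intro sets.finite_INT) (auto intro!: measurable_sets_borel[of _ borel])

lemma space_torus[simp]: "space torus = cube"
  by (simp add: torus_def space_restrict_space)

lemma sets_torus: "sets torus = sets (restrict_space borel cube)"
  by (simp add: torus_def sets_restrict_space)

lemma measurable_torus_borel: "f \<in> borel \<rightarrow>\<^sub>M N \<Longrightarrow> f \<in> torus \<rightarrow>\<^sub>M N"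
  unfolding torus_def by (intro measurable_restrict_space1) simp

lemma emeasure_torus: "A \<in> sets borel \<Longrightarrow> A \<subseteq> cube \<Longrightarrow> emeasure torus A = emeasure lborel A"
  unfolding torus_def by (rule emeasure_restrict_space) auto

lemma box_subset_cube: "box 0 One \<subseteq> cube" and cube_subset_cbox: "cube \<subseteq> cbox 0 One"
  by (auto simp: cube_def box_def cbox_def less_imp_le)

lemma emeasure_cube: "emeasure lborel (cube :: 'a::euclidean_space set) = 1"
proof (rule antisym)
  show "emeasure lborel (cube::'a set) \<le> 1"
  proof -
    have "emeasure lborel (cube::'a set) \<le> emeasure lborel (cbox (0::'a) One)"
      by (rule emeasure_mono[OF cube_subset_cbox]) simp
    also have "\<dots> = 1" by (subst emeasure_lborel_cbox) (auto simp: inner_sum_left inner_Basis intro!: prod.neutral)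
    finally show ?thesis .
  qed
  show "1 \<le> emeasure lborel (cube::'a set)"
  proof -
    have "1 = emeasure lborel (box (0::'a) One)" by (subst emeasure_lborel_box) (auto simp: inner_sum_left inner_Basis intro!: prod.neutral)
    also have "\<dots> \<le> emeasure lborel (cube::'a set)" by (rule emeasure_mono[OF box_subset_cube]) simp
    finally show ?thesis .
  qed
qed

lemma prob_space_torus: "prob_space torus"
  by (rule prob_spaceI) (simp add: emeasure_torus emeasure_cube)

lemma frac_inner: "b \<in> Basis \<Longrightarrow> frac_vec x \<bullet> b = frac (x \<bullet> b)"
  by (simp add: frac_vec_def inner_sum_left inner_Basis if_distrib sum.If_cases cong: if_cong)

lemma frac_vec_in_cube[simp]: "frac_vec x \<in> cube"
  by (simp add: cube_def frac_inner frac_lt_1)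

lemma frac_vec_diff_int_lattice: "x - frac_vec x \<in> int_lattice"
  by (simp add: int_lattice_def inner_diff_left frac_inner frac_def)

lemma int_lattice_0[simp]: "0 \<in> int_lattice" and int_lattice_add: "k \<in> int_lattice \<Longrightarrow> l \<in> int_lattice \<Longrightarrow> k + l \<in> int_lattice"
  and int_lattice_uminus: "k \<in> int_lattice \<Longrightarrow> - k \<in> int_lattice" and int_lattice_diff: "k \<in> int_lattice \<Longrightarrow> l \<in> int_lattice \<Longrightarrow> k - l \<in> int_lattice"
  by (auto simp: int_lattice_def inner_add_left inner_diff_left)

lemma int_lattice_Basis: "b \<in> Basis \<Longrightarrow> b \<in> int_lattice"
  by (simp add: int_lattice_def inner_Basis)

lemma frac_vec_unique: "y \<in> cube \<Longrightarrow> x - y \<in> int_lattice \<Longrightarrow> frac_vec x = y"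
proof (rule euclidean_eqI)
  fix b :: 'a assume y: "y \<in> cube" "x - y \<in> int_lattice" and b: "b \<in> Basis"
  then have "x \<bullet> b - y \<bullet> b \<in> \<int>" "0 \<le> y \<bullet> b" "y \<bullet> b < 1" by (auto simp: int_lattice_def cube_def inner_diff_left)
  then show "frac_vec x \<bullet> b = y \<bullet> b"
    using b by (simp add: frac_inner frac_unique_iff)
qed

lemma frac_vec_cube: "x \<in> cube \<Longrightarrow> frac_vec x = x"
  by (rule frac_vec_unique) auto

lemma frac_vec_add_int_lattice: "k \<in> int_lattice \<Longrightarrow> frac_vec (x + k) = frac_vec x"
  by (rule frac_vec_unique) (auto simp: int_lattice_add frac_vec_diff_int_lattice add.commute[of x] add_diff_eq[symmetric])

lemma frac_vec_frac_vec_add: "frac_vec (frac_vec x + y) = frac_vec (x + y)"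
proof -
  have "frac_vec (frac_vec x + y) = frac_vec (frac_vec x + y + (x - frac_vec x))" by (rule frac_vec_add_int_lattice[symmetric]) (rule frac_vec_diff_int_lattice)
  then show ?thesis by (simp add: algebra_simps)
qed

lemma translate_translate: "translate a (translate b x) = translate (a + b) x"
  unfolding translate_def frac_vec_frac_vec_add by (simp add: ac_simps)

lemma translate_0: "x \<in> cube \<Longrightarrow> translate 0 x = x"
  by (simp add: translate_def frac_vec_cube)

lemma translate_in_cube[simp]: "translate a x \<in> cube"
  by (simp add: translate_def)

lemma frac_vec_borel[measurable]: "frac_vec \<in> borel_measurable borel"
  unfolding frac_vec_def frac_def by measurable

lemma measurable_into_torus: "f \<in> M \<rightarrow>\<^sub>M borel \<Longrightarrow> (\<And>x. x \<in> space M \<Longrightarrow> f x \<in> cube) \<Longrightarrow> f \<in> M \<rightarrow>\<^sub>M torus"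
  unfolding torus_def by (intro measurable_restrict_space2) auto

lemma translate_measurable[measurable]: "translate a \<in> torus \<rightarrow>\<^sub>M torus"
  by (rule measurable_into_torus) (auto intro!: measurable_torus_borel simp: translate_def[abs_def])

lemma countable_int_lattice: "countable (int_lattice :: 'a::euclidean_space set)"
proof -
  let ?F = "(\<lambda>f. \<Sum>b\<in>Basis. of_int (f b) *\<^sub>R b) ` (Basis \<rightarrow>\<^sub>E (UNIV::int set)) :: 'a set"
  have "countable ?F" by (intro countable_image countable_PiE) auto
  moreover have "int_lattice \<subseteq> ?F"
  proof
    fix k :: 'a assume k: "k \<in> int_lattice"
    have "k = (\<Sum>b\<in>Basis. of_int (restrict (\<lambda>b. \<lfloor>k \<bullet> b\<rfloor>) Basis b) *\<^sub>R b)"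
      using k by (subst euclidean_representation[symmetric], intro sum.cong) (auto simp: int_lattice_def elim!: Ints_cases)
    then show "k \<in> ?F" by (rule image_eqI[where x = "restrict (\<lambda>b. \<lfloor>k \<bullet> b\<rfloor>) Basis"]) auto
  qed
  ultimately show ?thesis by (rule countable_subset[rotated])
qed

text \<open>Translation by \<open>a\<close> moves each of the countably many pieces of the cube on which the integer part of \<open>x + a\<close> is constant rigidly, and the images again partition the cube.\<close>

lemma distr_translate: "distr torus torus (translate a) = (torus :: 'a::euclidean_space measure)"
proof (rule measure_eqI)
  fix A :: "'a set" assume A0: "A \<in> sets (distr torus torus (translate a))"
  then have A: "A \<in> sets borel" "A \<subseteq> cube" by (auto simp: sets_torus sets_restrict_space)
  define S where "S k = {x \<in> cube. x + a - frac_vec (x + a) = k \<and> x + a - k \<in> A}" for k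
  define S' where "S' k = {y \<in> cube. y \<in> A \<and> y - a - frac_vec (y - a) = - k}" for k
  have Sb[measurable]: "S k \<in> sets borel" "S' k \<in> sets borel" for k
  proof -
    note A(1)[measurable]
    show "S k \<in> sets borel" unfolding S_def by measurable
    show "S' k \<in> sets borel" unfolding S'_def by measurable
  qed
  have shift: "emeasure lborel (S k) = emeasure lborel (S' k)" if k: "k \<in> int_lattice" for k
  proof -
    have "S k = ((+) (a - k)) -` S' k"
    proof (intro set_eqI iffI)
      fix x assume "x \<in> S k"
      then have x: "x \<in> cube" "x + a - frac_vec (x + a) = k" "x + a - k \<in> A" by (auto simp: S_def)
      have 1: "frac_vec (a - k + x - a) = x" by (rule frac_vec_unique) (use x k int_lattice_uminus[OF k] in \<open>auto simp: algebra_simps\<close>)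
      have 2: "a - k + x = frac_vec (x + a)" using x(2) by (simp add: algebra_simps)
      show "x \<in> (+) (a - k) -` S' k" unfolding S'_def mem_Collect_eq vimage_def
      proof (intro conjI)
        show "a - k + x \<in> cube" unfolding 2 by simp
        show "a - k + x \<in> A" using x(3) by (simp add: algebra_simps)
        show "a - k + x - a - frac_vec (a - k + x - a) = - k" unfolding 1 by simp
      qed
    next
      fix x assume y: "x \<in> (+) (a - k) -` S' k"
      then have y: "a - k + x \<in> cube" "a - k + x \<in> A" "a - k + x - a - frac_vec (a - k + x - a) = - k" by (auto simp: S'_def)
      have "frac_vec (x + a) = a - k + x" by (rule frac_vec_unique) (use y k in \<open>auto simp: algebra_simps\<close>)
      moreover have "x = frac_vec (a - k + x - a)" using y(3) by (simp add: algebra_simps)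
      ultimately show "x \<in> S k" using y frac_vec_in_cube[of "a - k + x - a"] by (auto simp: S_def algebra_simps)
    qed
    then have "emeasure lborel (S k) = emeasure (distr lborel borel ((+) (a - k))) (S' k)"
      by (subst emeasure_distr) auto
    then show ?thesis by (simp only: lborel_distr_plus)
  qed
  have 1: "translate a -` A \<inter> cube = (\<Union>k\<in>int_lattice. S k)"
  proof (intro set_eqI iffI)
    fix x assume "x \<in> translate a -` A \<inter> cube"
    then show "x \<in> (\<Union>k\<in>int_lattice. S k)"
      by (intro UN_I[of "x + a - frac_vec (x + a)"]) (auto simp: frac_vec_diff_int_lattice S_def translate_def)
  next
    fix x assume "x \<in> (\<Union>k\<in>int_lattice. S k)"
    then obtain k where "x \<in> cube" "k = x + a - frac_vec (x + a)" "x + a - k \<in> A" by (auto simp: S_def)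
    then show "x \<in> translate a -` A \<inter> cube" by (auto simp: translate_def)
  qed
  have 2: "A = (\<Union>k\<in>int_lattice. S' k)"
  proof safe
    fix x assume "x \<in> A"
    then show "x \<in> (\<Union>k\<in>int_lattice. S' k)"
      using A(2) by (intro UN_I[of "- (x - a - frac_vec (x - a))"] int_lattice_uminus frac_vec_diff_int_lattice) (auto simp: S'_def)
  qed (auto simp: S'_def)
  have "emeasure (distr torus torus (translate a)) A = emeasure torus (translate a -` A \<inter> cube)"
    using A0 by (subst emeasure_distr) auto
  also have "\<dots> = emeasure lborel (\<Union>k\<in>int_lattice. S k)"
    unfolding 1
  proof (rule emeasure_torus)
    show "(\<Union>k\<in>int_lattice. S k) \<in> sets borel" by (intro sets.countable_UN' countable_int_lattice) (use Sb in auto)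
  qed (auto simp: S_def)
  also have "\<dots> = (\<integral>\<^sup>+k. emeasure lborel (S k) \<partial>count_space int_lattice)"
  proof (rule emeasure_UN_countable[OF _ countable_int_lattice])
    show "disjoint_family_on S int_lattice" by (auto simp: disjoint_family_on_def S_def)
  qed (use Sb in auto)
  also have "\<dots> = (\<integral>\<^sup>+k. emeasure lborel (S' k) \<partial>count_space int_lattice)"
    by (rule nn_integral_cong) (use shift in auto)
  also have "\<dots> = emeasure lborel (\<Union>k\<in>int_lattice. S' k)"
  proof (rule emeasure_UN_countable[OF _ countable_int_lattice, symmetric])
    show "disjoint_family_on S' int_lattice" by (auto simp: disjoint_family_on_def S'_def)
  qed (use Sb in auto)
  also have "\<dots> = emeasure torus A" using A by (simp add: emeasure_torus flip: 2)
  finally show "emeasure (distr torus torus (translate a)) A = emeasure torus A" .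
qed simp

lemma measure_preserving_pair_translate: "measure_preserving_pair torus (translate a) (translate (- a))"
  by standard (auto simp: translate_translate translate_0 distr_translate)

section \<open>Characters and Fourier coefficients\<close>

lemma character_add: "character k (x + y) = character k x * character k y"
  by (simp add: character_def inner_add_right distrib_left cis_mult)

lemma character_add_left: "character (k + l) x = character k x * character l x"
  by (simp add: character_def inner_add_left distrib_left cis_mult)

lemma character_uminus: "character (- k) x = cnj (character k x)" and character_uminus_right: "character k (- x) = cnj (character k x)"
  by (simp_all add: character_def cis_cnj)

lemma character_0[simp]: "character 0 x = 1" "character k 0 = 1"
  by (simp_all add: character_def)

lemma norm_character[simp]: "cmod (character k x) = 1"
  by (simp add: character_def)

lemma character_cnj_mult[simp]: "cnj (character k x) * character k x = 1" "character k x * cnj (character k x) = 1"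
  using complex_norm_square[of "character k x"] by (simp_all add: mult.commute)

lemma character_int_lattice: assumes "k \<in> int_lattice" "l \<in> int_lattice" shows "character k l = 1"
proof -
  have "k \<bullet> l = (\<Sum>b\<in>Basis. (k \<bullet> b) * (l \<bullet> b))" by (rule euclidean_inner)
  also have "\<dots> \<in> \<int>" using assms by (intro Ints_sum Ints_mult) (auto simp: int_lattice_def)
  finally obtain n where "k \<bullet> l = of_int n" by (auto elim!: Ints_cases)
  then show ?thesis unfolding character_def by (simp add: cis_multiple_2pi)
qed

lemma character_frac_vec: "k \<in> int_lattice \<Longrightarrow> character k (frac_vec x) = character k x"
  using character_add[of k "frac_vec x" "x - frac_vec x"] character_int_lattice[of k "x - frac_vec x"] frac_vec_diff_int_lattice[of x] by simp

lemma character_translate: "k \<in> int_lattice \<Longrightarrow> character k (translate a x) = character k a * character k x"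
  by (simp add: translate_def character_frac_vec character_add mult.commute)

lemma character_borel[measurable]: "character k \<in> borel_measurable borel"
  unfolding character_def[abs_def] cis_conv_exp by measurable

lemma character_torus[measurable]: "character k \<in> borel_measurable torus"
  by (rule measurable_torus_borel) measurable

lemma finite_torus: "finite_measure torus"
  using prob_space_torus by (rule prob_space.axioms)

lemma sqint_character: "sqint torus (character k)"
  by (rule sqint_bounded[OF finite_torus, where C = 1]) auto

lemma integral_character: assumes "k \<in> int_lattice" shows "(LINT x|torus. character k x) = (if k = 0 then 1 else 0)"
proof (cases "k = 0")
  case True
  then show ?thesis using prob_space.prob_space[OF prob_space_torus[where 'a = 'a]] by simp
next
  case False
  then obtain b where b: "b \<in> Basis" "k \<bullet> b \<noteq> 0" using euclidean_all_zero_iff by blast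
  \<comment> \<open>Half a period in direction \<open>b\<close>: here
    \<open>k \<bullet> a = 1/2\<close>, so translation by \<open>a\<close> flips the sign of the
    integral.\<close>
  define a where "a = (1 / (2 * (k \<bullet> b))) *\<^sub>R b"
  interpret measure_preserving_pair torus "translate a" "translate (- a)" by (rule measure_preserving_pair_translate)
  have "character k a = - 1" using b by (simp add: character_def a_def)
  moreover have "(LINT x|torus. character k x) = (LINT x|torus. character k (translate a x))"
    by (rule integral_comp[symmetric]) auto
  moreover have "\<dots> = character k a * (LINT x|torus. character k x)" by (simp add: character_translate[OF assms])
  ultimately show ?thesis using False by simp
qed

section \<open>Trigonometric polynomials and uniqueness of Fourier coefficients\<close>

inductive trig :: "('a::euclidean_space \<Rightarrow> complex) \<Rightarrow> bool" where
  trig_character: "k \<in> int_lattice \<Longrightarrow> trig (character k)"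
| trig_add: "trig f \<Longrightarrow> trig g \<Longrightarrow> trig (\<lambda>x. f x + g x)"
| trig_cmult: "trig f \<Longrightarrow> trig (\<lambda>x. c * f x)"

lemma trig_const: "trig (\<lambda>x. c)"
  using trig_cmult[OF trig_character[OF int_lattice_0], of c] by simp

lemma trig_mult: assumes "trig f" "trig g" shows "trig (\<lambda>x. f x * g x)"
  using assms(1)
proof induction
  case (trig_character k)
  from assms(2) show ?case
  proof induction
    case (trig_character l)
    then show ?case using trig.trig_character[OF int_lattice_add[OF \<open>k \<in> int_lattice\<close> trig_character]] by (simp add: character_add_left[abs_def])
  next
    case (trig_add f g)
    then show ?case using trig.trig_add by (auto simp: distrib_left)
  next
    case (trig_cmult f c)
    then show ?case using trig.trig_cmult[of "\<lambda>x. character k x * f x" c] by (simp add: mult.left_commute)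
  qed
next
  case (trig_add f g)
  then show ?case using trig.trig_add by (auto simp: distrib_right)
next
  case (trig_cmult f c)
  then show ?case using trig.trig_cmult[of "\<lambda>x. f x * g x" c] by (simp add: mult.assoc)
qed

lemma trig_prod: "finite I \<Longrightarrow> (\<And>i. i \<in> I \<Longrightarrow> trig (f i)) \<Longrightarrow> trig (\<lambda>x. \<Prod>i\<in>I. f i x)"
  by (induction I rule: finite_induct) (auto intro: trig_mult trig_const)

lemma trig_measurable: "trig f \<Longrightarrow> f \<in> borel_measurable torus"
  by (induction rule: trig.induct) auto

lemma trig_bounded: "trig f \<Longrightarrow> \<exists>C. \<forall>x. cmod (f x) \<le> C"
proof (induction rule: trig.induct)
  case (trig_add f g)
  then obtain C D where "\<forall>x. cmod (f x) \<le> C" "\<forall>x. cmod (g x) \<le> D" by auto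
  then show ?case by (intro exI[of _ "C + D"]) (auto intro!: order_trans[OF norm_triangle_ineq] add_mono)
next
  case (trig_cmult f c)
  then obtain C where "\<forall>x. cmod (f x) \<le> C" by auto
  then show ?case by (intro exI[of _ "cmod c * C"]) (auto simp: norm_mult intro!: mult_left_mono)
qed (auto intro: exI[of _ 1])

lemma integrable_mult_bounded:
  fixes F :: "'a \<Rightarrow> complex"
  assumes "integrable M F" "b \<in> borel_measurable M" "\<And>x. x \<in> space M \<Longrightarrow> cmod (b x) \<le> C"
  shows "integrable M (\<lambda>x. b x * F x)"
proof (rule Bochner_Integration.integrable_bound)
  show "integrable M (\<lambda>x. C * cmod (F x))" using assms by auto
  show "AE x in M. cmod (b x * F x) \<le> norm (C * cmod (F x))"
  proof (rule AE_I2)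
    fix x assume "x \<in> space M"
    then have "cmod (b x * F x) \<le> C * cmod (F x)" unfolding norm_mult by (intro mult_right_mono assms) auto
    then show "cmod (b x * F x) \<le> norm (C * cmod (F x))" by (simp add: abs_of_nonneg norm_mult)
  qed
qed (use assms in auto)

lemma trig_integral_zero:
  assumes F: "integrable torus F" and z: "\<And>k. k \<in> int_lattice \<Longrightarrow> (LINT x|torus. character k x * F x) = 0"
  shows "trig f \<Longrightarrow> (LINT x|torus. f x * F x) = 0"
proof (induction rule: trig.induct)
  case (trig_add f g)
  have "integrable torus (\<lambda>x. h x * F x)" if "trig h" for h
    using trig_bounded[OF that] integrable_mult_bounded[OF F trig_measurable[OF that]] by auto
  then show ?case using trig_add by (simp add: distrib_right)
qed (simp_all add: z mult.assoc)

text \<open>A real-linear function on the complex plane is a combination of real and imaginary part.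
  On the circle these are cosine and sine, hence combinations of \<open>character b\<close> and
  \<open>character (- b)\<close>.\<close>

lemma trig_polynomial_cis:
  assumes "real_polynomial_function g" and b: "b \<in> Basis"
  shows "trig (\<lambda>x. complex_of_real (g (cis (2 * pi * (x \<bullet> b)))))"
  using assms(1)
proof induction
  case (linear f)
  interpret f: bounded_linear f by fact
  have "f z = Re z * f 1 + Im z * f \<i>" for z
  proof -
    have "f z = f (Re z *\<^sub>R 1 + Im z *\<^sub>R \<i>)" by (rule arg_cong[where f = f]) (simp add: complex_eq_iff)
    then show ?thesis by (simp only: f.add f.scaleR real_scaleR_def)
  qed
  from this[of "cis _"] have 1: "f (cis t) = cos t * f 1 + sin t * f \<i>" for t by simp
  have 2: "complex_of_real (cos (2 * pi * (x \<bullet> b))) = (1/2) * (character b x + character (- b) x)"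
    "complex_of_real (sin (2 * pi * (x \<bullet> b))) = (- \<i> / 2) * (character b x + (-1) * character (- b) x)" for x
    by (auto simp: character_def complex_eq_iff inner_commute)
  have "trig (\<lambda>x. of_real (f 1) * ((1/2) * (character b x + character (- b) x)) + of_real (f \<i>) * ((- \<i> / 2) * (character b x + (-1) * character (- b) x)))"
    by (intro trig_add trig_cmult trig_character int_lattice_Basis int_lattice_uminus b)
  then show ?case unfolding 1 of_real_add of_real_mult 2[symmetric] by (simp only: mult.commute)
qed (simp_all add: trig_const trig_add trig_mult)

lemma cis_arc_inj:
  assumes "0 \<le> s" "s \<le> 1" "0 < t" "t < 1" "cis (2 * pi * s) = cis (2 * pi * t)" shows "s = t"
proof -
  have "sin (2 * pi * s) = sin (2 * pi * t) \<and> cos (2 * pi * s) = cos (2 * pi * t)"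
    using assms(5) by (simp add: complex_eq_iff)
  then obtain n where "2 * pi * s = 2 * pi * t + 2 * pi * of_int n" using sin_cos_eq_iff by blast
  then have "2 * pi * s = 2 * pi * (t + of_int n)" by (simp add: distrib_left)
  then have n: "s = t + of_int n" by simp
  then have "of_int n < (1::real)" "of_int n > (- 1::real)" using assms by linarith+
  then have "n = 0" by linarith
  then show ?thesis using n by simp
qed

text \<open>With \<open>A\<close> the closed complementary arc, min(1, n dist(z, A)) increases to
  the indicator of the open arc, and Stone--Weierstrass replaces it by polynomials with error below
  1/(n + 1); hence the bound 2. The parameters 0 and 1 give the same point of the circle, and it
  always lies in \<open>A\<close>.\<close>

lemma arc_approx:
  fixes \<alpha> \<beta> :: real
  assumes ab: "0 \<le> \<alpha>" "\<alpha> < \<beta>" "\<beta> \<le> 1"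
  obtains p :: "nat \<Rightarrow> complex \<Rightarrow> real" where "\<And>n. real_polynomial_function (p n)"
    "\<And>n z. cmod z = 1 \<Longrightarrow> \<bar>p n z\<bar> \<le> 2"
    "\<And>t. 0 \<le> t \<Longrightarrow> t \<le> 1 \<Longrightarrow> (\<lambda>n. p n (cis (2 * pi * t))) \<longlonglongrightarrow> indicator {\<alpha><..<\<beta>} t"
proof -
  define A where "A = (\<lambda>t. cis (2 * pi * t)) ` ({0..\<alpha>} \<union> {\<beta>..1})"
  have A: "compact A" unfolding A_def cis_conv_exp by (intro compact_continuous_image continuous_intros) auto
  have "A \<noteq> {}" unfolding A_def using ab by auto
  define \<phi> where "\<phi> n z = min 1 (real n * infdist z A)" for n and z :: complex
  have c: "continuous_on (sphere 0 1) (\<phi> n)" for n unfolding \<phi>_def by (intro continuous_intros)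
  have "\<exists>g. real_polynomial_function g \<and> (\<forall>z\<in>sphere 0 1. \<bar>\<phi> n z - g z\<bar> < 1 / Suc n)" for n
  proof -
    obtain g where "real_polynomial_function g" "\<And>z. z \<in> sphere 0 1 \<Longrightarrow> \<bar>\<phi> n z - g z\<bar> < 1 / Suc n"
      using Stone_Weierstrass_real_polynomial_function[OF compact_sphere c, of "1 / Suc n" n] by auto
    then show ?thesis by blast
  qed
  then have "\<forall>n. \<exists>g. real_polynomial_function g \<and> (\<forall>z\<in>sphere 0 1. \<bar>\<phi> n z - g z\<bar> < 1 / Suc n)" by blast
  from choice[OF this] obtain p where
    pp: "\<forall>n. real_polynomial_function (p n) \<and> (\<forall>z\<in>sphere 0 1. \<bar>\<phi> n z - p n z\<bar> < 1 / Suc n)" by blast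
  then have p: "\<And>n. real_polynomial_function (p n)" "\<And>n z. cmod z = 1 \<Longrightarrow> \<bar>\<phi> n z - p n z\<bar> < 1 / Suc n"
    by (blast, metis mem_sphere_0)
  show ?thesis
  proof (rule that[of p])
    show "\<bar>p n z\<bar> \<le> 2" if "cmod z = 1" for n z
    proof -
      have "0 \<le> \<phi> n z" "\<phi> n z \<le> 1" unfolding \<phi>_def by (auto simp: infdist_nonneg)
      moreover have "1 / real (Suc n) \<le> 1" by simp
      ultimately show ?thesis using p(2)[OF that, of n] by linarith
    qed
    fix t :: real assume t: "0 \<le> t" "t \<le> 1"
    let ?z = "cis (2 * pi * t)"
    have "(\<lambda>n. \<phi> n ?z) \<longlonglongrightarrow> indicator {\<alpha><..<\<beta>} t"
    proof (cases "t \<in> {\<alpha><..<\<beta>}")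
      case True
      have "?z \<notin> A"
      proof
        assume "?z \<in> A"
        then obtain s where "?z = cis (2 * pi * s)" "s \<in> {0..\<alpha>} \<union> {\<beta>..1}" unfolding A_def by (rule imageE)
        then show False using cis_arc_inj[of s t] True ab by auto
      qed
      then have d: "infdist ?z A > 0" using A \<open>A \<noteq> {}\<close> by (simp add: infdist_pos_not_in_closed compact_imp_closed)
      then obtain N where N: "real N * infdist ?z A > 1" using reals_Archimedean3 by blast
      have "\<forall>\<^sub>F n in sequentially. 1 = \<phi> n ?z"
        using eventually_ge_at_top[of N]
      proof eventually_elim
        fix n assume "N \<le> n"
        then have "real N * infdist ?z A \<le> real n * infdist ?z A" using d by (intro mult_right_mono) auto
        then show "1 = \<phi> n ?z" using N by (simp add: \<phi>_def)
      qed
      then have "(\<lambda>n. \<phi> n ?z) \<longlonglongrightarrow> 1" by (rule Lim_transform_eventually[OF tendsto_const])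
      then show ?thesis using True by simp
    next
      case False
      then have "?z \<in> A" unfolding A_def using t by auto
      then have "\<phi> n ?z = 0" for n by (simp add: \<phi>_def)
      then show ?thesis using False by simp
    qed
    moreover have "(\<lambda>n. p n ?z - \<phi> n ?z) \<longlonglongrightarrow> 0"
    proof (rule Lim_null_comparison)
      show "\<forall>\<^sub>F n in sequentially. norm (p n ?z - \<phi> n ?z) \<le> 1 / Suc n"
        using p(2)[of ?z] by (intro always_eventually allI) (auto simp: abs_minus_commute less_imp_le)
      show "(\<lambda>n. 1 / real (Suc n)) \<longlonglongrightarrow> 0" by (rule lim_1_over_n[THEN LIMSEQ_Suc, unfolded of_nat_Suc[symmetric]])
    qed
    ultimately show "(\<lambda>n. p n ?z) \<longlonglongrightarrow> indicator {\<alpha><..<\<beta>} t" using tendsto_add by fastforce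
  qed (fact p)
qed

text \<open>A product over the coordinates of approximations of arcs; the bounds 2 multiply.\<close>

lemma box_approx:
  fixes a b :: "'a::euclidean_space"
  assumes ab: "\<And>i. i \<in> Basis \<Longrightarrow> 0 \<le> a \<bullet> i \<and> a \<bullet> i < b \<bullet> i \<and> b \<bullet> i \<le> 1"
  obtains q :: "nat \<Rightarrow> 'a \<Rightarrow> complex" where "\<And>n. trig (q n)" "\<And>n x. cmod (q n x) \<le> 2 ^ DIM('a)"
    "\<And>x. x \<in> cube \<Longrightarrow> (\<lambda>n. q n x) \<longlonglongrightarrow> indicator (box a b) x"
proof -
  have "\<forall>i\<in>Basis. \<exists>p :: nat \<Rightarrow> complex \<Rightarrow> real. (\<forall>n. real_polynomial_function (p n)) \<and> (\<forall>n z. cmod z = 1 \<longrightarrow> \<bar>p n z\<bar> \<le> 2) \<and>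
    (\<forall>t. 0 \<le> t \<longrightarrow> t \<le> 1 \<longrightarrow> (\<lambda>n. p n (cis (2 * pi * t))) \<longlonglongrightarrow> indicator {a \<bullet> i<..<b \<bullet> i} t)"
    using arc_approx ab by metis
  then obtain p :: "'a \<Rightarrow> nat \<Rightarrow> complex \<Rightarrow> real" where p: "\<And>i n. i \<in> Basis \<Longrightarrow> real_polynomial_function (p i n)"
    "\<And>i n z. i \<in> Basis \<Longrightarrow> cmod z = 1 \<Longrightarrow> \<bar>p i n z\<bar> \<le> 2"
    "\<And>i t. i \<in> Basis \<Longrightarrow> 0 \<le> t \<Longrightarrow> t \<le> 1 \<Longrightarrow> (\<lambda>n. p i n (cis (2 * pi * t))) \<longlonglongrightarrow> indicator {a \<bullet> i<..<b \<bullet> i} t"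
    by metis
  define q where "q n x = (\<Prod>i\<in>Basis. complex_of_real (p i n (cis (2 * pi * (x \<bullet> i)))))" for n x
  show ?thesis
  proof (rule that[of q])
    show "trig (q n)" for n unfolding q_def by (intro trig_prod trig_polynomial_cis p) auto
    show "cmod (q n x) \<le> 2 ^ DIM('a)" for n x
    proof -
      have "cmod (q n x) = (\<Prod>i\<in>Basis. \<bar>p i n (cis (2 * pi * (x \<bullet> i)))\<bar>)" by (simp add: q_def prod_norm[symmetric])
      also have "\<dots> \<le> (\<Prod>i\<in>(Basis::'a set). 2)" by (intro prod_mono conjI p) auto
      finally show ?thesis by simp
    qed
    fix x :: 'a assume x: "x \<in> cube"
    have "(\<lambda>n. q n x) \<longlonglongrightarrow> (\<Prod>i\<in>Basis. complex_of_real (indicator {a \<bullet> i<..<b \<bullet> i} (x \<bullet> i)))"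
      unfolding q_def using x by (intro tendsto_prod tendsto_of_real p) (auto simp: cube_def less_imp_le)
    also have "(\<Prod>i\<in>Basis. complex_of_real (indicator {a \<bullet> i<..<b \<bullet> i} (x \<bullet> i))) = indicator (box a b) x"
      by (auto simp: indicator_def box_def)
    finally show "(\<lambda>n. q n x) \<longlonglongrightarrow> indicator (box a b) x" .
  qed
qed

lemma AE_torus_box: "AE x in torus. x \<in> box 0 One"
proof -
  have "cbox 0 One - box 0 (One::'a) \<in> null_sets lborel"
    by (rule null_setsI) (auto simp: emeasure_Diff emeasure_lborel_box_eq emeasure_lborel_cbox_eq box_subset_cbox)
  then have "AE x in lborel. x \<notin> cbox 0 One - box 0 (One::'a)" by (rule AE_not_in)
  then show ?thesis unfolding torus_def
    by (subst AE_restrict_space_iff) (use cube_subset_cbox in auto)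
qed

text \<open>Integrals of \<open>F\<close> over boxes vanish by trigonometric approximation and
  dominated convergence. Boxes generate the Borel sets, and a function all of whose set integrals
  vanish is zero almost everywhere.\<close>

theorem fourier_unique:
  fixes F :: "'a::euclidean_space \<Rightarrow> complex"
  assumes F: "integrable torus F" and z: "\<And>k. k \<in> int_lattice \<Longrightarrow> (LINT x|torus. character k x * F x) = 0"
  shows "AE x in torus. F x = 0"
proof -
  have Fm: "F \<in> borel_measurable torus" by (rule borel_measurable_integrable[OF F])
  have m: "(\<lambda>x. indicator A x * F x) \<in> borel_measurable torus" if "A \<in> sets borel" for A :: "'a set"
    by (rule borel_measurable_times[OF measurable_torus_borel[OF borel_measurable_indicator[OF that]] Fm])
  have 1: "(LINT x|torus. indicator (box a b) x * F x) = 0"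
    if ab: "\<And>i. i \<in> Basis \<Longrightarrow> 0 \<le> a \<bullet> i \<and> a \<bullet> i < b \<bullet> i \<and> b \<bullet> i \<le> 1" for a b :: 'a
  proof -
    obtain q :: "nat \<Rightarrow> 'a \<Rightarrow> complex" where q: "\<And>n. trig (q n)" "\<And>n x. cmod (q n x) \<le> 2 ^ DIM('a)"
      "\<And>x. x \<in> cube \<Longrightarrow> (\<lambda>n. q n x) \<longlonglongrightarrow> indicator (box a b) x"
      using box_approx[of a b] ab by blast
    have "(\<lambda>n. LINT x|torus. q n x * F x) \<longlonglongrightarrow> (LINT x|torus. indicator (box a b) x * F x)"
    proof (rule integral_dominated_convergence[where w = "\<lambda>x. 2 ^ DIM('a) * cmod (F x)"])
      show "AE x in torus. (\<lambda>n. q n x * F x) \<longlonglongrightarrow> indicator (box a b) x * F x"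
        by (intro AE_I2 tendsto_intros q) auto
      show "AE x in torus. cmod (q n x * F x) \<le> 2 ^ DIM('a) * cmod (F x)" for n
        unfolding norm_mult by (intro AE_I2 mult_right_mono q) auto
      show "(\<lambda>x. indicator (box a b) x * F x) \<in> borel_measurable torus"
        by (rule m) simp
    qed (use F Fm trig_measurable[OF q(1)] in auto)
    then show ?thesis using trig_integral_zero[OF F z q(1)] by (simp add: LIMSEQ_const_iff)
  qed
  have 2: "(LINT x|torus. indicator (box a b) x * F x) = 0" for a b :: 'a
  proof -
    \<comment> \<open>Clipping to the unit cube changes the box only outside the open cube, a null
      set for \<open>torus\<close>.\<close>
    define a' where "a' = (\<Sum>i\<in>Basis. max 0 (a \<bullet> i) *\<^sub>R i)"
    define b' where "b' = (\<Sum>i\<in>Basis. min 1 (b \<bullet> i) *\<^sub>R i)"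
    have i: "a' \<bullet> i = max 0 (a \<bullet> i)" "b' \<bullet> i = min 1 (b \<bullet> i)" if "i \<in> Basis" for i
      using that by (simp_all add: a'_def b'_def inner_sum_left inner_Basis if_distrib sum.If_cases cong: if_cong)
    have eq: "x \<in> box a b \<longleftrightarrow> x \<in> box a' b'" if "x \<in> box 0 One" for x
      using that by (auto simp: box_def i)
    have "(LINT x|torus. indicator (box a b) x * F x) = (LINT x|torus. indicator (box a' b') x * F x)"
    proof (rule integral_cong_AE)
      show "AE x in torus. indicator (box a b) x * F x = indicator (box a' b') x * F x"
        using AE_torus_box by eventually_elim (simp add: eq indicator_def)
    qed (rule m, simp)+
    also have "\<dots> = 0"
    proof (cases "box a' b' = {}")
      case False
      then have "\<And>i. i \<in> Basis \<Longrightarrow> a' \<bullet> i < b' \<bullet> i" by (simp add: box_ne_empty)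
      then show ?thesis by (intro 1) (auto simp: i)
    qed simp
    finally show ?thesis .
  qed

  have intA: "integrable torus (\<lambda>x. indicator A x * F x)" if "A \<in> sets borel" for A :: "'a set"
    by (rule Bochner_Integration.integrable_bound[OF F m[OF that]]) (auto simp: indicator_def)
  have 3: "(LINT x|torus. indicator A x * F x) = 0" if A: "A \<in> sets borel" for A :: "'a set"
  proof -
    have sb: "sets borel = sigma_sets UNIV (range (\<lambda>(a, b). box a b :: 'a set))"
      by (subst borel_eq_box) (simp add: sets_measure_of)
    have "Int_stable (range (\<lambda>(a, b). box a b :: 'a set))"
      by (auto simp: Int_stable_def box_Int_box)
    moreover have "range (\<lambda>(a, b). box a b :: 'a set) \<subseteq> Pow UNIV" by simp
    ultimately show ?thesis using A unfolding sb
    proof (induction rule: sigma_sets_induct_disjoint)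
      case (basic A)
      then show ?case using 2 by auto
    next
      case (compl A)
      have A: "A \<in> sets borel" using compl(1) unfolding sb .
      have "(LINT x|torus. indicator (UNIV - A) x * F x) = (LINT x|torus. F x - indicator A x * F x)"
        by (rule Bochner_Integration.integral_cong) (auto simp: indicator_def)
      also have "\<dots> = (LINT x|torus. F x) - (LINT x|torus. indicator A x * F x)"
        by (rule Bochner_Integration.integral_diff[OF F intA[OF A]])
      also have "\<dots> = 0" using compl z[of 0] by simp
      finally show ?case .
    next
      case (union A)
      then have A: "\<And>i. A i \<in> sets borel" unfolding sb by auto
      have "(\<lambda>n. LINT x|torus. (\<Sum>i<n. indicator (A i) x * F x)) \<longlonglongrightarrow> (LINT x|torus. indicator (\<Union>i. A i) x * F x)"
      proof (rule integral_dominated_convergence[where w = "\<lambda>x. cmod (F x)"])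
        have ind: "(\<Sum>i<n. indicator (A i) x * F x) = indicator (\<Union>i<n. A i) x * F x" for n x
        proof (induction n)
          case (Suc n)
          have "A i \<inter> A n = {}" if "i < n" for i using union(1) that by (auto simp: disjoint_family_on_def)
          then have "indicator (\<Union>i<Suc n. A i) x = indicator (\<Union>i<n. A i) x + (indicator (A n) x :: complex)"
            by (auto simp: lessThan_Suc indicator_def)
          then show ?case using Suc by (simp add: distrib_right)
        qed simp
        show "AE x in torus. (\<lambda>n. \<Sum>i<n. indicator (A i) x * F x) \<longlonglongrightarrow> indicator (\<Union>i. A i) x * F x"
          unfolding ind by (intro AE_I2 tendsto_intros LIMSEQ_indicator_UN)
        show "AE x in torus. cmod (\<Sum>i<n. indicator (A i) x * F x) \<le> cmod (F x)" for n
          unfolding ind by (auto simp: indicator_def)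
        show "(\<lambda>x. indicator (\<Union>i. A i) x * F x) \<in> borel_measurable torus" by (rule m) (use A in auto)
        show "(\<lambda>x. \<Sum>i<n. indicator (A i) x * F x) \<in> borel_measurable torus" for n by (intro borel_measurable_sum m A)
      qed (use F in auto)
      moreover have "(LINT x|torus. (\<Sum>i<n. indicator (A i) x * F x)) = 0" for n
        using A by (subst Bochner_Integration.integral_sum) (auto simp: intA union)
      ultimately show ?case by (simp add: LIMSEQ_const_iff)
    qed simp
  qed
  show ?thesis
  proof -
    have A: "A \<in> sets borel" if "A \<in> sets torus" for A :: "'a set"
      using that by (auto simp: sets_torus sets_restrict_space)
    have "AE x in torus. Re (F x) = 0"
    proof (rule density_unique_real)
      fix A :: "'a set" assume "A \<in> sets torus"
      then have "Re (LINT x|torus. indicator A x * F x) = 0" "integrable torus (\<lambda>x. indicator A x * F x)"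
        using 3[OF A] intA[OF A] by auto
      then have "(LINT x|torus. Re (indicator A x * F x)) = 0" by (simp only: integral_Re)
      moreover have "Re (indicator A x * F x) = indicator A x *\<^sub>R Re (F x)" for x by (simp add: indicator_def)
      ultimately show "(LINT x:A|torus. Re (F x)) = (LINT x:A|torus. 0)" by (simp add: set_lebesgue_integral_def)
    qed (use F in auto)
    moreover have "AE x in torus. Im (F x) = 0"
    proof (rule density_unique_real)
      fix A :: "'a set" assume "A \<in> sets torus"
      then have "Im (LINT x|torus. indicator A x * F x) = 0" "integrable torus (\<lambda>x. indicator A x * F x)"
        using 3[OF A] intA[OF A] by auto
      then have "(LINT x|torus. Im (indicator A x * F x)) = 0" by (simp only: integral_Im)
      moreover have "Im (indicator A x * F x) = indicator A x *\<^sub>R Im (F x)" for x by (simp add: indicator_def)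
      ultimately show "(LINT x:A|torus. Im (F x)) = (LINT x:A|torus. 0)" by (simp add: set_lebesgue_integral_def)
    qed (use F in auto)
    ultimately show ?thesis by eventually_elim (simp add: complex_eq_iff)
  qed
qed

corollary fourier_unique_const:
  assumes F: "integrable torus F" and z: "\<And>k. k \<in> int_lattice \<Longrightarrow> (LINT x|torus. cnj (character k x) * F x) = (if k = 0 then c else 0)"
  shows "AE x in torus. F x = c"
proof -
  interpret prob_space torus by (rule prob_space_torus)
  have "AE x in torus. F x - c = 0"
  proof (rule fourier_unique)
    fix k :: 'a assume k: "k \<in> int_lattice"
    have "(LINT x|torus. character k x * (F x - c)) = (LINT x|torus. character k x * F x) - c * (LINT x|torus. character k x)"
      using integrable_mult_bounded[OF F character_torus[of k], of 1] integrable_sqint[OF finite_torus sqint_character[of k]]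
      by (simp add: right_diff_distrib mult.commute[of _ c])
    then show "(LINT x|torus. character k x * (F x - c)) = 0"
      using z[OF int_lattice_uminus[OF k]] by (auto simp: character_uminus integral_character[OF k])
  qed (use F in auto)
  then show ?thesis by simp
qed

abbreviation circ :: "real measure" where "circ \<equiv> torus"

definition e :: "int \<Rightarrow> real \<Rightarrow> complex" where
  "e n t = character (of_int n) t"

lemma int_lattice_real: "int_lattice = (\<int> :: real set)"
  by (auto simp: int_lattice_def)

lemma complete_orthonormal_e: "complete_orthonormal circ e"
  unfolding complete_orthonormal_def orthonormal_def
proof safe
  show "sqint circ (e i)" for i unfolding e_def[abs_def] by (rule sqint_character)
  show "ip circ (e i) (e j) = (if i = j then 1 else 0)" for i j
  proof -
    have "cnj (e i t) * e j t = character (of_int (j - i)) t" for t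
      using character_add_left[of "- of_int i" "of_int j" t] by (simp add: e_def character_uminus)
    then show ?thesis by (simp add: ip_def integral_character int_lattice_real)
  qed
  fix u assume u: "sqint circ u" and z: "\<forall>i. ip circ (e i) u = 0"
  have "AE t in circ. u t = 0"
  proof (rule fourier_unique[OF integrable_sqint[OF finite_torus u]])
    fix k :: real assume "k \<in> int_lattice"
    then obtain i where "k = - of_int i" by (auto simp: int_lattice_real elim!: Ints_cases) (metis minus_minus of_int_minus)
    then show "(LINT t|circ. character k t * u t) = 0" using z[rule_format, of i] by (simp add: ip_def e_def character_uminus)
  qed
  then show "norm_sq circ u = 0" by (rule norm_sq_zeroI)
qed

section \<open>Square integrable functions on products\<close>

lemma measure_preserving_pair_prod:
  assumes "measure_preserving_pair M \<sigma> \<tau>" "measure_preserving_pair N \<sigma>' \<tau>'" "sigma_finite_measure N"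
  shows "measure_preserving_pair (M \<Otimes>\<^sub>M N) (\<lambda>(x, t). (\<sigma> x, \<sigma>' t)) (\<lambda>(x, t). (\<tau> x, \<tau>' t))"
proof -
  interpret A: measure_preserving_pair M \<sigma> \<tau> by fact
  interpret B: measure_preserving_pair N \<sigma>' \<tau>' by fact
  show ?thesis
  proof
    have "distr M M \<sigma> \<Otimes>\<^sub>M distr N N \<sigma>' = distr (M \<Otimes>\<^sub>M N) (M \<Otimes>\<^sub>M N) (\<lambda>(x, t). (\<sigma> x, \<sigma>' t))"
      by (rule pair_measure_distr) (auto simp: B.distr_\<sigma> assms)
    then show "distr (M \<Otimes>\<^sub>M N) (M \<Otimes>\<^sub>M N) (\<lambda>(x, t). (\<sigma> x, \<sigma>' t)) = M \<Otimes>\<^sub>M N" by (simp add: A.distr_\<sigma> B.distr_\<sigma>)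
  qed (auto simp: space_pair_measure A.\<sigma>\<tau> A.\<tau>\<sigma> B.\<sigma>\<tau> B.\<tau>\<sigma>)
qed

lemma measure_preserving_pair_id: "measure_preserving_pair M (\<lambda>x. x) (\<lambda>x. x)"
  by standard (auto simp: distr_id2)

context pair_sigma_finite
begin

lemma sqint_section_snd: assumes "sqint (M1 \<Otimes>\<^sub>M M2) U"
  shows "AE y in M2. sqint M1 (\<lambda>x. U (x, y))"
proof -
  note [measurable] = sqint_measurable[OF assms]
  have "AE y in M2. integrable M1 (\<lambda>x. (cmod (U (x, y)))^2)"
    by (rule AE_integrable_snd) (use sqint_integrable[OF assms] in \<open>simp add: case_prod_beta'\<close>)
  moreover have "AE y in M2. (\<lambda>x. U (x, y)) \<in> borel_measurable M1" by (rule AE_I2) measurable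
  ultimately show ?thesis by eventually_elim (simp add: sqint_def)
qed

lemma sqint_section_fst: assumes "sqint (M1 \<Otimes>\<^sub>M M2) U"
  shows "AE x in M1. sqint M2 (\<lambda>y. U (x, y))"
proof -
  note [measurable] = sqint_measurable[OF assms]
  have "AE x in M1. integrable M2 (\<lambda>y. (cmod (U (x, y)))^2)"
    by (rule AE_integrable_fst) (use sqint_integrable[OF assms] in \<open>simp add: case_prod_beta'\<close>)
  moreover have "AE x in M1. (\<lambda>y. U (x, y)) \<in> borel_measurable M2" by (rule AE_I2) measurable
  ultimately show ?thesis by eventually_elim (simp add: sqint_def)
qed

lemma norm_sq_sections:
  assumes "sqint (M1 \<Otimes>\<^sub>M M2) U"
  shows "integrable M2 (\<lambda>y. norm_sq M1 (\<lambda>x. U (x, y)))" "(LINT y|M2. norm_sq M1 (\<lambda>x. U (x, y))) = norm_sq (M1 \<Otimes>\<^sub>M M2) U"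
    "integrable M1 (\<lambda>x. norm_sq M2 (\<lambda>y. U (x, y)))" "(LINT x|M1. norm_sq M2 (\<lambda>y. U (x, y))) = norm_sq (M1 \<Otimes>\<^sub>M M2) U"
proof -
  have i: "integrable (M1 \<Otimes>\<^sub>M M2) (case_prod (\<lambda>x y. (cmod (U (x, y)))^2))"
    using sqint_integrable[OF assms] by (simp add: case_prod_beta')
  show "integrable M2 (\<lambda>y. norm_sq M1 (\<lambda>x. U (x, y)))" "integrable M1 (\<lambda>x. norm_sq M2 (\<lambda>y. U (x, y)))"
    unfolding norm_sq_def using integrable_snd[OF i] integrable_fst[OF i] by simp_all
  show "(LINT y|M2. norm_sq M1 (\<lambda>x. U (x, y))) = norm_sq (M1 \<Otimes>\<^sub>M M2) U" "(LINT x|M1. norm_sq M2 (\<lambda>y. U (x, y))) = norm_sq (M1 \<Otimes>\<^sub>M M2) U"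
    unfolding norm_sq_def using integral_snd[OF i] integral_fst[OF i] by (simp_all add: case_prod_beta')
qed

lemma sqint_pairI:
  assumes [measurable]: "U \<in> borel_measurable (M1 \<Otimes>\<^sub>M M2)"
    and "AE y in M2. sqint M1 (\<lambda>x. U (x, y)) \<and> norm_sq M1 (\<lambda>x. U (x, y)) \<le> h y" and h: "integrable M2 h"
  shows "sqint (M1 \<Otimes>\<^sub>M M2) U"
  unfolding sqint_def
proof (intro conjI integrableI_bounded)
  have "(\<integral>\<^sup>+z. ennreal (norm ((cmod (U z))^2)) \<partial>(M1 \<Otimes>\<^sub>M M2)) = (\<integral>\<^sup>+y. \<integral>\<^sup>+x. ennreal ((cmod (U (x, y)))^2) \<partial>M1 \<partial>M2)"
    by (subst nn_integral_snd[symmetric]) auto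
  also have "\<dots> \<le> (\<integral>\<^sup>+y. ennreal (norm (h y)) \<partial>M2)"
  proof (rule nn_integral_mono_AE, use assms(2) in eventually_elim)
    fix y assume y: "sqint M1 (\<lambda>x. U (x, y)) \<and> norm_sq M1 (\<lambda>x. U (x, y)) \<le> h y"
    then have "(\<integral>\<^sup>+x. ennreal ((cmod (U (x, y)))^2) \<partial>M1) = ennreal (norm_sq M1 (\<lambda>x. U (x, y)))"
      unfolding norm_sq_def by (intro nn_integral_eq_integral) (auto simp: sqint_integrable)
    then show "(\<integral>\<^sup>+x. ennreal ((cmod (U (x, y)))^2) \<partial>M1) \<le> ennreal (norm (h y))" using y by (auto intro!: ennreal_leI)
  qed
  also have "\<dots> < \<infinity>" using h by (simp add: integrable_iff_bounded)
  finally show "(\<integral>\<^sup>+z. ennreal (norm ((cmod (U z))^2)) \<partial>(M1 \<Otimes>\<^sub>M M2)) < \<infinity>" .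
qed measurable

end

lemma e_measurable[measurable]: "e n \<in> borel_measurable circ" "e n \<in> borel_measurable borel"
  unfolding e_def[abs_def] by measurable

lemma norm_e[simp]: "cmod (e n t) = 1" by (simp add: e_def)

lemma cnj_e: "cnj (e n t) = e (- n) t" by (simp add: e_def character_uminus)
lemma e_add: "e (m + n) t = e m t * e n t" by (simp add: e_def character_add_left)
lemma e_translate: "e n (translate s t) = e n s * e n t"
  by (simp add: e_def character_translate int_lattice_real)

lemma borel_to_torus[measurable (raw)]: "f \<in> borel_measurable borel \<Longrightarrow> f \<in> borel_measurable torus"
  by (rule measurable_torus_borel)

section \<open>Measurable choice of eigenfunctions of the dual operator\<close>

text \<open>The data distilled from reducibility and absolute continuity: \<open>t\<close> is a
  phase of the dual operator, \<open>E t\<close> an eigenvalue at that phase, and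
  \<open>separated\<close> says that energies at phases differing by a nonzero k\<cdot>\<alpha> are
  distinct.\<close>

locale quasiperiodic =
  fixes \<alpha> :: "'a::euclidean_space" and v :: "'a \<Rightarrow> real" and V :: real and E :: "real \<Rightarrow> real" and B :: real
  assumes v_measurable[measurable]: "v \<in> borel_measurable torus" and v_le: "\<And>x. \<bar>v x\<bar> \<le> V"
    and E_measurable[measurable]: "E \<in> borel_measurable circ" and E_le: "\<And>t. \<bar>E t\<bar> \<le> B"
    and eigen: "AE t in circ. \<exists>a. sqint torus a \<and> norm_sq torus a \<noteq> 0 \<and>
      (AE x in torus. e 1 t * a (translate \<alpha> x) + cnj (e 1 t) * a (translate (- \<alpha>) x) + of_real (v x) * a x = of_real (E t) * a x)"
    and separated: "\<And>k. k \<in> int_lattice \<Longrightarrow> k \<noteq> 0 \<Longrightarrow> AE t in circ. E t \<noteq> E (translate (- (k \<bullet> \<alpha>)) t)"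
begin

sublocale X: prob_space "torus :: 'a measure" by (rule prob_space_torus)
sublocale C: prob_space circ by (rule prob_space_torus)
sublocale P: pair_prob_space "torus :: 'a measure" circ ..

abbreviation PM :: "('a \<times> real) measure" where "PM \<equiv> torus \<Otimes>\<^sub>M circ"

text \<open>Dual operator at phase \<open>t\<close> minus \<open>E t\<close>, so that eigenfunctions
  become kernel vectors. \<open>Sj\<close> below is the same operator on the product space, where
  limits are automatically jointly measurable.\<close>

definition Sf :: "real \<Rightarrow> ('a \<Rightarrow> complex) \<Rightarrow> 'a \<Rightarrow> complex" where
  "Sf t u x = e 1 t * u (translate \<alpha> x) + cnj (e 1 t) * u (translate (- \<alpha>) x) + of_real (v x - E t) * u x"

definition Sj :: "('a \<times> real \<Rightarrow> complex) \<Rightarrow> 'a \<times> real \<Rightarrow> complex" where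
  "Sj U z = Sf (snd z) (\<lambda>x. U (x, snd z)) (fst z)"

definition R :: real where "R = sqrt (6 + 3 * (V + B)^2)"

lemma q_le: "\<bar>v x - E t\<bar> \<le> V + B"
  using v_le[of x] E_le[of t] by linarith

sublocale fib: symmetric_operator torus "Sf t" R for t
proof -
  interpret j: jacobi torus "translate \<alpha>" "translate (- \<alpha>)" "\<lambda>_. e 1 t" "\<lambda>x. v x - E t" "V + B"
    using measure_preserving_pair_translate by (rule jacobi.intro) (unfold_locales, use q_le in auto)
  have "j.J = Sf t" by (simp add: fun_eq_iff j.J_def Sf_def)
  then show "symmetric_operator torus (Sf t) R" using j.symmetric_operator_axioms by (simp add: R_def)
qed

sublocale joint: symmetric_operator PM Sj R
proof -
  have "measure_preserving_pair PM (\<lambda>(x, t). (translate \<alpha> x, t)) (\<lambda>(x, t). (translate (- \<alpha>) x, t))"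
    by (rule measure_preserving_pair_prod[OF measure_preserving_pair_translate measure_preserving_pair_id]) unfold_locales
  then interpret j: jacobi PM "\<lambda>(x, t). (translate \<alpha> x, t)" "\<lambda>(x, t). (translate (- \<alpha>) x, t)" "\<lambda>(x, t). e 1 t" "\<lambda>(x, t). v x - E t" "V + B"
    by (rule jacobi.intro) (unfold_locales, use q_le in auto)
  have "j.J = Sj" by (auto simp: fun_eq_iff j.J_def Sf_def Sj_def)
  then show "symmetric_operator PM Sj R" using j.symmetric_operator_axioms by (simp add: R_def)
qed

text \<open>The operator acts in x alone, so iterating and taking sections commute exactly, with no
  exceptional phases.\<close>

lemma joint_K_fib: "(joint.K ^^ n) U (x, t) = (fib.K t ^^ n) (\<lambda>x. U (x, t)) x"
proof -
  have "(\<lambda>x. (joint.K ^^ n) U (x, t)) = (fib.K t ^^ n) (\<lambda>x. U (x, t))"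
  proof (induction n)
    case (Suc n)
    have "(\<lambda>x. joint.K W (x, t)) = fib.K t (\<lambda>x. W (x, t))" for W
      by (simp add: fun_eq_iff joint.K_def fib.K_def Sj_def)
    then show ?case using Suc by simp
  qed simp
  then show ?thesis by (rule fun_cong)
qed

text \<open>Convergence on the product is convergence in mean of the fibre norms, hence convergence
  for almost every \<open>t\<close> along a subsequence. By \<open>K_pow_kernel\<close> the section
  of \<open>P\<close> then pairs with kernel vectors exactly as the character does.\<close>

lemma projection_section:
  fixes k :: 'a
  assumes P: "sqint PM P" and lim: "(\<lambda>n. norm_sq PM (\<lambda>z. (joint.K ^^ n) (\<lambda>z. character k (fst z)) z - P z)) \<longlonglongrightarrow> 0"
  shows "AE t in circ. sqint torus (\<lambda>x. P (x, t)) \<and>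
    (\<forall>a. sqint torus a \<longrightarrow> (AE x in torus. Sf t a x = 0) \<longrightarrow> ip torus (\<lambda>x. P (x, t)) a = ip torus (character k) a)"
proof -
  have U: "sqint PM (\<lambda>z. character k (fst z))"
    by (rule sqint_bounded[where C = 1]) (auto intro: P.finite_measure_axioms)
  define D where "D n z = (joint.K ^^ n) (\<lambda>z. character k (fst z)) z - P z" for n z
  have D: "sqint PM (D n)" for n unfolding D_def by (intro sqint_diff joint.K_pow_sqint U P)
  have "\<exists>r::nat\<Rightarrow>nat. strict_mono r \<and> (AE t in circ. (\<lambda>n. norm_sq torus (\<lambda>x. D (r n) (x, t))) \<longlonglongrightarrow> 0)"
  proof (rule tendsto_L1_AE_subseq)
    show "integrable circ (\<lambda>t. norm_sq torus (\<lambda>x. D n (x, t)))" for n by (rule P.norm_sq_sections[OF D])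
    show "(\<lambda>n. LINT t|circ. norm (norm_sq torus (\<lambda>x. D n (x, t)))) \<longlonglongrightarrow> 0"
      using lim P.norm_sq_sections(2)[OF D] by (simp add: D_def[abs_def])
  qed
  then obtain r :: "nat \<Rightarrow> nat" where r: "AE t in circ. (\<lambda>n. norm_sq torus (\<lambda>x. D (r n) (x, t))) \<longlonglongrightarrow> 0" by blast
  from r P.sqint_section_snd[OF P] show ?thesis
  proof eventually_elim
    fix t assume t: "(\<lambda>n. norm_sq torus (\<lambda>x. D (r n) (x, t))) \<longlonglongrightarrow> 0" and Pt: "sqint torus (\<lambda>x. P (x, t))"
    have "ip torus (\<lambda>x. P (x, t)) a = ip torus (character k) a" if a: "sqint torus a" "AE x in torus. Sf t a x = 0" for a
    proof (rule LIMSEQ_unique)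
      show "(\<lambda>n. ip torus ((fib.K t ^^ r n) (character k)) a) \<longlonglongrightarrow> ip torus (\<lambda>x. P (x, t)) a"
        by (rule tendsto_ip_left[OF a(1) _ Pt]) (use t in \<open>simp_all add: D_def joint_K_fib fib.K_pow_sqint sqint_character\<close>)
      show "(\<lambda>n. ip torus ((fib.K t ^^ r n) (character k)) a) \<longlonglongrightarrow> ip torus (character k) a"
        by (simp add: fib.K_pow_kernel[OF sqint_character a])
    qed
    with Pt show "sqint torus (\<lambda>x. P (x, t)) \<and>
    (\<forall>a. sqint torus a \<longrightarrow> (AE x in torus. Sf t a x = 0) \<longrightarrow> ip torus (\<lambda>x. P (x, t)) a = ip torus (character k) a)" by blast
  qed
qed

text \<open>Project every character onto the kernel. At a phase where all projections vanish, each
  kernel vector is orthogonal to all characters and hence zero, against \<open>eigen\<close>. So the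
  first nonvanishing projection is a choice of eigenfunction, and it is measurable because its index
  takes countably many values.\<close>

theorem eigenfunction_selection:
  obtains f where "sqint PM f" "AE t in circ. sqint torus (\<lambda>x. f (x, t)) \<and> norm_sq torus (\<lambda>x. f (x, t)) = 1"
    "AE z in PM. Sj f z = 0"
proof -
  define kk :: "nat \<Rightarrow> 'a" where "kk = from_nat_into int_lattice"
  have "(int_lattice :: 'a set) \<noteq> {}" using int_lattice_0 by blast
  then have kk: "range kk = int_lattice" unfolding kk_def using countable_int_lattice by (rule range_from_nat_into)
  have "\<exists>P. sqint PM P \<and> (\<lambda>n. norm_sq PM (\<lambda>z. (joint.K ^^ n) (\<lambda>z. character k (fst z)) z - P z)) \<longlonglongrightarrow> 0 \<and> (AE z in PM. Sj P z = 0)" for k :: 'a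
  proof -
    have "sqint PM (\<lambda>z. character k (fst z))"
      by (rule sqint_bounded[where C = 1]) (auto intro: P.finite_measure_axioms)
    from joint.K_pow_converges[OF this] show ?thesis by blast
  qed
  then have "\<forall>i. \<exists>P. sqint PM P \<and> (\<lambda>n. norm_sq PM (\<lambda>z. (joint.K ^^ n) (\<lambda>z. character (kk i) (fst z)) z - P z)) \<longlonglongrightarrow> 0 \<and> (AE z in PM. Sj P z = 0)"
    by blast
  from choice[OF this] obtain P where P: "\<And>i. sqint PM (P i)"
    "\<And>i. (\<lambda>n. norm_sq PM (\<lambda>z. (joint.K ^^ n) (\<lambda>z. character (kk i) (fst z)) z - P i z)) \<longlonglongrightarrow> 0" "\<And>i. AE z in PM. Sj (P i) z = 0" by blast
  note [measurable] = sqint_measurable[OF P(1)]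
  define N where "N i t = norm_sq torus (\<lambda>x. P i (x, t))" for i t
  have [measurable]: "N i \<in> borel_measurable circ" for i unfolding N_def
    by (rule borel_measurable_integrable) (rule P.norm_sq_sections[OF P(1)])
  \<comment> \<open>At phases without such an index \<open>LEAST\<close> is unspecified; these
    phases form a null set.\<close>
  define \<kappa> where "\<kappa> t = (LEAST i. N i t \<noteq> 0)" for t
  have \<kappa>[measurable]: "\<kappa> \<in> circ \<rightarrow>\<^sub>M count_space UNIV" unfolding \<kappa>_def by measurable
  define f where "f z = P (\<kappa> (snd z)) z / complex_of_real (sqrt (N (\<kappa> (snd z)) (snd z)))" for z
  have fm[measurable]: "f \<in> borel_measurable PM"
    unfolding f_def
    by (rule measurable_compose_countable[where g = "\<lambda>z. \<kappa> (snd z)" and f = "\<lambda>i z. P i z / complex_of_real (sqrt (N i (snd z)))"]) measurable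
  have "AE t in circ. \<forall>i. sqint torus (\<lambda>x. P i (x, t)) \<and>
    (\<forall>a. sqint torus a \<longrightarrow> (AE x in torus. Sf t a x = 0) \<longrightarrow> ip torus (\<lambda>x. P i (x, t)) a = ip torus (character (kk i)) a)"
    unfolding AE_all_countable using projection_section[OF P(1,2)] by blast
  from this eigen
  have unit: "AE t in circ. sqint torus (\<lambda>x. f (x, t)) \<and> norm_sq torus (\<lambda>x. f (x, t)) = 1"
  proof eventually_elim
    fix t assume 1: "\<forall>i. sqint torus (\<lambda>x. P i (x, t)) \<and>
      (\<forall>a. sqint torus a \<longrightarrow> (AE x in torus. Sf t a x = 0) \<longrightarrow> ip torus (\<lambda>x. P i (x, t)) a = ip torus (character (kk i)) a)"
      and "\<exists>a. sqint torus a \<and> norm_sq torus a \<noteq> 0 \<and>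
      (AE x in torus. e 1 t * a (translate \<alpha> x) + cnj (e 1 t) * a (translate (- \<alpha>) x) + of_real (v x) * a x = of_real (E t) * a x)"
    then obtain a where a: "sqint torus a" "norm_sq torus a \<noteq> 0"
      "AE x in torus. e 1 t * a (translate \<alpha> x) + cnj (e 1 t) * a (translate (- \<alpha>) x) + of_real (v x) * a x = of_real (E t) * a x" by blast
    have Sa: "AE x in torus. Sf t a x = 0"
      using a(3) by eventually_elim (simp add: Sf_def left_diff_distrib add_diff_eq)
    have "\<exists>i. N i t \<noteq> 0"
    proof (rule ccontr)
      assume "\<nexists>i. N i t \<noteq> 0"
      then have "ip torus (\<lambda>x. P i (x, t)) a = 0" for i
        using ip_zero_right[OF a(1), of "\<lambda>x. P i (x, t)"] 1 ip_cnj[of torus a "\<lambda>x. P i (x, t)"] by (simp add: N_def)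
      then have ip0: "ip torus (character (kk i)) a = 0" for i using 1 a(1) Sa by simp
      have "AE x in torus. a x = 0"
      proof (rule fourier_unique[OF integrable_sqint[OF finite_torus a(1)]])
        fix k :: 'a assume "k \<in> int_lattice"
        then have "- k \<in> range kk" unfolding kk by (rule int_lattice_uminus)
        then obtain i where "kk i = - k" by auto
        then show "(LINT x|torus. character k x * a x) = 0" using ip0[of i] by (simp add: ip_def character_uminus)
      qed
      then show False using a(2) norm_sq_zeroI by blast
    qed
    then have nz: "N (\<kappa> t) t \<noteq> 0" unfolding \<kappa>_def by (rule LeastI_ex)
    define c where "c = 1 / complex_of_real (sqrt (N (\<kappa> t) t))"
    have feq: "(\<lambda>x. f (x, t)) = (\<lambda>x. c * P (\<kappa> t) (x, t))" by (simp add: f_def c_def)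
    have Np: "N (\<kappa> t) t > 0" using nz by (simp add: N_def less_le)
    have "norm_sq torus (\<lambda>x. f (x, t)) = (cmod c)^2 * N (\<kappa> t) t" unfolding feq norm_sq_scale N_def ..
    also have "\<dots> = 1" using Np by (simp add: c_def norm_divide power_divide)
    finally show "sqint torus (\<lambda>x. f (x, t)) \<and> norm_sq torus (\<lambda>x. f (x, t)) = 1"
      unfolding feq using 1 sqint_cmult[of torus "\<lambda>x. P (\<kappa> t) (x, t)" c] by simp
  qed
  have f: "sqint PM f"
    by (rule P.sqint_pairI[OF fm, of "\<lambda>_. 1"]) (use unit in auto)
  have "AE z in PM. \<forall>i. Sj (P i) z = 0" unfolding AE_all_countable using P(3) by blast
  then have "AE z in PM. Sj f z = 0"
  proof eventually_elim
    fix z assume "\<forall>i. Sj (P i) z = 0"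
    then have "Sj (P (\<kappa> (snd z))) z = 0" by blast
    moreover have "Sj f z = Sj (P (\<kappa> (snd z))) z / complex_of_real (sqrt (N (\<kappa> (snd z)) (snd z)))"
      unfolding Sj_def Sf_def f_def by (simp add: add_divide_distrib)
    ultimately show "Sj f z = 0" by simp
  qed
  with f unit that show ?thesis by blast
qed

end

section \<open>The Zak transform\<close>

text \<open>The conjugates of the \<open>e n\<close>, so that \<open>coef F n x\<close> is the
  integral of e(n t) F(x, t) over t.\<close>

definition en :: "int \<Rightarrow> real \<Rightarrow> complex" where "en n = e (- n)"

lemma complete_orthonormal_en: "complete_orthonormal circ en"
proof -
  have "ip circ (e (- i)) u = 0" if "\<forall>i. ip circ (en i) u = 0" for i u using that by (simp add: en_def)
  then have "ip circ (e i) u = 0" if "\<forall>i. ip circ (en i) u = 0" for i u using that by (metis minus_minus)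
  then show ?thesis
    using complete_orthonormal_e unfolding complete_orthonormal_def orthonormal_def en_def by (auto simp: en_def)
qed

lemma sqint_e: "sqint circ (e n)" unfolding e_def[abs_def] by (rule sqint_character)

definition orbit :: "'a::euclidean_space \<Rightarrow> int \<Rightarrow> 'a \<Rightarrow> 'a" where
  "orbit \<alpha> n = translate (of_int n *\<^sub>R \<alpha>)"

definition coef :: "('a \<times> real \<Rightarrow> complex) \<Rightarrow> int \<Rightarrow> 'a \<Rightarrow> complex" where
  "coef F n x = ip circ (en n) (\<lambda>t. F (x, t))"

text \<open>The n-th entry is the integral of e(n t) F(x + n \<alpha>, t) over t. For F(x, t) = c(t)
  f(x, t) this superposes the generalised eigenfunctions of H(x) with weight c.\<close>

definition zak :: "'a::euclidean_space \<Rightarrow> ('a \<times> real \<Rightarrow> complex) \<Rightarrow> 'a \<Rightarrow> int \<Rightarrow> complex" where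
  "zak \<alpha> F x n = coef F n (orbit \<alpha> n x)"

lemma orbit_in_cube[simp]: "orbit \<alpha> n x \<in> cube" by (simp add: orbit_def)
lemma orbit_measurable[measurable]: "orbit \<alpha> n \<in> torus \<rightarrow>\<^sub>M torus" by (simp add: orbit_def)

lemma orbit_orbit: "orbit \<alpha> m (orbit \<alpha> n x) = orbit \<alpha> (m + n) x"
  by (simp add: orbit_def translate_translate scaleR_add_left)

lemma orbit_0: "x \<in> cube \<Longrightarrow> orbit \<alpha> 0 x = x" by (simp add: orbit_def translate_0)

lemma orbit_1: "orbit \<alpha> 1 = translate \<alpha>" "orbit \<alpha> (- 1) = translate (- \<alpha>)" by (simp_all add: orbit_def)

lemma measure_preserving_pair_orbit: "measure_preserving_pair torus (orbit \<alpha> n) (orbit \<alpha> (- n))"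
  using measure_preserving_pair_translate[of "of_int n *\<^sub>R \<alpha>"] by (simp add: orbit_def)

text \<open>Each slice is a translation of the torus. This allows the n-dependent shift in
  \<open>zak\<close> to be undone under an integral over integers times torus.\<close>

lemma measure_preserving_pair_skew: "measure_preserving_pair (CS \<Otimes>\<^sub>M torus) (\<lambda>(n, x). (n, orbit \<alpha> n x)) (\<lambda>(n, x). (n, orbit \<alpha> (- n) x))"
proof
  interpret X: prob_space "torus :: 'a measure" by (rule prob_space_torus)
  have m: "(\<lambda>(n, x). (n, orbit \<alpha> (s * n) x)) \<in> CS \<Otimes>\<^sub>M torus \<rightarrow>\<^sub>M CS \<Otimes>\<^sub>M torus" for s
  proof -
    have "(\<lambda>(n, x). orbit \<alpha> (s * n) x) \<in> CS \<Otimes>\<^sub>M torus \<rightarrow>\<^sub>M torus"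
      by (rule measurable_pair_measure_countable1) auto
    then have "(\<lambda>z. (fst z, (\<lambda>(n, x). orbit \<alpha> (s * n) x) z)) \<in> CS \<Otimes>\<^sub>M torus \<rightarrow>\<^sub>M CS \<Otimes>\<^sub>M torus" by measurable
    then show ?thesis by (simp add: case_prod_beta')
  qed
  show m1: "(\<lambda>(n, x). (n, orbit \<alpha> n x)) \<in> CS \<Otimes>\<^sub>M torus \<rightarrow>\<^sub>M CS \<Otimes>\<^sub>M torus" using m[of 1] by simp
  show "(\<lambda>(n, x). (n, orbit \<alpha> (- n) x)) \<in> CS \<Otimes>\<^sub>M torus \<rightarrow>\<^sub>M CS \<Otimes>\<^sub>M torus" using m[of "-1"] by simp
  show "distr (CS \<Otimes>\<^sub>M torus) (CS \<Otimes>\<^sub>M torus) (\<lambda>(n, x). (n, orbit \<alpha> n x)) = CS \<Otimes>\<^sub>M torus"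
  proof (rule measure_eqI)
    fix A assume "A \<in> sets (distr (CS \<Otimes>\<^sub>M torus) (CS \<Otimes>\<^sub>M torus) (\<lambda>(n, x). (n, orbit \<alpha> n x)))"
    then have A: "A \<in> sets (CS \<Otimes>\<^sub>M torus)" by simp
    let ?pre = "(\<lambda>(n, x). (n, orbit \<alpha> n x)) -` A \<inter> space (CS \<Otimes>\<^sub>M torus)"
    have "emeasure (distr (CS \<Otimes>\<^sub>M torus) (CS \<Otimes>\<^sub>M torus) (\<lambda>(n, x). (n, orbit \<alpha> n x))) A = emeasure (CS \<Otimes>\<^sub>M torus) ?pre"
      by (rule emeasure_distr[OF m1 A])
    also have "\<dots> = (\<integral>\<^sup>+n. emeasure torus (Pair n -` ?pre) \<partial>CS)"
      by (rule X.emeasure_pair_measure_alt) (rule measurable_sets[OF m1 A])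
    also have "\<dots> = (\<integral>\<^sup>+n. emeasure torus (Pair n -` A) \<partial>CS)"
    proof (rule nn_integral_cong)
      fix n
      have s: "Pair n -` A \<in> sets torus" using A by (rule sets_Pair1)
      have "Pair n -` ?pre = orbit \<alpha> n -` (Pair n -` A) \<inter> space torus" by (auto simp: space_pair_measure)
      then have "emeasure torus (Pair n -` ?pre) = emeasure (distr torus torus (orbit \<alpha> n)) (Pair n -` A)"
        using s by (simp add: emeasure_distr)
      then show "emeasure torus (Pair n -` ?pre) = emeasure torus (Pair n -` A)" by (simp add: orbit_def distr_translate)
    qed
    also have "\<dots> = emeasure (CS \<Otimes>\<^sub>M torus) A" by (rule X.emeasure_pair_measure_alt[OF A, symmetric])
    finally show "emeasure (distr (CS \<Otimes>\<^sub>M torus) (CS \<Otimes>\<^sub>M torus) (\<lambda>(n, x). (n, orbit \<alpha> n x))) A = emeasure (CS \<Otimes>\<^sub>M torus) A" .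
  qed simp
qed (auto simp: space_pair_measure orbit_orbit orbit_0)

context
  fixes F :: "'a::euclidean_space \<times> real \<Rightarrow> complex"
  assumes F: "sqint (torus \<Otimes>\<^sub>M circ) F"
begin

lemma coef_measurable[measurable]: "coef F n \<in> borel_measurable torus"
proof -
  interpret C: prob_space circ by (rule prob_space_torus)
  note [measurable] = sqint_measurable[OF F]
  show ?thesis unfolding coef_def ip_def en_def by measurable
qed

lemma sqint_coef: "sqint (CS \<Otimes>\<^sub>M torus) (\<lambda>(n, x). coef F n x)"
proof -
  interpret X: prob_space "torus :: 'a measure" by (rule prob_space_torus)
  interpret C: prob_space circ by (rule prob_space_torus)
  interpret I: sigma_finite_measure CS by (rule sigma_finite_CS)
  interpret P: pair_prob_space "torus :: 'a measure" circ ..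
  interpret Q: pair_sigma_finite CS "torus :: 'a measure" ..
  show ?thesis
  proof (rule Q.sqint_pairI)
    show "(\<lambda>(n, x). coef F n x) \<in> borel_measurable (CS \<Otimes>\<^sub>M torus)"
      by (rule measurable_pair_measure_countable1) auto
    show "integrable torus (\<lambda>x. norm_sq circ (\<lambda>t. F (x, t)))" by (rule P.norm_sq_sections[OF F])
    show "AE x in torus. sqint CS (\<lambda>n. case (n, x) of (n, x) \<Rightarrow> coef F n x) \<and> norm_sq CS (\<lambda>n. case (n, x) of (n, x) \<Rightarrow> coef F n x) \<le> norm_sq circ (\<lambda>t. F (x, t))"
      using P.sqint_section_fst[OF F]
    proof eventually_elim
      fix x assume "sqint circ (\<lambda>t. F (x, t))"
      moreover have "orthonormal circ en" using complete_orthonormal_en by (simp add: complete_orthonormal_def)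
      ultimately show "sqint CS (\<lambda>n. case (n, x) of (n, x) \<Rightarrow> coef F n x) \<and> norm_sq CS (\<lambda>n. case (n, x) of (n, x) \<Rightarrow> coef F n x) \<le> norm_sq circ (\<lambda>t. F (x, t))"
        unfolding coef_def using bessel by auto
    qed
  qed
qed

lemma sqint_zak_pair: "sqint (CS \<Otimes>\<^sub>M torus) (\<lambda>(n, x). zak \<alpha> F x n)"
proof -
  interpret measure_preserving_pair "CS \<Otimes>\<^sub>M torus" "\<lambda>(n, x). (n, orbit \<alpha> n x)" "\<lambda>(n, x). (n, orbit \<alpha> (- n) x)" by (rule measure_preserving_pair_skew)
  show ?thesis using sqint_comp[OF sqint_coef] by (simp add: zak_def case_prod_beta')
qed

lemma sqint_zak: "AE x in torus. sqint CS (zak \<alpha> F x)"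
proof -
  interpret X: prob_space "torus :: 'a measure" by (rule prob_space_torus)
  interpret I: sigma_finite_measure CS by (rule sigma_finite_CS)
  interpret Q: pair_sigma_finite CS "torus :: 'a measure" ..
  show ?thesis using Q.sqint_section_snd[OF sqint_zak_pair] by simp
qed

end

lemma zak_integrable:
  fixes \<alpha> :: "'a::euclidean_space"
  assumes F: "sqint (torus \<Otimes>\<^sub>M circ) F" and G: "sqint (torus \<Otimes>\<^sub>M circ) G"
  shows "integrable torus (\<lambda>x. ip CS (zak \<alpha> F x) (zak \<alpha> G x))"
proof -
  interpret X: prob_space "torus :: 'a measure" by (rule prob_space_torus)
  interpret I: sigma_finite_measure CS by (rule sigma_finite_CS)
  interpret Q: pair_sigma_finite CS "torus :: 'a measure" ..
  have "integrable (CS \<Otimes>\<^sub>M torus) (\<lambda>z. cnj ((\<lambda>(n, x). zak \<alpha> F x n) z) * (\<lambda>(n, x). zak \<alpha> G x n) z)"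
    by (intro integrable_ip sqint_zak_pair F G)
  then have "integrable (CS \<Otimes>\<^sub>M torus) (\<lambda>(n, x). cnj (zak \<alpha> F x n) * zak \<alpha> G x n)" by (simp add: case_prod_beta')
  from Q.integrable_snd[OF this] show ?thesis by (simp add: ip_def)
qed

text \<open>Substituting x - n \<alpha> for x in the n-th term removes the orbit shift and leaves a
  factor e(n s). On Fourier coefficients in \<open>t\<close> this factor is translation of the
  second function by \<open>s\<close>, and Parseval in \<open>n\<close> closes the sum.\<close>

lemma zak_fourier:
  fixes \<alpha> :: "'a::euclidean_space"
  assumes F: "sqint (torus \<Otimes>\<^sub>M circ) F" and G: "sqint (torus \<Otimes>\<^sub>M circ) G" and k: "k \<in> int_lattice"
  defines "s \<equiv> k \<bullet> \<alpha>"
  shows "(LINT x|torus. cnj (character k x) * ip CS (zak \<alpha> F x) (zak \<alpha> G x))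
      = (LINT t|circ. ip torus (\<lambda>x. character k x * F (x, t)) (\<lambda>x. G (x, translate (- s) t)))"
    and "integrable circ (\<lambda>t. ip torus (\<lambda>x. character k x * F (x, t)) (\<lambda>x. G (x, translate (- s) t)))"
proof -
  interpret X: prob_space "torus :: 'a measure" by (rule prob_space_torus)
  interpret C: prob_space circ by (rule prob_space_torus)
  interpret I: sigma_finite_measure CS by (rule sigma_finite_CS)
  interpret P: pair_prob_space "torus :: 'a measure" circ ..
  interpret Q: pair_sigma_finite CS "torus :: 'a measure" ..
  interpret sk: measure_preserving_pair "CS \<Otimes>\<^sub>M torus" "\<lambda>(n, x). (n, orbit \<alpha> n x)" "\<lambda>(n, x). (n, orbit \<alpha> (- n) x)" by (rule measure_preserving_pair_skew)
  interpret sh: measure_preserving_pair circ "translate (- s)" "translate (- (- s))" by (rule measure_preserving_pair_translate)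
  have "measure_preserving_pair (torus \<Otimes>\<^sub>M circ) (\<lambda>(x, t). (x, translate (- s) t)) (\<lambda>(x, t). (x, translate (- (- s)) t))"
    by (rule measure_preserving_pair_prod[OF measure_preserving_pair_id measure_preserving_pair_translate]) unfold_locales
  then interpret psh: measure_preserving_pair "torus \<Otimes>\<^sub>M circ" "\<lambda>(x, t). (x :: 'a, translate (- s) t)" "\<lambda>(x, t). (x, translate (- (- s)) t)" .
  define G' where "G' z = G (fst z, translate (- s) (snd z))" for z
  have G': "sqint (torus \<Otimes>\<^sub>M circ) G'" unfolding G'_def using psh.sqint_comp[OF G] by (simp add: case_prod_beta')
  have chF: "sqint (torus \<Otimes>\<^sub>M circ) (\<lambda>z. character k (fst z) * F z)"
    by (rule sqint_mult_bounded[OF F, where C = 1]) auto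
  have intP: "integrable (torus \<Otimes>\<^sub>M circ) (\<lambda>(x, t). cnj (character k x * F (x, t)) * G (x, translate (- s) t))"
    using integrable_ip[OF chF G'] by (simp add: case_prod_beta' G'_def)
  show "integrable circ (\<lambda>t. ip torus (\<lambda>x. character k x * F (x, t)) (\<lambda>x. G (x, translate (- s) t)))"
    using P.integrable_snd[OF intP] by (simp add: ip_def)
  have character_orbit: "cnj (character k (orbit \<alpha> (- n) x)) = e n s * cnj (character k x)" for n x
    using character_translate[OF k, of "of_int (- n) *\<^sub>R \<alpha>" x] by (simp add: orbit_def s_def e_def character_def cis_cnj algebra_simps)
  define \<Psi> where "\<Psi> n x = cnj (character k (orbit \<alpha> (- n) x)) * (cnj (coef F n x) * coef G n x)" for n x
  have \<Psi>int: "integrable (CS \<Otimes>\<^sub>M torus) (\<lambda>(n, x). \<Psi> n x)"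
  proof -
    have "integrable (CS \<Otimes>\<^sub>M torus) (\<lambda>z. cnj ((\<lambda>(n, x). coef F n x) z) * (\<lambda>(n, x). coef G n x) z)"
      by (intro integrable_ip sqint_coef F G)
    then have 1: "integrable (CS \<Otimes>\<^sub>M torus) (\<lambda>(n, x). cnj (coef F n x) * coef G n x)" by (simp add: case_prod_beta')
    have 2: "(\<lambda>(n, x). cnj (character k (orbit \<alpha> (- n) x))) \<in> borel_measurable (CS \<Otimes>\<^sub>M torus)"
      by (rule measurable_pair_measure_countable1) auto
    have "integrable (CS \<Otimes>\<^sub>M torus) (\<lambda>z. (\<lambda>(n, x). cnj (character k (orbit \<alpha> (- n) x))) z * (\<lambda>(n, x). cnj (coef F n x) * coef G n x) z)"
      by (rule integrable_mult_bounded[OF 1 2, of 1]) auto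
    then show ?thesis by (simp add: \<Psi>_def case_prod_beta')
  qed
  have "(LINT x|torus. cnj (character k x) * ip CS (zak \<alpha> F x) (zak \<alpha> G x)) = (LINT x|torus. LINT n|CS. \<Psi> n (orbit \<alpha> n x))"
  proof (rule Bochner_Integration.integral_cong[OF refl])
    fix x :: 'a assume "x \<in> space torus"
    then have "character k (orbit \<alpha> (- n) (orbit \<alpha> n x)) = character k x" for n by (simp add: orbit_orbit orbit_0)
    then have "\<Psi> n (orbit \<alpha> n x) = cnj (character k x) * (cnj (zak \<alpha> F x n) * zak \<alpha> G x n)" for n by (simp add: \<Psi>_def zak_def)
    then show "cnj (character k x) * ip CS (zak \<alpha> F x) (zak \<alpha> G x) = (LINT n|CS. \<Psi> n (orbit \<alpha> n x))"
      by (simp add: ip_def)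
  qed
  also have "\<dots> = (LINT z|(CS \<Otimes>\<^sub>M torus). (\<lambda>(n, x). \<Psi> n x) ((\<lambda>(n, x). (n, orbit \<alpha> n x)) z))"
    using Q.integral_snd[of "\<lambda>n x. \<Psi> n (orbit \<alpha> n x)"] sk.integrable_comp[OF \<Psi>int] by (simp add: case_prod_beta')
  also have "\<dots> = (LINT z|(CS \<Otimes>\<^sub>M torus). (\<lambda>(n, x). \<Psi> n x) z)"
    by (rule sk.integral_comp[OF borel_measurable_integrable[OF \<Psi>int]])
  also have "\<dots> = (LINT x|torus. LINT n|CS. \<Psi> n x)" by (rule Q.integral_snd[OF \<Psi>int, symmetric])
  also have "\<dots> = (LINT x|torus. cnj (character k x) * ip circ (\<lambda>t. F (x, t)) (\<lambda>t. G (x, translate (- s) t)))"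
  proof (rule integral_cong_AE)
    have "AE x in torus. sqint circ (\<lambda>t. F (x, t)) \<and> sqint circ (\<lambda>t. G (x, t))"
      using P.sqint_section_fst[OF F] P.sqint_section_fst[OF G] by eventually_elim simp
    then show "AE x in torus. (LINT n|CS. \<Psi> n x) = cnj (character k x) * ip circ (\<lambda>t. F (x, t)) (\<lambda>t. G (x, translate (- s) t))"
    proof eventually_elim
      fix x assume x: "sqint circ (\<lambda>t. F (x, t)) \<and> sqint circ (\<lambda>t. G (x, t))"
      then have Gs: "sqint circ (\<lambda>t. G (x, translate (- s) t))" using sh.sqint_comp[of "\<lambda>t. G (x, t)"] by simp
      have "ip circ (en n) (\<lambda>t. G (x, translate (- s) t)) = e n s * coef G n x" for n
      proof -
        note [measurable] = sqint_measurable[OF x[THEN conjunct2]]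
        have [simp]: "e n s * e n (- s) = 1" using e_translate[of n s "- s"] by (simp add: e_def character_uminus_right)
        have "(LINT t|circ. (\<lambda>t. e n s * (e n t * G (x, t))) (translate (- s) t)) = (LINT t|circ. e n s * (e n t * G (x, t)))"
          by (rule sh.integral_comp) measurable
        moreover have "e n s * (e n (translate (- s) t) * G (x, translate (- s) t)) = e n t * G (x, translate (- s) t)" for t
        proof -
          have "e n s * (e n (translate (- s) t) * G (x, translate (- s) t)) = (e n s * e n (- s)) * (e n t * G (x, translate (- s) t))"
            by (simp only: e_translate mult_ac)
          then show ?thesis by simp
        qed
        ultimately show ?thesis by (simp add: ip_def coef_def en_def cnj_e)
      qed
      then have "(LINT n|CS. \<Psi> n x) = (LINT n|CS. cnj (character k x) * (cnj (ip circ (en n) (\<lambda>t. F (x, t))) * ip circ (en n) (\<lambda>t. G (x, translate (- s) t))))"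
        by (intro Bochner_Integration.integral_cong) (auto simp: \<Psi>_def character_orbit coef_def mult_ac)
      also have "\<dots> = cnj (character k x) * ip CS (\<lambda>n. ip circ (en n) (\<lambda>t. F (x, t))) (\<lambda>n. ip circ (en n) (\<lambda>t. G (x, translate (- s) t)))"
        by (simp add: ip_def)
      also have "\<dots> = cnj (character k x) * ip circ (\<lambda>t. F (x, t)) (\<lambda>t. G (x, translate (- s) t))"
        using parseval[OF complete_orthonormal_en x[THEN conjunct1] Gs] by simp
      finally show "(LINT n|CS. \<Psi> n x) = cnj (character k x) * ip circ (\<lambda>t. F (x, t)) (\<lambda>t. G (x, translate (- s) t))" .
    qed
    show "(\<lambda>x. LINT n|CS. \<Psi> n x) \<in> borel_measurable torus" using Q.integrable_snd[OF \<Psi>int] by auto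
    have "integrable torus (\<lambda>x. LINT t|circ. cnj (character k x * F (x, t)) * G (x, translate (- s) t))"
      using P.integrable_fst[OF intP] .
    then show "(\<lambda>x. cnj (character k x) * ip circ (\<lambda>t. F (x, t)) (\<lambda>t. G (x, translate (- s) t))) \<in> borel_measurable torus"
      by (auto simp: ip_def mult.assoc)
  qed
  also have "\<dots> = (LINT x|torus. LINT t|circ. cnj (character k x * F (x, t)) * G (x, translate (- s) t))"
    by (simp add: ip_def mult.assoc)
  also have "\<dots> = (LINT t|circ. LINT x|torus. cnj (character k x * F (x, t)) * G (x, translate (- s) t))"
    by (rule P.Fubini_integral[OF intP, symmetric])
  also have "\<dots> = (LINT t|circ. ip torus (\<lambda>x. character k x * F (x, t)) (\<lambda>x. G (x, translate (- s) t)))"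
    by (simp add: ip_def)
  finally show "(LINT x|torus. cnj (character k x) * ip CS (zak \<alpha> F x) (zak \<alpha> G x))
      = (LINT t|circ. ip torus (\<lambda>x. character k x * F (x, t)) (\<lambda>x. G (x, translate (- s) t)))" .
qed

section \<open>Generalised eigenfunctions form a basis\<close>

locale quasiperiodic_basis = quasiperiodic +
  fixes f :: "'a \<times> real \<Rightarrow> complex"
  assumes f: "sqint PM f" and f_unit: "AE t in circ. sqint torus (\<lambda>x. f (x, t)) \<and> norm_sq torus (\<lambda>x. f (x, t)) = 1"
    and f_eq: "AE z in PM. Sj f z = 0"
begin

lemma f_measurable[measurable]: "f \<in> borel_measurable PM" using f by (rule sqint_measurable)

lemma Sj_measurable[measurable]: "Sj f \<in> borel_measurable PM"
  by (rule sqint_measurable[OF joint.S_sqint[OF f]])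

lemma f_eq_fst: "AE x in torus. AE t in circ. Sj f (x, t) = 0"
  using P.AE_pair[OF f_eq] by simp

lemma f_eq_snd: "AE t in circ. AE x in torus. Sf t (\<lambda>x. f (x, t)) x = 0"
proof -
  have "(AE x in torus. AE t in circ. Sj f (x, t) = 0) = (AE t in circ. AE x in torus. Sj f (x, t) = 0)"
    by (rule P.AE_commute) measurable
  then show ?thesis using f_eq_fst by (simp add: Sj_def)
qed

text \<open>Multiplication by \<open>character k\<close> carries the dual operator at phase t into
  the one at phase t - s, where s = k\<cdot>\<alpha>. Both functions are thus eigenfunctions of the
  same symmetric operator, with the distinct eigenvalues E(t) and E(t - s).\<close>

lemma translate_orthogonal:
  assumes k: "k \<in> int_lattice" "k \<noteq> 0"
  shows "AE t in circ. ip torus (\<lambda>x. character k x * f (x, t)) (\<lambda>x. f (x, translate (- (k \<bullet> \<alpha>)) t)) = 0"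
proof -
  define s where "s = k \<bullet> \<alpha>"
  interpret sh: measure_preserving_pair circ "translate (- s)" "translate (- (- s))" by (rule measure_preserving_pair_translate)
  have "AE t in circ. sqint torus (\<lambda>x. f (x, t)) \<and> (AE x in torus. Sf t (\<lambda>x. f (x, t)) x = 0)"
    using f_unit f_eq_snd by eventually_elim simp
  moreover from sh.AE_comp[OF this] have "AE t in circ. sqint torus (\<lambda>x. f (x, translate (- s) t)) \<and> (AE x in torus. Sf (translate (- s) t) (\<lambda>x. f (x, translate (- s) t)) x = 0)" .
  moreover note separated[OF k, folded s_def]
  ultimately show ?thesis unfolding s_def[symmetric]
  proof eventually_elim
    fix t
    assume 1: "sqint torus (\<lambda>x. f (x, t)) \<and> (AE x in torus. Sf t (\<lambda>x. f (x, t)) x = 0)"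
      and 2: "sqint torus (\<lambda>x. f (x, translate (- s) t)) \<and> (AE x in torus. Sf (translate (- s) t) (\<lambda>x. f (x, translate (- s) t)) x = 0)"
      and ne: "E t \<noteq> E (translate (- s) t)"
    define t' where "t' = translate (- s) t"
    let ?u = "\<lambda>x. character k x * f (x, t)" and ?w = "\<lambda>x. f (x, t')"
    have u: "sqint torus ?u" by (rule sqint_mult_bounded[where C = 1]) (use 1 in auto)
    have w: "sqint torus ?w" using 2 by (simp add: t'_def)
    have et: "e 1 t' = e 1 t * cnj (e 1 s)"
      by (simp add: t'_def e_translate mult.commute) (simp add: e_def character_uminus_right)
    have cha: "character k \<alpha> = e 1 s" by (simp add: e_def character_def s_def)
    have ee: "cnj (e 1 s) * e 1 s = 1" by (simp add: e_def)
    have Su: "AE x in torus. Sf t' ?u x = of_real (E t - E t') * ?u x"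
      using 1[THEN conjunct2]
    proof eventually_elim
      fix x assume x: "Sf t (\<lambda>x. f (x, t)) x = 0"
      have "Sf t' ?u x = (cnj (e 1 s) * e 1 s) * (character k x * (e 1 t * f (translate \<alpha> x, t)))
          + (cnj (e 1 s) * e 1 s) * (character k x * (cnj (e 1 t) * f (translate (- \<alpha>) x, t))) + character k x * (of_real (v x - E t') * f (x, t))"
        unfolding Sf_def et character_translate[OF k(1)] cha character_uminus_right by (simp add: mult_ac)
      also have "\<dots> = character k x * Sf t (\<lambda>x. f (x, t)) x + of_real (E t - E t') * ?u x"
        unfolding ee Sf_def by (simp add: algebra_simps)
      finally show "Sf t' ?u x = of_real (E t - E t') * ?u x" using x by simp
    qed
    have "ip torus (Sf t' ?u) ?w = ip torus ?u (Sf t' ?w)" by (rule fib.S_symmetric[OF u w])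
    also have "\<dots> = 0"
      by (rule ip_zero_right[OF u fib.S_sqint[OF w]]) (use 2 in \<open>auto intro: norm_sq_zeroI simp: t'_def\<close>)
    also have "ip torus (Sf t' ?u) ?w = ip torus (\<lambda>x. of_real (E t - E t') * ?u x) ?w"
      unfolding ip_def
    proof (rule integral_cong_AE)
      show "AE x in torus. cnj (Sf t' ?u x) * ?w x = cnj (of_real (E t - E t') * ?u x) * ?w x"
        using Su by eventually_elim simp
    qed (use sqint_measurable[OF fib.S_sqint[OF u, of t']] sqint_measurable[OF u] sqint_measurable[OF w] in measurable)
    also have "\<dots> = of_real (E t - E t') * ip torus ?u ?w"
      unfolding ip_scale_left by simp
    finally show "ip torus ?u (\<lambda>x. f (x, translate (- s) t)) = 0" using ne by (simp add: t'_def)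
  qed
qed

definition cf :: "(real \<Rightarrow> complex) \<Rightarrow> 'a \<times> real \<Rightarrow> complex" where "cf c z = c (snd z) * f z"

lemma sqint_cf: "c \<in> borel_measurable circ \<Longrightarrow> (\<And>t. cmod (c t) \<le> C) \<Longrightarrow> sqint PM (cf c)"
  unfolding cf_def by (rule sqint_mult_bounded[OF f]) auto

text \<open>By \<open>zak_fourier\<close> the Fourier coefficient at k averages correlations of f at
  phases t and t - k\<cdot>\<alpha>. These vanish for nonzero k, and for k = 0 the fibre norm 1
  leaves the orthonormality of the \<open>e m\<close>. So the inner product is constant in
  x.\<close>

lemma zak_cf_columns: "AE x in torus. ip CS (zak \<alpha> (cf (e m)) x) (zak \<alpha> (cf (e l)) x) = (if m = l then 1 else 0)"
proof (rule fourier_unique_const)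
  have sq: "sqint PM (cf (e n))" for n by (rule sqint_cf[where C = 1]) auto
  show "integrable torus (\<lambda>x. ip CS (zak \<alpha> (cf (e m)) x) (zak \<alpha> (cf (e l)) x))" by (intro zak_integrable sq)
  fix k :: 'a assume k: "k \<in> int_lattice"
  define s where "s = k \<bullet> \<alpha>"
  have int: "integrable circ (\<lambda>t. ip torus (\<lambda>x. character k x * cf (e m) (x, t)) (\<lambda>x. cf (e l) (x, translate (- s) t)))"
    unfolding s_def by (rule zak_fourier(2)[OF sq sq k])
  have fib: "ip torus (\<lambda>x. character k x * cf (e m) (x, t)) (\<lambda>x. cf (e l) (x, translate (- s) t))
     = cnj (e m t) * e l (translate (- s) t) * ip torus (\<lambda>x. character k x * f (x, t)) (\<lambda>x. f (x, translate (- s) t))" for t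
  proof -
    have "ip torus (\<lambda>x. character k x * cf (e m) (x, t)) (\<lambda>x. cf (e l) (x, translate (- s) t))
       = ip torus (\<lambda>x. e m t * (character k x * f (x, t))) (\<lambda>x. e l (translate (- s) t) * f (x, translate (- s) t))"
      by (simp add: cf_def mult_ac)
    then show ?thesis unfolding ip_scale_left ip_scale_right by simp
  qed
  have "(LINT x|torus. cnj (character k x) * ip CS (zak \<alpha> (cf (e m)) x) (zak \<alpha> (cf (e l)) x))
      = (LINT t|circ. ip torus (\<lambda>x. character k x * cf (e m) (x, t)) (\<lambda>x. cf (e l) (x, translate (- s) t)))"
    unfolding s_def by (rule zak_fourier(1)[OF sq sq k])
  also have "\<dots> = (if k = 0 then if m = l then 1 else 0 else 0)"
  proof (cases "k = 0")
    case False
    have "AE t in circ. ip torus (\<lambda>x. character k x * cf (e m) (x, t)) (\<lambda>x. cf (e l) (x, translate (- s) t)) = 0"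
      using translate_orthogonal[OF k False] unfolding s_def[symmetric] by eventually_elim (simp add: fib)
    then show ?thesis using False by (simp add: integral_eq_zero_AE)
  next
    case True
    have "(LINT t|circ. ip torus (\<lambda>x. character k x * cf (e m) (x, t)) (\<lambda>x. cf (e l) (x, translate (- s) t))) = (LINT t|circ. cnj (e m t) * e l t)"
    proof (rule integral_cong_AE)
      have "AE t in circ. t \<in> cube" by (rule AE_I2) simp
      with f_unit show "AE t in circ. ip torus (\<lambda>x. character k x * cf (e m) (x, t)) (\<lambda>x. cf (e l) (x, translate (- s) t)) = cnj (e m t) * e l t"
      proof eventually_elim
        fix t :: real assume "sqint torus (\<lambda>x. f (x, t)) \<and> norm_sq torus (\<lambda>x. f (x, t)) = 1" "t \<in> cube"
        then show "ip torus (\<lambda>x. character k x * cf (e m) (x, t)) (\<lambda>x. cf (e l) (x, translate (- s) t)) = cnj (e m t) * e l t"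
          unfolding fib using True by (simp add: s_def translate_0 ip_self)
      qed
    qed (use int in \<open>auto intro: borel_measurable_integrable\<close>)
    also have "\<dots> = (if m = l then 1 else 0)"
      using complete_orthonormal_e unfolding complete_orthonormal_def orthonormal_def ip_def by simp
    finally show ?thesis using True by simp
  qed
  finally show "(LINT x|torus. cnj (character k x) * ip CS (zak \<alpha> (cf (e m)) x) (zak \<alpha> (cf (e l)) x))
      = (if k = 0 then if m = l then 1 else 0 else 0)" .
qed

text \<open>Conjugated because \<open>ip\<close> is conjugate-linear on the left:
  \<open>ip circ (\<phi> x n) c\<close> is the plain integral of e(n t) f(x + n \<alpha>, t)
  c(t).\<close>

definition \<phi> :: "'a \<Rightarrow> int \<Rightarrow> real \<Rightarrow> complex" where
  "\<phi> x n t = cnj (e n t * f (orbit \<alpha> n x, t))"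

lemma zak_cf: "zak \<alpha> (cf c) x n = ip circ (\<phi> x n) c"
  by (simp add: zak_def coef_def ip_def cf_def \<phi>_def en_def cnj_e mult_ac)

lemma AE_all_orbit: assumes "AE x in torus. Q x" shows "AE x in torus. \<forall>n. Q (orbit \<alpha> n x)"
  unfolding AE_all_countable
proof
  fix n
  interpret measure_preserving_pair torus "orbit \<alpha> n" "orbit \<alpha> (- n)" by (rule measure_preserving_pair_orbit)
  show "AE x in torus. Q (orbit \<alpha> n x)" by (rule AE_comp[OF assms])
qed

lemma sqint_f_sections: "AE x in torus. \<forall>n. sqint circ (\<lambda>t. f (orbit \<alpha> n x, t))"
  by (rule AE_all_orbit) (rule P.sqint_section_fst[OF f])

lemma sqint_\<phi>I: "sqint circ (\<lambda>t. f (orbit \<alpha> n x, t)) \<Longrightarrow> sqint circ (\<phi> x n)"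
  unfolding \<phi>_def by (intro sqint_cnj sqint_mult_bounded[where C = 1]) auto

lemma norm_sq_\<phi>: "norm_sq circ (\<phi> x n) = norm_sq circ (\<lambda>t. f (orbit \<alpha> n x, t))"
  by (simp add: norm_sq_def \<phi>_def norm_mult)

text \<open>\<open>zak_cf_columns\<close> makes \<open>\<phi> x\<close> a Parseval frame, so
  \<open>r\<close>, the squared norm over t of f at the point x, is at most 1. Its mean is
  \<open>norm_sq PM f = 1\<close>, hence it is 1 almost everywhere, and along the whole orbit of
  almost every x. A Parseval frame of unit vectors is an orthonormal basis.\<close>

theorem complete_orthonormal_\<phi>: "AE x in torus. complete_orthonormal circ (\<phi> x)"
proof -
  have sq: "sqint PM (cf (e n))" for n by (rule sqint_cf[where C = 1]) auto
  have "AE x in torus. \<forall>m l. ip CS (zak \<alpha> (cf (e m)) x) (zak \<alpha> (cf (e l)) x) = (if m = l then 1 else 0)"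
    unfolding AE_all_countable using zak_cf_columns by blast
  moreover have "AE x in torus. \<forall>m. sqint CS (zak \<alpha> (cf (e m)) x)"
    unfolding AE_all_countable using sqint_zak[OF sq] by blast
  moreover note sqint_f_sections
  ultimately have fr: "AE x in torus. (\<forall>n. sqint circ (\<phi> x n)) \<and> orthonormal CS (\<lambda>m n. ip circ (\<phi> x n) (e m))"
    by eventually_elim (auto simp: orthonormal_def zak_cf[abs_def] intro: sqint_\<phi>I)
  define r where "r x = norm_sq circ (\<lambda>t. f (x, t))" for x
  have r: "integrable torus r" "(LINT x|torus. r x) = norm_sq PM f" unfolding r_def by (rule P.norm_sq_sections[OF f])+
  have "norm_sq PM f = (LINT t|circ. norm_sq torus (\<lambda>x. f (x, t)))" by (rule P.norm_sq_sections(2)[OF f, symmetric])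
  also have "\<dots> = (LINT t|circ. 1)"
    by (rule integral_cong_AE) (use f_unit P.norm_sq_sections[OF f] in auto)
  finally have n1: "norm_sq PM f = 1" using C.prob_space by simp
  have le: "AE x in torus. r x \<le> 1"
  proof -
    have "AE x in torus. x \<in> cube" by (rule AE_I2) simp
    with fr show ?thesis
    proof eventually_elim
      fix x :: 'a assume x: "(\<forall>n. sqint circ (\<phi> x n)) \<and> orthonormal CS (\<lambda>m n. ip circ (\<phi> x n) (e m))" "x \<in> cube"
      then have "norm_sq circ (\<phi> x 0) \<le> 1" by (intro frame_norm_le[OF complete_orthonormal_e]) auto
      then show "r x \<le> 1" using x(2) by (simp add: norm_sq_\<phi> r_def orbit_0)
    qed
  qed
  have "(LINT x|torus. 1 - r x) = 0" using r n1 X.prob_space by simp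
  then have "AE x in torus. 1 - r x = 0"
    using integral_nonneg_eq_0_iff_AE[of torus "\<lambda>x. 1 - r x"] r(1) le by auto
  then have "AE x in torus. \<forall>n. 1 - r (orbit \<alpha> n x) = 0" by (rule AE_all_orbit)
  with fr show ?thesis
  proof eventually_elim
    fix x assume x: "(\<forall>n. sqint circ (\<phi> x n)) \<and> orthonormal CS (\<lambda>m n. ip circ (\<phi> x n) (e m))" "\<forall>n. 1 - r (orbit \<alpha> n x) = 0"
    then show "complete_orthonormal circ (\<phi> x)"
      by (intro complete_orthonormal_from_frame[OF complete_orthonormal_e]) (auto simp: norm_sq_\<phi> r_def)
  qed
qed

definition Hx :: "'a \<Rightarrow> (int \<Rightarrow> complex) \<Rightarrow> int \<Rightarrow> complex" where
  "Hx x \<psi> n = \<psi> (n + 1) + \<psi> (n - 1) + of_real (v (orbit \<alpha> n x)) * \<psi> n"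

lemma ip_\<phi>_shift:
  "ip circ (\<phi> x (n + 1)) c = ip circ (\<lambda>t. cnj (e n t * (e 1 t * f (translate \<alpha> (orbit \<alpha> n x), t)))) c"
  "ip circ (\<phi> x (n - 1)) c = ip circ (\<lambda>t. cnj (e n t * (cnj (e 1 t) * f (translate (- \<alpha>) (orbit \<alpha> n x), t)))) c"
proof -
  have "orbit \<alpha> (n + 1) x = translate \<alpha> (orbit \<alpha> n x)" "orbit \<alpha> (n - 1) x = translate (- \<alpha>) (orbit \<alpha> n x)"
    using orbit_orbit[of \<alpha> 1 n x] orbit_orbit[of \<alpha> "-1" n x] by (simp_all add: orbit_1 add.commute)
  then show "ip circ (\<phi> x (n + 1)) c = ip circ (\<lambda>t. cnj (e n t * (e 1 t * f (translate \<alpha> (orbit \<alpha> n x), t)))) c"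
  "ip circ (\<phi> x (n - 1)) c = ip circ (\<lambda>t. cnj (e n t * (cnj (e 1 t) * f (translate (- \<alpha>) (orbit \<alpha> n x), t)))) c"
    using e_add[of n 1] e_add[of n "-1"] by (simp_all add: ip_def \<phi>_def cnj_e mult_ac)
qed

text \<open>The dual eigenvalue equation at the point x + n \<alpha>, multiplied by e(n t), is the
  equation of \<open>Hx x\<close> at site n for the sequence e(n t) f(x + n \<alpha>, t) with energy
  E(t).\<close>

theorem diagonalised_Hx: "AE x in torus. diagonalised circ (\<phi> x) E B (Hx x)"
proof -
  have "AE x in torus. \<forall>n. AE t in circ. Sj f (orbit \<alpha> n x, t) = 0"
    by (rule AE_all_orbit[OF f_eq_fst])
  moreover note sqint_f_sections complete_orthonormal_\<phi>
  ultimately show ?thesis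
  proof eventually_elim
    fix x assume eq: "\<forall>n. AE t in circ. Sj f (orbit \<alpha> n x, t) = 0"
      and sq: "\<forall>n. sqint circ (\<lambda>t. f (orbit \<alpha> n x, t))" and co: "complete_orthonormal circ (\<phi> x)"
    have s\<phi>: "sqint circ (\<phi> x n)" for n using sq by (intro sqint_\<phi>I) simp
    show "diagonalised circ (\<phi> x) E B (Hx x)"
    proof
      fix c assume c: "sqint circ c"
      have Ec: "sqint circ (\<lambda>t. of_real (E t) * c t)"
        by (rule sqint_mult_bounded[OF c, where C = B]) (use E_le in auto)
      show "Hx x (\<lambda>n. ip circ (\<phi> x n) c) = (\<lambda>n. ip circ (\<phi> x n) (\<lambda>t. of_real (E t) * c t))"
      proof
        fix n
        let ?y = "orbit \<alpha> n x"
        have "Hx x (\<lambda>n. ip circ (\<phi> x n) c) n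
          = (LINT t|circ. cnj (\<phi> x (n + 1) t) * c t + cnj (\<phi> x (n - 1) t) * c t + of_real (v ?y) * (cnj (\<phi> x n t) * c t))"
          unfolding Hx_def ip_def using integrable_ip[OF s\<phi> c] by simp
        also have "\<dots> = (LINT t|circ. cnj (\<phi> x n t) * (of_real (E t) * c t))"
        proof (rule integral_cong_AE)
          show "AE t in circ. cnj (\<phi> x (n + 1) t) * c t + cnj (\<phi> x (n - 1) t) * c t + of_real (v ?y) * (cnj (\<phi> x n t) * c t)
            = cnj (\<phi> x n t) * (of_real (E t) * c t)"
            using eq[rule_format, of n]
          proof eventually_elim
            fix t assume t: "Sj f (?y, t) = 0"
            have tt: "orbit \<alpha> (n + 1) x = translate \<alpha> ?y" "orbit \<alpha> (n - 1) x = translate (- \<alpha>) ?y"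
              using orbit_orbit[of \<alpha> 1 n x] orbit_orbit[of \<alpha> "-1" n x] by (simp_all add: orbit_1 add.commute)
            have "e (n - 1) t = e n t * cnj (e 1 t)" using e_add[of n "-1" t] by (simp add: cnj_e)
            then have "cnj (\<phi> x (n + 1) t) * c t + cnj (\<phi> x (n - 1) t) * c t + of_real (v ?y) * (cnj (\<phi> x n t) * c t)
               - cnj (\<phi> x n t) * (of_real (E t) * c t) = e n t * c t * Sj f (?y, t)"
              unfolding \<phi>_def tt e_add Sj_def Sf_def by (simp add: algebra_simps)
            then show "cnj (\<phi> x (n + 1) t) * c t + cnj (\<phi> x (n - 1) t) * c t + of_real (v ?y) * (cnj (\<phi> x n t) * c t)
              = cnj (\<phi> x n t) * (of_real (E t) * c t)" using t by simp
          qed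
        qed (use integrable_ip[OF s\<phi> c] integrable_ip[OF s\<phi> Ec] in \<open>auto intro!: borel_measurable_integrable\<close>)
        finally show "Hx x (\<lambda>n. ip circ (\<phi> x n) c) n = ip circ (\<phi> x n) (\<lambda>t. of_real (E t) * c t)" by (simp add: ip_def)
      qed
    qed (use co E_le in \<open>auto intro: C.sigma_finite_measure_axioms\<close>)
  qed
qed

end

section \<open>The averaged current in the eigenbasis\<close>

text \<open>Uniform bound, limit off zero and value at zero: what dominated convergence over the
  phases asks for.\<close>

lemma time_average_kernel:
  fixes y :: real
  shows "T > 0 \<Longrightarrow> cmod (complex_of_real (1 / T) * (LINT \<tau>|tint T. cis (\<tau> * y))) \<le> 1"
    and "y \<noteq> 0 \<Longrightarrow> filterlim Tk at_top sequentially \<Longrightarrow> (\<And>k. Tk k > 0) \<Longrightarrow>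
      (\<lambda>k. complex_of_real (1 / Tk k) * (LINT \<tau>|tint (Tk k). cis (\<tau> * y))) \<longlonglongrightarrow> 0"
    and "T > 0 \<Longrightarrow> complex_of_real (1 / T) * (LINT \<tau>|tint T. cis (\<tau> * 0)) = 1"
proof -
  show 1: "complex_of_real (1 / T) * (LINT \<tau>|tint T. cis (\<tau> * 0)) = 1" if "T > 0"
    using that by (simp add: measure_tint space_restrict_space scaleR_conv_of_real)
  show "cmod (complex_of_real (1 / T) * (LINT \<tau>|tint T. cis (\<tau> * y))) \<le> 1" if T: "T > 0"
  proof -
    have "cmod (LINT \<tau>|tint T. cis (\<tau> * y)) \<le> (LINT \<tau>|tint T. cmod (cis (\<tau> * y)))" by (rule integral_norm_bound)
    also have "\<dots> = T" using T by (simp add: measure_tint space_restrict_space)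
    finally show ?thesis using T by (simp add: norm_mult norm_divide divide_le_eq)
  qed
  assume l: "y \<noteq> 0" and T: "filterlim Tk at_top sequentially" "\<And>k. Tk k > 0"
  have ce: "cis (r * y) = exp (\<i> * complex_of_real r * complex_of_real y)" for r
    by (simp add: cis_conv_exp mult.assoc)
  have ftc: "(LINT \<tau>|tint S. cis (\<tau> * y)) = (cis (S * y) - 1) / (\<i> * of_real y)" if S: "S > 0" for S
  proof -
    have "(LINT \<tau>|lborel. indicator {0..S} \<tau> *\<^sub>R cis (\<tau> * y)) = cis (S * y) / (\<i> * of_real y) - cis (0 * y) / (\<i> * of_real y)"
    proof (rule integral_FTC_Icc)
      fix x :: real
      have "((\<lambda>z. exp (\<i> * z * of_real y) / (\<i> * of_real y)) has_field_derivative exp (\<i> * of_real x * of_real y)) (at (of_real x))"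
        using l by (auto intro!: derivative_eq_intros)
      then have "((\<lambda>r. exp (\<i> * of_real r * of_real y) / (\<i> * of_real y)) has_vector_derivative exp (\<i> * of_real x * of_real y)) (at x)"
        by (rule has_vector_derivative_real_field)
      then show "((\<lambda>r. cis (r * y) / (\<i> * of_real y)) has_vector_derivative cis (x * y)) (at x within {0..S})"
        unfolding ce by (rule has_vector_derivative_at_within)
      show "continuous_on {0..S} (\<lambda>r. cis (r * y))" unfolding cis_conv_exp by (intro continuous_intros)
    qed (use S in simp)
    then show ?thesis by (simp add: integral_restrict_space diff_divide_distrib)
  qed
  show "(\<lambda>k. complex_of_real (1 / Tk k) * (LINT \<tau>|tint (Tk k). cis (\<tau> * y))) \<longlonglongrightarrow> 0"
  proof (rule Lim_null_comparison)
    show "\<forall>\<^sub>F k in sequentially. cmod (complex_of_real (1 / Tk k) * (LINT \<tau>|tint (Tk k). cis (\<tau> * y))) \<le> (2 / \<bar>y\<bar>) / Tk k"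
    proof (intro always_eventually allI)
      fix k
      have "cmod (cis (Tk k * y) - 1) \<le> 2" using norm_triangle_ineq4[of "cis (Tk k * y)" 1] by simp
      then show "cmod (complex_of_real (1 / Tk k) * (LINT \<tau>|tint (Tk k). cis (\<tau> * y))) \<le> (2 / \<bar>y\<bar>) / Tk k"
        using T(2)[of k] l divide_right_mono[of "cmod (cis (Tk k * y) - 1)" 2 "Tk k * \<bar>y\<bar>"]
        by (simp add: ftc norm_mult norm_divide mult.commute)
    qed
    show "(\<lambda>k. (2 / \<bar>y\<bar>) / Tk k) \<longlonglongrightarrow> 0" by (rule real_tendsto_divide_at_top[OF tendsto_const T(1)])
  qed
qed

context quasiperiodic_basis
begin

text \<open>The current A on the dual side: acting on the sequence e(n t) f(x + n \<alpha>, t), the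
  shifts of n become translations by \<plusminus>\<alpha> with phase factors
  e(\<plusminus>t).\<close>

definition Af :: "real \<Rightarrow> ('a \<Rightarrow> complex) \<Rightarrow> 'a \<Rightarrow> complex" where
  "Af t u x = \<i> * e 1 t * u (translate \<alpha> x) + cnj (\<i> * e 1 t) * u (translate (- \<alpha>) x)"

definition Aj :: "'a \<times> real \<Rightarrow> complex" where
  "Aj z = Af (snd z) (\<lambda>x. f (x, snd z)) (fst z)"

lemma Af_properties:
  assumes "sqint torus u"
  shows "sqint torus (Af t u)" "norm_sq torus (Af t u) \<le> 6 * norm_sq torus u" "sqint torus w \<Longrightarrow> ip torus (Af t u) w = ip torus u (Af t w)"
proof -
  interpret j: jacobi torus "translate \<alpha>" "translate (- \<alpha>)" "\<lambda>_. \<i> * e 1 t" "\<lambda>_. 0" 0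
    using measure_preserving_pair_translate by (rule jacobi.intro) (unfold_locales, auto simp: norm_mult)
  have J: "j.J = Af t" by (simp add: fun_eq_iff j.J_def Af_def)
  show "sqint torus (Af t u)" "norm_sq torus (Af t u) \<le> 6 * norm_sq torus u" "sqint torus w \<Longrightarrow> ip torus (Af t u) w = ip torus u (Af t w)"
    using j.sqint_J[OF assms] j.norm_sq_J_le[OF assms] j.J_symmetric[OF assms] by (simp_all add: J)
qed

lemma sqint_Aj: "sqint PM Aj"
proof -
  have "measure_preserving_pair PM (\<lambda>(x, t). (translate \<alpha> x, t)) (\<lambda>(x, t). (translate (- \<alpha>) x, t))"
    by (rule measure_preserving_pair_prod[OF measure_preserving_pair_translate measure_preserving_pair_id]) unfold_locales
  then interpret j: jacobi PM "\<lambda>(x, t). (translate \<alpha> x, t)" "\<lambda>(x, t). (translate (- \<alpha>) x, t)" "\<lambda>(x, t). \<i> * e 1 t" "\<lambda>(x, t). 0" 0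
    by (rule jacobi.intro) (unfold_locales, auto simp: norm_mult)
  have "j.J f = Aj" by (auto simp: fun_eq_iff j.J_def Af_def Aj_def)
  then show ?thesis using j.sqint_J[OF f] by simp
qed

lemma Aj_measurable[measurable]: "Aj \<in> borel_measurable PM" by (rule sqint_measurable[OF sqint_Aj])

text \<open>The inner product is real and bounded by 3 for almost every \<open>t\<close>, so the truncation only affects a null set.\<close>

definition g :: "real \<Rightarrow> real" where
  "g t = max (- 3) (min 3 (Re (ip torus (\<lambda>x. f (x, t)) (\<lambda>x. Aj (x, t)))))"

lemma g_measurable[measurable]: "g \<in> borel_measurable circ"
proof -
  have "integrable PM (\<lambda>(x, t). cnj (f (x, t)) * Aj (x, t))"
    using integrable_ip[OF f sqint_Aj] by (simp add: case_prod_beta')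
  then have "integrable circ (\<lambda>t. ip torus (\<lambda>x. f (x, t)) (\<lambda>x. Aj (x, t)))"
    unfolding ip_def by (rule P.integrable_snd)
  then have [measurable]: "(\<lambda>t. ip torus (\<lambda>x. f (x, t)) (\<lambda>x. Aj (x, t))) \<in> borel_measurable circ" by auto
  show ?thesis unfolding g_def by measurable
qed

lemma g_le: "\<bar>g t\<bar> \<le> 3" by (auto simp: g_def)

text \<open>The norm of \<open>Af t\<close> is at most sqrt 6, hence at most 3, and its symmetry
  makes the form real.\<close>

lemma AE_g: "AE t in circ. ip torus (\<lambda>x. f (x, t)) (Af t (\<lambda>x. f (x, t))) = of_real (g t)"
  using f_unit
proof eventually_elim
  fix t assume t: "sqint torus (\<lambda>x. f (x, t)) \<and> norm_sq torus (\<lambda>x. f (x, t)) = 1"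
  let ?w = "\<lambda>x. f (x, t)"
  have "(cmod (ip torus ?w (Af t ?w)))^2 \<le> norm_sq torus ?w * norm_sq torus (Af t ?w)" using t by (intro cauchy_schwarz Af_properties) auto
  also have "\<dots> \<le> 3^2" using t Af_properties(2)[of ?w t] by simp
  finally have "cmod (ip torus ?w (Af t ?w)) \<le> 3" by (rule power2_le_imp_le) simp
  then have "\<bar>Re (ip torus ?w (Af t ?w))\<bar> \<le> 3" using abs_Re_le_cmod order_trans by blast
  then have "g t = Re (ip torus ?w (Af t ?w))" by (auto simp: g_def Aj_def min_def max_def)
  moreover have "cnj (ip torus ?w (Af t ?w)) = ip torus ?w (Af t ?w)" using t by (simp add: ip_cnj Af_properties)
  then have "Im (ip torus ?w (Af t ?w)) = 0" by (simp add: complex_eq_iff)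
  ultimately show "ip torus ?w (Af t ?w) = of_real (g t)" by (simp add: complex_eq_iff)
qed

definition ce :: "real \<Rightarrow> int \<Rightarrow> real \<Rightarrow> complex" where "ce \<tau> m t = cis ((- \<tau>) * E t) * e m t"

definition caf :: "(real \<Rightarrow> complex) \<Rightarrow> 'a \<times> real \<Rightarrow> complex" where "caf c z = c (snd z) * Aj z"

lemma ce_measurable[measurable]: "ce \<tau> m \<in> borel_measurable circ"
  unfolding ce_def cis_conv_exp by measurable

lemma norm_ce[simp]: "cmod (ce \<tau> m t) = 1" by (simp add: ce_def norm_mult)

lemma sqint_caf: "c \<in> borel_measurable circ \<Longrightarrow> (\<And>t. cmod (c t) \<le> C) \<Longrightarrow> sqint PM (caf c)"
  unfolding caf_def by (rule sqint_mult_bounded[OF sqint_Aj]) auto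

text \<open>The matrix elements \<open>am\<close> expressed through functions on \<open>PM\<close>.
  This makes them jointly measurable in x and \<tau> and opens them to \<open>zak_fourier\<close>;
  agreement with \<open>am\<close> holds for almost every x.\<close>

definition amx :: "int \<Rightarrow> int \<Rightarrow> 'a \<Rightarrow> real \<Rightarrow> complex" where
  "amx m l x \<tau> = ip CS (zak \<alpha> (cf (ce \<tau> m)) x) (zak \<alpha> (caf (ce \<tau> l)) x)"

lemma zak_caf:
  assumes sq: "\<And>n. sqint circ (\<lambda>t. f (orbit \<alpha> n x, t))" and c: "sqint circ c"
  shows "zak \<alpha> (caf c) x n = Aop (\<lambda>n. ip circ (\<phi> x n) c) n"
proof -
  have s\<phi>: "sqint circ (\<phi> x n)" for n using sq by (intro sqint_\<phi>I)
  have tt: "orbit \<alpha> (n + 1) x = translate \<alpha> (orbit \<alpha> n x)" "orbit \<alpha> (n - 1) x = translate (- \<alpha>) (orbit \<alpha> n x)"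
    using orbit_orbit[of \<alpha> 1 n x] orbit_orbit[of \<alpha> "-1" n x] by (simp_all add: orbit_1 add.commute)
  have e1: "e (n - 1) t = e n t * cnj (e 1 t)" for t using e_add[of n "-1" t] by (simp add: cnj_e)
  have "Aop (\<lambda>n. ip circ (\<phi> x n) c) n = (LINT t|circ. \<i> * (cnj (\<phi> x (n + 1) t) * c t - cnj (\<phi> x (n - 1) t) * c t))"
    unfolding Aop_def ip_def using integrable_ip[OF s\<phi> c] by simp
  also have "\<dots> = zak \<alpha> (caf c) x n"
    unfolding zak_def coef_def ip_def
    by (rule Bochner_Integration.integral_cong[OF refl])
       (unfold \<phi>_def tt e_add e1 caf_def Aj_def Af_def en_def, simp add: algebra_simps cnj_e)
  finally show ?thesis ..
qed

lemma amx_am: "AE x in torus. diagonalised circ (\<phi> x) E B (Hx x) \<and> (\<forall>m l \<tau>. amx m l x \<tau> = diagonalised.am circ (\<phi> x) E \<tau> (e m) (e l))"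
  using diagonalised_Hx sqint_f_sections
proof eventually_elim
  fix x assume d: "diagonalised circ (\<phi> x) E B (Hx x)" and sq: "\<forall>n. sqint circ (\<lambda>t. f (orbit \<alpha> n x, t))"
  interpret d: diagonalised circ "\<phi> x" E B "Hx x" by fact
  have ce: "d.ev (- \<tau>) (e m) = ce \<tau> m" for \<tau> m by (simp add: fun_eq_iff d.ev_def ce_def)
  have sce: "sqint circ (ce \<tau> m)" for \<tau> m
    by (rule sqint_bounded[where C = 1]) (auto intro: C.finite_measure_axioms)
  have "amx m l x \<tau> = d.am \<tau> (e m) (e l)" for m l \<tau>
  proof -
    have W: "d.W c = (\<lambda>n. ip circ (\<phi> x n) c)" for c by (simp add: fun_eq_iff d.W_def)
    have "zak \<alpha> (cf (ce \<tau> m)) x = d.W (ce \<tau> m)" by (simp add: fun_eq_iff zak_cf d.W_def)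
    moreover have "zak \<alpha> (caf (ce \<tau> l)) x = Aop (d.W (ce \<tau> l))"
      unfolding W by (rule ext) (rule zak_caf[OF _ sce], use sq in blast)
    ultimately show ?thesis by (simp add: amx_def d.am_def ce)
  qed
  with d show "diagonalised circ (\<phi> x) E B (Hx x) \<and> (\<forall>m l \<tau>. amx m l x \<tau> = d.am \<tau> (e m) (e l))" by blast
qed

lemma amx_le: "AE x in torus. \<forall>m l \<tau>. cmod (amx m l x \<tau>) \<le> 3"
  using amx_am
proof eventually_elim
  fix x assume x: "diagonalised circ (\<phi> x) E B (Hx x) \<and> (\<forall>m l \<tau>. amx m l x \<tau> = diagonalised.am circ (\<phi> x) E \<tau> (e m) (e l))"
  then interpret d: diagonalised circ "\<phi> x" E B "Hx x" by blast
  have [simp]: "norm_sq circ (e m) = 1" for m using C.prob_space by (simp add: norm_sq_def)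
  have "(cmod (d.am \<tau> (e m) (e l)))^2 \<le> 3^2" for m l \<tau>
    using d.am_bound[OF sqint_e[of m] sqint_e[of l], of \<tau>] by simp
  then have "cmod (d.am \<tau> (e m) (e l)) \<le> 3" for m l \<tau> by (rule power2_le_imp_le) simp
  then show "\<forall>m l \<tau>. cmod (amx m l x \<tau>) \<le> 3" using x by simp
qed

lemma amx_measurable[measurable]: "(\<lambda>(x, \<tau>). amx m l x \<tau>) \<in> borel_measurable (torus \<Otimes>\<^sub>M borel)"
proof -
  interpret I: sigma_finite_measure CS by (rule sigma_finite_CS)
  have 1: "(\<lambda>(x, \<tau>). zak \<alpha> (cf (ce \<tau> m)) x n) \<in> borel_measurable (torus \<Otimes>\<^sub>M borel)" for n m
    unfolding zak_def coef_def ip_def cf_def ce_def en_def cis_conv_exp case_prod_beta' by measurable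
  have 2: "(\<lambda>(x, \<tau>). zak \<alpha> (caf (ce \<tau> m)) x n) \<in> borel_measurable (torus \<Otimes>\<^sub>M borel)" for n m
    unfolding zak_def coef_def ip_def caf_def ce_def en_def cis_conv_exp case_prod_beta' by measurable
  have "(\<lambda>(n, z). cnj (zak \<alpha> (cf (ce (snd z) m)) (fst z) n) * zak \<alpha> (caf (ce (snd z) l)) (fst z) n) \<in> borel_measurable (CS \<Otimes>\<^sub>M (torus \<Otimes>\<^sub>M borel))"
    by (rule measurable_pair_measure_countable1) (use 1[of m] 2[of l] in \<open>auto simp: case_prod_beta' intro!: borel_measurable_times borel_measurable_cnj'\<close>)
  from measurable_pair_swap[OF this]
  have "(\<lambda>(z, n). cnj (zak \<alpha> (cf (ce (snd z) m)) (fst z) n) * zak \<alpha> (caf (ce (snd z) l)) (fst z) n) \<in> borel_measurable ((torus \<Otimes>\<^sub>M borel) \<Otimes>\<^sub>M CS)"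
    by simp
  then show ?thesis unfolding amx_def ip_def case_prod_beta' by (rule I.borel_measurable_lebesgue_integral[unfolded case_prod_beta'])
qed

definition avg :: "real \<Rightarrow> int \<Rightarrow> int \<Rightarrow> 'a \<Rightarrow> complex" where
  "avg T m l x = complex_of_real (1 / T) * (LINT \<tau>|tint T. amx m l x \<tau>)"

lemma amx_tint_measurable: "(\<lambda>(x, \<tau>). amx m l x \<tau>) \<in> borel_measurable (torus \<Otimes>\<^sub>M tint T)"
proof -
  have "(\<lambda>z. (fst z, snd z)) \<in> torus \<Otimes>\<^sub>M tint T \<rightarrow>\<^sub>M torus \<Otimes>\<^sub>M borel"
    by (intro measurable_Pair measurable_fst measurable_compose[OF measurable_snd] measurable_restrict_space1) auto
  from measurable_compose[OF this amx_measurable] show ?thesis by (simp add: case_prod_beta')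
qed

lemma avg_measurable[measurable]: "avg T m l \<in> borel_measurable torus"
proof -
  interpret N: finite_measure "tint T" by (rule finite_tint)
  have "(\<lambda>x. LINT \<tau>|tint T. amx m l x \<tau>) \<in> borel_measurable torus"
    by (rule N.borel_measurable_lebesgue_integral) (rule amx_tint_measurable)
  then show ?thesis unfolding avg_def[abs_def] by measurable
qed

lemma amx_integrable: "integrable (torus \<Otimes>\<^sub>M tint T) (\<lambda>(x, \<tau>). amx m l x \<tau>)"
proof -
  interpret N: finite_measure "tint T" by (rule finite_tint)
  interpret Q: pair_sigma_finite "torus :: 'a measure" "tint T" ..
  note [measurable] = amx_tint_measurable
  have mx: "(\<lambda>\<tau>. amx m l x \<tau>) \<in> borel_measurable (tint T)" if "x \<in> cube" for x
    using measurable_compose[OF measurable_Pair1'[of x torus "tint T"] amx_tint_measurable] that by simp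
  have ix: "AE x in torus. integrable (tint T) (amx m l x) \<and> (LINT \<tau>|tint T. cmod (amx m l x \<tau>)) \<le> 3 * measure (tint T) (space (tint T))"
  proof -
    have "AE x in torus. x \<in> cube" by (rule AE_I2) simp
    with amx_le show ?thesis
    proof eventually_elim
      fix x :: 'a assume x: "\<forall>m l \<tau>. cmod (amx m l x \<tau>) \<le> 3" "x \<in> cube"
      have i: "integrable (tint T) (amx m l x)"
        by (rule N.integrable_const_bound[of _ 3]) (use x mx in auto)
      have "(LINT \<tau>|tint T. cmod (amx m l x \<tau>)) \<le> (LINT \<tau>|tint T. 3)"
        by (rule integral_mono) (use i x in auto)
      with i show "integrable (tint T) (amx m l x) \<and> (LINT \<tau>|tint T. cmod (amx m l x \<tau>)) \<le> 3 * measure (tint T) (space (tint T))"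
        by (simp add: mult.commute)
    qed
  qed
  show ?thesis
  proof (rule Q.Fubini_integrable)
    show "(\<lambda>(x, \<tau>). amx m l x \<tau>) \<in> borel_measurable (torus \<Otimes>\<^sub>M tint T)" by (rule amx_tint_measurable)
    have "(\<lambda>(x, \<tau>). cmod (amx m l x \<tau>)) \<in> borel_measurable (torus \<Otimes>\<^sub>M tint T)"
      using measurable_compose[OF amx_tint_measurable[of m l T] borel_measurable_norm] by (simp add: case_prod_beta')
    then have m: "(\<lambda>x. LINT \<tau>|tint T. cmod (amx m l x \<tau>)) \<in> borel_measurable torus"
      by (rule N.borel_measurable_lebesgue_integral)
    show "integrable torus (\<lambda>x. LINT \<tau>|tint T. norm (case (x, \<tau>) of (x, \<tau>) \<Rightarrow> amx m l x \<tau>))"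
      using m by (intro X.integrable_const_bound[of _ "3 * measure (tint T) (space (tint T))"]) (use ix in auto)
    show "AE x in torus. integrable (tint T) (\<lambda>\<tau>. case (x, \<tau>) of (x, \<tau>) \<Rightarrow> amx m l x \<tau>)"
      using ix by eventually_elim simp
  qed
qed

text \<open>\<open>zak_fourier\<close> at each time: the evolution factors at the phases t and t - s
  combine to cis(\<tau> (E(t) - E(t - s))). Fubini, once over x and once over t, brings the time
  average inside.\<close>

lemma avg_fourier:
  fixes m l :: int
  assumes k: "k \<in> int_lattice" and T: "T > 0"
  defines "s \<equiv> k \<bullet> \<alpha>"
  defines "\<gamma> \<equiv> \<lambda>t. cnj (e m t) * e l (translate (- s) t) * ip torus (\<lambda>x. character k x * f (x, t)) (\<lambda>x. Aj (x, translate (- s) t))"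
  shows "integrable circ \<gamma>"
    and "(LINT x|torus. cnj (character k x) * avg T m l x)
      = (LINT t|circ. (complex_of_real (1 / T) * (LINT \<tau>|tint T. cis (\<tau> * (E t - E (translate (- s) t))))) * \<gamma> t)"
proof -
  have sq: "sqint PM (cf (ce \<tau> n))" "sqint PM (caf (ce \<tau> n))" for \<tau> n
    by (rule sqint_cf[where C = 1]; auto) (rule sqint_caf[where C = 1]; auto)
  have fib: "ip torus (\<lambda>x. character k x * cf (ce \<tau> m) (x, t)) (\<lambda>x. caf (ce \<tau> l) (x, translate (- s) t))
     = cis (\<tau> * (E t - E (translate (- s) t))) * \<gamma> t" for t \<tau>
  proof -
    have "ip torus (\<lambda>x. character k x * cf (ce \<tau> m) (x, t)) (\<lambda>x. caf (ce \<tau> l) (x, translate (- s) t))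
       = ip torus (\<lambda>x. ce \<tau> m t * (character k x * f (x, t))) (\<lambda>x. ce \<tau> l (translate (- s) t) * Aj (x, translate (- s) t))"
      by (simp add: cf_def caf_def mult_ac)
    also have "\<dots> = cnj (ce \<tau> m t) * ce \<tau> l (translate (- s) t) * ip torus (\<lambda>x. character k x * f (x, t)) (\<lambda>x. Aj (x, translate (- s) t))"
      unfolding ip_scale_left ip_scale_right by simp
    also have "cnj (ce \<tau> m t) * ce \<tau> l (translate (- s) t) = cis (\<tau> * (E t - E (translate (- s) t))) * (cnj (e m t) * e l (translate (- s) t))"
    proof -
      have "cnj (cis ((- \<tau>) * E t)) * cis ((- \<tau>) * E (translate (- s) t)) = cis (\<tau> * (E t - E (translate (- s) t)))"
        by (simp add: cis_cnj cis_mult algebra_simps)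
      then show ?thesis unfolding ce_def complex_cnj_mult by (simp only: mult_ac)
    qed
    finally show ?thesis by (simp add: \<gamma>_def mult.assoc)
  qed
  have "integrable circ (\<lambda>t. cis (0 * (E t - E (translate (- s) t))) * \<gamma> t)"
    using zak_fourier(2)[OF sq(1)[of 0 m] sq(2)[of 0 l] k, of \<alpha>] unfolding s_def[symmetric] fib .
  then show \<gamma>: "integrable circ \<gamma>" by simp
  interpret N: finite_measure "tint T" by (rule finite_tint)
  interpret Q: pair_sigma_finite "torus :: 'a measure" "tint T" ..
  interpret Q': pair_sigma_finite circ "tint T" ..
  have "(LINT x|torus. cnj (character k x) * avg T m l x)
     = complex_of_real (1 / T) * (LINT x|torus. LINT \<tau>|tint T. cnj (character k x) * amx m l x \<tau>)"
    by (simp add: avg_def mult_ac)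
  also have "(LINT x|torus. LINT \<tau>|tint T. cnj (character k x) * amx m l x \<tau>) = (LINT \<tau>|tint T. LINT x|torus. cnj (character k x) * amx m l x \<tau>)"
  proof (rule Q.Fubini_integral[symmetric])
    have "integrable (torus \<Otimes>\<^sub>M tint T) (\<lambda>z. cnj (character k (fst z)) * (\<lambda>(x, \<tau>). amx m l x \<tau>) z)"
      by (rule integrable_mult_bounded[OF amx_integrable, where C = 1]) auto
    then show "integrable (torus \<Otimes>\<^sub>M tint T) (\<lambda>(x, \<tau>). cnj (character k x) * amx m l x \<tau>)" by (simp add: case_prod_beta')
  qed
  also have "\<dots> = (LINT \<tau>|tint T. LINT t|circ. cis (\<tau> * (E t - E (translate (- s) t))) * \<gamma> t)"
    unfolding amx_def zak_fourier(1)[OF sq(1) sq(2) k] s_def[symmetric] fib ..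
  also have "\<dots> = (LINT t|circ. LINT \<tau>|tint T. cis (\<tau> * (E t - E (translate (- s) t))) * \<gamma> t)"
  proof (rule Q'.Fubini_integral)
    note [measurable] = borel_measurable_integrable[OF \<gamma>]
    have [measurable]: "(\<lambda>\<tau>. \<tau>) \<in> borel_measurable (tint T)" by (intro measurable_restrict_space1) simp
    have m[measurable]: "(\<lambda>(t, \<tau>). cis (\<tau> * (E t - E (translate (- s) t))) * \<gamma> t) \<in> borel_measurable (circ \<Otimes>\<^sub>M tint T)"
      unfolding cis_conv_exp by measurable
    show "integrable (circ \<Otimes>\<^sub>M tint T) (\<lambda>(t, \<tau>). cis (\<tau> * (E t - E (translate (- s) t))) * \<gamma> t)"
    proof (rule Q'.Fubini_integrable[OF m])
      show "integrable circ (\<lambda>t. LINT \<tau>|tint T. norm (case (t, \<tau>) of (t, \<tau>) \<Rightarrow> cis (\<tau> * (E t - E (translate (- s) t))) * \<gamma> t))"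
        using \<gamma> by (simp add: norm_mult)
      have "(\<lambda>\<tau>. cis (\<tau> * (E t - E (translate (- s) t))) * \<gamma> t) \<in> borel_measurable (tint T)" for t
        unfolding cis_conv_exp by measurable
      then show "AE t in circ. integrable (tint T) (\<lambda>\<tau>. case (t, \<tau>) of (t, \<tau>) \<Rightarrow> cis (\<tau> * (E t - E (translate (- s) t))) * \<gamma> t)"
        by (intro AE_I2) (auto intro!: N.integrable_const_bound[of _ "cmod (\<gamma> _)"] simp: norm_mult)
    qed
  qed
  also have "complex_of_real (1 / T) * \<dots> = (LINT t|circ. (complex_of_real (1 / T) * (LINT \<tau>|tint T. cis (\<tau> * (E t - E (translate (- s) t))))) * \<gamma> t)"
    by (simp add: mult.assoc)
  finally show "(LINT x|torus. cnj (character k x) * avg T m l x)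
      = (LINT t|circ. (complex_of_real (1 / T) * (LINT \<tau>|tint T. cis (\<tau> * (E t - E (translate (- s) t))))) * \<gamma> t)" .
qed

text \<open>The phases \<open>\<tau> (E t - E (t - s))\<close> average out unless \<open>k = 0\<close>, so the limit does not depend on \<open>x\<close>.\<close>

lemma avg_fourier_limit:
  assumes k: "k \<in> int_lattice" and T: "filterlim T at_top sequentially" "\<And>j. T j > 0"
  shows "(\<lambda>j. LINT x|torus. cnj (character k x) * avg (T j) m l x) \<longlonglongrightarrow> (if k = 0 then ip circ (e m) (\<lambda>t. of_real (g t) * e l t) else 0)"
proof -
  define s where "s = k \<bullet> \<alpha>"
  define \<gamma> where "\<gamma> t = cnj (e m t) * e l (translate (- s) t) * ip torus (\<lambda>x. character k x * f (x, t)) (\<lambda>x. Aj (x, translate (- s) t))" for t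
  define D where "D j t = complex_of_real (1 / T j) * (LINT \<tau>|tint (T j). cis (\<tau> * (E t - E (translate (- s) t))))" for j t
  have \<gamma>: "integrable circ \<gamma>" unfolding \<gamma>_def[abs_def] s_def by (rule avg_fourier(1)[OF k T(2)])
  note [measurable] = borel_measurable_integrable[OF \<gamma>]
  have eq: "(LINT x|torus. cnj (character k x) * avg (T j) m l x) = (LINT t|circ. D j t * \<gamma> t)" for j
    unfolding D_def \<gamma>_def s_def by (rule avg_fourier(2)[OF k T(2)])
  have Dm[measurable]: "D j \<in> borel_measurable circ" for j
  proof -
    interpret N: finite_measure "tint (T j)" by (rule finite_tint)
    have [measurable]: "(\<lambda>\<tau>. \<tau>) \<in> borel_measurable (tint (T j))" by (intro measurable_restrict_space1) simp
    show ?thesis unfolding D_def[abs_def] cis_conv_exp by measurable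
  qed
  show ?thesis unfolding eq
  proof (cases "k = 0")
    case True
    have "(LINT t|circ. D j t * \<gamma> t) = ip circ (e m) (\<lambda>t. of_real (g t) * e l t)" for j
      unfolding ip_def[of circ]
    proof (rule integral_cong_AE)
      have "AE t in circ. t \<in> cube" by (rule AE_I2) simp
      with AE_g show "AE t in circ. D j t * \<gamma> t = cnj (e m t) * (of_real (g t) * e l t)"
      proof eventually_elim
        fix t :: real assume t: "ip torus (\<lambda>x. f (x, t)) (Af t (\<lambda>x. f (x, t))) = of_real (g t)" "t \<in> cube"
        have "D j t = 1" using time_average_kernel(3)[OF T(2)[of j]] True t(2) by (simp add: D_def s_def translate_0)
        moreover have "\<gamma> t = cnj (e m t) * (of_real (g t) * e l t)"
          using t True by (simp add: \<gamma>_def s_def translate_0 Aj_def[abs_def])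
        ultimately show "D j t * \<gamma> t = cnj (e m t) * (of_real (g t) * e l t)" by simp
      qed
    qed measurable
    then show "(\<lambda>j. LINT t|circ. D j t * \<gamma> t) \<longlonglongrightarrow> (if k = 0 then ip circ (e m) (\<lambda>t. of_real (g t) * e l t) else 0)"
      using True by simp
  next
    case False
    have "(\<lambda>j. LINT t|circ. D j t * \<gamma> t) \<longlonglongrightarrow> (LINT t|circ. 0)"
    proof (rule integral_dominated_convergence[where w = "\<lambda>t. cmod (\<gamma> t)"])
      show "AE t in circ. (\<lambda>j. D j t * \<gamma> t) \<longlonglongrightarrow> 0"
        using separated[OF k False, folded s_def]
      proof eventually_elim
        fix t assume "E t \<noteq> E (translate (- s) t)"
        then have "(\<lambda>j. D j t) \<longlonglongrightarrow> 0" unfolding D_def by (intro time_average_kernel(2) T) auto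
        then show "(\<lambda>j. D j t * \<gamma> t) \<longlonglongrightarrow> 0" by (rule tendsto_mult_left_zero)
      qed
      show "AE t in circ. cmod (D j t * \<gamma> t) \<le> cmod (\<gamma> t)" for j
      proof (rule AE_I2)
        fix t
        have "cmod (D j t) * cmod (\<gamma> t) \<le> 1 * cmod (\<gamma> t)"
          unfolding D_def by (intro mult_right_mono time_average_kernel(1) T) auto
        then show "cmod (D j t * \<gamma> t) \<le> cmod (\<gamma> t)" by (simp add: norm_mult)
      qed
    qed (use \<gamma> in \<open>auto intro: borel_measurable_times\<close>)
    then show "(\<lambda>j. LINT t|circ. D j t * \<gamma> t) \<longlonglongrightarrow> (if k = 0 then ip circ (e m) (\<lambda>t. of_real (g t) * e l t) else 0)"
      using False by simp
  qed
qed

text \<open>Convergence being given, only the limit function is to be found. The averages are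
  bounded by 3, so Fourier coefficients pass to the limit, where they are those of a
  constant.\<close>

theorem avg_limit:
  assumes T: "filterlim T at_top sequentially" "\<And>j. T j > 0" and conv: "AE x in torus. convergent (\<lambda>j. avg (T j) m l x)"
  shows "AE x in torus. (\<lambda>j. avg (T j) m l x) \<longlonglongrightarrow> ip circ (e m) (\<lambda>t. of_real (g t) * e l t)"
proof -
  define q where "q x = lim (\<lambda>j. avg (T j) m l x)" for x
  have qm[measurable]: "q \<in> borel_measurable torus" unfolding q_def[abs_def] by measurable
  have q: "AE x in torus. (\<lambda>j. avg (T j) m l x) \<longlonglongrightarrow> q x"
    using conv by eventually_elim (simp add: q_def convergent_LIMSEQ_iff)
  have bnd: "AE x in torus. \<forall>j. cmod (avg (T j) m l x) \<le> 3"
  proof -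
    have "AE x in torus. x \<in> cube" by (rule AE_I2) simp
    with amx_le show ?thesis
    proof eventually_elim
      fix x :: 'a assume x: "\<forall>m l \<tau>. cmod (amx m l x \<tau>) \<le> 3" "x \<in> cube"
      show "\<forall>j. cmod (avg (T j) m l x) \<le> 3"
      proof
        fix j
        interpret N: finite_measure "tint (T j)" by (rule finite_tint)
        have mx: "(\<lambda>\<tau>. amx m l x \<tau>) \<in> borel_measurable (tint (T j))"
          using measurable_compose[OF measurable_Pair1'[of x torus "tint (T j)"] amx_tint_measurable] x(2) by simp
        have i: "integrable (tint (T j)) (amx m l x)"
          by (rule N.integrable_const_bound[of _ 3]) (use x mx in auto)
        have "cmod (LINT \<tau>|tint (T j). amx m l x \<tau>) \<le> (LINT \<tau>|tint (T j). cmod (amx m l x \<tau>))" by (rule integral_norm_bound)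
        also have "\<dots> \<le> (LINT \<tau>|tint (T j). 3)" by (rule integral_mono) (use i x in auto)
        also have "\<dots> = 3 * T j" using T(2)[of j] by (simp add: measure_tint space_restrict_space)
        finally show "cmod (avg (T j) m l x) \<le> 3" using T(2)[of j] by (simp add: avg_def norm_mult norm_divide field_simps)
      qed
    qed
  qed
  have "AE x in torus. cmod (q x) \<le> 3"
    using q bnd by eventually_elim (rule LIMSEQ_le_const2[OF tendsto_norm], auto)
  then have qi: "integrable torus q" by (intro X.integrable_const_bound[of _ 3]) auto
  have "AE x in torus. q x = ip circ (e m) (\<lambda>t. of_real (g t) * e l t)"
  proof (rule fourier_unique_const[OF qi])
    fix k :: 'a assume k: "k \<in> int_lattice"
    have "(\<lambda>j. LINT x|torus. cnj (character k x) * avg (T j) m l x) \<longlonglongrightarrow> (LINT x|torus. cnj (character k x) * q x)"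
    proof (rule integral_dominated_convergence[where w = "\<lambda>_. 3"])
      show "AE x in torus. (\<lambda>j. cnj (character k x) * avg (T j) m l x) \<longlonglongrightarrow> cnj (character k x) * q x"
        using q by eventually_elim (intro tendsto_intros)
      show "AE x in torus. cmod (cnj (character k x) * avg (T j) m l x) \<le> 3" for j
        using bnd by eventually_elim (simp add: norm_mult)
    qed auto
    from LIMSEQ_unique[OF this avg_fourier_limit[OF k T]]
    show "(LINT x|torus. cnj (character k x) * q x) = (if k = 0 then ip circ (e m) (\<lambda>t. of_real (g t) * e l t) else 0)" .
  qed
  with q show ?thesis by eventually_elim simp
qed

text \<open>Countably many pairs (m, l) share a set of x of full measure on which all matrix
  elements converge to those of multiplication by \<open>g\<close>; there \<open>Q_diagonal\<close>
  and \<open>opnorm_le_iff\<close> apply.\<close>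

theorem opnorm_Q:
  assumes T: "filterlim T at_top sequentially"
    and Q: "AE x in torus. \<forall>\<psi>. sqint CS \<psi> \<longrightarrow> sqint CS (Q x \<psi>) \<and> (\<lambda>k. norm_sq CS (\<lambda>n. diagonalised.tavg (Hx x) (T k) \<psi> n - Q x \<psi> n)) \<longlonglongrightarrow> 0"
  shows "AE x in torus. 0 \<le> opnorm (Q x) \<and> (\<forall>z\<ge>0. opnorm (Q x) \<le> z \<longleftrightarrow> (AE t in circ. \<bar>g t\<bar> \<le> z))"
proof -
  have "\<forall>\<^sub>F k in sequentially. T k > 0" using T by (simp add: filterlim_at_top_dense)
  then obtain k0 where k0: "\<And>k. k \<ge> k0 \<Longrightarrow> T k > 0" by (auto simp: eventually_sequentially)
  \<comment> \<open>The results on averages require positive times; shifting the index leaves the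
    limit unchanged.\<close>
  define T' where "T' k = T (k + k0)" for k
  have T': "filterlim T' at_top sequentially" "\<And>j. T' j > 0"
    using filterlim_compose[OF T filterlim_add_const_nat_at_top[of k0]] k0 by (auto simp: T'_def[abs_def])
  have Q': "AE x in torus. \<forall>\<psi>. sqint CS \<psi> \<longrightarrow> sqint CS (Q x \<psi>) \<and> (\<lambda>k. norm_sq CS (\<lambda>n. diagonalised.tavg (Hx x) (T' k) \<psi> n - Q x \<psi> n)) \<longlonglongrightarrow> 0"
    using Q
  proof eventually_elim
    fix x assume x: "\<forall>\<psi>. sqint CS \<psi> \<longrightarrow> sqint CS (Q x \<psi>) \<and> (\<lambda>k. norm_sq CS (\<lambda>n. diagonalised.tavg (Hx x) (T k) \<psi> n - Q x \<psi> n)) \<longlonglongrightarrow> 0"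
    show "\<forall>\<psi>. sqint CS \<psi> \<longrightarrow> sqint CS (Q x \<psi>) \<and> (\<lambda>k. norm_sq CS (\<lambda>n. diagonalised.tavg (Hx x) (T' k) \<psi> n - Q x \<psi> n)) \<longlonglongrightarrow> 0"
    proof (intro allI impI conjI)
      fix \<psi> assume "sqint CS \<psi>"
      then have "sqint CS (Q x \<psi>)" and l: "(\<lambda>k. norm_sq CS (\<lambda>n. diagonalised.tavg (Hx x) (T k) \<psi> n - Q x \<psi> n)) \<longlonglongrightarrow> 0" using x by auto
      then show "sqint CS (Q x \<psi>)" by simp
      show "(\<lambda>k. norm_sq CS (\<lambda>n. diagonalised.tavg (Hx x) (T' k) \<psi> n - Q x \<psi> n)) \<longlonglongrightarrow> 0"
        unfolding T'_def by (rule LIMSEQ_ignore_initial_segment[OF l])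
    qed
  qed
  have avg_am: "AE x in torus. \<forall>m l T. avg T m l x = complex_of_real (1 / T) * (LINT \<tau>|tint T. diagonalised.am circ (\<phi> x) E \<tau> (e m) (e l))"
    using amx_am by eventually_elim (simp add: avg_def)
  have conv: "AE x in torus. \<forall>m l. convergent (\<lambda>j. avg (T' j) m l x)"
    using Q' amx_am avg_am
  proof eventually_elim
    fix x assume q: "\<forall>\<psi>. sqint CS \<psi> \<longrightarrow> sqint CS (Q x \<psi>) \<and> (\<lambda>k. norm_sq CS (\<lambda>n. diagonalised.tavg (Hx x) (T' k) \<psi> n - Q x \<psi> n)) \<longlonglongrightarrow> 0"
      and d: "diagonalised circ (\<phi> x) E B (Hx x) \<and> (\<forall>m l \<tau>. amx m l x \<tau> = diagonalised.am circ (\<phi> x) E \<tau> (e m) (e l))"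
      and a: "\<forall>m l T. avg T m l x = complex_of_real (1 / T) * (LINT \<tau>|tint T. diagonalised.am circ (\<phi> x) E \<tau> (e m) (e l))"
    from d interpret d: diagonalised circ "\<phi> x" E B "Hx x" by blast
    show "\<forall>m l. convergent (\<lambda>j. avg (T' j) m l x)"
    proof (intro allI)
      fix m l
      have "(\<lambda>k. complex_of_real (1 / T' k) * (LINT s|tint (T' k). d.am s (e m) (e l))) \<longlonglongrightarrow> ip CS (d.W (e m)) (Q x (d.W (e l)))"
        by (rule d.time_average_limit[OF T'(1) _ _ sqint_e sqint_e]) (use q in auto)
      then show "convergent (\<lambda>j. avg (T' j) m l x)" using a by (auto simp: convergent_def)
    qed
  qed
  have lims: "AE x in torus. \<forall>m l. (\<lambda>j. avg (T' j) m l x) \<longlonglongrightarrow> ip circ (e m) (\<lambda>t. of_real (g t) * e l t)"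
    unfolding AE_all_countable
  proof (intro allI avg_limit[OF T'])
    show "AE x in torus. convergent (\<lambda>j. avg (T' j) m l x)" for m l using conv by eventually_elim blast
  qed
  from Q' amx_am avg_am lims show ?thesis
  proof eventually_elim
    fix x assume q: "\<forall>\<psi>. sqint CS \<psi> \<longrightarrow> sqint CS (Q x \<psi>) \<and> (\<lambda>k. norm_sq CS (\<lambda>n. diagonalised.tavg (Hx x) (T' k) \<psi> n - Q x \<psi> n)) \<longlonglongrightarrow> 0"
      and d: "diagonalised circ (\<phi> x) E B (Hx x) \<and> (\<forall>m l \<tau>. amx m l x \<tau> = diagonalised.am circ (\<phi> x) E \<tau> (e m) (e l))"
      and a: "\<forall>m l T. avg T m l x = complex_of_real (1 / T) * (LINT \<tau>|tint T. diagonalised.am circ (\<phi> x) E \<tau> (e m) (e l))"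
      and lim: "\<forall>m l. (\<lambda>j. avg (T' j) m l x) \<longlonglongrightarrow> ip circ (e m) (\<lambda>t. of_real (g t) * e l t)"
    from d interpret d: diagonalised circ "\<phi> x" E B "Hx x" by blast
    have "Q x (d.W c) = d.W (\<lambda>t. of_real (g t) * c t)" if "sqint circ c" for c
      by (rule d.Q_diagonal[OF T'(1) _ _ complete_orthonormal_e g_measurable g_le _ that]) (use q lim a in auto)
    then show "0 \<le> opnorm (Q x) \<and> (\<forall>z\<ge>0. opnorm (Q x) \<le> z \<longleftrightarrow> (AE t in circ. \<bar>g t\<bar> \<le> z))"
      using d.opnorm_le_iff[OF C.finite_measure_axioms g_measurable g_le] d.opnorm_nonneg[OF C.finite_measure_axioms g_measurable g_le] by blast
  qed
qed

section \<open>The Hellmann--Feynman formula\<close>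

lemma e1_derivative:
  assumes "h \<longlonglongrightarrow> 0" "\<And>j. h j \<noteq> 0"
  shows "(\<lambda>j. (e 1 (h j) - 1) / of_real (h j)) \<longlonglongrightarrow> 2 * pi * \<i>"
proof -
  have "((\<lambda>z. exp (2 * pi * \<i> * z)) has_field_derivative (2 * pi * \<i>)) (at 0)"
    by (auto intro!: derivative_eq_intros)
  then have "((\<lambda>z. (exp (2 * pi * \<i> * z) - 1) / z) \<longlongrightarrow> 2 * pi * \<i>) (at 0)"
    by (simp add: DERIV_def)
  moreover have "filterlim (\<lambda>j. complex_of_real (h j)) (at 0) sequentially"
    unfolding filterlim_at using assms tendsto_of_real[OF assms(1), where 'a = complex] by (auto intro: always_eventually)
  ultimately have "(\<lambda>j. (exp (2 * pi * \<i> * of_real (h j)) - 1) / of_real (h j)) \<longlonglongrightarrow> 2 * pi * \<i>"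
    by (rule filterlim_compose)
  moreover have "e 1 t = exp (2 * pi * \<i> * of_real t)" for t
    by (simp add: e_def character_def cis_conv_exp mult_ac)
  ultimately show ?thesis by simp
qed

text \<open>On Fourier coefficients in \<open>t\<close>, translation by h is multiplication by e(- n
  h). The factors e(- n h) - 1 are bounded by 2 and tend to 0, so dominated convergence over
  integers times torus applies.\<close>

lemma translation_continuous:
  assumes h: "h \<longlonglongrightarrow> 0"
  shows "(\<lambda>j. LINT t|circ. norm_sq torus (\<lambda>x. f (x, translate (h j) t) - f (x, t))) \<longlonglongrightarrow> 0"
    and "integrable circ (\<lambda>t. norm_sq torus (\<lambda>x. f (x, translate (h j) t) - f (x, t)))"
proof -
  interpret I: sigma_finite_measure CS by (rule sigma_finite_CS)
  interpret Q: pair_sigma_finite CS "torus :: 'a measure" ..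
  define D where "D j z = f (fst z, translate (h j) (snd z)) - f z" for j and z :: "'a \<times> real"
  have D: "sqint PM (D j)" for j
  proof -
    have "measure_preserving_pair PM (\<lambda>(x, t). (x, translate (h j) t)) (\<lambda>(x, t). (x, translate (- (h j)) t))"
      by (rule measure_preserving_pair_prod[OF measure_preserving_pair_id measure_preserving_pair_translate]) unfold_locales
    then interpret psh: measure_preserving_pair PM "\<lambda>(x, t). (x :: 'a, translate (h j) t)" "\<lambda>(x, t). (x, translate (- (h j)) t)" .
    show ?thesis unfolding D_def[abs_def] using sqint_diff[OF psh.sqint_comp[OF f] f] by (simp add: case_prod_beta')
  qed
  show "integrable circ (\<lambda>t. norm_sq torus (\<lambda>x. f (x, translate (h j) t) - f (x, t)))" for j
    using P.norm_sq_sections(1)[OF D[of j]] by (simp add: D_def)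
  have "(LINT t|circ. norm_sq torus (\<lambda>x. f (x, translate (h j) t) - f (x, t)))
      = (LINT z|(CS \<Otimes>\<^sub>M torus). (cmod ((e (fst z) (- h j) - 1) * coef f (fst z) (snd z)))^2)" for j
  proof -
    have sqc: "sqint (CS \<Otimes>\<^sub>M torus) (\<lambda>z. (e (fst z) (- h j) - 1) * (\<lambda>(n, x). coef f n x) z)"
    proof (rule sqint_mult_bounded[OF sqint_coef[OF f], where C = 2])
      show "cmod (e (fst z) (- h j) - 1) \<le> 2" for z :: "int \<times> 'a"
        using norm_triangle_ineq4[of "e (fst z) (- h j)" 1] by simp
      show "(\<lambda>z. e (fst z) (- h j) - 1) \<in> borel_measurable (CS \<Otimes>\<^sub>M torus)"
        by (rule measurable_compose[OF measurable_fst]) simp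
    qed
    have "(LINT t|circ. norm_sq torus (\<lambda>x. f (x, translate (h j) t) - f (x, t))) = norm_sq PM (D j)"
      using P.norm_sq_sections(2)[OF D[of j]] by (simp add: D_def)
    also have "\<dots> = (LINT x|torus. norm_sq circ (\<lambda>t. D j (x, t)))" by (rule P.norm_sq_sections(4)[OF D, symmetric])
    also have "\<dots> = (LINT x|torus. norm_sq CS (\<lambda>n. (e n (- h j) - 1) * coef f n x))"
    proof (rule integral_cong_AE)
      show "AE x in torus. norm_sq circ (\<lambda>t. D j (x, t)) = norm_sq CS (\<lambda>n. (e n (- h j) - 1) * coef f n x)"
        using P.sqint_section_fst[OF f]
      proof eventually_elim
        fix x assume x: "sqint circ (\<lambda>t. f (x, t))"
        interpret sh: measure_preserving_pair circ "translate (h j)" "translate (- h j)" by (rule measure_preserving_pair_translate)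
        note [measurable] = sqint_measurable[OF x]
        have sx: "sqint circ (\<lambda>t. f (x, translate (h j) t))" using sh.sqint_comp[OF x] .
        have "ip circ (en n) (\<lambda>t. f (x, translate (h j) t)) = e n (- h j) * coef f n x" for n
        proof -
          have 1: "e n (- h j) * e n (h j) = 1" using e_translate[of n "- h j" "h j"] by (simp add: e_def character_uminus_right)
          have "(LINT t|circ. (\<lambda>t. e n (- h j) * (e n t * f (x, t))) (translate (h j) t)) = (LINT t|circ. e n (- h j) * (e n t * f (x, t)))"
            by (rule sh.integral_comp) measurable
          moreover have "e n (- h j) * (e n (translate (h j) t) * f (x, translate (h j) t)) = e n t * f (x, translate (h j) t)" for t
          proof -
            have "e n (- h j) * (e n (translate (h j) t) * f (x, translate (h j) t)) = (e n (- h j) * e n (h j)) * (e n t * f (x, translate (h j) t))"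
              by (simp only: e_translate mult_ac)
            then show ?thesis by (simp add: 1)
          qed
          ultimately show ?thesis by (simp add: ip_def coef_def en_def cnj_e)
        qed
        then have "ip circ (en n) (\<lambda>t. D j (x, t)) = (e n (- h j) - 1) * coef f n x" for n
          using complete_orthonormal_en by (simp add: D_def ip_diff_right sx x complete_orthonormal_def orthonormal_sqint coef_def left_diff_distrib)
        moreover have "norm_sq CS (\<lambda>n. ip circ (en n) (\<lambda>t. D j (x, t))) = norm_sq circ (\<lambda>t. D j (x, t))"
          by (rule complete_orthonormal_expansion(2)[OF complete_orthonormal_en]) (simp add: D_def sqint_diff sx x)
        ultimately show "norm_sq circ (\<lambda>t. D j (x, t)) = norm_sq CS (\<lambda>n. (e n (- h j) - 1) * coef f n x)" by simp
      qed
      show "(\<lambda>x. norm_sq circ (\<lambda>t. D j (x, t))) \<in> borel_measurable torus" using P.norm_sq_sections(3)[OF D] by auto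
      show "(\<lambda>x. norm_sq CS (\<lambda>n. (e n (- h j) - 1) * coef f n x)) \<in> borel_measurable torus"
        using borel_measurable_integrable[OF Q.norm_sq_sections(1)[OF sqc]] by simp
    qed
    also have "\<dots> = norm_sq (CS \<Otimes>\<^sub>M torus) (\<lambda>z. (e (fst z) (- h j) - 1) * (\<lambda>(n, x). coef f n x) z)"
      using Q.norm_sq_sections(2)[OF sqc] by simp
    finally show ?thesis by (simp add: norm_sq_def case_prod_beta')
  qed
  moreover have "(\<lambda>j. LINT z|(CS \<Otimes>\<^sub>M torus). (cmod ((e (fst z) (- h j) - 1) * coef f (fst z) (snd z)))^2) \<longlonglongrightarrow> (LINT z|(CS \<Otimes>\<^sub>M (torus :: 'a measure)). 0)"
  proof (rule integral_dominated_convergence[where w = "\<lambda>z. 4 * (cmod ((\<lambda>(n, x). coef f n x) z))^2"])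
    have cm: "(\<lambda>z. coef f (fst z) (snd z)) \<in> borel_measurable (CS \<Otimes>\<^sub>M torus)"
      using sqint_measurable[OF sqint_coef[OF f]] by (simp add: case_prod_beta')
    have em: "(\<lambda>z. e (fst z) (- h j) - 1) \<in> borel_measurable (CS \<Otimes>\<^sub>M (torus :: 'a measure))" for j
      by (rule measurable_compose[OF measurable_fst]) simp
    show "(\<lambda>z. (cmod ((e (fst z) (- h j) - 1) * coef f (fst z) (snd z)))^2) \<in> borel_measurable (CS \<Otimes>\<^sub>M torus)" for j
      by (intro borel_measurable_power measurable_compose[OF _ borel_measurable_norm] borel_measurable_times em cm)
    show "integrable (CS \<Otimes>\<^sub>M torus) (\<lambda>z. 4 * (cmod ((\<lambda>(n, x). coef f n x) z))^2)"
      using sqint_integrable[OF sqint_coef[OF f]] by simp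
    show "AE z in CS \<Otimes>\<^sub>M torus. (\<lambda>j. (cmod ((e (fst z) (- h j) - 1) * coef f (fst z) (snd z)))^2) \<longlonglongrightarrow> 0"
    proof (rule AE_I2)
      fix z :: "int \<times> 'a"
      have "(\<lambda>j. cis (2 * pi * (of_int (fst z) * (- h j)))) \<longlonglongrightarrow> cis (2 * pi * (of_int (fst z) * (- 0)))"
        unfolding cis_conv_exp by (intro tendsto_intros h)
      then have "(\<lambda>j. e (fst z) (- h j)) \<longlonglongrightarrow> 1" by (simp add: e_def character_def)
      then have "(\<lambda>j. (cmod ((e (fst z) (- h j) - 1) * coef f (fst z) (snd z)))^2) \<longlonglongrightarrow> (cmod ((1 - 1) * coef f (fst z) (snd z)))^2"
        by (intro tendsto_intros)
      then show "(\<lambda>j. (cmod ((e (fst z) (- h j) - 1) * coef f (fst z) (snd z)))^2) \<longlonglongrightarrow> 0" by simp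
    qed
    show "AE z in CS \<Otimes>\<^sub>M torus. norm ((cmod ((e (fst z) (- h j) - 1) * coef f (fst z) (snd z)))^2) \<le> 4 * (cmod ((\<lambda>(n, x). coef f n x) z))^2" for j
    proof (rule AE_I2)
      fix z :: "int \<times> 'a"
      have "cmod (e (fst z) (- h j) - 1) \<le> 2" using norm_triangle_ineq4[of "e (fst z) (- h j)" 1] by simp
      then have "(cmod (e (fst z) (- h j) - 1))^2 \<le> 2^2" by (intro power_mono) auto
      then show "norm ((cmod ((e (fst z) (- h j) - 1) * coef f (fst z) (snd z)))^2) \<le> 4 * (cmod ((\<lambda>(n, x). coef f n x) z))^2"
        by (simp add: norm_mult power_mult_distrib case_prod_beta' mult_right_mono)
    qed
  qed simp
  ultimately show "(\<lambda>j. LINT t|circ. norm_sq torus (\<lambda>x. f (x, translate (h j) t) - f (x, t))) \<longlonglongrightarrow> 0" by simp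
qed

text \<open>Pair the eigenfunction at phase t + h with the one at phase t: by symmetry the
  difference of the energies is balanced by the difference of the operators, which comes from
  e(\<plusminus>t) alone. Only norm convergence of the eigenfunctions enters, available for almost
  every t along a sequence of h; as the derivative is assumed to exist, one sequence determines
  it.\<close>

theorem hellmann_feynman:
  "AE t in circ. \<forall>D. 0 < t \<longrightarrow> (E has_real_derivative D) (at t) \<longrightarrow> D = 2 * pi * g t"
proof -
  define h0 :: "nat \<Rightarrow> real" where "h0 j = 1 / Suc j" for j
  have h0: "h0 \<longlonglongrightarrow> 0" unfolding h0_def by (rule lim_1_over_n[THEN LIMSEQ_Suc, unfolded of_nat_Suc[symmetric]])
  have "\<exists>r::nat\<Rightarrow>nat. strict_mono r \<and> (AE t in circ. (\<lambda>j. norm_sq torus (\<lambda>x. f (x, translate (h0 (r j)) t) - f (x, t))) \<longlonglongrightarrow> 0)"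
    by (rule tendsto_L1_AE_subseq) (use translation_continuous[OF h0] in simp_all)
  then obtain r :: "nat \<Rightarrow> nat" where r: "strict_mono r" "AE t in circ. (\<lambda>j. norm_sq torus (\<lambda>x. f (x, translate (h0 (r j)) t) - f (x, t))) \<longlonglongrightarrow> 0" by blast
  define h where "h j = h0 (r j)" for j
  have h: "h \<longlonglongrightarrow> 0" using LIMSEQ_subseq_LIMSEQ[OF h0 r(1)] by (simp add: h_def[abs_def] o_def)
  have hp: "h j > 0" for j by (simp add: h_def h0_def)
  have good: "AE t in circ. sqint torus (\<lambda>x. f (x, t)) \<and> norm_sq torus (\<lambda>x. f (x, t)) = 1 \<and> (AE x in torus. Sf t (\<lambda>x. f (x, t)) x = 0)"
    using f_unit f_eq_snd by eventually_elim simp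
  have "AE t in circ. \<forall>j. sqint torus (\<lambda>x. f (x, translate (h j) t)) \<and> norm_sq torus (\<lambda>x. f (x, translate (h j) t)) = 1
     \<and> (AE x in torus. Sf (translate (h j) t) (\<lambda>x. f (x, translate (h j) t)) x = 0)"
    unfolding AE_all_countable
  proof
    fix j
    interpret sh: measure_preserving_pair circ "translate (h j)" "translate (- h j)" by (rule measure_preserving_pair_translate)
    show "AE t in circ. sqint torus (\<lambda>x. f (x, translate (h j) t)) \<and> norm_sq torus (\<lambda>x. f (x, translate (h j) t)) = 1
     \<and> (AE x in torus. Sf (translate (h j) t) (\<lambda>x. f (x, translate (h j) t)) x = 0)" by (rule sh.AE_comp[OF good])
  qed
  moreover have "AE t in circ. t \<in> cube" by (rule AE_I2) simp
  moreover note good r(2)[folded h_def] AE_g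
  ultimately show ?thesis
  proof eventually_elim
    fix t :: real
    assume gj: "\<forall>j. sqint torus (\<lambda>x. f (x, translate (h j) t)) \<and> norm_sq torus (\<lambda>x. f (x, translate (h j) t)) = 1
       \<and> (AE x in torus. Sf (translate (h j) t) (\<lambda>x. f (x, translate (h j) t)) x = 0)" and tc: "t \<in> cube"
      and gt: "sqint torus (\<lambda>x. f (x, t)) \<and> norm_sq torus (\<lambda>x. f (x, t)) = 1 \<and> (AE x in torus. Sf t (\<lambda>x. f (x, t)) x = 0)"
      and conv: "(\<lambda>j. norm_sq torus (\<lambda>x. f (x, translate (h j) t) - f (x, t))) \<longlonglongrightarrow> 0"
      and gg: "ip torus (\<lambda>x. f (x, t)) (Af t (\<lambda>x. f (x, t))) = of_real (g t)"
    show "\<forall>D. 0 < t \<longrightarrow> (E has_real_derivative D) (at t) \<longrightarrow> D = 2 * pi * g t"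
    proof (intro allI impI)
      fix D assume t0: "0 < t" and D: "(E has_real_derivative D) (at t)"
      define w where "w x = f (x, t)" for x
      define wj where "wj j x = f (x, translate (h j) t)" for j x
      have w: "sqint torus w" "norm_sq torus w = 1" "AE x in torus. Sf t w x = 0" using gt by (auto simp: w_def[abs_def])
      have wj: "sqint torus (wj j)" "AE x in torus. Sf (translate (h j) t) (wj j) x = 0" for j using gj by (auto simp: wj_def[abs_def])
      have cv: "(\<lambda>j. norm_sq torus (\<lambda>x. wj j x - w x)) \<longlonglongrightarrow> 0" using conv by (simp add: w_def wj_def)
      interpret mp: measure_preserving_pair torus "translate \<alpha>" "translate (- \<alpha>)" by (rule measure_preserving_pair_translate)
      interpret mp': measure_preserving_pair torus "translate (- \<alpha>)" "translate \<alpha>" by (rule mp.swap)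
      define wp where "wp x = w (translate \<alpha> x)" for x
      define wm where "wm x = w (translate (- \<alpha>) x)" for x
      have wpm: "sqint torus wp" "sqint torus wm" unfolding wp_def wm_def by (rule mp.sqint_comp[OF w(1)], rule mp'.sqint_comp[OF w(1)])
      define \<beta> where "\<beta> j = e 1 (translate (h j) t) - e 1 t" for j
      have key: "of_real (E (translate (h j) t) - E t) * ip torus (wj j) w = \<beta> j * ip torus (wj j) wp + cnj (\<beta> j) * ip torus (wj j) wm" for j
      proof -
        have 1: "ip torus (wj j) (Sf t w) = 0"
          by (rule ip_zero_right[OF wj(1) fib.S_sqint[OF w(1)] norm_sq_zeroI[OF w(3)]])
        have "ip torus (wj j) (Sf (translate (h j) t) w) = ip torus (Sf (translate (h j) t) (wj j)) w"
          by (rule fib.S_symmetric[OF wj(1) w(1), symmetric])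
        also have "\<dots> = cnj (ip torus w (Sf (translate (h j) t) (wj j)))" by (rule ip_cnj[symmetric])
        also have "ip torus w (Sf (translate (h j) t) (wj j)) = 0"
          by (rule ip_zero_right[OF w(1) fib.S_sqint[OF wj(1)] norm_sq_zeroI[OF wj(2)]])
        finally have 2: "ip torus (wj j) (Sf (translate (h j) t) w) = 0" by simp
        have eq: "Sf (translate (h j) t) w = (\<lambda>x. (Sf t w x + (\<beta> j * wp x + cnj (\<beta> j) * wm x)) - of_real (E (translate (h j) t) - E t) * w x)"
          by (simp add: fun_eq_iff Sf_def wp_def wm_def \<beta>_def algebra_simps)
        have "ip torus (wj j) (Sf (translate (h j) t) w) = ip torus (wj j) (Sf t w) + (\<beta> j * ip torus (wj j) wp + cnj (\<beta> j) * ip torus (wj j) wm) - of_real (E (translate (h j) t) - E t) * ip torus (wj j) w"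
          unfolding eq by (simp only: ip_diff_right ip_add_right ip_scale_right wj(1) w(1) wpm fib.S_sqint sqint_add sqint_cmult)
        then show ?thesis using 1 2 by simp
      qed
      have l1: "(\<lambda>j. ip torus (wj j) w) \<longlonglongrightarrow> 1"
        using tendsto_ip_left[OF w(1) wj(1) w(1) cv] w(2) by (simp add: ip_self)
      have l2: "(\<lambda>j. ip torus (wj j) wp) \<longlonglongrightarrow> ip torus w wp" "(\<lambda>j. ip torus (wj j) wm) \<longlonglongrightarrow> ip torus w wm"
        using tendsto_ip_left[OF wpm(1) wj(1) w(1) cv] tendsto_ip_left[OF wpm(2) wj(1) w(1) cv] by auto
      have \<beta>: "\<beta> j = e 1 t * (e 1 (h j) - 1)" for j by (simp add: \<beta>_def e_translate algebra_simps)
      have l3: "(\<lambda>j. \<beta> j / of_real (h j)) \<longlonglongrightarrow> e 1 t * (2 * pi * \<i>)"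
        using tendsto_mult[OF tendsto_const[of "e 1 t"] e1_derivative[OF h]] hp by (simp add: \<beta> less_imp_neq[symmetric])
      have l4: "(\<lambda>j. cnj (\<beta> j) / of_real (h j)) \<longlonglongrightarrow> cnj (e 1 t * (2 * pi * \<i>))"
        using tendsto_cnj[OF l3] by simp
      have t1: "t < 1" using tc by (simp add: cube_def)
      \<comment> \<open>Small positive increments do not wrap around the circle.\<close>
      have "\<forall>\<^sub>F j in sequentially. h j < 1 - t" using order_tendstoD(2)[OF h] t1 by simp
      then have trt: "\<forall>\<^sub>F j in sequentially. translate (h j) t = t + h j"
      proof eventually_elim
        fix j assume "h j < 1 - t"
        then have "t + h j \<in> cube" using hp[of j] t0 by (simp add: cube_def)
        then show "translate (h j) t = t + h j" by (simp add: translate_def frac_vec_cube)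
      qed
      have "((\<lambda>h. (E (t + h) - E t) / h) \<longlongrightarrow> D) (at 0)" using D by (simp add: DERIV_def)
      moreover have "filterlim h (at 0) sequentially"
        unfolding filterlim_at using h hp by (auto intro!: always_eventually simp: less_imp_neq[symmetric])
      ultimately have "(\<lambda>j. (E (t + h j) - E t) / h j) \<longlonglongrightarrow> D" by (rule filterlim_compose)
      then have "(\<lambda>j. (E (translate (h j) t) - E t) / h j) \<longlonglongrightarrow> D"
        by (rule Lim_transform_eventually) (use trt in eventually_elim, simp)
      then have "(\<lambda>j. of_real ((E (translate (h j) t) - E t) / h j) * ip torus (wj j) w) \<longlonglongrightarrow> of_real D * 1"
        by (intro tendsto_mult tendsto_of_real l1)
      moreover have "of_real ((E (translate (h j) t) - E t) / h j) * ip torus (wj j) w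
          = \<beta> j / of_real (h j) * ip torus (wj j) wp + cnj (\<beta> j) / of_real (h j) * ip torus (wj j) wm" for j
      proof -
        have "of_real ((E (translate (h j) t) - E t) / h j) * ip torus (wj j) w = (of_real (E (translate (h j) t) - E t) * ip torus (wj j) w) / of_real (h j)"
          by simp
        also have "\<dots> = \<beta> j / of_real (h j) * ip torus (wj j) wp + cnj (\<beta> j) / of_real (h j) * ip torus (wj j) wm"
          unfolding key by (simp add: add_divide_distrib)
        finally show ?thesis .
      qed
      moreover have "(\<lambda>j. \<beta> j / of_real (h j) * ip torus (wj j) wp + cnj (\<beta> j) / of_real (h j) * ip torus (wj j) wm)
          \<longlonglongrightarrow> e 1 t * (2 * pi * \<i>) * ip torus w wp + cnj (e 1 t * (2 * pi * \<i>)) * ip torus w wm"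
        by (intro tendsto_intros l2 l3 l4)
      ultimately have "complex_of_real D = e 1 t * (2 * pi * \<i>) * ip torus w wp + cnj (e 1 t * (2 * pi * \<i>)) * ip torus w wm"
        using LIMSEQ_unique by fastforce
      also have "\<dots> = of_real (2 * pi) * ip torus w (Af t w)"
      proof -
        have "Af t w = (\<lambda>x. (\<i> * e 1 t) * wp x + cnj (\<i> * e 1 t) * wm x)" by (simp add: fun_eq_iff Af_def wp_def wm_def)
        then have "ip torus w (Af t w) = (\<i> * e 1 t) * ip torus w wp + cnj (\<i> * e 1 t) * ip torus w wm"
          by (simp only: ip_add_right ip_scale_right w(1) wpm sqint_cmult)
        then show ?thesis by (simp only:) (simp add: algebra_simps)
      qed
      also have "ip torus w (Af t w) = of_real (g t)" using gg by (simp add: w_def[abs_def])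
      finally have "complex_of_real D = complex_of_real (2 * pi * g t)" by simp
      then show "D = 2 * pi * g t" using of_real_eq_iff by blast
    qed
  qed
qed

end

section \<open>Reducible families\<close>

lemma AE_torus_iff: "(AE x in torus. P x) \<longleftrightarrow> (AE x in lborel. x \<in> cube \<longrightarrow> P x)"
  unfolding torus_def by (rule AE_restrict_space_iff) auto

text \<open>Passes from the closed cube with completed Lebesgue measure to the half-open cube with
  its Borel measure; the boundary is negligible.\<close>

lemma AE_unit_cube_iff:
  "(AE x in lebesgue_on unit_cube. P x) \<longleftrightarrow> (AE x in torus. P x)" for P :: "real^'d \<Rightarrow> bool"
proof -
  have "negligible (unit_cube - box 0 One :: (real^'d) set)" unfolding unit_cube_def by (rule negligible_frontier_interval)
  then have "AE x in lebesgue. x \<notin> (unit_cube - box 0 One :: (real^'d) set)"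
    by (intro AE_not_in) (simp add: negligible_iff_null_sets)
  then have "AE x in lborel. x \<notin> (unit_cube - box 0 One :: (real^'d) set)" by (simp add: AE_completion_iff)
  then have "AE x in lborel. x \<in> cube \<longleftrightarrow> x \<in> (unit_cube :: (real^'d) set)"
    by eventually_elim (auto simp: unit_cube_def dest: subsetD[OF box_subset_cube] subsetD[OF cube_subset_cbox])
  then have "(AE x in lborel. x \<in> cube \<longrightarrow> P x) \<longleftrightarrow> (AE x in lborel. x \<in> unit_cube \<longrightarrow> P x)"
    by (intro eventually_subst) (auto elim: eventually_mono)
  moreover have "unit_cube \<in> sets (lebesgue :: (real^'d) measure)" by (simp add: unit_cube_def)
  ultimately show ?thesis
    by (simp add: AE_torus_iff AE_restrict_space_iff AE_completion_iff)
qed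

lemma Zd_periodic_int_lattice:
  assumes "Zd_periodic f" "k \<in> int_lattice" shows "f (x + k) = f x"
proof -
  have "k $ i \<in> \<int>" for i using \<open>k \<in> int_lattice\<close> by (auto simp: int_lattice_def Basis_vec_def inner_axis)
  then have "k = (\<chi> i. real_of_int \<lfloor>k $ i\<rfloor>)" by (auto simp: vec_eq_iff)
  then show ?thesis using assms(1) unfolding Zd_periodic_def by metis
qed

lemma Zd_periodic_frac_vec: assumes "Zd_periodic f" shows "f (frac_vec x) = f x"
proof -
  have "f (frac_vec x + (x - frac_vec x)) = f (frac_vec x)" by (rule Zd_periodic_int_lattice[OF assms frac_vec_diff_int_lattice])
  then show ?thesis by simp
qed

lemma Zd_periodic_translate: "Zd_periodic f \<Longrightarrow> f (translate a x) = f (x + a)"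
  by (simp add: translate_def Zd_periodic_frac_vec)

lemma AE_lborel_affine:
  fixes P :: "real \<Rightarrow> bool"
  assumes "c \<noteq> 0" "AE y in lborel. P y" shows "AE t in lborel. P (a + c * t)"
proof -
  obtain N where N: "{y. \<not> P y} \<subseteq> N" "N \<in> null_sets lborel"
    using assms(2) by (auto elim!: AE_E simp: null_sets_def)
  have [measurable]: "N \<in> sets borel" using N(2) by (auto simp: null_sets_def)
  have "AE y in lborel. y \<notin> N" using N(2) by (rule AE_not_in)
  then have "AE t in lborel. a + c * t \<notin> N" by (intro AE_borel_affine assms(1)) auto
  then show ?thesis by eventually_elim (use N(1) in auto)
qed

lemma AE_circ_iff: "(AE t in circ. P t) \<longleftrightarrow> (AE t in lborel. 0 < t \<and> t < 1 \<longrightarrow> P t)"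
proof -
  have "AE t in lborel. 0 \<le> t \<and> t < 1 \<longleftrightarrow> 0 < t \<and> t < (1::real)"
    using AE_lborel_singleton[of "0::real"] by eventually_elim auto
  then have "(AE t in lborel. 0 \<le> t \<and> t < 1 \<longrightarrow> P t) \<longleftrightarrow> (AE t in lborel. 0 < t \<and> t < 1 \<longrightarrow> P t)"
    by (intro eventually_subst) (auto elim: eventually_mono)
  then show ?thesis unfolding AE_torus_iff by (simp add: cube_def)
qed

text \<open>With N = 1 - 2 \<rho>, the phases \<plusminus>\<rho> modulo 1 are the two preimages of N
  under the fold \<open>\<bar>1 - 2 * t\<bar>\<close>, which is affine on each half of the
  circle.\<close>

lemma AE_circ_fold:
  "(AE t in circ. P \<bar>1 - 2 * t\<bar>) \<longleftrightarrow> (AE y in lborel. 0 < y \<and> y < 1 \<longrightarrow> P y)"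
proof
  assume "AE t in circ. P \<bar>1 - 2 * t\<bar>"
  then have "AE y in lborel. 0 < 1 / 2 + (- 1 / 2) * y \<and> 1 / 2 + (- 1 / 2) * y < 1 \<longrightarrow> P \<bar>1 - 2 * (1 / 2 + (- 1 / 2) * y)\<bar>"
    unfolding AE_circ_iff by (intro AE_lborel_affine) auto
  then show "AE y in lborel. 0 < y \<and> y < 1 \<longrightarrow> P y" by eventually_elim auto
next
  assume *: "AE y in lborel. 0 < y \<and> y < 1 \<longrightarrow> P y"
  have 1: "AE t in lborel. 0 < 1 + (- 2) * t \<and> 1 + (- 2) * t < 1 \<longrightarrow> P (1 + (- 2) * t)"
    by (rule AE_lborel_affine) (use * in auto)
  have 2: "AE t in lborel. 0 < - 1 + 2 * t \<and> - 1 + 2 * t < 1 \<longrightarrow> P (- 1 + 2 * t)"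
    by (rule AE_lborel_affine) (use * in auto)
  show "AE t in circ. P \<bar>1 - 2 * t\<bar>"
    unfolding AE_circ_iff using 1 2 AE_lborel_singleton[of "1/2"]
  proof eventually_elim
    fix t :: real
    assume h: "0 < 1 + (- 2) * t \<and> 1 + (- 2) * t < 1 \<longrightarrow> P (1 + (- 2) * t)"
      "0 < - 1 + 2 * t \<and> - 1 + 2 * t < 1 \<longrightarrow> P (- 1 + 2 * t)" "t \<noteq> 1 / 2"
    show "0 < t \<and> t < 1 \<longrightarrow> P \<bar>1 - 2 * t\<bar>"
      using h by (cases "t < 1 / 2") (auto simp: abs_if)
  qed
qed

lemma e_1: "e 1 t = cis (2 * pi * t)" by (simp add: e_def character_def)

lemma diag_rot_entries:
  "diag_rot r $ 1 $ 1 = cis (2 * pi * r)" "diag_rot r $ 2 $ 2 = cis (- (2 * pi * r))"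
  "diag_rot r $ 1 $ 2 = 0" "diag_rot r $ 2 $ 1 = 0"
  by (simp_all add: diag_rot_def cis_conv_exp mult_ac)

definition torus_eigen :: "('a::euclidean_space \<Rightarrow> real) \<Rightarrow> 'a \<Rightarrow> real \<Rightarrow> real \<Rightarrow> bool" where
  "torus_eigen v \<alpha> t l \<longleftrightarrow> (\<exists>a. sqint torus a \<and> norm_sq torus a \<noteq> 0 \<and>
      (AE x in torus. e 1 t * a (translate \<alpha> x) + cnj (e 1 t) * a (translate (- \<alpha>) x) + of_real (v x) * a x = of_real l * a x))"

lemma torus_eigen_cong: "e 1 t = e 1 s \<Longrightarrow> torus_eigen v \<alpha> t l \<longleftrightarrow> torus_eigen v \<alpha> s l"
  by (simp add: torus_eigen_def)

lemma torus_eigen_le: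
  assumes v: "v \<in> borel_measurable torus" "\<And>x. \<bar>v x\<bar> \<le> V" and eig: "torus_eigen v \<alpha> t l"
  shows "\<bar>l\<bar> \<le> sqrt (6 + 3 * V^2)"
proof -
  interpret measure_preserving_pair torus "translate \<alpha>" "translate (- \<alpha>)" by (rule measure_preserving_pair_translate)
  interpret jacobi torus "translate \<alpha>" "translate (- \<alpha>)" "\<lambda>_. e 1 t" v V
    by unfold_locales (use v in \<open>auto simp: e_def\<close>)
  obtain a where a: "sqint torus a" "norm_sq torus a \<noteq> 0"
    "AE x in torus. e 1 t * a (translate \<alpha> x) + cnj (e 1 t) * a (translate (- \<alpha>) x) + of_real (v x) * a x = of_real l * a x"
    using eig by (auto simp: torus_eigen_def)
  note [measurable] = sqint_measurable[OF a(1)] sqint_measurable[OF sqint_J[OF a(1)]]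
  have "norm_sq torus (J a) = norm_sq torus (\<lambda>x. of_real l * a x)"
    by (rule norm_sq_cong_AE) (use a(3) in \<open>auto simp: J_def intro!: sqint_J sqint_cmult a(1)\<close>)
  also have "\<dots> = l^2 * norm_sq torus a" by (simp add: norm_sq_scale)
  finally have "l^2 * norm_sq torus a \<le> (6 + 3 * V^2) * norm_sq torus a" using norm_sq_J_le[OF a(1)] by simp
  then have "l^2 \<le> 6 + 3 * V^2" using a(2) norm_sq_nonneg[of torus a] by (simp add: less_eq_real_def mult_le_cancel_right)
  then show ?thesis by (rule real_le_rsqrt[of "\<bar>l\<bar>", simplified])
qed

text \<open>Row i of the conjugacy expresses the first entry at x + \<alpha> through the second
  entry at x. Eliminating the first entry leaves a second-order equation for the second one, and
  multiplying by the conjugate of the diagonal entry puts it in the dual form with e(t) equal to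
  that conjugate. Row 2 gives the phase r, row 1 the phase -r.\<close>

lemma reducing_matrix_eigen:
  fixes v :: "real^'d \<Rightarrow> real" and M :: "real^'d \<Rightarrow> complex^2^2"
  assumes M: "M \<in> borel_measurable lborel" "Zd_periodic M"
    and sq: "\<And>i j. integrable (lebesgue_on unit_cube) (\<lambda>x. (cmod (M x $ i $ j))^2)"
    and red: "AE x in lebesgue_on unit_cube. cmod (det (M x)) = 1 \<and> M (x + \<alpha>) ** Smat v l x ** matrix_inv (M x) = diag_rot r"
    and per: "Zd_periodic v"
  shows "torus_eigen v \<alpha> r l \<and> torus_eigen v \<alpha> (- r) l"
proof -
  interpret T: prob_space "torus :: (real^'d) measure" by (rule prob_space_torus)
  interpret mp: measure_preserving_pair torus "translate \<alpha>" "translate (- \<alpha>)" by (rule measure_preserving_pair_translate)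
  interpret mps: measure_preserving_pair torus "translate (- \<alpha>)" "translate \<alpha>" by (rule mp.swap)
  have Mm: "(\<lambda>x. M x $ i $ j) \<in> borel_measurable borel" for i j
  proof -
    have "(\<lambda>A :: complex^2^2. A $ i $ j) \<in> borel_measurable borel"
      by (intro borel_measurable_continuous_onI continuous_intros)
    with M(1) show ?thesis by (auto dest: measurable_compose)
  qed
  have Msq: "sqint torus (\<lambda>x. M x $ i $ j)" for i j
  proof -
    have "set_integrable lebesgue unit_cube (\<lambda>x. (cmod (M x $ i $ j))^2)"
      using sq[of i j] by (simp add: integrable_restrict_space set_integrable_def unit_cube_def)
    then have "set_integrable lebesgue cube (\<lambda>x. (cmod (M x $ i $ j))^2)"
      by (rule set_integrable_subset) (use cube_subset_cbox cube_borel in \<open>auto simp: unit_cube_def\<close>)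
    then have "set_integrable lborel cube (\<lambda>x. (cmod (M x $ i $ j))^2)"
      unfolding set_integrable_def using Mm[of i j] cube_borel by (subst (asm) integrable_completion) measurable
    then show ?thesis
      using Mm[of i j] by (simp add: sqint_def torus_def integrable_restrict_space set_integrable_def measurable_restrict_space1)
  qed
  have ev: "AE x in torus. cmod (det (M x)) = 1 \<and>
      (\<forall>i. M (translate \<alpha> x) $ i $ 1 = - (diag_rot r $ i $ i) * (M x $ i $ 2) \<and>
           M (translate \<alpha> x) $ i $ 1 * of_real (l - v x) + M (translate \<alpha> x) $ i $ 2 = diag_rot r $ i $ i * (M x $ i $ 1))"
    using red unfolding AE_unit_cube_iff
  proof eventually_elim
    fix x assume x: "cmod (det (M x)) = 1 \<and> M (x + \<alpha>) ** Smat v l x ** matrix_inv (M x) = diag_rot r"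
    then have "invertible (M x)" by (auto simp: invertible_det_nz)
    then have "matrix_inv (M x) ** M x = mat 1"
      unfolding invertible_def matrix_inv_def by (rule someI2_ex) simp
    then have "M (translate \<alpha> x) ** Smat v l x = diag_rot r ** M x"
      using x by (metis Zd_periodic_translate[OF M(2)] matrix_mul_assoc matrix_mul_rid)
    then have "(M (translate \<alpha> x) ** Smat v l x) $ i $ j = (diag_rot r ** M x) $ i $ j" for i j by simp
    from this[of 1 1] this[of 1 2] this[of 2 1] this[of 2 2]
    have eqs: "M (translate \<alpha> x) $ 1 $ 1 * of_real (l - v x) + M (translate \<alpha> x) $ 1 $ 2 = diag_rot r $ 1 $ 1 * (M x $ 1 $ 1)"
      "- (M (translate \<alpha> x) $ 1 $ 1) = diag_rot r $ 1 $ 1 * (M x $ 1 $ 2)"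
      "M (translate \<alpha> x) $ 2 $ 1 * of_real (l - v x) + M (translate \<alpha> x) $ 2 $ 2 = diag_rot r $ 2 $ 2 * (M x $ 2 $ 1)"
      "- (M (translate \<alpha> x) $ 2 $ 1) = diag_rot r $ 2 $ 2 * (M x $ 2 $ 2)"
      by (simp_all add: matrix_matrix_mult_def sum_2 Smat_def diag_rot_entries)
    then show "cmod (det (M x)) = 1 \<and>
      (\<forall>i. M (translate \<alpha> x) $ i $ 1 = - (diag_rot r $ i $ i) * (M x $ i $ 2) \<and>
           M (translate \<alpha> x) $ i $ 1 * of_real (l - v x) + M (translate \<alpha> x) $ i $ 2 = diag_rot r $ i $ i * (M x $ i $ 1))"
      using x by (auto simp: forall_2 minus_equation_iff[of "M (translate \<alpha> x) $ _ $ 1"])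
  qed
  have sh: "AE x in torus. \<forall>i. M x $ i $ 1 = - (diag_rot r $ i $ i) * (M (translate (- \<alpha>) x) $ i $ 2)"
    using mps.AE_comp[OF ev]
  proof (rule AE_mp[OF _ AE_I2], intro impI)
    fix x :: "real^'d" assume x: "x \<in> space torus" "cmod (det (M (translate (- \<alpha>) x))) = 1 \<and>
      (\<forall>i. M (translate \<alpha> (translate (- \<alpha>) x)) $ i $ 1 = - (diag_rot r $ i $ i) * (M (translate (- \<alpha>) x) $ i $ 2) \<and>
           M (translate \<alpha> (translate (- \<alpha>) x)) $ i $ 1 * of_real (l - v (translate (- \<alpha>) x)) + M (translate \<alpha> (translate (- \<alpha>) x)) $ i $ 2 = diag_rot r $ i $ i * (M (translate (- \<alpha>) x) $ i $ 1))"
    then have "translate \<alpha> (translate (- \<alpha>) x) = x" by (simp add: translate_translate translate_0)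
    with x show "\<forall>i. M x $ i $ 1 = - (diag_rot r $ i $ i) * (M (translate (- \<alpha>) x) $ i $ 2)" by simp
  qed
  have main: "torus_eigen v \<alpha> t l" if t: "e 1 t = cnj (diag_rot r $ i $ i)" for t i
    unfolding torus_eigen_def
  proof (intro exI conjI)
    have dd: "cnj (diag_rot r $ i $ i) * diag_rot r $ i $ i = 1"
      using exhaust_2[of i] by (auto simp: diag_rot_entries cis_cnj cis_mult)
    show "sqint torus (\<lambda>x. M x $ i $ 2)" by (rule Msq)
    \<comment> \<open>If the second entry of row i vanished almost everywhere, so would the first,
      contradicting |det| = 1.\<close>
    show "norm_sq torus (\<lambda>x. M x $ i $ 2) \<noteq> 0"
    proof
      assume "norm_sq torus (\<lambda>x. M x $ i $ 2) = 0"
      then have z: "AE x in torus. M x $ i $ 2 = 0" by (rule norm_sq_zeroD[OF Msq])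
      have "AE x in (torus :: (real^'d) measure). False"
        using z mps.AE_comp[OF z] sh ev
        by eventually_elim (use exhaust_2[of i] in \<open>auto simp: det_2\<close>)
      then show False by simp
    qed
    show "AE x in torus. e 1 t * M (translate \<alpha> x) $ i $ 2 + cnj (e 1 t) * M (translate (- \<alpha>) x) $ i $ 2 + of_real (v x) * M x $ i $ 2 = of_real l * M x $ i $ 2"
      using ev sh
    proof eventually_elim
      fix x
      let ?d = "diag_rot r $ i $ i"
      assume "cmod (det (M x)) = 1 \<and>
      (\<forall>i. M (translate \<alpha> x) $ i $ 1 = - (diag_rot r $ i $ i) * (M x $ i $ 2) \<and>
           M (translate \<alpha> x) $ i $ 1 * of_real (l - v x) + M (translate \<alpha> x) $ i $ 2 = diag_rot r $ i $ i * (M x $ i $ 1))"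
        and "\<forall>i. M x $ i $ 1 = - (diag_rot r $ i $ i) * (M (translate (- \<alpha>) x) $ i $ 2)"
      then have "M (translate \<alpha> x) $ i $ 1 = - ?d * (M x $ i $ 2)" "M x $ i $ 1 = - ?d * (M (translate (- \<alpha>) x) $ i $ 2)"
        "M (translate \<alpha> x) $ i $ 1 * of_real (l - v x) + M (translate \<alpha> x) $ i $ 2 = ?d * (M x $ i $ 1)" by blast+
      then have u: "M (translate \<alpha> x) $ i $ 2 = ?d * (of_real (l - v x) * M x $ i $ 2) - ?d * (?d * M (translate (- \<alpha>) x) $ i $ 2)"
        by (simp add: algebra_simps)
      have "e 1 t * M (translate \<alpha> x) $ i $ 2 = (cnj ?d * ?d) * (of_real (l - v x) * M x $ i $ 2) - (cnj ?d * ?d) * (?d * M (translate (- \<alpha>) x) $ i $ 2)"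
        unfolding t u by (simp only: right_diff_distrib mult.assoc)
      also have "\<dots> = of_real (l - v x) * M x $ i $ 2 - ?d * M (translate (- \<alpha>) x) $ i $ 2" by (simp add: dd)
      finally show "e 1 t * M (translate \<alpha> x) $ i $ 2 + cnj (e 1 t) * M (translate (- \<alpha>) x) $ i $ 2 + of_real (v x) * M x $ i $ 2 = of_real l * M x $ i $ 2"
        by (simp add: t algebra_simps)
    qed
  qed
  show ?thesis
    by (intro conjI main[of r 2] main[of "- r" 1]) (simp_all add: e_1 diag_rot_entries cis_cnj)
qed

locale reducible_family =
  fixes v :: "real^'d \<Rightarrow> real" and \<alpha> :: "real^'d"
  assumes cont: "continuous_on UNIV v" and per: "Zd_periodic v" and indep: "rat_indep \<alpha>"
    and red: "L2_deg0_reducible v \<alpha>" and ac: "absolutely_continuous lborel (dos v \<alpha>)"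
begin

definition V :: real where "V = (SOME V. \<forall>x. \<bar>v x\<bar> \<le> V)"

lemma v_le: "\<bar>v x\<bar> \<le> V"
proof -
  have "bounded (v ` cbox 0 One)"
    by (intro compact_imp_bounded compact_continuous_image continuous_on_subset[OF cont] compact_cbox) auto
  then obtain C where C: "\<And>x. x \<in> cbox 0 One \<Longrightarrow> \<bar>v x\<bar> \<le> C" by (auto simp: bounded_iff)
  have "\<bar>v y\<bar> \<le> C" for y
    using C[OF subsetD[OF cube_subset_cbox frac_vec_in_cube], of y] by (simp add: Zd_periodic_frac_vec[OF per])
  then have "\<exists>C. \<forall>x. \<bar>v x\<bar> \<le> C" by blast
  from someI_ex[OF this] show ?thesis by (simp add: V_def)
qed

lemma v_borel[measurable]: "v \<in> borel_measurable borel"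
  using cont by (rule borel_measurable_continuous_onI)

sublocale D: cdf_distribution "dos v \<alpha>"
  unfolding cdf_distribution_def using v_le v_borel by (rule dos_real_distribution)

lemma Einv_eq: "Einv v \<alpha> y = D.I y"
  by (simp add: Einv_def ids_def cdf_def)

lemma measure_dos_singleton: "measure (dos v \<alpha>) {x} = 0"
proof -
  have "{x} \<in> null_sets lborel" by (simp add: null_sets_def)
  with ac have "{x} \<in> null_sets (dos v \<alpha>)" by (auto simp: absolutely_continuous_def)
  then show ?thesis by (simp add: null_sets_def measure_def)
qed

lemma ids_Einv: "0 < y \<Longrightarrow> y < 1 \<Longrightarrow> ids v \<alpha> (Einv v \<alpha> y) = y"
  using D.cdf_I[OF measure_dos_singleton] by (simp add: Einv_eq ids_def cdf_def)

lemma Einv_mono: "0 < x \<Longrightarrow> x \<le> y \<Longrightarrow> y < 1 \<Longrightarrow> Einv v \<alpha> x \<le> Einv v \<alpha> y"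
  using D.mono_I unfolding Einv_eq by (rule mono_onD) auto

definition energy_bound :: real where "energy_bound = sqrt (6 + 3 * V^2)"

text \<open>Null sets of \<open>dos\<close> pull back to Lebesgue null sets under the quantile
  function, and N(E(y)) = y turns \<open>rot\<close> at E(y) into (1 - y) / 2.\<close>

lemma eigen_Einv:
  "AE y in lborel. 0 < y \<and> y < 1 \<longrightarrow>
     torus_eigen v \<alpha> ((1 - y) / 2) (Einv v \<alpha> y) \<and> torus_eigen v \<alpha> (- ((1 - y) / 2)) (Einv v \<alpha> y)"
proof -
  have "AE l in dos v \<alpha>. torus_eigen v \<alpha> (rot v \<alpha> l) l \<and> torus_eigen v \<alpha> (- rot v \<alpha> l) l"
    using red unfolding L2_deg0_reducible_def
    by eventually_elim (use reducing_matrix_eigen[OF _ _ _ _ per] in blast)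
  from D.AE_quantile[OF this] show ?thesis
    unfolding Einv_eq[symmetric] by eventually_elim (simp add: rot_def ids_Einv)
qed

text \<open>For almost every y the value is an eigenvalue of a dual operator and obeys its norm
  bound. Monotonicity between two such points on either side extends the bound to every y.\<close>

lemma Einv_le: assumes "0 < y" "y < 1" shows "\<bar>Einv v \<alpha> y\<bar> \<le> energy_bound"
proof -
  have *: "AE y in lborel. 0 < y \<and> y < 1 \<longrightarrow> \<bar>Einv v \<alpha> y\<bar> \<le> energy_bound"
    using eigen_Einv unfolding energy_bound_def
    by eventually_elim (use torus_eigen_le[OF measurable_torus_borel[OF v_borel] v_le] in blast)
  have ex: "\<exists>z\<in>{a<..<b}. \<bar>Einv v \<alpha> z\<bar> \<le> energy_bound" if ab: "0 \<le> a" "a < b" "b \<le> 1" for a b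
  proof (rule ccontr)
    assume n: "\<not> ?thesis"
    have "AE y in lborel. y \<notin> {a<..<b}" using * by eventually_elim (use n ab in auto)
    then have "{a<..<b} \<in> null_sets lborel" by (subst AE_iff_null_sets) auto
    then have "emeasure lborel {a<..<b} = 0" by (rule null_setsD1)
    with ab show False by simp
  qed
  obtain a where "a \<in> {0<..<y}" "\<bar>Einv v \<alpha> a\<bar> \<le> energy_bound" using ex[of 0 y] assms by auto
  moreover obtain b where "b \<in> {y<..<1}" "\<bar>Einv v \<alpha> b\<bar> \<le> energy_bound" using ex[of y 1] assms by auto
  ultimately show ?thesis using Einv_mono[of a y] Einv_mono[of y b] assms by auto
qed

text \<open>Outside (0, 1) \<open>Einv\<close> can be the infimum of an empty or unbounded set; 0 is
  a bounded measurable substitute there.\<close>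

definition q :: "real \<Rightarrow> real" where "q y = (if 0 < y \<and> y < 1 then Einv v \<alpha> y else 0)"

lemma q_measurable[measurable]: "q \<in> borel_measurable borel"
proof -
  have "(\<lambda>y. if y \<in> {0<..<1} then D.I y else 0) \<in> borel_measurable borel"
    using D.measurable_CI by (subst (asm) measurable_restrict_space_iff) auto
  then show ?thesis unfolding q_def[abs_def] Einv_eq by simp
qed

lemma energy_bound_nonneg: "0 \<le> energy_bound" by (simp add: energy_bound_def)

lemma q_le: "\<bar>q y\<bar> \<le> energy_bound" using Einv_le energy_bound_nonneg by (simp add: q_def)

text \<open>The energy as a function of the phase \<open>t = \<plusminus>\<rho>\<close> modulo 1, where \<open>\<rho> = (1 - N) / 2\<close>.\<close>

definition En :: "real \<Rightarrow> real" where "En t = q \<bar>1 - 2 * t\<bar>"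

lemma En_measurable[measurable]: "En \<in> borel_measurable borel"
  unfolding En_def by measurable

text \<open>For t < 1/2 the phase t is \<rho> itself; for t > 1/2 it is 1 - \<rho>, which has the
  same e(t) as -\<rho>.\<close>

lemma eigen_En: "AE t in circ. torus_eigen v \<alpha> t (En t)"
proof -
  have "AE t in circ. let y = \<bar>1 - 2 * t\<bar> in 0 < y \<and> y < 1 \<longrightarrow>
     torus_eigen v \<alpha> ((1 - y) / 2) (Einv v \<alpha> y) \<and> torus_eigen v \<alpha> (- ((1 - y) / 2)) (Einv v \<alpha> y)"
    unfolding Let_def by (subst AE_circ_fold) (use eigen_Einv in eventually_elim, simp)
  then have "AE t in lborel. 0 < t \<and> t < 1 \<longrightarrow> (let y = \<bar>1 - 2 * t\<bar> in 0 < y \<and> y < 1 \<longrightarrow>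
     torus_eigen v \<alpha> ((1 - y) / 2) (Einv v \<alpha> y) \<and> torus_eigen v \<alpha> (- ((1 - y) / 2)) (Einv v \<alpha> y))"
    unfolding AE_circ_iff .
  then show ?thesis
    unfolding AE_circ_iff using AE_lborel_singleton[of "1/2"]
  proof eventually_elim
    fix t :: real
    assume h: "0 < t \<and> t < 1 \<longrightarrow> (let y = \<bar>1 - 2 * t\<bar> in 0 < y \<and> y < 1 \<longrightarrow>
     torus_eigen v \<alpha> ((1 - y) / 2) (Einv v \<alpha> y) \<and> torus_eigen v \<alpha> (- ((1 - y) / 2)) (Einv v \<alpha> y))"
      and t: "t \<noteq> 1 / 2"
    show "0 < t \<and> t < 1 \<longrightarrow> torus_eigen v \<alpha> t (En t)"
    proof
      assume t01: "0 < t \<and> t < 1"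
      define y where "y = \<bar>1 - 2 * t\<bar>"
      have y: "0 < y" "y < 1" using t t01 by (auto simp: y_def)
      have T: "torus_eigen v \<alpha> ((1 - y) / 2) (En t)" "torus_eigen v \<alpha> (- ((1 - y) / 2)) (En t)"
        using h t01 y by (auto simp: Let_def y_def[symmetric] En_def q_def)
      show "torus_eigen v \<alpha> t (En t)"
      proof (cases "t < 1 / 2")
        case True
        then have "(1 - y) / 2 = t" by (simp add: y_def)
        with T(1) show ?thesis by simp
      next
        case False
        then have "- ((1 - y) / 2) = t - 1" by (simp add: y_def field_simps)
        moreover have "e 1 (t - 1) = e 1 t" by (simp add: e_1 right_diff_distrib cis_divide[symmetric])
        ultimately show ?thesis using T(2) torus_eigen_cong by metis
      qed
    qed
  qed
qed

lemma int_lattice_inner_not_int: assumes "k \<in> int_lattice" "k \<noteq> 0" shows "k \<bullet> \<alpha> \<notin> \<int>"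
proof
  assume "k \<bullet> \<alpha> \<in> \<int>"
  then obtain m where m: "k \<bullet> \<alpha> = of_int m" by (auto elim: Ints_cases)
  have "k $ i \<in> \<int>" for i using \<open>k \<in> int_lattice\<close> by (auto simp: int_lattice_def Basis_vec_def inner_axis)
  then have ki: "k $ i = of_int \<lfloor>k $ i\<rfloor>" for i by auto
  have "of_rat (of_int (- m)) + (\<Sum>i\<in>UNIV. of_rat (of_int \<lfloor>k $ i\<rfloor>) * (\<alpha> $ i)) = - of_int m + k \<bullet> \<alpha>"
    using ki by (simp add: inner_vec_def of_rat_minus)
  also have "\<dots> = 0" by (simp add: m)
  finally have "\<forall>i. (of_int \<lfloor>k $ i\<rfloor> :: rat) = 0" using indep[unfolded rat_indep_def, rule_format, of "of_int (- m)" "\<lambda>i. of_int \<lfloor>k $ i\<rfloor>"] by blast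
  then have "k $ i = 0" for i using ki[of i] by simp
  then have "k = 0" by (simp add: vec_eq_iff)
  with assms show False by simp
qed

text \<open>Since N(E(y)) = y, the energy determines y, so equal energies at t and t' force t' = t
  or t' = 1 - t. The first makes k\<cdot>\<alpha> an integer, against rational independence; the
  second happens for countably many t only.\<close>

lemma En_separated: assumes k: "k \<in> int_lattice" "k \<noteq> 0" shows "AE t in circ. En t \<noteq> En (translate (- (k \<bullet> \<alpha>)) t)"
proof -
  define s where "s = k \<bullet> \<alpha>"
  have s: "s \<notin> \<int>" using int_lattice_inner_not_int[OF k] by (simp add: s_def)
  have inj: "x = y" if "q x = q y" "0 < x" "x < 1" "0 < y" "y < 1" for x y
  proof -
    have "Einv v \<alpha> x = Einv v \<alpha> y" using that by (simp add: q_def)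
    then show ?thesis using ids_Einv[of x] ids_Einv[of y] that by metis
  qed
  have cnt: "countable ((\<lambda>n :: int. (of_int n + a) / 2) ` UNIV)" for a :: real by simp
  \<comment> \<open>For \<open>a = 0\<close> and \<open>a = 2 * s\<close> this keeps both phases
    away from 0 and 1/2, where \<open>q\<close> takes its default value; \<open>a = s\<close> rules
    out the reflection t' = 1 - t.\<close>
  have ae: "AE t in lborel. t \<notin> (\<lambda>n :: int. (of_int n + a) / 2) ` UNIV" for a :: real
    by (intro AE_not_in countable_imp_null_set_lborel cnt)
  have no: "t \<notin> (\<lambda>n :: int. (of_int n + a) / 2) ` UNIV \<Longrightarrow> 2 * t - a \<notin> \<int>" for t a :: real
    by (auto simp: image_iff field_simps elim!: Ints_cases)
  show ?thesis
    unfolding AE_circ_iff s_def[symmetric] using ae[of 0] ae[of "2 * s"] ae[of s]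
  proof eventually_elim
    fix t :: real
    assume a: "t \<notin> range (\<lambda>n :: int. (of_int n + 0) / 2)" "t \<notin> range (\<lambda>n :: int. (of_int n + 2 * s) / 2)" "t \<notin> range (\<lambda>n :: int. (of_int n + s) / 2)"
    show "0 < t \<and> t < 1 \<longrightarrow> En t \<noteq> En (translate (- s) t)"
    proof (intro impI notI)
      assume t: "0 < t \<and> t < 1" and eq: "En t = En (translate (- s) t)"
      define t' where "t' = translate (- s) t"
      have t': "t' = frac (t - s)" by (simp add: t'_def translate_def frac_vec_def)
      have n0: "2 * t \<notin> \<int>" "2 * t - 2 * s \<notin> \<int>" "2 * t - s \<notin> \<int>" using a[THEN no] by auto
      have tt: "t \<noteq> 1 / 2"
      proof
        assume "t = 1 / 2"
        then have "2 * t = 1" by simp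
        then show False using n0(1) by (metis Ints_1)
      qed
      have fl: "t' = t - s - of_int \<lfloor>t - s\<rfloor>" by (simp add: t' frac_def)
      have "t' \<noteq> 0"
      proof
        assume "t' = 0"
        then have "2 * t - 2 * s = of_int (2 * \<lfloor>t - s\<rfloor>)" using fl by simp
        then show False using n0(2) by (metis Ints_of_int)
      qed
      moreover have "t' \<noteq> 1 / 2"
      proof
        assume "t' = 1 / 2"
        then have "2 * t - 2 * s = of_int (1 + 2 * \<lfloor>t - s\<rfloor>)" using fl by simp
        then show False using n0(2) by (metis Ints_of_int)
      qed
      moreover have "0 \<le> t'" "t' < 1" by (auto simp: t' frac_lt_1)
      ultimately have b: "0 < \<bar>1 - 2 * t'\<bar>" "\<bar>1 - 2 * t'\<bar> < 1" by linarith+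
      have b': "0 < \<bar>1 - 2 * t\<bar>" "\<bar>1 - 2 * t\<bar> < 1" using tt t by linarith+
      have "q \<bar>1 - 2 * t\<bar> = q \<bar>1 - 2 * t'\<bar>" using eq by (simp add: En_def t'_def)
      from inj[OF this b' b] have "\<bar>1 - 2 * t\<bar> = \<bar>1 - 2 * t'\<bar>" .
      then consider "t = t'" | "t + t' = 1" by linarith
      then show False
      proof cases
        case 1
        then have "s = of_int (- \<lfloor>t - s\<rfloor>)" using fl by simp
        then show ?thesis using s by (metis Ints_of_int)
      next
        case 2
        then have "2 * t - s = of_int (1 + \<lfloor>t - s\<rfloor>)" using fl by simp
        then show ?thesis using n0(3) by (metis Ints_of_int)
      qed
    qed
  qed
qed

sublocale quasiperiodic \<alpha> v V En energy_bound
proof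
  show "v \<in> borel_measurable torus" by (rule measurable_torus_borel[OF v_borel])
  show "En \<in> borel_measurable circ" by (rule measurable_torus_borel[OF En_measurable])
  show "\<bar>v x\<bar> \<le> V" "\<bar>En t\<bar> \<le> energy_bound" for x t by (auto simp: v_le En_def q_le)
  show "AE t in circ. \<exists>a. sqint torus a \<and> norm_sq torus a \<noteq> 0 \<and>
      (AE x in torus. e 1 t * a (translate \<alpha> x) + cnj (e 1 t) * a (translate (- \<alpha>) x) + of_real (v x) * a x = of_real (En t) * a x)"
    using eigen_En unfolding torus_eigen_def .
qed (rule En_separated)


lemma Einv_differentiable:
  "AE y in lborel. 0 < y \<and> y < 1 \<longrightarrow> 0 < deriv (Einv v \<alpha>) y \<and> (Einv v \<alpha> has_real_derivative deriv (Einv v \<alpha>) y) (at y)"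
proof -
  have "D.I = Einv v \<alpha>" by (simp add: fun_eq_iff Einv_eq)
  with D.I_differentiable[OF ac] have "AE y in lborel. 0 < y \<and> y < 1 \<longrightarrow> (\<exists>D>0. (Einv v \<alpha> has_real_derivative D) (at y))" by simp
  then show ?thesis by eventually_elim (metis DERIV_imp_deriv)
qed

text \<open>The fold has slope -2 to the left of 1/2 and 2 to the right of it.\<close>

lemma En_has_derivative:
  assumes t: "0 < t" "t < 1" "t \<noteq> 1 / 2" and d: "(Einv v \<alpha> has_real_derivative d) (at \<bar>1 - 2 * t\<bar>)"
  shows "\<exists>c\<in>{2, - 2}. (En has_real_derivative c * d) (at t)"
proof -
  define c :: real where "c = (if t < 1 / 2 then - 2 else 2)"
  define a :: real where "a = (if t < 1 / 2 then 1 else - 1)"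
  define S where "S = (if t < 1 / 2 then {0<..<1/2} else {1/2<..<1::real})"
  have S: "open S" "t \<in> S" using t by (auto simp: S_def)
  have En: "En s = Einv v \<alpha> (a + c * s)" if "s \<in> S" for s
  proof -
    have "\<bar>1 - 2 * s\<bar> = a + c * s" "0 < \<bar>1 - 2 * s\<bar>" "\<bar>1 - 2 * s\<bar> < 1"
      using that by (auto simp: S_def a_def c_def split: if_splits)
    then show ?thesis by (simp add: En_def q_def)
  qed
  have at: "a + c * t = \<bar>1 - 2 * t\<bar>" using t by (auto simp: a_def c_def)
  have l: "((\<lambda>s. a + c * s) has_real_derivative c) (at t)" by (auto intro!: derivative_eq_intros)
  have "(Einv v \<alpha> has_real_derivative d) (at (a + c * t))" using d by (simp add: at)
  from DERIV_chain2[OF this l] have "((\<lambda>s. Einv v \<alpha> (a + c * s)) has_real_derivative c * d) (at t)" by (simp add: mult.commute)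
  then have "(En has_real_derivative c * d) (at t)"
    by (rule has_field_derivative_transform_within_open[OF _ S]) (simp add: En)
  then show ?thesis by (auto simp: c_def split: if_splits)
qed

end

text \<open>\<open>deriv\<close> is an arbitrary value where there is no derivative, so
  measurability is obtained for the completed measure, from almost everywhere equality with a limit
  of difference quotients of the Borel function \<open>q\<close>. It matters because
  \<open>esssup\<close> is top by definition on functions that are not measurable.\<close>

lemma deriv_measurable_AE:
  fixes F :: "real \<Rightarrow> real"
  assumes q: "q \<in> borel_measurable borel" and eq: "\<And>y. a < y \<Longrightarrow> y < b \<Longrightarrow> F y = q y"
    and diff: "AE y in lborel. a < y \<and> y < b \<longrightarrow> (F has_real_derivative deriv F y) (at y)"
  shows "deriv F \<in> borel_measurable (lebesgue_on {a..b})"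
proof -
  define h :: "nat \<Rightarrow> real" where "h k = 1 / real (Suc k)" for k
  have h: "h \<longlonglongrightarrow> 0" "h k > 0" for k
    using LIMSEQ_inverse_real_of_nat by (auto simp: h_def[abs_def] inverse_eq_divide)
  define G where "G y = (if y \<in> {a..b} then lim (\<lambda>k. (q (y + h k) - q y) / h k) else 0)" for y
  note q[measurable]
  have "G \<in> borel_measurable borel" unfolding G_def by measurable
  then have G: "G \<in> borel_measurable lebesgue" by (intro measurable_completion) simp
  have "AE y in lborel. G y = (if y \<in> {a..b} then deriv F y else 0)"
    using diff AE_lborel_singleton[of a] AE_lborel_singleton[of b]
  proof eventually_elim
    fix y assume d: "a < y \<and> y < b \<longrightarrow> (F has_real_derivative deriv F y) (at y)" and ne: "y \<noteq> a" "y \<noteq> b"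
    show "G y = (if y \<in> {a..b} then deriv F y else 0)"
    proof (cases "y \<in> {a..b}")
      case True
      then have y: "a < y" "y < b" using ne by auto
      with d have "((\<lambda>h. (F (y + h) - F y) / h) \<longlongrightarrow> deriv F y) (at 0)" by (simp add: DERIV_def)
      moreover have "filterlim h (at 0) sequentially" using h by (auto simp: filterlim_at intro!: always_eventually less_imp_neq[symmetric])
      ultimately have "(\<lambda>k. (F (y + h k) - F y) / h k) \<longlonglongrightarrow> deriv F y" by (rule filterlim_compose)
      moreover have "\<forall>\<^sub>F k in sequentially. h k < b - y" using h(1) y by (intro order_tendstoD(2)) auto
      then have "\<forall>\<^sub>F k in sequentially. (F (y + h k) - F y) / h k = (q (y + h k) - q y) / h k"
      proof eventually_elim
        fix k assume "h k < b - y"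
        with y h(2)[of k] show "(F (y + h k) - F y) / h k = (q (y + h k) - q y) / h k"
          by (simp add: eq)
      qed
      ultimately have "(\<lambda>k. (q (y + h k) - q y) / h k) \<longlonglongrightarrow> deriv F y" by (rule Lim_transform_eventually)
      with True show ?thesis by (simp add: G_def limI)
    qed (auto simp: G_def)
  qed
  then have "AE y in lebesgue. G y = (if y \<in> {a..b} then deriv F y else 0)" by (rule AE_completion)
  from borel_measurable_AE[OF G this]
  have "(\<lambda>y. if y \<in> {a..b} then deriv F y else 0) \<in> borel_measurable (lebesgue_on {a..b})"
    by (rule measurable_restrict_space1)
  then show ?thesis by (rule measurable_cong[THEN iffD1, rotated]) (simp add: space_restrict_space)
qed

lemma l2_iff_sqint: "l2 \<psi> \<longleftrightarrow> sqint CS \<psi>" by (simp add: l2_def sqint_CS_iff)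

lemma l2norm_tendsto_iff:
  assumes "\<forall>\<^sub>F k in sequentially. sqint CS (w k)"
  shows "(\<lambda>k. l2norm (w k)) \<longlonglongrightarrow> 0 \<Longrightarrow> (\<lambda>k. norm_sq CS (w k)) \<longlonglongrightarrow> 0"
proof -
  assume "(\<lambda>k. l2norm (w k)) \<longlonglongrightarrow> 0"
  then have "(\<lambda>k. (l2norm (w k))^2) \<longlonglongrightarrow> 0" using tendsto_power by fastforce
  moreover have "\<forall>\<^sub>F k in sequentially. (l2norm (w k))^2 = norm_sq CS (w k)"
    using assms by eventually_elim (simp add: l2norm_def norm_sq_CS[symmetric])
  ultimately show ?thesis by (rule Lim_transform_eventually)
qed

theorem theorem3p2:
  fixes v :: "real^'d \<Rightarrow> real" and \<alpha> :: "real^'d"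
    and T0 :: "(real^'d) set" and T :: "nat \<Rightarrow> real"
    and Q :: "real^'d \<Rightarrow> (int \<Rightarrow> complex) \<Rightarrow> (int \<Rightarrow> complex)"
  assumes "continuous_on UNIV v" and "Zd_periodic v" and "rat_indep \<alpha>"
    and "L2_deg0_reducible v \<alpha>"
    and "absolutely_continuous lborel (dos v \<alpha>)"
    and "T0 \<subseteq> unit_cube" and "AE x in lebesgue_on unit_cube. x \<in> T0"
    and "filterlim T at_top sequentially"
    and "\<forall>x\<in>T0. \<forall>\<psi>. l2 \<psi> \<longrightarrow>
           l2 (Q x \<psi>) \<and> (\<lambda>k. l2norm (\<lambda>n. time_avg v \<alpha> x (T k) \<psi> n - Q x \<psi> n)) \<longlonglongrightarrow> 0"
  shows "AE x in lebesgue_on unit_cube.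
           ereal (opnorm (Q x)) = esssup (lebesgue_on {0..1}) (\<lambda>N. ereal (deriv (Einv v \<alpha>) N)) / ereal pi"
proof -
  interpret F: reducible_family v \<alpha> by (rule reducible_family.intro) fact+
  obtain f where f: "sqint F.PM f" "AE t in circ. sqint torus (\<lambda>x. f (x, t)) \<and> norm_sq torus (\<lambda>x. f (x, t)) = 1"
    "AE z in F.PM. F.Sj f z = 0" by (rule F.eigenfunction_selection)
  interpret G: quasiperiodic_basis \<alpha> v F.V F.En F.energy_bound f by (intro quasiperiodic_basis.intro F.quasiperiodic_axioms quasiperiodic_basis_axioms.intro f)
  have Hx: "G.Hx x = Hop v \<alpha> x" for x
    by (simp add: fun_eq_iff G.Hx_def Hop_def orbit_def Zd_periodic_translate[OF assms(2)])
  have T_pos: "\<forall>\<^sub>F k in sequentially. T k > 0" using assms(8) by (simp add: filterlim_at_top_dense)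
  have "AE x in torus. \<forall>\<psi>. sqint CS \<psi> \<longrightarrow>
      sqint CS (Q x \<psi>) \<and> (\<lambda>k. norm_sq CS (\<lambda>n. diagonalised.tavg (G.Hx x) (T k) \<psi> n - Q x \<psi> n)) \<longlonglongrightarrow> 0"
    using G.diagonalised_Hx assms(7)[unfolded AE_unit_cube_iff]
  proof eventually_elim
    fix x assume d: "diagonalised circ (G.\<phi> x) F.En F.energy_bound (G.Hx x)" and x: "x \<in> T0"
    interpret d: diagonalised circ "G.\<phi> x" F.En F.energy_bound "G.Hx x" by (rule d)
    have tavg: "d.tavg t \<psi> = time_avg v \<alpha> x t \<psi>" for t \<psi>
      unfolding d.tavg_def d.hs_def fun_eq_iff unfolding Hx time_avg_def heis_def by simp
    show "\<forall>\<psi>. sqint CS \<psi> \<longrightarrow> sqint CS (Q x \<psi>) \<and> (\<lambda>k. norm_sq CS (\<lambda>n. d.tavg (T k) \<psi> n - Q x \<psi> n)) \<longlonglongrightarrow> 0"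
    proof (intro allI impI)
      fix \<psi> :: "int \<Rightarrow> complex" assume \<psi>: "sqint CS \<psi>"
      then have Q: "sqint CS (Q x \<psi>)" and lim: "(\<lambda>k. l2norm (\<lambda>n. d.tavg (T k) \<psi> n - Q x \<psi> n)) \<longlonglongrightarrow> 0"
        using assms(9) x by (auto simp: l2_iff_sqint tavg)
      obtain c where c: "sqint circ c" "\<psi> = d.W c" using d.W_surj[OF \<psi>] .
      have "\<forall>\<^sub>F k in sequentially. sqint CS (\<lambda>n. d.tavg (T k) \<psi> n - Q x \<psi> n)"
        using T_pos by eventually_elim (use d.sqint_tavg c Q in \<open>simp add: sqint_diff\<close>)
      from Q l2norm_tendsto_iff[OF this lim]
      show "sqint CS (Q x \<psi>) \<and> (\<lambda>k. norm_sq CS (\<lambda>n. d.tavg (T k) \<psi> n - Q x \<psi> n)) \<longlonglongrightarrow> 0" ..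
    qed
  qed
  note op = G.opnorm_Q[OF assms(8) this]
  let ?F = "deriv (Einv v \<alpha>)"
  have "AE t in circ. 0 < \<bar>1 - 2 * t\<bar> \<and> \<bar>1 - 2 * t\<bar> < 1 \<longrightarrow>
      0 < ?F \<bar>1 - 2 * t\<bar> \<and> (Einv v \<alpha> has_real_derivative ?F \<bar>1 - 2 * t\<bar>) (at \<bar>1 - 2 * t\<bar>)"
    by (subst AE_circ_fold) (use F.Einv_differentiable in eventually_elim, simp)
  \<comment> \<open>The slope \<plusminus>2 of the fold in the Hellmann--Feynman formula gives 2 pi
    g = \<plusminus>2 dE/dN, and dE/dN > 0 resolves the sign.\<close>
  then have g: "AE t in circ. \<bar>G.g t\<bar> = ?F \<bar>1 - 2 * t\<bar> / pi"
    using G.hellmann_feynman unfolding AE_circ_iff using AE_lborel_singleton[of "1 / 2 :: real"]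
  proof eventually_elim
    fix t :: real
    assume a: "0 < t \<and> t < 1 \<longrightarrow> 0 < \<bar>1 - 2 * t\<bar> \<and> \<bar>1 - 2 * t\<bar> < 1 \<longrightarrow>
      0 < ?F \<bar>1 - 2 * t\<bar> \<and> (Einv v \<alpha> has_real_derivative ?F \<bar>1 - 2 * t\<bar>) (at \<bar>1 - 2 * t\<bar>)"
      and hf: "0 < t \<and> t < 1 \<longrightarrow> (\<forall>D. 0 < t \<longrightarrow> (F.En has_real_derivative D) (at t) \<longrightarrow> D = 2 * pi * G.g t)"
      and t: "t \<noteq> 1 / 2"
    show "0 < t \<and> t < 1 \<longrightarrow> \<bar>G.g t\<bar> = ?F \<bar>1 - 2 * t\<bar> / pi"
    proof
      assume t01: "0 < t \<and> t < 1"
      define d where "d = ?F \<bar>1 - 2 * t\<bar>"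
      have "0 < \<bar>1 - 2 * t\<bar>" "\<bar>1 - 2 * t\<bar> < 1" using t t01 by linarith+
      then have d: "0 < d" "(Einv v \<alpha> has_real_derivative d) (at \<bar>1 - 2 * t\<bar>)" using a t01 by (auto simp: d_def)
      obtain c :: real where c: "c \<in> {2, - 2}" "(F.En has_real_derivative c * d) (at t)"
        using F.En_has_derivative[OF _ _ t d(2)] t01 by blast
      then have "c * d = 2 * pi * G.g t" using hf t01 by blast
      then have "G.g t = c * d / (2 * pi)" by simp
      then have "\<bar>G.g t\<bar> = \<bar>c\<bar> * d / (2 * pi)" using d(1) by (simp add: abs_mult)
      then show "\<bar>G.g t\<bar> = ?F \<bar>1 - 2 * t\<bar> / pi" using c(1) by (auto simp: d_def)
    qed
  qed
  have AE01: "(AE y in lebesgue_on {0..1}. P y) \<longleftrightarrow> (AE y in lborel. 0 < y \<and> y < 1 \<longrightarrow> P y)" for P :: "real \<Rightarrow> bool"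
  proof -
    have "AE y in lborel. 0 \<le> y \<and> y \<le> 1 \<longleftrightarrow> 0 < y \<and> y < (1::real)"
      using AE_lborel_singleton[of "0::real"] AE_lborel_singleton[of "1::real"] by eventually_elim auto
    then have "(AE y in lborel. 0 \<le> y \<and> y \<le> 1 \<longrightarrow> P y) \<longleftrightarrow> (AE y in lborel. 0 < y \<and> y < 1 \<longrightarrow> P y)"
      by (intro eventually_subst) (auto elim: eventually_mono)
    then show ?thesis by (simp add: AE_restrict_space_iff AE_completion_iff)
  qed
  \<comment> \<open>The two sides of the claim are compared through their upper bounds, the form in
    which \<open>opnorm_Q\<close> describes the norm.\<close>
  have le: "(AE t in circ. \<bar>G.g t\<bar> \<le> z) \<longleftrightarrow> (AE y in lebesgue_on {0..1}. ?F y \<le> pi * z)" for z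
  proof -
    have "(AE t in circ. \<bar>G.g t\<bar> \<le> z) \<longleftrightarrow> (AE t in circ. ?F \<bar>1 - 2 * t\<bar> \<le> pi * z)"
      by (rule eventually_subst) (use g in eventually_elim, simp add: pos_divide_le_eq mult.commute)
    also have "\<dots> \<longleftrightarrow> (AE y in lebesgue_on {0..1}. ?F y \<le> pi * z)"
      unfolding AE01 by (rule AE_circ_fold)
    finally show ?thesis .
  qed
  have meas: "(\<lambda>y. ereal (?F y)) \<in> borel_measurable (lebesgue_on {0..1})"
  proof (intro borel_measurable_ereal deriv_measurable_AE)
    show "F.q \<in> borel_measurable borel" by (rule F.q_measurable)
    show "AE y in lborel. 0 < y \<and> y < 1 \<longrightarrow> (Einv v \<alpha> has_real_derivative ?F y) (at y)"
      using F.Einv_differentiable by eventually_elim simp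
  qed (simp add: F.q_def)
  have pos: "AE y in lebesgue_on {0..1}. 0 < ?F y"
    unfolding AE01 using F.Einv_differentiable by eventually_elim simp
  \<comment> \<open>Together with positivity of the derivative this excludes a negative or minus
    infinite \<open>esssup\<close>.\<close>
  have nontriv: "\<not> (AE y in lebesgue_on {0..1::real}. False)"
  proof
    assume "AE y in lebesgue_on {0..1::real}. False"
    then have "emeasure (lebesgue_on {0..1::real}) (space (lebesgue_on {0..1})) = 0"
      by (simp only: ae_filter_eq_bot_iff[symmetric] trivial_limit_def)
    then show False by (simp add: emeasure_restrict_space space_restrict_space)
  qed
  show ?thesis
    unfolding AE_unit_cube_iff using op
  proof eventually_elim
    fix x
    assume x: "0 \<le> opnorm (Q x) \<and> (\<forall>z\<ge>0. opnorm (Q x) \<le> z \<longleftrightarrow> (AE t in circ. \<bar>G.g t\<bar> \<le> z))"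
    define Z where "Z = opnorm (Q x)"
    have Z: "0 \<le> Z" "\<And>z. 0 \<le> z \<Longrightarrow> Z \<le> z \<longleftrightarrow> (AE y in lebesgue_on {0..1}. ?F y \<le> pi * z)"
      using x by (auto simp: Z_def le)
    let ?S = "esssup (lebesgue_on {0..1}) (\<lambda>N. ereal (?F N))"
    have "?S \<le> ereal (pi * Z)"
      by (rule esssup_I[OF meas]) (use Z(2)[OF Z(1)] in simp)
    moreover have "ereal (pi * Z) \<le> ?S"
    proof (cases ?S)
      case (real r)
      have ae: "AE y in lebesgue_on {0..1}. ?F y \<le> r" using esssup_AE[of "\<lambda>N. ereal (?F N)" "lebesgue_on {0..1}"] by (simp add: real)
      have "0 \<le> r"
      proof (rule ccontr)
        assume "\<not> 0 \<le> r"
        with ae pos have "AE y in lebesgue_on {0..1::real}. False" by (elim AE_mp) (auto intro!: AE_I2)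
        with nontriv show False by blast
      qed
      then have "Z \<le> r / pi" using ae by (subst Z(2)) auto
      then show ?thesis by (simp add: real field_simps)
    next
      case MInf
      then have "AE y in lebesgue_on {0..1::real}. False"
        using esssup_AE[of "\<lambda>N. ereal (?F N)" "lebesgue_on {0..1}"] by simp
      with nontriv show ?thesis by blast
    qed simp
    ultimately have "?S = ereal (pi * Z)" by (rule antisym)
    then show "ereal (opnorm (Q x)) = ?S / ereal pi" by (simp add: Z_def)
  qed
qed

end
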